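(* Let $1\le p<n$ be integers and let $(x_1,y_1),\dots,(x_n,y_n)$ be i.i.d. random pairs in $\mathbb{R}^p\times\{-1,+1\}$ with $x_j\sim\mathcal{N}(0,I_p)$ and $y_j$ independent of $x_j$. Let $b:=\mathbb{P}[y_j=1]$. Then the probability of linear separability with intercept is $$ S_0(n,p)=b^n+(1-b)^n+2\sum_{j\ge1\text{ odd}}\mu_{n-p+j}, $$ where $\mu_n=\sum_{N=1}^{n-1}b^N(1-b)^{n-N}$, $\mu_0=0$, and for $k\in\{1,\dots,n-1\}$, with $(g,g')\sim\mathcal{N}(0,I_2)$, $$ \mu_{n-k}:=\binom{n}{k+1}\mathbb{E}\left[\big(b\Phi_k(ig)+(1-b)\Phi_k(-ig)\big)^{k+1}\big(b\Phi_k(g')+(1-b)\Phi_k(-g')\big)^{n-(k+1)}\right]. $$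
   Context: The probability of linear separability with intercept is $S_0(n,p):=\mathbb{P}\big[\bigcup_{(\beta_0,\beta)\in\mathbb{R}^{p+1}}\bigcap_{j=1}^n\{y_j(\beta_0+x_j^T\beta)>0\}\big]$. Here $i=\sqrt{-1}$ and, for $z\in\mathbb{C}$, $\Phi_k(z):=\frac12+\frac{1}{\sqrt{2\pi}}\int_0^{z/\sqrt{k+1}}e^{-t^2/2}\,dt$. Set $\mu_m:=0$ for $m>n$. *)

theory Defs
  imports "HOL-Probability.Probability" "HOL-Complex_Analysis.Complex_Analysis"
begin

definition std_gaussian :: "'a::euclidean_space measure" where
  "std_gaussian = density lborel (\<lambda>v. ennreal (\<Prod>i\<in>Basis. std_normal_density (v \<bullet> i)))"

text \<open>The event below is an uncountable union, but it is measurable: it is the preimage of an open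
  set of data \<open>(x\<^sub>1, y\<^sub>1, \<dots>, x\<^sub>n, y\<^sub>n)\<close>. So \<^const>\<open>measure\<close> does not fall back to its default value.\<close>

definition separability_prob ::
  "'w measure \<Rightarrow> nat \<Rightarrow> (nat \<Rightarrow> 'w \<Rightarrow> real ^ 'p) \<Rightarrow> (nat \<Rightarrow> 'w \<Rightarrow> real) \<Rightarrow> real" where
  "separability_prob M n x y =
     measure M (\<Union>(\<beta>\<^sub>0 :: real, \<beta> :: real ^ 'p)\<in>UNIV.
       \<Inter>j\<in>{1..n}. {\<omega> \<in> space M. y j \<omega> * (\<beta>\<^sub>0 + x j \<omega> \<bullet> \<beta>) > 0})"

text \<open>The integrand is entire, so integrating along the segment from \<open>0\<close> is no restriction.\<close>

definition Phi :: "nat \<Rightarrow> complex \<Rightarrow> complex" where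
  "Phi k z = 1 / 2 + 1 / complex_of_real (sqrt (2 * pi)) *
     contour_integral (linepath 0 (z / complex_of_real (sqrt (real k + 1))))
       (\<lambda>t. exp (- (t ^ 2) / 2))"

definition Phi_mix :: "real \<Rightarrow> nat \<Rightarrow> complex \<Rightarrow> complex" where
  "Phi_mix b k z = of_real b * Phi k z + of_real (1 - b) * Phi k (- z)"

text \<open>The argument \<open>m\<close> is the full index of \<open>\<mu>\<^sub>m\<close>, so that \<open>k = n - m\<close> in the third case. There the
  integrand is absolutely integrable because \<open>k \<ge> 1\<close>; its integral is a real number.\<close>

definition mu :: "real \<Rightarrow> nat \<Rightarrow> nat \<Rightarrow> complex" where
  "mu b n m =
    (if m = 0 \<or> m > n then 0
     else if m = n then (\<Sum>N = 1..n - 1. of_real (b ^ N * (1 - b) ^ (n - N)))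
     else (let k = n - m in
       of_nat (n choose (k + 1)) *
       (LINT (g, g') | (std_gaussian :: (real \<times> real) measure).
          Phi_mix b k (\<i> * of_real g) ^ (k + 1) *
          Phi_mix b k (of_real g') ^ (n - (k + 1)))))"

end

theory Submission
  imports Defs
begin

text \<open>
  Condition on the labels and add one feature at a time. Let \<open>S m\<close> be the probability of separability with
  \<open>m\<close> features and \<open>T m\<close> the same with a positive coefficient on the last feature. Changing the sign of the
  last column gives \<open>2 * T (m + 1) = S (m + 1) + S m\<close>, since a separating vector with both signs of the last
  coefficient averages to one that does not use it. Hence
  \<open>S (l + 2) - S l = 2 * (T (l + 2) - T (l + 1))\<close>.

  By linear programming duality in general position, the event counted by \<open>T (l + 2) - T (l + 1)\<close> is the
  disjoint union, over the sets \<open>K\<close> of \<open>l + 2\<close> samples, of the events that the hyperplane through the points of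
  \<open>K\<close> is optimal. For fixed \<open>K\<close>, the kernel direction of the Gaussian matrix of \<open>K\<close>, which decides dual
  feasibility, is uniform on the sphere orthogonal to the vector of ones; its probability is the solid angle of a
  cone. Given the hyperplane, the remaining samples are on the correct side independently. After Fourier
  inversion the solid angle is the expectation of a product of \<open>Phi k (\<plusminus> \<i> * g)\<close>, and the other factor is
  the expectation of a product of \<open>Phi k (\<plusminus> g')\<close>; summing over labels and \<open>K\<close> gives \<open>\<mu>\<close>.
\<close>

subsection \<open>Separation and dual certificates\<close>

text \<open>The intercept singles out the vector of ones. An orthogonal change of the rows in
  \<open>K\<close> sends it to \<open>\<tau>\<close> times one axis, where
  \<open>\<tau>^2 = card K = k + 1\<close>. On the other rows the intercept is absent; they
  determine the multipliers of the certificate and the slopes of the hyperplane. The remaining row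
  only adds a Gaussian offset scaled by \<open>1 / \<tau>\<close>. This is the origin of the
  factorisation, of \<open>sqrt (k + 1)\<close> in \<open>Phi k\<close> and of \<open>g'\<close>,
  the offset shared by all samples outside \<open>K\<close>. The imaginary argument comes from
  inversion at 0. \<open>Phi k (\<i> * y * g)\<close> is \<open>exp (g^2 / (2 * (k + 1)))\<close>
  times the characteristic function of a Gaussian cut off at 0, and \<open>k + 1\<close> such
  exponentials cancel the one in the density of \<open>g\<close>. What remains is a Fourier integral
  that fixes the component along the ones at 0. Two decaying factors make it converge absolutely;
  the case of one feature is counted directly, by ordering the values. A kernel vector is known only
  up to a scalar and has to be selected measurably; so cones and caps are made symmetric under sign,
  and degenerate data are discarded as null sets.\<close>

lemma homogeneous_system_solution:
  fixes A :: "'a \<Rightarrow> 'b \<Rightarrow> 'w \<Rightarrow> real"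
  assumes "finite I" "finite J" "card I < card J"
    and "\<And>i c. A i c \<in> borel_measurable M"
  shows "\<exists>s. (\<forall>c. s c \<in> borel_measurable M) \<and>
    (\<forall>w. (\<exists>c\<in>J. s c w \<noteq> 0) \<and> (\<forall>i\<in>I. (\<Sum>c\<in>J. s c w * A i c w) = 0))"
  using assms
proof (induction I arbitrary: J A rule: finite_induct)
  case empty
  then obtain c where "c \<in> J" by fastforce
  then show ?case by (intro exI[of _ "\<lambda>c w. 1"]) auto
next
  case (insert i I)
  note [measurable] = insert.prems(3)
  \<comment> \<open>The pivot of row \<open>i\<close> depends on the point \<open>w\<close>:
    \<open>Some c\<close> is a column with nonzero entry, \<open>None\<close> records that the row
    vanishes on \<open>D\<close>. There are finitely many cases, which keeps the construction
    measurable.\<close>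
  define ok where "ok D d w \<longleftrightarrow> (case d of None \<Rightarrow> (\<forall>c\<in>D. A i c w = 0) | Some c \<Rightarrow> A i c w \<noteq> 0)"
    for D and d :: "'b option" and w
  \<comment> \<open>Candidates for all pivots are glued into one measurable function, column by
    column; at every \<open>w\<close> the result agrees with a candidate whose pivot is valid
    there.\<close>
  have choice: "\<exists>s. (\<forall>c. s c \<in> borel_measurable M) \<and>
      (\<forall>w. \<exists>d\<in>insert None (Some ` D). ok D d w \<and> (\<forall>c. s c w = f d c w))"
    if "finite D" "\<And>d c. f d c \<in> borel_measurable M" for D and f :: "'b option \<Rightarrow> 'b \<Rightarrow> 'w \<Rightarrow> real"
    using that(1)
  proof (induction D rule: finite_induct)
    case empty
    show ?case using that(2) by (intro exI[of _ "f None"]) (simp add: ok_def)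
  next
    case (insert c D)
    from insert.IH obtain s where s: "\<forall>c. s c \<in> borel_measurable M"
      "\<forall>w. \<exists>d\<in>insert None (Some ` D). ok D d w \<and> (\<forall>c. s c w = f d c w)" by (elim exE conjE)
    note [measurable] = s(1)[rule_format] that(2)
    show ?case
    proof (intro exI[of _ "\<lambda>c' w. if A i c w \<noteq> 0 then f (Some c) c' w else s c' w"] conjI allI)
      fix w
      show "\<exists>d\<in>insert None (Some ` insert c D). ok (insert c D) d w
          \<and> (\<forall>c'. (if A i c w \<noteq> 0 then f (Some c) c' w else s c' w) = f d c' w)"
      proof (cases "A i c w = 0")
        case True
        from s(2)[rule_format, of w] obtain d where d: "d\<in>insert None (Some ` D)" "ok D d w"
          "\<forall>c. s c w = f d c w" by (elim bexE conjE)
        have "ok (insert c D) d w" using d(2) True by (cases d) (simp_all add: ok_def)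
        then show ?thesis using True d by (intro bexI[of _ d]) auto
      next
        case False
        then show ?thesis by (intro bexI[of _ "Some c"]) (auto simp: ok_def)
      qed
    qed measurable
  qed
  \<comment> \<open>Elimination: a multiple of the pivot column \<open>c0\<close> is subtracted from
    each column so that row \<open>i\<close> disappears. One unknown and one equation are lost, so
    the induction hypothesis still applies.\<close>
  define B where "B d j c w = (case d of None \<Rightarrow> A j c w | Some c0 \<Rightarrow> A j c w - A j c0 w * A i c w / A i c0 w)"
    for d j c w
  have Bm: "B d j c \<in> borel_measurable M" for d j c
    unfolding B_def by (cases d) auto
  have "\<exists>t. (\<forall>c. t c \<in> borel_measurable M) \<and> (\<forall>w. (\<exists>c\<in>J - set_option d. t c w \<noteq> 0) \<and>
       (\<forall>j\<in>I. (\<Sum>c\<in>J - set_option d. t c w * B d j c w) = 0))"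
    if "d \<in> insert None (Some ` J)" for d
  proof (rule insert.IH)
    show "finite (J - set_option d)" using insert.prems by auto
    show "card I < card (J - set_option d)"
      using that insert by (auto simp: card_Diff_singleton_if)
  qed (rule Bm)
  then have "\<forall>d\<in>insert None (Some ` J). \<exists>t. (\<forall>c. t c \<in> borel_measurable M) \<and> (\<forall>w. (\<exists>c\<in>J - set_option d. t c w \<noteq> 0) \<and>
       (\<forall>j\<in>I. (\<Sum>c\<in>J - set_option d. t c w * B d j c w) = 0))" by (rule ballI)
  from bchoice[OF this] obtain t where tt: "\<forall>d\<in>insert None (Some ` J). (\<forall>c. t d c \<in> borel_measurable M) \<and> (\<forall>w. (\<exists>c\<in>J - set_option d. t d c w \<noteq> 0) \<and>
       (\<forall>j\<in>I. (\<Sum>c\<in>J - set_option d. t d c w * B d j c w) = 0))" by (elim exE)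
  have t: "\<And>d c. d \<in> insert None (Some ` J) \<Longrightarrow> t d c \<in> borel_measurable M"
    "\<And>d w. d \<in> insert None (Some ` J) \<Longrightarrow> \<exists>c\<in>J - set_option d. t d c w \<noteq> 0"
    "\<And>d w j. d \<in> insert None (Some ` J) \<Longrightarrow> j \<in> I \<Longrightarrow> (\<Sum>c\<in>J - set_option d. t d c w * B d j c w) = 0"
    by (drule bspec[OF tt], simp)+
  \<comment> \<open>Back substitution: the coordinate at \<open>c0\<close> is the value that makes
    row \<open>i\<close> vanish. The value 0 at indices that are not candidate pivots is only a
    measurable default.\<close>
  define f where "f d c w = (if d \<notin> insert None (Some ` J) then 0 else
     case d of None \<Rightarrow> t None c w
     | Some c0 \<Rightarrow> if c = c0 then - (\<Sum>c\<in>J - {c0}. t d c w * A i c w) / A i c0 w else t d c w)" for d c w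
  have fm: "f d c \<in> borel_measurable M" for d c
  proof (cases "d \<in> insert None (Some ` J)")
    case True
    have tm: "t d c \<in> borel_measurable M" for c using t(1)[OF True] .
    show ?thesis
    proof (cases d)
      case None
      then show ?thesis using tm unfolding f_def by simp
    next
      case (Some c0)
      then have "f d c = (if c = c0 then \<lambda>w. - (\<Sum>c\<in>J - {c0}. t d c w * A i c w) / A i c0 w else t d c)"
        using True by (auto simp: f_def fun_eq_iff)
      then show ?thesis using tm by simp
    qed
  next
    case False
    then have "f d c = (\<lambda>w. 0)" by (auto simp: f_def fun_eq_iff)
    then show ?thesis by simp
  qed
  from choice[of J f, OF insert.prems(1) fm] obtain s where s0: "\<forall>c. s c \<in> borel_measurable M"
    "\<forall>w. \<exists>d\<in>insert None (Some ` J). ok J d w \<and> (\<forall>c. s c w = f d c w)" by (elim exE conjE)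
  note s = s0[rule_format]
  show ?case
  proof (intro exI[of _ s] conjI allI s(1))
    fix w
    from s(2)[of w] obtain d where d: "d\<in>insert None (Some ` J)" "ok J d w" "\<forall>c. s c w = f d c w"
      by (elim bexE conjE)
    have "(\<exists>c\<in>J. f d c w \<noteq> 0) \<and> (\<forall>j\<in>insert i I. (\<Sum>c\<in>J. f d c w * A j c w) = 0)"
    proof (cases d)
      case None
      then show ?thesis using d(1,2) t(2)[OF d(1), of w] t(3)[OF d(1), of _ w]
        by (auto simp: f_def B_def ok_def)
    next
      case (Some c0)
      then have c0: "c0 \<in> J" "A i c0 w \<noteq> 0" using d by (auto simp: ok_def)
      have ne: "\<exists>c\<in>J. f d c w \<noteq> 0" using t(2)[OF d(1), of w] Some c0 by (auto simp: f_def)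
      have split: "(\<Sum>c\<in>J. f d c w * A j c w) =
          (- (\<Sum>c\<in>J - {c0}. t d c w * A i c w) / A i c0 w) * A j c0 w + (\<Sum>c\<in>J - {c0}. t d c w * A j c w)" for j
        using c0 insert.prems(1) Some
        by (subst sum.remove[of J c0]) (auto simp: f_def intro!: sum.cong)
      have "(\<Sum>c\<in>J. f d c w * A j c w) = 0" if "j \<in> I" for j
      proof -
        have "(\<Sum>c\<in>J - {c0}. t d c w * (A j c w - A j c0 w * A i c w / A i c0 w)) = 0"
          using t(3)[OF d(1) that, of w] Some by (simp add: B_def)
        then have "(\<Sum>c\<in>J - {c0}. t d c w * A j c w) =
            (\<Sum>c\<in>J - {c0}. t d c w * (A j c0 w * A i c w / A i c0 w))"
          by (simp add: right_diff_distrib sum_subtractf)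
        also have "\<dots> = (\<Sum>c\<in>J - {c0}. t d c w * A i c w) / A i c0 w * A j c0 w"
          unfolding sum_distrib_right sum_divide_distrib by (intro sum.cong refl) simp
        finally show ?thesis unfolding split by simp
      qed
      moreover have "(\<Sum>c\<in>J. f d c w * A i c w) = 0" unfolding split using c0 by simp
      ultimately show ?thesis using ne by blast
    qed
    then show "\<exists>c\<in>J. s c w \<noteq> 0" "\<forall>j\<in>insert i I. (\<Sum>c\<in>J. s c w * A j c w) = 0"
      using d(3) by simp_all
  qed
qed

lemma homogeneous_system_solution_const:
  fixes A :: "'a \<Rightarrow> 'b \<Rightarrow> real"
  assumes "finite I" "finite J" "card I < card J"
  shows "\<exists>s. (\<exists>c\<in>J. s c \<noteq> 0) \<and> (\<forall>i\<in>I. (\<Sum>c\<in>J. s c * A i c) = 0)"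
proof -
  have m: "\<And>i c. (\<lambda>_::unit. A i c) \<in> borel_measurable (count_space UNIV)" by simp
  obtain s :: "'b \<Rightarrow> unit \<Rightarrow> real" where "\<forall>w. (\<exists>c\<in>J. s c w \<noteq> 0) \<and> (\<forall>i\<in>I. (\<Sum>c\<in>J. s c w * A i c) = 0)"
    using homogeneous_system_solution[OF assms, where A="\<lambda>i c _. A i c", OF m] by blast
  then show ?thesis by (intro exI[of _ "\<lambda>c. s c ()"]) auto
qed

text \<open>For \<open>card I = card J\<close> this is invertibility of the matrix, stated through
  its kernel so that determinants are avoided.\<close>

definition nonsing :: "'a set \<Rightarrow> 'b set \<Rightarrow> ('a \<Rightarrow> 'b \<Rightarrow> real) \<Rightarrow> bool" where
  "nonsing I J A \<longleftrightarrow> (\<forall>s. (\<forall>i\<in>I. (\<Sum>c\<in>J. s c * A i c) = 0) \<longrightarrow> (\<forall>c\<in>J. s c = 0))"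

text \<open>The right-hand side is added as a column \<open>None\<close>. The enlarged system has
  more unknowns than equations, so it has a nonzero solution; its coordinate at \<open>None\<close>
  cannot vanish, and dividing by it solves the original system.\<close>

lemma nonsing_solve:
  assumes "finite I" "finite J" "card I = card J" "nonsing I J A"
  shows "\<exists>s. \<forall>i\<in>I. (\<Sum>c\<in>J. s c * A i c) = r i"
proof -
  have "card I < card (insert None (Some ` J))"
    using assms by (subst card_insert_disjoint) (auto simp: card_image)
  from homogeneous_system_solution_const[OF assms(1) _ this, of "\<lambda>i c. case c of None \<Rightarrow> r i | Some c \<Rightarrow> A i c"]
  obtain s where s: "\<exists>c\<in>insert None (Some ` J). s c \<noteq> 0"
    "\<And>i. i\<in>I \<Longrightarrow> (\<Sum>c\<in>insert None (Some ` J). s c * (case c of None \<Rightarrow> r i | Some c \<Rightarrow> A i c)) = 0"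
    using assms by auto
  have *: "s None * r i + (\<Sum>c\<in>J. s (Some c) * A i c) = 0" if "i \<in> I" for i
    using s(2)[OF that] assms by (subst (asm) sum.insert) (auto simp: sum.reindex)
  have ne: "s None \<noteq> 0"
  proof
    assume "s None = 0"
    with * have "\<forall>i\<in>I. (\<Sum>c\<in>J. s (Some c) * A i c) = 0" by simp
    with assms(4) have "\<forall>c\<in>J. s (Some c) = 0" unfolding nonsing_def by (auto dest: spec[of _ "\<lambda>c. s (Some c)"])
    with s(1) \<open>s None = 0\<close> show False by auto
  qed
  show ?thesis
  proof (intro exI[of _ "\<lambda>c. - s (Some c) / s None"] ballI)
    fix i assume "i \<in> I"
    have "(\<Sum>c\<in>J. - s (Some c) / s None * A i c) = - (\<Sum>c\<in>J. s (Some c) * A i c) / s None"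
      by (simp add: sum_divide_distrib sum_negf)
    also have "\<dots> = r i" using *[OF \<open>i \<in> I\<close>] ne by (simp add: field_simps)
    finally show "(\<Sum>c\<in>J. - s (Some c) / s None * A i c) = r i" .
  qed
qed

text \<open>If \<open>a\<close> annihilates all columns, solve the system with right-hand side
  \<open>a\<close> itself; pairing the solution with \<open>a\<close> shows that the sum of squares
  of \<open>a\<close> is 0.\<close>

lemma nonsing_transpose:
  assumes "finite I" "finite J" "card I = card J" "nonsing I J A"
  shows "nonsing J I (\<lambda>c i. A i c)"
  unfolding nonsing_def
proof (intro allI impI ballI)
  fix a i assume a: "\<forall>c\<in>J. (\<Sum>i\<in>I. a i * A i c) = 0" and i: "i \<in> I"
  from nonsing_solve[OF assms, of a] obtain s where s: "\<And>i. i \<in> I \<Longrightarrow> (\<Sum>c\<in>J. s c * A i c) = a i" by blast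
  have "(\<Sum>i\<in>I. a i * a i) = (\<Sum>i\<in>I. a i * (\<Sum>c\<in>J. s c * A i c))" using s by simp
  also have "\<dots> = (\<Sum>i\<in>I. \<Sum>c\<in>J. s c * (a i * A i c))" by (simp add: sum_distrib_left mult_ac)
  also have "\<dots> = (\<Sum>c\<in>J. s c * (\<Sum>i\<in>I. a i * A i c))" by (subst sum.swap) (simp add: sum_distrib_left)
  also have "\<dots> = 0" using a by simp
  finally have "\<forall>i\<in>I. a i * a i = 0" using assms(1) by (subst (asm) sum_nonneg_eq_0_iff) auto
  then show "a i = 0" using i by simp
qed

text \<open>Sample \<open>j\<close> has the features \<open>X (j, 0), X (j, 1), \<dots>\<close>; column \<open>0\<close> of the design matrix
  is the intercept, which shifts the features by one.\<close>

definition row :: "(nat \<times> nat \<Rightarrow> real) \<Rightarrow> nat \<Rightarrow> nat \<Rightarrow> real" where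
  "row X j c = (case c of 0 \<Rightarrow> 1 | Suc i \<Rightarrow> X (j, i))"

definition aff :: "(nat \<times> nat \<Rightarrow> real) \<Rightarrow> nat \<Rightarrow> (nat \<Rightarrow> real) \<Rightarrow> nat \<Rightarrow> real" where
  "aff X m \<beta> j = (\<Sum>c\<le>m. \<beta> c * row X j c)"

text \<open>General position in the first \<open>m\<close> features: any \<open>m + 1\<close> of the
  points are affinely independent.\<close>

definition gen :: "(nat \<times> nat \<Rightarrow> real) \<Rightarrow> nat set \<Rightarrow> nat \<Rightarrow> bool" where
  "gen X S m \<longleftrightarrow> (\<forall>K\<subseteq>S. card K = Suc m \<longrightarrow> nonsing K {..m} (row X))"

definition sep :: "nat set \<Rightarrow> (nat \<Rightarrow> real) \<Rightarrow> nat \<Rightarrow> (nat \<times> nat \<Rightarrow> real) \<Rightarrow> bool" where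
  "sep S y m X \<longleftrightarrow> (\<exists>\<beta>. \<forall>j\<in>S. y j * aff X m \<beta> j > 0)"

definition seppos :: "nat set \<Rightarrow> (nat \<Rightarrow> real) \<Rightarrow> nat \<Rightarrow> (nat \<times> nat \<Rightarrow> real) \<Rightarrow> bool" where
  "seppos S y m X \<longleftrightarrow> (\<exists>\<beta>. \<beta> m > 0 \<and> (\<forall>j\<in>S. y j * aff X m \<beta> j > 0))"

text \<open>The points of \<open>K\<close> admit a Farkas certificate against \<open>seppos\<close> in dimension \<open>l + 1\<close>, and
  one more feature turns the hyperplane through them into a separating one. In general position, exactly one
  such \<open>K\<close> of size \<open>l + 2\<close> exists when \<open>seppos\<close> holds in dimension \<open>l + 2\<close> but not in dimension \<open>l + 1\<close>.\<close>

definition dualcert :: "nat set \<Rightarrow> (nat \<Rightarrow> real) \<Rightarrow> nat \<Rightarrow> (nat \<times> nat \<Rightarrow> real) \<Rightarrow> bool" where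
  "dualcert K y l X \<longleftrightarrow> (\<exists>\<alpha>. (\<forall>j\<in>K. y j * \<alpha> j > 0) \<and> (\<forall>c\<le>l. (\<Sum>j\<in>K. \<alpha> j * row X j c) = 0) \<and>
     (\<Sum>j\<in>K. \<alpha> j * row X j (Suc l)) < 0)"

definition supporting :: "nat set \<Rightarrow> nat set \<Rightarrow> (nat \<Rightarrow> real) \<Rightarrow> nat \<Rightarrow> (nat \<times> nat \<Rightarrow> real) \<Rightarrow> bool" where
  "supporting S K y p X \<longleftrightarrow> (\<exists>\<beta>. \<beta> p = 1 \<and> (\<forall>j\<in>K. aff X p \<beta> j = 0) \<and> (\<forall>j\<in>S - K. y j * aff X p \<beta> j > 0))"

lemma aff_Suc: "aff X (Suc m) \<beta> j = aff X m \<beta> j + \<beta> (Suc m) * X (j, m)"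
  by (simp add: aff_def row_def)

lemma aff_upd: "aff X m (\<beta>(Suc m := t)) j = aff X m \<beta> j"
  unfolding aff_def by (intro sum.cong) auto

lemma aff_add: "aff X m (\<lambda>c. \<beta> c + \<epsilon> * d c) j = aff X m \<beta> j + \<epsilon> * aff X m d j"
  by (simp add: aff_def sum.distrib sum_distrib_left algebra_simps)

lemma aff_scale: "aff X m (\<lambda>c. \<epsilon> * d c) j = \<epsilon> * aff X m d j"
  by (simp add: aff_def sum_distrib_left algebra_simps)

lemma gen_solve:
  assumes "gen X S m" "Z \<subseteq> S" "card Z \<le> Suc m" "Suc m \<le> card S" "finite S"
  shows "\<exists>\<beta>. \<forall>j\<in>Z. aff X m \<beta> j = r j"
proof -
  obtain Z' where Z': "Z \<subseteq> Z'" "Z' \<subseteq> S" "card Z' = Suc m"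
    using assms by (metis exists_subset_between)
  have "finite Z'" using Z' assms finite_subset by blast
  moreover have "nonsing Z' {..m} (row X)" using assms(1) Z' unfolding gen_def by blast
  ultimately obtain s where "\<forall>i\<in>Z'. (\<Sum>c\<in>{..m}. s c * row X i c) = r i"
    using nonsing_solve[of Z' "{..m}" "row X" r] Z' by auto
  then show ?thesis using Z'(1) unfolding aff_def by (intro exI[of _ s]) auto
qed

lemma gen_zero:
  assumes "gen X S m" "K \<subseteq> S" "Suc m \<le> card K" "\<forall>j\<in>K. aff X m \<beta> j = 0"
  shows "\<forall>c\<le>m. \<beta> c = 0"
proof -
  obtain K' where "K' \<subseteq> K" "card K' = Suc m"
    using assms(3) by (metis obtain_subset_with_card_n)
  moreover have "nonsing K' {..m} (row X)" using assms(1,2) calculation by (auto simp: gen_def)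
  moreover have "\<forall>j\<in>K'. (\<Sum>c\<in>{..m}. \<beta> c * row X j c) = 0"
    using assms(4) calculation(1) by (auto simp: aff_def)
  ultimately have "\<forall>c\<in>{..m}. \<beta> c = 0" unfolding nonsing_def by (elim allE impE) simp_all
  then show ?thesis by simp
qed

section \<open>Linear programming duality for separating hyperplanes\<close>

lemma small_perturbation:
  fixes g h :: "'a \<Rightarrow> real"
  assumes "finite S" "\<And>j. j \<in> S \<Longrightarrow> g j > 0 \<or> (g j = 0 \<and> h j > 0)"
  shows "\<exists>\<epsilon>>0. \<forall>j\<in>S. g j + \<epsilon> * h j > 0"
proof -
  have "\<exists>e>0. \<forall>\<epsilon>. 0 < \<epsilon> \<and> \<epsilon> < e \<longrightarrow> g j + \<epsilon> * h j > 0" if "j \<in> S" for j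
  proof (cases "g j = 0")
    case True
    then show ?thesis using assms(2)[OF that] by (intro exI[of _ 1]) auto
  next
    case False
    then have "g j > 0" using assms(2)[OF that] by auto
    show ?thesis
    proof (intro exI[of _ "g j / (\<bar>h j\<bar> + 1)"] conjI allI impI)
      fix \<epsilon> assume e: "0 < \<epsilon> \<and> \<epsilon> < g j / (\<bar>h j\<bar> + 1)"
      then have "\<epsilon> * (\<bar>h j\<bar> + 1) < g j" by (simp add: field_simps)
      moreover have "\<epsilon> * (- \<bar>h j\<bar>) \<le> \<epsilon> * h j" using e by (intro mult_left_mono) auto
      ultimately show "g j + \<epsilon> * h j > 0" using e by (simp add: algebra_simps)
    qed (use \<open>g j > 0\<close> in auto)
  qed
  then obtain e where e: "\<And>j. j \<in> S \<Longrightarrow> e j > 0"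
    "\<And>j \<epsilon>. j \<in> S \<Longrightarrow> 0 < \<epsilon> \<and> \<epsilon> < e j \<Longrightarrow> g j + \<epsilon> * h j > 0" by metis
  define m where "m = Min (insert 1 (e ` S))"
  have "m > 0" unfolding m_def using assms(1) e(1) by (subst Min_gr_iff) auto
  moreover have "m \<le> e j" if "j \<in> S" for j unfolding m_def using assms(1) that by (intro Min_le) auto
  ultimately show ?thesis by (intro exI[of _ "m/2"] conjI ballI e(2)) fastforce+
qed

text \<open>The supporting hyperplane meets the points of \<open>K\<close>. General position
  provides a direction \<open>d\<close> with value \<open>y j\<close> at each of them; a small
  multiple of it makes these inequalities strict without losing the others, and leaves the last
  coefficient at 1.\<close>

lemma certificate_imp_seppos:
  assumes "finite S" "\<And>j. j \<in> S \<Longrightarrow> y j \<in> {-1, 1}" "gen X S (Suc l)" "l + 2 \<le> card S"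
    "K \<subseteq> S" "card K = l + 2" "supporting S K y (l + 2) X"
  shows "seppos S y (l + 2) X"
proof -
  from assms(7) obtain \<beta> where b: "\<beta> (l+2) = 1" "\<And>j. j \<in> K \<Longrightarrow> aff X (l+2) \<beta> j = 0"
    "\<And>j. j \<in> S - K \<Longrightarrow> y j * aff X (l+2) \<beta> j > 0" unfolding supporting_def by blast
  obtain d0 where d0: "\<And>j. j \<in> K \<Longrightarrow> aff X (Suc l) d0 j = y j"
    using gen_solve[of X S "Suc l" K y] assms by auto
  define d where "d = d0(Suc (Suc l) := 0)"
  have d: "aff X (l+2) d j = y j" if "j \<in> K" for j
    using d0[OF that] by (simp add: d_def aff_Suc aff_upd del: fun_upd_apply) simp
  have yy: "y j * y j = 1" if "j \<in> S" for j using assms(2)[OF that] by auto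
  have "\<exists>\<epsilon>>0. \<forall>j\<in>S. y j * aff X (l+2) \<beta> j + \<epsilon> * (y j * aff X (l+2) d j) > 0"
  proof (rule small_perturbation[OF assms(1)])
    fix j assume "j \<in> S"
    then show "y j * aff X (l+2) \<beta> j > 0 \<or> (y j * aff X (l+2) \<beta> j = 0 \<and> y j * aff X (l+2) d j > 0)"
      using b(2)[of j] b(3)[of j] d[of j] yy[of j] by (cases "j \<in> K") simp_all
  qed
  then obtain \<epsilon> where e: "\<epsilon> > 0" "\<And>j. j \<in> S \<Longrightarrow> y j * aff X (l+2) \<beta> j + \<epsilon> * (y j * aff X (l+2) d j) > 0"
    by blast
  have "d (l+2) = 0" by (simp add: d_def)
  then show ?thesis unfolding seppos_def
    by (intro exI[of _ "\<lambda>c. \<beta> c + \<epsilon> * d c"] conjI)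
      (use e b in \<open>auto simp: aff_add distrib_left mult.left_commute\<close>)
qed

text \<open>Weak duality: pairing the multipliers with the values of a separating function gives
  nonnegative terms, whereas exchanging the sums leaves only the last column, which contributes a
  negative number.\<close>

lemma dualcert_imp_not_seppos:
  assumes "dualcert K y l X" "K \<subseteq> S" "finite S"
    "\<And>j. j \<in> S \<Longrightarrow> y j \<in> {-1, 1}"
  shows "\<not> seppos S y (Suc l) X"
proof
  assume "seppos S y (Suc l) X"
  then obtain d where d: "d (Suc l) > 0" "\<And>j. j \<in> S \<Longrightarrow> y j * aff X (Suc l) d j > 0" unfolding seppos_def by blast
  from assms(1) obtain \<alpha> where a: "\<And>j. j \<in> K \<Longrightarrow> y j * \<alpha> j > 0" "\<And>c. c \<le> l \<Longrightarrow> (\<Sum>j\<in>K. \<alpha> j * row X j c) = 0"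
     "(\<Sum>j\<in>K. \<alpha> j * row X j (Suc l)) < 0" unfolding dualcert_def by blast
  have "(\<Sum>j\<in>K. \<alpha> j * aff X (Suc l) d j) = (\<Sum>c\<le>Suc l. d c * (\<Sum>j\<in>K. \<alpha> j * row X j c))"
    unfolding aff_def sum_distrib_left by (subst sum.swap) (simp add: mult_ac)
  also have "\<dots> = d (Suc l) * (\<Sum>j\<in>K. \<alpha> j * row X j (Suc l))" using a(2) by simp
  also have "\<dots> < 0" using d(1) a(3) by (simp add: mult_pos_neg)
  finally have "(\<Sum>j\<in>K. \<alpha> j * aff X (Suc l) d j) < 0" .
  moreover have "\<alpha> j * aff X (Suc l) d j \<ge> 0" if "j \<in> K" for j
  proof -
    have "j \<in> S" using that assms by auto
    have "(y j * \<alpha> j) * (y j * aff X (Suc l) d j) > 0" using mult_pos_pos[OF a(1)[OF that] d(2)[OF \<open>j \<in> S\<close>]] .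
    then show ?thesis using assms(4)[OF \<open>j \<in> S\<close>] by auto
  qed
  ultimately show False by (simp add: sum_nonneg leD)
qed

text \<open>Consider maximising the coefficient at \<open>l + 1\<close> among functions with
  coefficient 1 at \<open>l + 2\<close> that are weakly correct on \<open>S\<close>. The certificate
  bounds the objective by its value at \<open>b\<close>, and equality forces complementary slackness
  on \<open>K\<close>.\<close>

lemma certificate_unique_aux:
  assumes S: "finite S" "\<And>j. j \<in> S \<Longrightarrow> y j \<in> {-1, 1}"
    and K: "K \<subseteq> S" "dualcert K y l X"
    and b: "b (l+2) = 1" "\<And>j. j \<in> K \<Longrightarrow> aff X (l+2) b j = 0"
    and b': "b' (l+2) = 1" "\<And>j. j \<in> S \<Longrightarrow> y j * aff X (l+2) b' j \<ge> 0"
  shows "b' (Suc l) \<le> b (Suc l)" "b' (Suc l) = b (Suc l) \<Longrightarrow> \<forall>j\<in>K. aff X (l+2) b' j = 0"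
proof -
  from K(2) obtain \<alpha> where a: "\<And>j. j \<in> K \<Longrightarrow> y j * \<alpha> j > 0" "\<And>c. c \<le> l \<Longrightarrow> (\<Sum>j\<in>K. \<alpha> j * row X j c) = 0"
     "(\<Sum>j\<in>K. \<alpha> j * row X j (Suc l)) < 0" unfolding dualcert_def by blast
  have fK: "finite K" using S K finite_subset by blast
  have exp: "(\<Sum>j\<in>K. \<alpha> j * aff X (l+2) d j) = d (Suc l) * (\<Sum>j\<in>K. \<alpha> j * row X j (Suc l)) + d (l+2) * (\<Sum>j\<in>K. \<alpha> j * row X j (l+2))" for d
  proof -
    have "(\<Sum>j\<in>K. \<alpha> j * aff X (l+2) d j) = (\<Sum>c\<le>l+2. d c * (\<Sum>j\<in>K. \<alpha> j * row X j c))"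
      unfolding aff_def sum_distrib_left by (subst sum.swap) (simp add: mult_ac)
    also have "\<dots> = d (Suc l) * (\<Sum>j\<in>K. \<alpha> j * row X j (Suc l)) + d (l+2) * (\<Sum>j\<in>K. \<alpha> j * row X j (l+2))" using a(2) by simp
    finally show ?thesis .
  qed
  have 0: "(\<Sum>j\<in>K. \<alpha> j * aff X (l+2) b j) = 0" using b by simp
  have nn: "\<alpha> j * aff X (l+2) b' j \<ge> 0" if "j \<in> K" for j
  proof -
    have "j \<in> S" using that K by auto
    have "(y j * \<alpha> j) * (y j * aff X (l+2) b' j) \<ge> 0"
      using mult_nonneg_nonneg[OF less_imp_le[OF a(1)[OF that]] b'(2)[OF \<open>j \<in> S\<close>]] .
    then show ?thesis using S(2)[OF \<open>j \<in> S\<close>] by auto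
  qed
  have eq: "(\<Sum>j\<in>K. \<alpha> j * aff X (l+2) b' j) = (b' (Suc l) - b (Suc l)) * (\<Sum>j\<in>K. \<alpha> j * row X j (Suc l))"
    using exp[of b'] exp[of b] 0 b b' by (simp add: algebra_simps)
  moreover have "(\<Sum>j\<in>K. \<alpha> j * aff X (l+2) b' j) \<ge> 0" using nn by (rule sum_nonneg)
  ultimately show "b' (Suc l) \<le> b (Suc l)" using a(3)
    by (metis diff_gt_0_iff_gt linorder_not_less mult_pos_neg)
  assume "b' (Suc l) = b (Suc l)"
  with eq have "(\<Sum>j\<in>K. \<alpha> j * aff X (l+2) b' j) = 0" by simp
  then have "\<forall>j\<in>K. \<alpha> j * aff X (l+2) b' j = 0" using nn fK by (simp add: sum_nonneg_eq_0_iff)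
  then show "\<forall>j\<in>K. aff X (l+2) b' j = 0" using a(1) by fastforce
qed

text \<open>Both supporting functions are optimal for the same linear program, so each vanishes on
  the set that belongs to the other. As each is strictly correct off its own set, the sets
  coincide.\<close>

lemma certificate_unique:
  assumes S: "finite S" "\<And>j. j \<in> S \<Longrightarrow> y j \<in> {-1, 1}"
    and K: "K \<subseteq> S" "dualcert K y l X" "supporting S K y (l + 2) X"
    and K': "K' \<subseteq> S" "dualcert K' y l X" "supporting S K' y (l + 2) X"
  shows "K = K'"
proof -
  from K(3) obtain b where b: "b (l+2) = 1" "\<And>j. j \<in> K \<Longrightarrow> aff X (l+2) b j = 0"
    "\<And>j. j \<in> S - K \<Longrightarrow> y j * aff X (l+2) b j > 0" unfolding supporting_def by blast
  from K'(3) obtain b' where b': "b' (l+2) = 1" "\<And>j. j \<in> K' \<Longrightarrow> aff X (l+2) b' j = 0"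
    "\<And>j. j \<in> S - K' \<Longrightarrow> y j * aff X (l+2) b' j > 0" unfolding supporting_def by blast
  have n: "y j * aff X (l+2) b j \<ge> 0" if "j \<in> S" for j using b that by (cases "j \<in> K") (auto intro: less_imp_le)
  have n': "y j * aff X (l+2) b' j \<ge> 0" if "j \<in> S" for j using b' that by (cases "j \<in> K'") (auto intro: less_imp_le)
  have eq: "b' (Suc l) = b (Suc l)"
    using certificate_unique_aux(1)[OF S K(1,2) b(1,2) b'(1) n'] certificate_unique_aux(1)[OF S K'(1,2) b'(1,2) b(1) n]
    by auto
  have 1: "\<forall>j\<in>K. aff X (l+2) b' j = 0" using certificate_unique_aux(2)[OF S K(1,2) b(1,2) b'(1) n' eq] by blast
  have 2: "\<forall>j\<in>K'. aff X (l+2) b j = 0" using certificate_unique_aux(2)[OF S K'(1,2) b'(1,2) b(1) n eq[symmetric]] by blast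
  show ?thesis
  proof (intro equalityI subsetI)
    fix j assume "j \<in> K" then show "j \<in> K'" using 1 b'(3)[of j] K(1) by (cases "j \<in> K'") auto
  next
    fix j assume "j \<in> K'" then show "j \<in> K" using 2 b(3)[of j] K'(1) by (cases "j \<in> K") auto
  qed
qed

text \<open>Strong duality by a simplex argument on the polyhedron \<open>F\<close> with objective
  \<open>v (l + 1)\<close>. Failure of \<open>seppos\<close> with \<open>l + 1\<close> features
  bounds the program; general position makes an optimal vertex nondegenerate, so that its active set
  is the required \<open>K\<close> and determines the multipliers.\<close>

lemma certificate_exists:
  assumes S: "finite S" "\<And>j. j \<in> S \<Longrightarrow> y j \<in> {-1, 1}" "l + 2 < card S"
    and g: "gen X S l" "gen X S (Suc l)" "gen X S (l + 2)"
    and sp: "seppos S y (l + 2) X" "\<not> seppos S y (Suc l) X"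
  shows "\<exists>K\<subseteq>S. card K = l + 2 \<and> dualcert K y l X \<and> supporting S K y (l + 2) X"
proof -
  define h where "h d j = y j * aff X (l+2) d j" for d j
  have h_add: "h (\<lambda>c. v c + e * d c) j = h v j + e * h d j" for v d e j
    by (simp add: h_def aff_add algebra_simps)
  define F where "F = {v. v (l+2) = (1::real) \<and> (\<forall>j\<in>S. h v j \<ge> 0)}"
  define act where "act v = {j\<in>S. h v j = 0}" for v
  have affz: "aff X (l+2) d j = aff X (Suc l) d j" if "d (l+2) = 0" for d j
    using that by (simp add: aff_Suc[of X "Suc l"])
  have h_zero: "aff X (l+2) d j = 0" if "h d j = 0" "j \<in> S" for d j
    using that S(2)[OF that(2)] by (auto simp: h_def)
  \<comment> \<open>No direction with nonnegative objective stays feasible forever. Otherwise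
    general position leaves at most \<open>l + 1\<close> of its inequalities tight, and adding a
    small multiple of a direction \<open>e\<close> with coefficient 1 at \<open>l + 1\<close> yields
    a strictly separating function with positive coefficient there, against the assumption.\<close>
  have norec: "\<exists>j\<in>S. h d j < 0" if d: "d (l+2) = 0" "d (Suc l) \<ge> 0" "\<exists>c\<le>Suc l. d c \<noteq> 0" for d
  proof (rule ccontr)
    assume "\<not> ?thesis"
    then have nn: "\<And>j. j \<in> S \<Longrightarrow> h d j \<ge> 0" by force
    have "card (act d) \<le> Suc l"
    proof (rule ccontr)
      assume "\<not> ?thesis"
      then have "Suc (Suc l) \<le> card (act d)" by simp
      moreover have "\<forall>j\<in>act d. aff X (Suc l) d j = 0"
        using h_zero[of d] affz[of d, OF d(1)] by (simp add: act_def)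
      moreover have "act d \<subseteq> S" by (auto simp: act_def)
      ultimately have "\<forall>c\<le>Suc l. d c = 0" using gen_zero[OF g(2)] by blast
      with d(3) show False by auto
    qed
    then obtain e0 where e0: "\<And>j. j \<in> act d \<Longrightarrow> aff X l e0 j = y j - X (j, l)"
      using gen_solve[OF g(1), of "act d" "\<lambda>j. y j - X (j, l)"] S by (auto simp: act_def)
    define e where "e = (e0(Suc l := 1))(l+2 := 0)"
    have e: "e (l+2) = 0" "e (Suc l) = 1" by (auto simp: e_def)
    have ea: "aff X (l+2) e j = y j" if "j \<in> act d" for j
      unfolding affz[of e, OF e(1)] using e0[OF that] unfolding aff_Suc[of X l]
      by (simp add: e_def aff_def)
    have he: "h e j > 0" if "j \<in> act d" for j
      using ea[OF that] S(2)[of j] that by (auto simp: h_def act_def)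
    have "\<exists>\<epsilon>>0. \<forall>j\<in>S. h d j + \<epsilon> * h e j > 0"
    proof (rule small_perturbation[OF S(1)])
      fix j assume "j \<in> S"
      then show "h d j > 0 \<or> (h d j = 0 \<and> h e j > 0)"
        using nn[of j] he[of j] by (auto simp: act_def less_le)
    qed
    then obtain \<epsilon> where eps: "\<epsilon> > 0" "\<And>j. j \<in> S \<Longrightarrow> h d j + \<epsilon> * h e j > 0" by blast
    define f where "f = (\<lambda>c. d c + \<epsilon> * e c)"
    have "f (Suc l) > 0" using eps d e by (simp add: f_def)
    moreover have "y j * aff X (Suc l) f j > 0" if "j \<in> S" for j
    proof -
      have "h f j > 0" using eps(2)[OF that] unfolding f_def h_add .
      moreover have "f (l+2) = 0" using d e by (simp add: f_def)
      ultimately show ?thesis using affz[of f j] by (simp add: h_def)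
    qed
    ultimately show False using sp(2) unfolding seppos_def by blast
  qed
  \<comment> \<open>The ratio test: \<open>\<epsilon>\<close> is the first step length at which a
    decreasing inequality becomes active. It is positive because inequalities active at
    \<open>v\<close> do not decrease along \<open>d\<close>.\<close>
  have step: "\<exists>v'\<in>F. \<exists>j'. j' \<notin> act v \<and> insert j' {j\<in>act v. h d j = 0} \<subseteq> act v' \<and> (\<exists>\<epsilon>>0. v' (Suc l) = v (Suc l) + \<epsilon> * d (Suc l))"
    if v: "v \<in> F" and d: "d (l+2) = 0" "d (Suc l) \<ge> 0" "\<exists>c\<le>Suc l. d c \<noteq> 0" "\<And>j. j \<in> act v \<Longrightarrow> h d j \<ge> 0" for v d
  proof -
    define N where "N = {j\<in>S. h d j < 0}"
    have N: "finite N" "N \<noteq> {}" using norec[OF d(1-3)] S by (auto simp: N_def)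
    define q where "q j = h v j / (- h d j)" for j
    define \<epsilon> where "\<epsilon> = Min (q ` N)"
    have "\<epsilon> \<in> q ` N" unfolding \<epsilon>_def using N by (intro Min_in) auto
    then obtain j' where j': "j' \<in> N" "\<epsilon> = q j'" by auto
    have vp: "h v j > 0" if "j \<in> N" for j
    proof -
      have "h v j \<ge> 0" using that v by (auto simp: N_def F_def)
      moreover have "h v j \<noteq> 0" using that d(4)[of j] by (auto simp: N_def act_def)
      ultimately show ?thesis by simp
    qed
    have eps: "\<epsilon> > 0" using vp[OF j'(1)] j' unfolding q_def N_def by (simp add: divide_pos_pos del: divide_minus_right)
    have le: "\<epsilon> \<le> q j" if "j \<in> N" for j unfolding \<epsilon>_def using N that by (intro Min_le) auto
    define v' where "v' = (\<lambda>c. v c + \<epsilon> * d c)"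
    have hv': "h v' j = h v j + \<epsilon> * h d j" for j unfolding v'_def h_add ..
    have "h v' j \<ge> 0" if "j \<in> S" for j
    proof (cases "j \<in> N")
      case True
      then have "\<epsilon> * (- h d j) \<le> h v j" using le[OF True] by (auto simp: q_def N_def field_simps)
      then show ?thesis unfolding hv' by simp
    next
      case False
      then show ?thesis unfolding hv' using that v eps by (auto simp: N_def F_def)
    qed
    then have "v' \<in> F" using v d by (simp add: F_def v'_def)
    moreover have "j' \<in> act v'" using j' by (auto simp: act_def hv' q_def N_def field_simps)
    moreover have "j' \<notin> act v" using vp[OF j'(1)] by (auto simp: act_def)
    moreover have "{j\<in>act v. h d j = 0} \<subseteq> act v'" by (auto simp: act_def hv')
    moreover have "v' (Suc l) = v (Suc l) + \<epsilon> * d (Suc l)" by (simp add: v'_def)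
    ultimately show ?thesis using eps by blast
  qed
  have fact: "finite (act v)" for v using S by (simp add: act_def)
  \<comment> \<open>With fewer than \<open>l + 2\<close> active points some nonzero direction
    vanishes on all of them. Its sign is chosen so that the objective does not fall, and every move
    gains an active point.\<close>
  have vert: "\<exists>v'\<in>F. l + 2 \<le> card (act v') \<and> v' (Suc l) \<ge> v (Suc l)" if "v \<in> F" for v
    using that
  proof (induction "card S - card (act v)" arbitrary: v rule: less_induct)
    case less
    show ?case
    proof (cases "l + 2 \<le> card (act v)")
      case True
      then show ?thesis using less.prems by blast
    next
      case False
      then have "card (act v) < card {..Suc l}" by simp
      from homogeneous_system_solution_const[OF fact _ this, of "row X"] obtain d0 where d0:
        "\<exists>c\<le>Suc l. d0 c \<noteq> 0" "\<And>j. j \<in> act v \<Longrightarrow> aff X (Suc l) d0 j = 0"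
        unfolding aff_def by auto
      define s where "s = (if d0 (Suc l) \<ge> 0 then 1 else -1 :: real)"
      define d where "d = (\<lambda>c. s * d0 c)(l+2 := 0)"
      have s: "s \<noteq> 0" by (simp add: s_def)
      have d: "d (l+2) = 0" "d (Suc l) \<ge> 0" "\<exists>c\<le>Suc l. d c \<noteq> 0"
        using d0(1) s unfolding d_def by (simp, simp add: s_def, fastforce)
      have "aff X (Suc l) d j = s * aff X (Suc l) d0 j" for j
        unfolding aff_scale[symmetric] unfolding aff_def d_def by (intro sum.cong) auto
      then have hd: "h d j = 0" if "j \<in> act v" for j
        using d0(2)[OF that] affz[of d, OF d(1)] by (simp add: h_def)
      have hd0: "\<And>j. j \<in> act v \<Longrightarrow> h d j \<ge> 0" by (simp add: hd)
      from step[of v d] less.prems d hd0 obtain v' j' \<epsilon> where v'0: "v' \<in> F" "j' \<notin> act v"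
        "insert j' {j\<in>act v. h d j = 0} \<subseteq> act v'" "\<epsilon> > 0" "v' (Suc l) = v (Suc l) + \<epsilon> * d (Suc l)"
        by blast
      have "{j\<in>act v. h d j = 0} = act v" using hd by auto
      then have v': "v' \<in> F" "j' \<notin> act v" "insert j' (act v) \<subseteq> act v'" "v' (Suc l) \<ge> v (Suc l)"
        using v'0 d(2) by auto
      have "card (act v) < card (act v')"
        using v' fact by (intro psubset_card_mono) auto
      moreover have "card (act v') \<le> card S" using S by (intro card_mono) (auto simp: act_def)
      ultimately have "card S - card (act v') < card S - card (act v)" by linarith
      from less.hyps[OF this v'(1)] v'(4) show ?thesis by force
    qed
  qed
  from sp(1) obtain b where b: "b (l+2) > 0" "\<And>j. j \<in> S \<Longrightarrow> y j * aff X (l+2) b j > 0" unfolding seppos_def by blast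
  define v0 where "v0 = (\<lambda>c. (1 / b (l+2)) * b c)"
  have "y j * aff X (l+2) v0 j \<ge> 0" if "j \<in> S" for j
  proof -
    have "y j * aff X (l+2) v0 j = (y j * aff X (l+2) b j) / b (l+2)"
      unfolding v0_def aff_scale by simp
    then show ?thesis using b that by (simp add: less_imp_le)
  qed
  then have v0: "v0 \<in> F" using b by (auto simp: F_def v0_def h_def)
  define V where "V = {v\<in>F. l + 2 \<le> card (act v)}"
  have "V \<noteq> {}" using vert[OF v0] by (auto simp: V_def)
  \<comment> \<open>The objective at a vertex depends only on its active set, hence takes finitely
    many values on vertices; this is why the maximum \<open>M\<close> exists.\<close>
  have vdet: "v (Suc l) = v' (Suc l)" if "v \<in> V" "v' \<in> V" "act v = act v'" for v v'
  proof -
    define d where "d = (\<lambda>c. v c + (-1) * v' c)"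
    have "d (l+2) = 0" using that by (auto simp: d_def V_def F_def)
    have "aff X (Suc l) d j = 0" if "j \<in> act v" for j
    proof -
      have "aff X (l+2) d j = aff X (l+2) v j + (-1) * aff X (l+2) v' j" unfolding d_def aff_add ..
      also have "\<dots> = 0" using that \<open>act v = act v'\<close> h_zero by (auto simp: act_def)
      finally show ?thesis using affz[of d, OF \<open>d (l+2) = 0\<close>] by simp
    qed
    then have "\<forall>c\<le>Suc l. d c = 0" using gen_zero[OF g(2), of "act v" d] that by (auto simp: act_def V_def)
    then show ?thesis by (simp add: d_def)
  qed
  have "finite ((\<lambda>v. v (Suc l)) ` V)"
  proof -
    have "(\<lambda>v. v (Suc l)) ` V \<subseteq> (\<lambda>A. (SOME v. v \<in> V \<and> act v = A) (Suc l)) ` Pow S"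
    proof
      fix t assume "t \<in> (\<lambda>v. v (Suc l)) ` V"
      then obtain v where v: "v \<in> V" "t = v (Suc l)" by auto
      have "(SOME v'. v' \<in> V \<and> act v' = act v) \<in> V \<and> act (SOME v'. v' \<in> V \<and> act v' = act v) = act v"
        by (rule someI[of _ v]) (use v in auto)
      then have "t = (SOME v'. v' \<in> V \<and> act v' = act v) (Suc l)" using vdet v by metis
      moreover have "act v \<in> Pow S" by (auto simp: act_def)
      ultimately show "t \<in> (\<lambda>A. (SOME v. v \<in> V \<and> act v = A) (Suc l)) ` Pow S" by blast
    qed
    then show ?thesis using S by (meson finite_Pow_iff finite_imageI finite_subset)
  qed
  then have fin: "finite ((\<lambda>v. v (Suc l)) ` V)" .
  define M where "M = Max ((\<lambda>v. v (Suc l)) ` V)"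
  have "M \<in> (\<lambda>v. v (Suc l)) ` V" unfolding M_def using fin \<open>V \<noteq> {}\<close> by (intro Max_in) auto
  then obtain v where v: "v \<in> V" "v (Suc l) = M" by auto
  have Mmax: "v' (Suc l) \<le> M" if "v' \<in> F" for v'
  proof -
    from vert[OF that] obtain v'' where "v'' \<in> V" "v' (Suc l) \<le> v'' (Suc l)" by (auto simp: V_def)
    moreover have "v'' (Suc l) \<le> M" unfolding M_def using fin \<open>v'' \<in> V\<close> by (intro Max_ge) auto
    ultimately show ?thesis by simp
  qed
  have vF: "v \<in> F" using v by (simp add: V_def)
  define K where "K = act v"
  have KS: "K \<subseteq> S" by (auto simp: K_def act_def)
  \<comment> \<open>A further active point would force \<open>v\<close> to vanish, by general
    position in \<open>l + 2\<close> features, although its last coefficient is 1.\<close>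
  have cK: "card K = l + 2"
  proof (rule ccontr)
    assume "card K \<noteq> l + 2"
    then have "Suc (l+2) \<le> card K" using v by (auto simp: V_def K_def)
    then have "\<forall>c\<le>l+2. v c = 0"
      using gen_zero[OF g(3) KS, of v] h_zero by (auto simp: K_def act_def)
    then show False using vF by (auto simp: F_def)
  qed
  have fK: "finite K" using fact by (simp add: K_def)
  have ns: "nonsing K {..Suc l} (row X)" using g(2) KS cK by (auto simp: gen_def)
  have "nonsing {..Suc l} K (\<lambda>c j. row X j c)" using nonsing_transpose[OF fK _ _ ns] cK by simp
  from nonsing_solve[OF _ fK _ this, of "\<lambda>c. if c = Suc l then -1 else 0"] cK obtain \<alpha> where
    al: "\<And>c. c \<le> Suc l \<Longrightarrow> (\<Sum>j\<in>K. \<alpha> j * row X j c) = (if c = Suc l then -1 else 0)" by auto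
  have apos: "y j0 * \<alpha> j0 > 0" if j0: "j0 \<in> K" for j0
  proof -
    \<comment> \<open>The edge at the vertex that leaves only the constraint \<open>j0\<close>. The
      objective must fall along it: a rise contradicts the maximum, and slope 0 contradicts general
      position of the other \<open>l + 1\<close> points. The multiplier of \<open>j0\<close> is read
      off from this slope.\<close>
    obtain d0 where d0: "\<And>j. j \<in> K \<Longrightarrow> aff X (Suc l) d0 j = (if j = j0 then y j0 else 0)"
      using gen_solve[OF g(2) KS, of "\<lambda>j. if j = j0 then y j0 else 0"] cK S by auto
    define d where "d = d0(l+2 := 0)"
    have d: "d (l+2) = 0" by (simp add: d_def)
    have da: "aff X (Suc l) d j = (if j = j0 then y j0 else 0)" if "j \<in> K" for j
      using d0[OF that] by (simp add: d_def aff_upd)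
    have "y j0 \<in> {-1,1}" using S KS j0 by auto
    then have y1: "y j0 * y j0 = 1" "y j0 \<noteq> 0" by auto
    have ex: "\<exists>c\<le>Suc l. d c \<noteq> 0"
    proof (rule ccontr)
      assume "\<not> ?thesis"
      then have "aff X (Suc l) d j0 = 0" by (simp add: aff_def)
      with da[OF j0] y1 show False by simp
    qed
    have "d (Suc l) < 0"
    proof (rule ccontr)
      assume "\<not> ?thesis"
      then have d2: "d (Suc l) \<ge> 0" by simp
      have "h d j \<ge> 0" if "j \<in> act v" for j
        using da[of j] that y1 affz[of d, OF d] by (auto simp: h_def K_def)
      from step[OF vF d d2 ex this] obtain v' \<epsilon> where v': "v' \<in> F" "\<epsilon> > 0" "v' (Suc l) = v (Suc l) + \<epsilon> * d (Suc l)"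
        by blast
      then have "\<epsilon> * d (Suc l) \<le> 0" using Mmax[of v'] v by simp
      then have "d (Suc l) = 0" using v'(2) d2 by (simp add: mult_le_0_iff)
      then have "aff X l d j = aff X (Suc l) d j" for j by (simp add: aff_Suc)
      then have "\<forall>j\<in>K - {j0}. aff X l d j = 0" using da by auto
      moreover have "Suc l \<le> card (K - {j0})" using cK j0 fK by simp
      ultimately have "\<forall>c\<le>l. d c = 0" using gen_zero[OF g(1), of "K - {j0}" d] KS by blast
      with ex \<open>d (Suc l) = 0\<close> show False by (metis le_Suc_eq)
    qed
    moreover have "\<alpha> j0 * y j0 = - d (Suc l)"
    proof -
      have "(\<Sum>j\<in>K. \<alpha> j * aff X (Suc l) d j) = (\<Sum>c\<le>Suc l. d c * (\<Sum>j\<in>K. \<alpha> j * row X j c))"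
        unfolding aff_def sum_distrib_left by (subst sum.swap) (simp add: mult_ac)
      also have "\<dots> = - d (Suc l)" using al by simp
      also have "(\<Sum>j\<in>K. \<alpha> j * aff X (Suc l) d j) = (\<Sum>j\<in>K. if j = j0 then \<alpha> j0 * y j0 else 0)"
        using da by (intro sum.cong) auto
      also have "\<dots> = \<alpha> j0 * y j0" using fK j0 by simp
      finally show ?thesis .
    qed
    ultimately show ?thesis by (simp add: mult.commute)
  qed
  have "dualcert K y l X" unfolding dualcert_def using apos al by (intro exI[of _ \<alpha>]) auto
  moreover have "supporting S K y (l+2) X" unfolding supporting_def
  proof (intro exI[of _ v] conjI ballI)
    show "v (l+2) = 1" using vF by (simp add: F_def)
    show "aff X (l+2) v j = 0" if "j \<in> K" for j using that h_zero by (auto simp: K_def act_def)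
    show "y j * aff X (l+2) v j > 0" if "j \<in> S - K" for j
    proof -
      have "h v j \<ge> 0" "h v j \<noteq> 0" using that vF by (auto simp: F_def K_def act_def)
      then show ?thesis unfolding h_def by linarith
    qed
  qed
  ultimately show ?thesis using KS cK by blast
qed

subsection \<open>Infinite Gaussian arrays\<close>

abbreviation std_normal :: "real measure" where
  "std_normal \<equiv> density lborel (\<lambda>x. ennreal (std_normal_density x))"

text \<open>All features of all samples at once. The infinite index set leaves rows and columns for
  fresh Gaussians and is closed under transposition and permutations, so the space never has to
  change.\<close>

definition Om :: "(nat \<times> nat \<Rightarrow> real) measure" where
  "Om = PiM UNIV (\<lambda>_. std_normal)"

lemma prob_space_std_normal: "prob_space std_normal"
  by (rule prob_space_normal_density) simp

lemma space_Om [simp]: "space Om = UNIV"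
  by (simp add: Om_def space_PiM)

lemma prob_space_Om: "prob_space Om"
  unfolding Om_def by (rule prob_space_PiM) (rule prob_space_std_normal)

interpretation Om: prob_space Om by (rule prob_space_Om)
interpretation std_normal: prob_space std_normal by (rule prob_space_std_normal)

lemma sets_Om: "sets Om = sets (PiM UNIV (\<lambda>_. borel))"
  unfolding Om_def by (rule sets_PiM_cong) simp_all

lemma measurable_Om_component [measurable (raw)]: "(\<lambda>X. X i) \<in> borel_measurable Om"
  using measurable_component_singleton[of i UNIV "\<lambda>_. borel :: real measure"]
  by (subst measurable_cong_sets[OF sets_Om refl]) simp

lemma measurable_Om_component' [measurable_dest]:
  assumes "f \<in> measurable N Om" "g \<in> measurable L N"
  shows "(\<lambda>w. f (g w) i) \<in> borel_measurable L"
  using measurable_compose[OF measurable_compose[OF assms(2,1)] measurable_Om_component] .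

lemma measurable_into_Om:
  assumes "\<And>i. (\<lambda>w. f w i) \<in> borel_measurable M"
  shows "f \<in> measurable M Om"
  by (subst measurable_cong_sets[OF refl sets_Om], rule measurable_PiM_single')
    (use assms in \<open>auto simp: space_PiM\<close>)

lemma Om_eqI:
  assumes "sets P = sets Om" "finite_measure P"
    and "\<And>A J. finite J \<Longrightarrow> (\<And>i. i \<in> J \<Longrightarrow> A i \<in> sets borel) \<Longrightarrow>
      emeasure P {X. \<forall>i\<in>J. X i \<in> A i} = (\<Prod>i\<in>J. emeasure std_normal (A i))"
  shows "P = Om"
  unfolding Om_def
proof (rule measure_eqI_PiM_infinite)
  show "sets P = sets (Pi\<^sub>M UNIV (\<lambda>_. std_normal))" using assms(1) by (simp add: Om_def)
  fix A :: "nat \<times> nat \<Rightarrow> real set" and J :: "(nat \<times> nat) set"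
  assume J: "finite J" and A: "\<And>i. i \<in> J \<Longrightarrow> A i \<in> sets std_normal"
  have "prod_emb UNIV (\<lambda>_. std_normal) J (Pi\<^sub>E J A) = {X. \<forall>i\<in>J. X i \<in> A i}"
    by (auto simp: prod_emb_def PiE_iff)
  moreover have "emeasure (Pi\<^sub>M UNIV (\<lambda>_. std_normal)) (prod_emb UNIV (\<lambda>_. std_normal) J (Pi\<^sub>E J A)) =
    (\<Prod>i\<in>J. emeasure std_normal (A i))"
    using J A prob_space_std_normal by (intro emeasure_PiM_emb) auto
  ultimately show "emeasure P (prod_emb UNIV (\<lambda>_. std_normal) J (Pi\<^sub>E J A)) =
    emeasure (Pi\<^sub>M UNIV (\<lambda>_. std_normal)) (prod_emb UNIV (\<lambda>_. std_normal) J (Pi\<^sub>E J A))"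
    using assms(3)[of J A] J A by simp
qed (use assms in simp_all)

lemma emeasure_Om_box:
  assumes "finite J" "\<And>i. i \<in> J \<Longrightarrow> A i \<in> sets borel"
  shows "emeasure Om {X. \<forall>i\<in>J. X i \<in> A i} = (\<Prod>i\<in>J. emeasure std_normal (A i))"
proof -
  have "prod_emb UNIV (\<lambda>_. std_normal) J (Pi\<^sub>E J A) = {X. \<forall>i\<in>J. X i \<in> A i}"
    by (auto simp: prod_emb_def PiE_iff)
  moreover have "emeasure (Pi\<^sub>M UNIV (\<lambda>_. std_normal)) (prod_emb UNIV (\<lambda>_. std_normal) J (Pi\<^sub>E J A)) =
    (\<Prod>i\<in>J. emeasure std_normal (A i))"
    using assms prob_space_std_normal by (intro emeasure_PiM_emb) auto
  ultimately show ?thesis by (simp add: Om_def)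
qed

section \<open>Resampling of coordinates and measure-preserving maps\<close>

definition override :: "'a set \<Rightarrow> ('a \<Rightarrow> 'b) \<Rightarrow> ('a \<Rightarrow> 'b) \<Rightarrow> 'a \<Rightarrow> 'b" where
  "override A x x' = (\<lambda>i. if i \<in> A then x i else x' i)"

lemma measurable_override [measurable (raw)]:
  assumes [measurable]: "f \<in> measurable M Om" "g \<in> measurable M Om"
  shows "(\<lambda>w. override A (f w) (g w)) \<in> measurable M Om"
  by (rule measurable_into_Om) (simp add: override_def)

lemma measurable_Om_upd [measurable (raw)]:
  assumes [measurable]: "f \<in> measurable M Om" "g \<in> borel_measurable M"
  shows "(\<lambda>w. (f w)(a := g w)) \<in> measurable M Om"
  by (rule measurable_into_Om) simp

lemma distr_override: "distr (Om \<Otimes>\<^sub>M Om) Om (\<lambda>(x, x'). override A x x') = Om"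
proof (rule Om_eqI)
  interpret P: pair_prob_space Om Om ..
  have m: "(\<lambda>(x, x'). override A x x') \<in> measurable (Om \<Otimes>\<^sub>M Om) Om" by measurable
  show "finite_measure (distr (Om \<Otimes>\<^sub>M Om) Om (\<lambda>(x, x'). override A x x'))"
    using P.prob_space_distr[OF m] by (simp add: prob_space_def)
  fix B :: "nat \<times> nat \<Rightarrow> real set" and J :: "(nat \<times> nat) set"
  assume J: "finite J" and B: "\<And>i. i \<in> J \<Longrightarrow> B i \<in> sets borel"
  have s: "{X. \<forall>i\<in>J'. X i \<in> B i} \<in> sets Om" if "J' \<subseteq> J" for J'
  proof -
    have "finite J'" using J that finite_subset by blast
    have "{X \<in> space Om. \<forall>i\<in>J'. X i \<in> B i} \<in> sets Om"
      using B that \<open>finite J'\<close> by (intro sets.sets_Collect_finite_All measurable_sets_Collect[OF measurable_Om_component]) auto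
    then show ?thesis by simp
  qed
  have "emeasure (distr (Om \<Otimes>\<^sub>M Om) Om (\<lambda>(x, x'). override A x x')) {X. \<forall>i\<in>J. X i \<in> B i} =
    emeasure (Om \<Otimes>\<^sub>M Om) ({X. \<forall>i\<in>J\<inter>A. X i \<in> B i} \<times> {X. \<forall>i\<in>J-A. X i \<in> B i})"
  proof -
    have "(\<lambda>(x, x'). override A x x') -` {X. \<forall>i\<in>J. X i \<in> B i} \<inter> space (Om \<Otimes>\<^sub>M Om) =
        {X. \<forall>i\<in>J\<inter>A. X i \<in> B i} \<times> {X. \<forall>i\<in>J-A. X i \<in> B i}"
      by (simp add: space_pair_measure override_def set_eq_iff Ball_def) blast
    then show ?thesis by (simp only: emeasure_distr[OF m s[OF order_refl]])
  qed
  also have "\<dots> = emeasure Om {X. \<forall>i\<in>J\<inter>A. X i \<in> B i} * emeasure Om {X. \<forall>i\<in>J-A. X i \<in> B i}"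
    by (intro Om.emeasure_pair_measure_Times s) auto
  also have "\<dots> = (\<Prod>i\<in>J\<inter>A. emeasure std_normal (B i)) * (\<Prod>i\<in>J-A. emeasure std_normal (B i))"
    using emeasure_Om_box[of "J \<inter> A" B] emeasure_Om_box[of "J - A" B] J B by simp
  also have "\<dots> = (\<Prod>i\<in>J. emeasure std_normal (B i))"
    using J by (subst prod.union_disjoint[symmetric]) (auto intro!: prod.cong)
  finally show "emeasure (distr (Om \<Otimes>\<^sub>M Om) Om (\<lambda>(x, x'). override A x x')) {X. \<forall>i\<in>J. X i \<in> B i} =
    (\<Prod>i\<in>J. emeasure std_normal (B i))" .
qed simp

lemma distr_upd: "distr (std_normal \<Otimes>\<^sub>M Om) Om (\<lambda>(u, x). x(a := u)) = Om"
  using distr_pair_PiM_eq_PiM[of UNIV "\<lambda>_::nat\<times>nat. std_normal" a] prob_space_std_normal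
  unfolding Om_def by simp

lemma prob_pair_fubini:
  assumes "prob_space M" "prob_space N" "Measurable.pred (M \<Otimes>\<^sub>M N) Q"
  shows "measure (M \<Otimes>\<^sub>M N) {z \<in> space (M \<Otimes>\<^sub>M N). Q z} = (\<integral>x. measure N {y \<in> space N. Q (x, y)} \<partial>M)"
    and "(\<lambda>x. measure N {y \<in> space N. Q (x, y)}) \<in> borel_measurable M"
proof -
  interpret M: prob_space M by fact
  interpret N: prob_space N by fact
  interpret P: pair_prob_space M N ..
  have S: "{z \<in> space (M \<Otimes>\<^sub>M N). Q z} \<in> sets (M \<Otimes>\<^sub>M N)" using assms(3) by measurable
  have eq: "Pair x -` {z \<in> space (M \<Otimes>\<^sub>M N). Q z} = {y \<in> space N. Q (x, y)}" if "x \<in> space M" for x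
    using that by (auto simp: space_pair_measure)
  have "emeasure (M \<Otimes>\<^sub>M N) {z \<in> space (M \<Otimes>\<^sub>M N). Q z} = (\<integral>\<^sup>+x. emeasure N {y \<in> space N. Q (x, y)} \<partial>M)"
    by (subst N.emeasure_pair_measure_alt[OF S]) (intro nn_integral_cong arg_cong[where f="emeasure N"] eq)
  moreover have m0: "(\<lambda>x. emeasure N {y \<in> space N. Q (x, y)}) \<in> borel_measurable M"
    using N.measurable_emeasure_Pair[OF S] by (rule measurable_cong[THEN iffD1, rotated]) (intro arg_cong[where f="emeasure N"] eq)
  ultimately have em: "emeasure (M \<Otimes>\<^sub>M N) {z \<in> space (M \<Otimes>\<^sub>M N). Q z} =
      (\<integral>\<^sup>+x. emeasure N {y \<in> space N. Q (x, y)} \<partial>M)"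
    and [measurable]: "(\<lambda>x. emeasure N {y \<in> space N. Q (x, y)}) \<in> borel_measurable M" by blast+
  have me: "measure N {y \<in> space N. Q (x, y)} = enn2real (emeasure N {y \<in> space N. Q (x, y)})" for x
    by (rule measure_def)
  show m: "(\<lambda>x. measure N {y \<in> space N. Q (x, y)}) \<in> borel_measurable M"
    unfolding me by measurable
  have "(\<integral>x. measure N {y \<in> space N. Q (x, y)} \<partial>M) =
      enn2real (\<integral>\<^sup>+x. ennreal (measure N {y \<in> space N. Q (x, y)}) \<partial>M)"
    by (rule integral_eq_nn_integral[OF m]) simp
  also have "\<dots> = enn2real (emeasure (M \<Otimes>\<^sub>M N) {z \<in> space (M \<Otimes>\<^sub>M N). Q z})"
    unfolding em by (simp only: N.emeasure_eq_measure)
  finally show "measure (M \<Otimes>\<^sub>M N) {z \<in> space (M \<Otimes>\<^sub>M N). Q z} = (\<integral>x. measure N {y \<in> space N. Q (x, y)} \<partial>M)"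
    by (simp add: measure_def)
qed

text \<open>Conditioning on the coordinates in \<open>A\<close> takes this form throughout: they are
  frozen at \<open>x\<close>, and all others are drawn afresh from an independent copy
  \<open>x'\<close>.\<close>

lemma prob_resample:
  assumes [measurable]: "Measurable.pred Om Q"
  shows "measure Om {X. Q X} = (\<integral>x. measure Om {x'. Q (override A x x')} \<partial>Om)"
    and "(\<lambda>x. measure Om {x'. Q (override A x x')}) \<in> borel_measurable Om"
proof -
  have m: "(\<lambda>(x, x'). override A x x') \<in> measurable (Om \<Otimes>\<^sub>M Om) Om" by measurable
  have p: "Measurable.pred (Om \<Otimes>\<^sub>M Om) (\<lambda>z. Q (override A (fst z) (snd z)))" by measurable
  have "{X. Q X} \<in> sets Om" using assms by (simp add: pred_def)
  then have "measure (distr (Om \<Otimes>\<^sub>M Om) Om (\<lambda>(x, x'). override A x x')) {X. Q X} =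
      measure (Om \<Otimes>\<^sub>M Om) {z \<in> space (Om \<Otimes>\<^sub>M Om). Q (override A (fst z) (snd z))}"
    by (subst measure_distr[OF m]) (simp_all add: vimage_def split_beta space_pair_measure)
  then show "measure Om {X. Q X} = (\<integral>x. measure Om {x'. Q (override A x x')} \<partial>Om)"
    unfolding distr_override using prob_pair_fubini(1)[OF prob_space_Om prob_space_Om p] by simp
  show "(\<lambda>x. measure Om {x'. Q (override A x x')}) \<in> borel_measurable Om"
    using prob_pair_fubini(2)[OF prob_space_Om prob_space_Om p] by simp
qed

lemma prob_upd:
  assumes [measurable]: "Measurable.pred Om Q"
  shows "measure Om {X. Q X} = (\<integral>x. measure std_normal {u. Q (x(a := u))} \<partial>Om)"
proof -
  interpret S: pair_prob_space std_normal Om ..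
  have m: "(\<lambda>(u, x). x(a := u)) \<in> measurable (std_normal \<Otimes>\<^sub>M Om) Om" by measurable
  have m': "(\<lambda>(x, u). x(a := u)) \<in> measurable (Om \<Otimes>\<^sub>M std_normal) Om" by measurable
  have p: "Measurable.pred (Om \<Otimes>\<^sub>M std_normal) (\<lambda>z. Q ((fst z)(a := snd z)))" by measurable
  have "Om = distr (distr (Om \<Otimes>\<^sub>M std_normal) (std_normal \<Otimes>\<^sub>M Om) (\<lambda>(x, y). (y, x))) Om (\<lambda>(u, x). x(a := u))"
    unfolding S.distr_pair_swap[symmetric] distr_upd ..
  also have "\<dots> = distr (Om \<Otimes>\<^sub>M std_normal) Om (\<lambda>(x, u). x(a := u))"
    by (subst distr_distr[OF m]) (simp_all add: comp_def case_prod_unfold)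
  finally have "distr (Om \<Otimes>\<^sub>M std_normal) Om (\<lambda>(x, u). x(a := u)) = Om" ..
  moreover have "{X. Q X} \<in> sets Om" using assms by (simp add: pred_def)
  then have "measure (distr (Om \<Otimes>\<^sub>M std_normal) Om (\<lambda>(x, u). x(a := u))) {X. Q X} =
      measure (Om \<Otimes>\<^sub>M std_normal) {z \<in> space (Om \<Otimes>\<^sub>M std_normal). Q ((fst z)(a := snd z))}"
    by (subst measure_distr[OF m']) (simp_all add: vimage_def split_beta space_pair_measure)
  ultimately show ?thesis
    using prob_pair_fubini(1)[OF prob_space_Om prob_space_std_normal p] by simp
qed

definition mpres :: "((nat \<times> nat \<Rightarrow> real) \<Rightarrow> (nat \<times> nat \<Rightarrow> real)) \<Rightarrow> bool" where
  "mpres F \<longleftrightarrow> F \<in> measurable Om Om \<and> distr Om Om F = Om"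

lemma mpres_measurable: "mpres F \<Longrightarrow> F \<in> measurable Om Om" by (simp add: mpres_def)

lemma mpres_comp: "mpres F \<Longrightarrow> mpres G \<Longrightarrow> mpres (\<lambda>X. F (G X))"
  unfolding mpres_def using distr_distr[of F Om Om G Om] by (auto simp: comp_def)

lemma mpres_id: "mpres (\<lambda>X. X)"
  unfolding mpres_def using distr_id[of Om] by (simp add: id_def)

lemma mpres_prob:
  assumes "mpres F" "Measurable.pred Om Q"
  shows "measure Om {X. Q (F X)} = measure Om {X. Q X}"
proof -
  have "{X. Q X} \<in> sets Om" using assms(2) by (simp add: pred_def)
  then have "measure (distr Om Om F) {X. Q X} = measure Om {X. Q (F X)}"
    using assms(1) by (subst measure_distr) (auto simp: mpres_def vimage_def)
  then show ?thesis using assms(1) by (simp add: mpres_def)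
qed

lemma mpres_AE: "mpres F \<Longrightarrow> AE X in Om. P X \<Longrightarrow> AE X in Om. P (F X)"
proof -
  assume F: "mpres F" and P: "AE X in Om. P X"
  have "AE X in distr Om Om F. P X" using F P by (simp only: mpres_def)
  then show "AE X in Om. P (F X)" using F by (intro AE_distrD[of F Om Om P]) (auto simp: mpres_def)
qed

section \<open>Rotation and sign invariance of the Gaussian array\<close>

lemma nn_integral_std_normal:
  "f \<in> borel_measurable borel \<Longrightarrow> integral\<^sup>N std_normal f = (\<integral>\<^sup>+x. ennreal (std_normal_density x) * f x \<partial>lborel)"
  by (intro nn_integral_density) auto

lemma std_normal_uminus: "distr std_normal std_normal uminus = std_normal"
proof (rule measure_eqI)
  fix A assume "A \<in> sets (distr std_normal std_normal uminus)"
  then have [measurable]: "A \<in> sets borel" by simp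
  have "emeasure (distr std_normal std_normal uminus) A = (\<integral>\<^sup>+x. indicator A x \<partial>distr std_normal std_normal uminus)"
    by simp
  also have "\<dots> = (\<integral>\<^sup>+x. indicator A (- x) \<partial>std_normal)"
    by (rule nn_integral_distr) auto
  also have "\<dots> = (\<integral>\<^sup>+x. ennreal (std_normal_density x) * indicator A (- x) \<partial>lborel)"
    by (rule nn_integral_std_normal) measurable
  also have "\<dots> = (\<integral>\<^sup>+x. ennreal (std_normal_density x) * indicator A x \<partial>lborel)"
    by (subst nn_integral_real_affine[where c="-1" and t=0]) (auto simp: normal_density_def)
  also have "\<dots> = emeasure std_normal A"
    by (subst emeasure_density) auto
  finally show "emeasure (distr std_normal std_normal uminus) A = emeasure std_normal A" .
qed simp

text \<open>The joint density depends only on the radius. The rotation is performed by two affine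
  substitutions in one variable each, with Fubini in between; both need \<open>c \<noteq> 0\<close>,
  so the quarter turns are treated apart.\<close>

lemma std_normal_rotation:
  fixes c s :: real
  assumes cs: "c\<^sup>2 + s\<^sup>2 = 1"
  shows "distr (std_normal \<Otimes>\<^sub>M std_normal) (borel \<Otimes>\<^sub>M borel) (\<lambda>(u, v). (c * u + s * v, - s * u + c * v)) =
    distr (std_normal \<Otimes>\<^sub>M std_normal) (borel \<Otimes>\<^sub>M borel) (\<lambda>z. z)" (is "?L = ?R")
proof (rule measure_eqI)
  show "sets ?L = sets ?R" by simp
  fix A assume "A \<in> sets ?L"
  then have A[measurable]: "A \<in> sets (borel \<Otimes>\<^sub>M borel)" by simp
  let ?\<phi> = "\<lambda>x. ennreal (std_normal_density x)"
  have *: "emeasure (distr (std_normal \<Otimes>\<^sub>M std_normal) (borel \<Otimes>\<^sub>M borel) F) A =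
      (\<integral>\<^sup>+u. \<integral>\<^sup>+v. ?\<phi> u * ?\<phi> v * indicator A (F (u, v)) \<partial>lborel \<partial>lborel)"
    if [measurable]: "F \<in> measurable (borel \<Otimes>\<^sub>M borel) (borel \<Otimes>\<^sub>M borel)" for F :: "real \<times> real \<Rightarrow> real \<times> real"
  proof -
    have F': "F \<in> measurable (std_normal \<Otimes>\<^sub>M std_normal) (borel \<Otimes>\<^sub>M borel)"
      by (subst measurable_cong_sets[OF sets_pair_measure_cong refl]) (use that in auto)
    have "emeasure (distr (std_normal \<Otimes>\<^sub>M std_normal) (borel \<Otimes>\<^sub>M borel) F) A =
        (\<integral>\<^sup>+z. indicator A z \<partial>distr (std_normal \<Otimes>\<^sub>M std_normal) (borel \<Otimes>\<^sub>M borel) F)" by simp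
    also have "\<dots> = (\<integral>\<^sup>+z. indicator A (F z) \<partial>(std_normal \<Otimes>\<^sub>M std_normal))"
      by (rule nn_integral_distr[OF F']) auto
    also have "\<dots> = (\<integral>\<^sup>+u. \<integral>\<^sup>+v. indicator A (F (u, v)) \<partial>std_normal \<partial>std_normal)"
      by (subst std_normal.nn_integral_fst[symmetric]) (auto intro!: measurable_compose[OF F'])
    also have "\<dots> = (\<integral>\<^sup>+u. \<integral>\<^sup>+v. ?\<phi> v * indicator A (F (u, v)) \<partial>lborel \<partial>std_normal)"
      by (intro nn_integral_cong nn_integral_std_normal) measurable
    also have "\<dots> = (\<integral>\<^sup>+u. ?\<phi> u * (\<integral>\<^sup>+v. ?\<phi> v * indicator A (F (u, v)) \<partial>lborel) \<partial>lborel)"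
      by (rule nn_integral_std_normal) measurable
    also have "\<dots> = (\<integral>\<^sup>+u. \<integral>\<^sup>+v. ?\<phi> u * ?\<phi> v * indicator A (F (u, v)) \<partial>lborel \<partial>lborel)"
      by (simp add: nn_integral_cmult[symmetric] mult.assoc)
    finally show ?thesis .
  qed
  show "emeasure ?L A = emeasure ?R A"
  proof (cases "c = 0")
    case True
    then have s: "s = 1 \<or> s = -1" using cs by (auto simp: power2_eq_1_iff)
    have flip: "(\<integral>\<^sup>+v. g (t * v) \<partial>lborel) = (\<integral>\<^sup>+v. g v \<partial>lborel)"
      if "t = 1 \<or> t = -1" "g \<in> borel_measurable borel" for t :: real and g :: "real \<Rightarrow> ennreal"
      using that by (subst (2) nn_integral_real_affine[where c=t and t=0]) auto
    have phi: "?\<phi> (t * v) = ?\<phi> v" if "t = 1 \<or> t = -1" for t v :: real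
      using that by (auto simp: normal_density_def)
    have "emeasure ?L A = (\<integral>\<^sup>+u. \<integral>\<^sup>+v. ?\<phi> u * ?\<phi> (s * v) * indicator A (s * v, - s * u) \<partial>lborel \<partial>lborel)"
      by (subst *) (use True phi[OF s] in auto)
    also have "\<dots> = (\<integral>\<^sup>+u. \<integral>\<^sup>+v. ?\<phi> u * ?\<phi> v * indicator A (v, - s * u) \<partial>lborel \<partial>lborel)"
      by (rule nn_integral_cong, rule flip[OF s, of "\<lambda>v. ?\<phi> u * ?\<phi> v * indicator A (v, - s * u)" for u]) measurable
    also have "\<dots> = (\<integral>\<^sup>+u. \<integral>\<^sup>+v. ?\<phi> (-s * u) * ?\<phi> v * indicator A (v, - s * u) \<partial>lborel \<partial>lborel)"
      using phi[of "-s"] s by auto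
    also have "\<dots> = (\<integral>\<^sup>+u. \<integral>\<^sup>+v. ?\<phi> u * ?\<phi> v * indicator A (v, u) \<partial>lborel \<partial>lborel)"
      by (rule flip[of "-s" "\<lambda>u. \<integral>\<^sup>+v. ?\<phi> u * ?\<phi> v * indicator A (v, u) \<partial>lborel"]) (use s in auto)
    also have "\<dots> = (\<integral>\<^sup>+v. \<integral>\<^sup>+u. ?\<phi> u * ?\<phi> v * indicator A (v, u) \<partial>lborel \<partial>lborel)"
      by (rule lborel_pair.Fubini') measurable
    also have "\<dots> = emeasure ?R A" by (subst *) (auto simp: mult_ac)
    finally show ?thesis .
  next
    case False
    have "emeasure ?L A = (\<integral>\<^sup>+u. \<integral>\<^sup>+v. ?\<phi> u * ?\<phi> v * indicator A (c * u + s * v, - s * u + c * v) \<partial>lborel \<partial>lborel)"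
      by (subst *) auto
    also have "\<dots> = (\<integral>\<^sup>+v. \<integral>\<^sup>+u. ?\<phi> u * ?\<phi> v * indicator A (c * u + s * v, - s * u + c * v) \<partial>lborel \<partial>lborel)"
      by (rule lborel_pair.Fubini') measurable
    also have "\<dots> = (\<integral>\<^sup>+v. \<integral>\<^sup>+u. ennreal \<bar>1/c\<bar> * (?\<phi> (- s * v / c + (1/c) * u) * ?\<phi> v * indicator A (u, (v - s * u) / c)) \<partial>lborel \<partial>lborel)"
    proof (rule nn_integral_cong)
      fix v :: real
      have "- s * (- s * v / c + (1/c) * u) + c * v = ((c\<^sup>2 + s\<^sup>2) * v - s * u) / c" for u
        using False by (simp add: field_simps power2_eq_square)
      then have e: "c * (- s * v / c + (1/c) * u) + s * v = u" "- s * (- s * v / c + (1/c) * u) + c * v = (v - s * u) / c" for u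
        using False cs by (simp_all add: field_simps)
      have "(\<integral>\<^sup>+u. ?\<phi> u * ?\<phi> v * indicator A (c * u + s * v, - s * u + c * v) \<partial>lborel) =
        ennreal \<bar>1/c\<bar> * (\<integral>\<^sup>+u. ?\<phi> (- s * v / c + (1/c) * u) * ?\<phi> v * indicator A (c * (- s * v / c + (1/c) * u) + s * v, - s * (- s * v / c + (1/c) * u) + c * v) \<partial>lborel)"
        using False by (subst nn_integral_real_affine[where c="1/c" and t="- s * v / c"]) auto
      also have "\<dots> = (\<integral>\<^sup>+u. ennreal \<bar>1/c\<bar> * (?\<phi> (- s * v / c + (1/c) * u) * ?\<phi> v * indicator A (u, (v - s * u) / c)) \<partial>lborel)"
        unfolding e by (rule nn_integral_cmult[symmetric]) measurable
      finally show "(\<integral>\<^sup>+u. ?\<phi> u * ?\<phi> v * indicator A (c * u + s * v, - s * u + c * v) \<partial>lborel) =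
        (\<integral>\<^sup>+u. ennreal \<bar>1/c\<bar> * (?\<phi> (- s * v / c + (1/c) * u) * ?\<phi> v * indicator A (u, (v - s * u) / c)) \<partial>lborel)" .
    qed
    also have "\<dots> = (\<integral>\<^sup>+u. \<integral>\<^sup>+v. ennreal \<bar>1/c\<bar> * (?\<phi> (- s * v / c + (1/c) * u) * ?\<phi> v * indicator A (u, (v - s * u) / c)) \<partial>lborel \<partial>lborel)"
      by (rule lborel_pair.Fubini') measurable
    also have "\<dots> = (\<integral>\<^sup>+u. \<integral>\<^sup>+v. ?\<phi> u * ?\<phi> v * indicator A (u, v) \<partial>lborel \<partial>lborel)"
    proof (rule nn_integral_cong)
      fix u :: real
      have "(c\<^sup>2 + s\<^sup>2) * u / c - s * s * u / c - s * v = c * u - s * v" for v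
        using False by (simp add: field_simps power2_eq_square)
      then have e: "- s * (s * u + c * v) / c + (1/c) * u = c * u - s * v" "((s * u + c * v) - s * u) / c = v" for v
        using False cs by (simp_all add: field_simps)
      have d: "?\<phi> (c * u - s * v) * ?\<phi> (s * u + c * v) = ?\<phi> u * ?\<phi> v" for v
      proof -
        have "(c * u - s * v)\<^sup>2 + (s * u + c * v)\<^sup>2 = (c\<^sup>2 + s\<^sup>2) * (u\<^sup>2 + v\<^sup>2)"
          by (simp add: power2_eq_square algebra_simps)
        then have "- (c * u - s * v)\<^sup>2 / 2 + - (s * u + c * v)\<^sup>2 / 2 = - u\<^sup>2 / 2 + - v\<^sup>2 / 2"
          using cs by (simp add: field_simps)
        then show ?thesis by (simp add: normal_density_def ennreal_mult[symmetric] exp_add[symmetric])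
      qed
      have "(\<integral>\<^sup>+v. ennreal \<bar>1/c\<bar> * (?\<phi> (- s * v / c + (1/c) * u) * ?\<phi> v * indicator A (u, (v - s * u) / c)) \<partial>lborel) =
        ennreal \<bar>c\<bar> * (\<integral>\<^sup>+v. ennreal \<bar>1/c\<bar> * (?\<phi> (- s * (s * u + c * v) / c + (1/c) * u) * ?\<phi> (s * u + c * v) * indicator A (u, ((s * u + c * v) - s * u) / c)) \<partial>lborel)"
        using False by (subst nn_integral_real_affine[where c="c" and t="s * u"]) auto
      also have "\<dots> = ennreal \<bar>c\<bar> * (\<integral>\<^sup>+v. ennreal \<bar>1/c\<bar> * (?\<phi> u * ?\<phi> v * indicator A (u, v)) \<partial>lborel)"
        unfolding e d ..
      also have "\<dots> = ennreal \<bar>c\<bar> * (ennreal \<bar>1/c\<bar> * (\<integral>\<^sup>+v. ?\<phi> u * ?\<phi> v * indicator A (u, v) \<partial>lborel))"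
        by (subst nn_integral_cmult) auto
      also have "\<dots> = (\<integral>\<^sup>+v. ?\<phi> u * ?\<phi> v * indicator A (u, v) \<partial>lborel)"
        using False by (simp add: mult.assoc[symmetric] ennreal_mult[symmetric])
      finally show "(\<integral>\<^sup>+v. ennreal \<bar>1/c\<bar> * (?\<phi> (- s * v / c + (1/c) * u) * ?\<phi> v * indicator A (u, (v - s * u) / c)) \<partial>lborel) =
         (\<integral>\<^sup>+v. ?\<phi> u * ?\<phi> v * indicator A (u, v) \<partial>lborel)" .
    qed
    also have "\<dots> = emeasure ?R A" by (subst *) auto
    finally show ?thesis .
  qed
qed

text \<open>The array is the law of \<open>\<Psi>\<close>, where an independent pair
  \<open>(u, v)\<close> overwrites the entries at \<open>a\<close> and \<open>b\<close>; the map
  acts on that pair alone, as a planar rotation.\<close>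

lemma mpres_rotation:
  assumes cs: "c\<^sup>2 + s\<^sup>2 = 1" and ab: "a \<noteq> b"
  shows "mpres (\<lambda>X. X(a := c * X a + s * X b, b := - s * X a + c * X b))" (is "mpres ?F")
proof -
  let ?P = "(std_normal \<Otimes>\<^sub>M std_normal) \<Otimes>\<^sub>M Om"
  define \<Psi> where "\<Psi> = (\<lambda>((u::real, v::real), x::nat \<times> nat \<Rightarrow> real). x(a := u, b := v))"
  define R where "R = (\<lambda>(u, v). (c * u + s * v, - s * u + c * v))"
  interpret S: pair_prob_space std_normal std_normal ..
  interpret T: pair_prob_space std_normal Om ..
  have sb: "sets (std_normal \<Otimes>\<^sub>M std_normal) = sets (borel \<Otimes>\<^sub>M borel)"
    by (intro sets_pair_measure_cong) auto
  have F[measurable]: "?F \<in> measurable Om Om" by measurable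
  have Psi[measurable]: "\<Psi> \<in> measurable ?P Om" unfolding \<Psi>_def case_prod_unfold by measurable
  have R[measurable]: "R \<in> measurable (std_normal \<Otimes>\<^sub>M std_normal) (std_normal \<Otimes>\<^sub>M std_normal)"
    unfolding R_def case_prod_unfold by measurable
  have Rd: "distr (std_normal \<Otimes>\<^sub>M std_normal) (std_normal \<Otimes>\<^sub>M std_normal) R = std_normal \<Otimes>\<^sub>M std_normal"
  proof -
    have "distr (std_normal \<Otimes>\<^sub>M std_normal) (std_normal \<Otimes>\<^sub>M std_normal) R =
        distr (std_normal \<Otimes>\<^sub>M std_normal) (borel \<Otimes>\<^sub>M borel) R" by (rule distr_cong) (simp_all add: sb)
    also have "\<dots> = distr (std_normal \<Otimes>\<^sub>M std_normal) (borel \<Otimes>\<^sub>M borel) (\<lambda>z. z)"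
      unfolding R_def by (rule std_normal_rotation[OF cs])
    also have "\<dots> = std_normal \<Otimes>\<^sub>M std_normal" by (rule distr_id2) (simp add: sb)
    finally show ?thesis .
  qed
  have Pd: "distr ?P Om \<Psi> = Om"
  proof (rule measure_eqI)
    fix A assume "A \<in> sets (distr ?P Om \<Psi>)"
    then have A[measurable]: "A \<in> sets Om" by simp
    have one: "(\<integral>\<^sup>+u. \<integral>\<^sup>+x. f (x(d := u)) \<partial>Om \<partial>std_normal) = integral\<^sup>N Om f"
      if [measurable]: "f \<in> borel_measurable Om" for f d
    proof -
      have "integral\<^sup>N Om f = integral\<^sup>N (distr (std_normal \<Otimes>\<^sub>M Om) Om (\<lambda>(u, x). x(d := u))) f"
        unfolding distr_upd ..
      also have "\<dots> = (\<integral>\<^sup>+z. f ((snd z)(d := fst z)) \<partial>(std_normal \<Otimes>\<^sub>M Om))"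
        by (subst nn_integral_distr) (auto simp: split_beta)
      also have "\<dots> = (\<integral>\<^sup>+u. \<integral>\<^sup>+x. f (x(d := u)) \<partial>Om \<partial>std_normal)"
        by (subst Om.nn_integral_fst[symmetric]) auto
      finally show ?thesis ..
    qed
    have "emeasure (distr ?P Om \<Psi>) A = (\<integral>\<^sup>+z. indicator A z \<partial>distr ?P Om \<Psi>)" by simp
    also have "\<dots> = (\<integral>\<^sup>+z. indicator A (\<Psi> z) \<partial>?P)"
      by (rule nn_integral_distr[OF Psi]) auto
    also have "\<dots> = (\<integral>\<^sup>+p. \<integral>\<^sup>+x. indicator A (\<Psi> (p, x)) \<partial>Om \<partial>(std_normal \<Otimes>\<^sub>M std_normal))"
      by (subst Om.nn_integral_fst[symmetric]) auto
    also have "\<dots> = (\<integral>\<^sup>+u. \<integral>\<^sup>+v. \<integral>\<^sup>+x. indicator A (\<Psi> ((u, v), x)) \<partial>Om \<partial>std_normal \<partial>std_normal)"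
      by (subst std_normal.nn_integral_fst[symmetric]) auto
    also have "\<dots> = (\<integral>\<^sup>+u. \<integral>\<^sup>+v. \<integral>\<^sup>+x. indicator A ((x(b := v))(a := u)) \<partial>Om \<partial>std_normal \<partial>std_normal)"
      using ab by (simp add: \<Psi>_def fun_upd_twist)
    also have "\<dots> = (\<integral>\<^sup>+u. \<integral>\<^sup>+x. indicator A (x(a := u)) \<partial>Om \<partial>std_normal)"
      by (intro nn_integral_cong one) measurable
    also have "\<dots> = (\<integral>\<^sup>+x. indicator A x \<partial>Om)" by (rule one) measurable
    also have "\<dots> = emeasure Om A" by simp
    finally show "emeasure (distr ?P Om \<Psi>) A = emeasure Om A" .
  qed simp
  have Rid: "distr ?P ?P (map_prod R id) = ?P"
  proof -
    have "distr (std_normal \<Otimes>\<^sub>M std_normal) (std_normal \<Otimes>\<^sub>M std_normal) R \<Otimes>\<^sub>M distr Om Om (\<lambda>x. x) =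
      distr ?P ?P (\<lambda>(x, y). (R x, y))"
      by (rule pair_measure_distr) (auto simp: distr_id2 Om.sigma_finite_measure_axioms)
    then show ?thesis by (simp add: Rd distr_id2 map_prod_def id_def)
  qed
  have "distr Om Om ?F = distr (distr ?P Om \<Psi>) Om ?F" unfolding Pd ..
  also have "\<dots> = distr ?P Om (\<lambda>z. ?F (\<Psi> z))" by (subst distr_distr[OF F Psi]) (simp add: comp_def)
  also have "(\<lambda>z. ?F (\<Psi> z)) = (\<lambda>z. \<Psi> (map_prod R id z))"
    using ab by (auto simp: fun_eq_iff \<Psi>_def R_def)
  also have "distr ?P Om \<dots> = distr (distr ?P ?P (map_prod R id)) Om \<Psi>"
    by (subst distr_distr[OF Psi]) (auto simp: comp_def map_prod_def split_beta)
  also have "\<dots> = Om" unfolding Rid Pd ..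
  finally show ?thesis using F unfolding mpres_def by blast
qed

lemma mpres_signs:
  assumes sg: "\<And>i. sg i = 1 \<or> sg i = (-1::real)"
  shows "mpres (\<lambda>X i. sg i * X i)"
  unfolding mpres_def
proof
  show F: "(\<lambda>X i. sg i * X i) \<in> measurable Om Om" by (rule measurable_into_Om) measurable
  show "distr Om Om (\<lambda>X i. sg i * X i) = Om"
  proof (rule Om_eqI)
    show "finite_measure (distr Om Om (\<lambda>X i. sg i * X i))"
      using Om.prob_space_distr[OF F] by (simp add: prob_space_def)
    fix B :: "nat \<times> nat \<Rightarrow> real set" and J :: "(nat \<times> nat) set"
    assume J: "finite J" and B: "\<And>i. i \<in> J \<Longrightarrow> B i \<in> sets borel"
    have s: "{X. \<forall>i\<in>J. X i \<in> B i} \<in> sets Om"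
    proof -
      have "{X \<in> space Om. \<forall>i\<in>J. X i \<in> B i} \<in> sets Om"
        using B J by (intro sets.sets_Collect_finite_All measurable_sets_Collect[OF measurable_Om_component]) auto
      then show ?thesis by simp
    qed
    have "emeasure (distr Om Om (\<lambda>X i. sg i * X i)) {X. \<forall>i\<in>J. X i \<in> B i} =
        emeasure Om {X. \<forall>i\<in>J. X i \<in> (\<lambda>x. sg i * x) -` B i}"
      by (subst emeasure_distr[OF F s]) (simp add: vimage_def)
    also have "\<dots> = (\<Prod>i\<in>J. emeasure std_normal ((\<lambda>x. sg i * x) -` B i))"
    proof (rule emeasure_Om_box[OF J])
      fix i assume "i \<in> J"
      have "(\<lambda>x. sg i * x) \<in> borel_measurable borel" by measurable
      from measurable_sets[OF this B[OF \<open>i \<in> J\<close>]] show "(\<lambda>x. sg i * x) -` B i \<in> sets borel" by simp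
    qed
    also have "\<dots> = (\<Prod>i\<in>J. emeasure std_normal (B i))"
    proof (rule prod.cong[OF refl])
      fix i assume i: "i \<in> J"
      have "emeasure (distr std_normal std_normal uminus) (B i) = emeasure std_normal (uminus -` B i)"
        using B[OF i] by (subst emeasure_distr) auto
      then have "emeasure std_normal (uminus -` B i) = emeasure std_normal (B i)" unfolding std_normal_uminus ..
      moreover have "(\<lambda>x. sg i * x) -` B i = (if sg i = 1 then B i else uminus -` B i)" using sg[of i] by auto
      ultimately show "emeasure std_normal ((\<lambda>x. sg i * x) -` B i) = emeasure std_normal (B i)" by simp
    qed
    finally show "emeasure (distr Om Om (\<lambda>X i. sg i * X i)) {X. \<forall>i\<in>J. X i \<in> B i} = (\<Prod>i\<in>J. emeasure std_normal (B i))" .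
  qed simp
qed

subsection \<open>Rotations and kernel directions\<close>

definition app :: "nat set \<Rightarrow> (nat \<Rightarrow> nat \<Rightarrow> real) \<Rightarrow> (nat \<Rightarrow> real) \<Rightarrow> nat \<Rightarrow> real" where
  "app K T x j = (\<Sum>k\<in>K. T j k * x k)"

definition ip :: "nat set \<Rightarrow> (nat \<Rightarrow> real) \<Rightarrow> (nat \<Rightarrow> real) \<Rightarrow> real" where
  "ip K x y = (\<Sum>k\<in>K. x k * y k)"

definition isom :: "nat set \<Rightarrow> (nat \<Rightarrow> nat \<Rightarrow> real) \<Rightarrow> bool" where
  "isom K T \<longleftrightarrow> (\<forall>x. ip K (app K T x) (app K T x) = ip K x x)"

definition tr :: "(nat \<Rightarrow> nat \<Rightarrow> real) \<Rightarrow> nat \<Rightarrow> nat \<Rightarrow> real" where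
  "tr T j k = T k j"

definition act :: "(nat \<Rightarrow> nat \<Rightarrow> real) \<Rightarrow> nat set \<Rightarrow> nat set \<Rightarrow> (nat \<times> nat \<Rightarrow> real) \<Rightarrow> nat \<times> nat \<Rightarrow> real" where
  "act T K C X = (\<lambda>(j, i). if j \<in> K \<and> i \<in> C then app K T (\<lambda>k. X (k, i)) j else X (j, i))"

text \<open>Collects what products of Givens rotations inherit: the matrix and its transpose are
  isometries, and the Gaussian array is invariant when the same matrix acts on the rows
  \<open>K\<close> in each column of \<open>C\<close>.\<close>

definition good :: "nat set \<Rightarrow> (nat \<Rightarrow> nat \<Rightarrow> real) \<Rightarrow> bool" where
  "good K T \<longleftrightarrow> isom K T \<and> isom K (tr T) \<and> (\<forall>C. finite C \<longrightarrow> mpres (act T K C))"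

lemma ip_cong: "(\<And>k. k \<in> K \<Longrightarrow> x k = x' k) \<Longrightarrow> (\<And>k. k \<in> K \<Longrightarrow> y k = y' k) \<Longrightarrow> ip K x y = ip K x' y'"
  unfolding ip_def by (intro sum.cong) auto

lemma app_cong: "(\<And>k. k \<in> K \<Longrightarrow> x k = x' k) \<Longrightarrow> app K T x j = app K T x' j"
  unfolding app_def by (intro sum.cong) auto

lemma ip_commute: "ip K x y = ip K y x"
  unfolding ip_def by (simp add: mult.commute)

lemma ip_scale: "ip K (\<lambda>k. c * x k) y = c * ip K x y" "ip K x (\<lambda>k. c * y k) = c * ip K x y"
  unfolding ip_def by (simp_all add: sum_distrib_left mult_ac)

lemma ip_add: "ip K (\<lambda>k. x k + x' k) y = ip K x y + ip K x' y" "ip K x (\<lambda>k. y k + y' k) = ip K x y + ip K x y'"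
  unfolding ip_def by (simp_all add: sum.distrib algebra_simps)

lemma ip_nonneg: "ip K x x \<ge> 0"
  unfolding ip_def by (intro sum_nonneg) auto

lemma ip_eq_0: "finite K \<Longrightarrow> ip K x x = 0 \<longleftrightarrow> (\<forall>k\<in>K. x k = 0)"
  unfolding ip_def by (subst sum_nonneg_eq_0_iff) auto

lemma ip_pos: "finite K \<Longrightarrow> k \<in> K \<Longrightarrow> x k \<noteq> 0 \<Longrightarrow> ip K x x > 0"
  using ip_nonneg[of K x] ip_eq_0[of K x] by force

lemma ip_Cauchy_Schwarz: "(ip K x y)\<^sup>2 \<le> ip K x x * ip K y y"
  using Cauchy_Schwarz_ineq_sum[of x y K] by (simp add: ip_def power2_eq_square)

lemma ip_axis: "finite K \<Longrightarrow> k0 \<in> K \<Longrightarrow> (\<And>k. k \<in> K - {k0} \<Longrightarrow> x k = 0) \<Longrightarrow> ip K x y = x k0 * y k0"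
  unfolding ip_def by (subst sum.remove[of K k0]) auto

lemma app_add: "app K T (\<lambda>k. x k + y k) j = app K T x j + app K T y j"
  unfolding app_def by (simp add: sum.distrib algebra_simps)

lemma ip_app_adjoint: "ip K (app K T x) y = ip K x (app K (tr T) y)"
proof -
  have "ip K (app K T x) y = (\<Sum>j\<in>K. \<Sum>k\<in>K. T j k * x k * y j)"
    by (simp add: ip_def app_def sum_distrib_right)
  also have "\<dots> = (\<Sum>k\<in>K. \<Sum>j\<in>K. T j k * x k * y j)" by (rule sum.swap)
  also have "\<dots> = ip K x (app K (tr T) y)"
    by (simp add: ip_def app_def tr_def sum_distrib_left mult_ac)
  finally show ?thesis .
qed

lemma isom_ip: "isom K T \<Longrightarrow> ip K (app K T x) (app K T y) = ip K x y"
proof -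
  assume T: "isom K T"
  have "ip K (app K T (\<lambda>k. x k + y k)) (app K T (\<lambda>k. x k + y k)) =
      ip K (\<lambda>j. app K T x j + app K T y j) (\<lambda>j. app K T x j + app K T y j)"
    by (rule ip_cong) (simp_all add: app_add)
  then have "ip K (\<lambda>j. app K T x j + app K T y j) (\<lambda>j. app K T x j + app K T y j) = ip K (\<lambda>k. x k + y k) (\<lambda>k. x k + y k)"
    using T by (simp add: isom_def)
  moreover have "ip K (app K T x) (app K T x) = ip K x x" "ip K (app K T y) (app K T y) = ip K y y"
    using T by (simp_all add: isom_def)
  ultimately show ?thesis using ip_commute[of K x y] ip_commute[of K "app K T x" "app K T y"]
    by (simp add: ip_add)
qed

lemma isom_left_inverse:
  assumes "finite K" "isom K T" "j \<in> K"
  shows "app K (tr T) (app K T x) j = x j"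
proof -
  let ?e = "\<lambda>k. if k = j then 1 else 0 :: real"
  have "ip K ?e (app K (tr T) (app K T x)) = ip K (app K T ?e) (app K T x)" by (simp add: ip_app_adjoint)
  also have "\<dots> = ip K ?e x" using assms(2) by (rule isom_ip)
  finally show ?thesis using assms ip_axis[of K j ?e] by simp
qed

lemma tr_tr: "tr (tr T) = T" by (simp add: tr_def fun_eq_iff)

lemma good_id:
  assumes "finite K"
  shows "good K (\<lambda>j k. if j = k then 1 else 0)" (is "good K ?T")
proof -
  have a: "app K ?T x j = x j" if "j \<in> K" for x j
  proof -
    have "app K ?T x j = (\<Sum>k\<in>K. if j = k then x k else 0)" unfolding app_def by (intro sum.cong) auto
    then show ?thesis using assms that by simp
  qed
  have "tr ?T = ?T" by (auto simp: tr_def fun_eq_iff)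
  moreover have "isom K ?T" unfolding isom_def by (intro allI ip_cong a)
  moreover have "act ?T K C = (\<lambda>X. X)" for C by (auto simp: act_def a fun_eq_iff)
  ultimately show ?thesis by (simp add: good_def mpres_id)
qed

lemma app_mult: "app K (\<lambda>j k. \<Sum>l\<in>K. T j l * U l k) x j = app K T (app K U x) j"
proof -
  have "app K (\<lambda>j k. \<Sum>l\<in>K. T j l * U l k) x j = (\<Sum>k\<in>K. \<Sum>l\<in>K. T j l * U l k * x k)"
    by (simp add: app_def sum_distrib_right)
  also have "\<dots> = (\<Sum>l\<in>K. \<Sum>k\<in>K. T j l * U l k * x k)" by (rule sum.swap)
  also have "\<dots> = app K T (app K U x) j" by (simp add: app_def sum_distrib_left mult_ac)
  finally show ?thesis .
qed

lemma good_mult: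
  assumes "good K T" "good K U"
  shows "good K (\<lambda>j k. \<Sum>l\<in>K. T j l * U l k)" (is "good K ?V")
proof -
  have V: "app K ?V x = app K T (app K U x)" for x by (simp add: fun_eq_iff app_mult)
  have trV: "tr ?V = (\<lambda>j k. \<Sum>l\<in>K. tr U j l * tr T l k)" by (simp add: tr_def fun_eq_iff mult.commute)
  have V': "app K (tr ?V) x = app K (tr U) (app K (tr T) x)" for x unfolding trV by (simp add: fun_eq_iff app_mult)
  have "act ?V K C = (\<lambda>X. act T K C (act U K C X))" for C
  proof (intro ext)
    fix X and p :: "nat \<times> nat"
    obtain j i where p: "p = (j, i)" by force
    show "act ?V K C X p = act T K C (act U K C X) p"
    proof (cases "j \<in> K \<and> i \<in> C")
      case True
      have "app K T (app K U (\<lambda>k. X (k, i))) j = app K T (\<lambda>k. act U K C X (k, i)) j"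
        by (rule app_cong) (use True in \<open>simp add: act_def\<close>)
      then show ?thesis using True by (simp add: p act_def V)
    qed (auto simp: p act_def)
  qed
  then show ?thesis using assms unfolding good_def isom_def V V' by (simp add: mpres_comp)
qed

definition givens :: "nat \<Rightarrow> nat \<Rightarrow> real \<Rightarrow> real \<Rightarrow> nat \<Rightarrow> nat \<Rightarrow> real" where
  "givens a b c s j k = (if j = a then (if k = a then c else if k = b then s else 0)
     else if j = b then (if k = a then - s else if k = b then c else 0) else if j = k then 1 else 0)"

lemma app_givens:
  assumes "finite K" "a \<in> K" "b \<in> K" "a \<noteq> b" "j \<in> K"
  shows "app K (givens a b c s) x j = (if j = a then c * x a + s * x b else if j = b then - s * x a + c * x b else x j)"
proof -
  have "app K (givens a b c s) x j = givens a b c s j a * x a + (givens a b c s j b * x b + (\<Sum>k\<in>K - {a} - {b}. givens a b c s j k * x k))"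
    unfolding app_def using assms by (subst sum.remove[of K a], simp, simp, subst sum.remove[of "K - {a}" b]) auto
  also have "(\<Sum>k\<in>K - {a} - {b}. givens a b c s j k * x k) = (\<Sum>k\<in>K - {a} - {b}. if k = j then x j else 0)"
    by (intro sum.cong) (use assms in \<open>auto simp: givens_def\<close>)
  finally have eq: "app K (givens a b c s) x j = givens a b c s j a * x a + (givens a b c s j b * x b +
      (\<Sum>k\<in>K - {a} - {b}. if k = j then x j else 0))" .
  show ?thesis unfolding eq using assms by (auto simp: givens_def)
qed

lemma isom_givens:
  assumes "finite K" "a \<in> K" "b \<in> K" "a \<noteq> b" "c\<^sup>2 + s\<^sup>2 = 1"
  shows "isom K (givens a b c s)"
  unfolding isom_def
proof
  fix x
  let ?y = "app K (givens a b c s) x"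
  have sp: "ip K z z = z a * z a + (z b * z b + (\<Sum>k\<in>K - {a} - {b}. z k * z k))" for z
    unfolding ip_def using assms by (subst sum.remove[of K a], simp, simp, subst sum.remove[of "K - {a}" b]) auto
  have "?y a * ?y a + ?y b * ?y b = (c\<^sup>2 + s\<^sup>2) * (x a * x a + x b * x b)"
    using assms(1-4) by (simp add: app_givens power2_eq_square algebra_simps)
  moreover have "(\<Sum>k\<in>K - {a} - {b}. ?y k * ?y k) = (\<Sum>k\<in>K - {a} - {b}. x k * x k)"
    by (intro sum.cong) (use assms in \<open>auto simp: app_givens\<close>)
  ultimately show "ip K ?y ?y = ip K x x" using assms(5) by (simp add: sp)
qed

lemma good_givens:
  assumes K: "finite K" "a \<in> K" "b \<in> K" "a \<noteq> b" and cs: "c\<^sup>2 + s\<^sup>2 = 1"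
  shows "good K (givens a b c s)"
proof -
  have "tr (givens a b c s) = givens a b c (- s)" using K by (auto simp: tr_def givens_def fun_eq_iff)
  moreover have "mpres (act (givens a b c s) K C)" if "finite C" for C
    using that
  proof (induction C rule: finite_induct)
    case empty
    have "act (givens a b c s) K {} = (\<lambda>X. X)" by (auto simp: act_def fun_eq_iff)
    then show ?case by (simp add: mpres_id)
  next
    case (insert i C)
    have eq: "act (givens a b c s) K (insert i C) = (\<lambda>X. (act (givens a b c s) K C X)
        ((a,i) := c * act (givens a b c s) K C X (a,i) + s * act (givens a b c s) K C X (b,i),
         (b,i) := - s * act (givens a b c s) K C X (a,i) + c * act (givens a b c s) K C X (b,i)))"
      using insert.hyps K by (auto simp: act_def fun_eq_iff app_givens)
    show ?case unfolding eq
      by (rule mpres_comp[OF mpres_rotation[OF cs, of "(a,i)" "(b,i)"] insert.IH]) (use K in simp)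
  qed
  ultimately show ?thesis using isom_givens[OF K cs] isom_givens[OF K, of c "- s"] cs by (simp add: good_def)
qed

text \<open>Givens rotations in the planes of \<open>k0\<close> and \<open>b\<close> clear the
  coordinates of \<open>w\<close> one at a time, with cosine and sine read off from the two current
  entries. If both are 0 there is nothing to rotate.\<close>

lemma rotate_to_axis:
  assumes K: "finite K" "k0 \<in> K"
  shows "\<exists>T. good K T \<and> (\<forall>j\<in>K - {k0}. app K T w j = 0)"
proof -
  have "\<exists>T. good K T \<and> (\<forall>j\<in>B. app K T w j = 0)" if "finite B" "B \<subseteq> K - {k0}" for B
    using that
  proof (induction B rule: finite_induct)
    case empty
    then show ?case using good_id[OF K(1)] by blast
  next
    case (insert b B)
    then obtain T where T: "good K T" "\<And>j. j \<in> B \<Longrightarrow> app K T w j = 0" by auto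
    define v where "v = app K T w"
    define r where "r = sqrt ((v k0)\<^sup>2 + (v b)\<^sup>2)"
    show ?case
    proof (cases "r = 0")
      case True
      then have "v b = 0" by (simp add: r_def sum_power2_eq_zero_iff)
      then show ?thesis using T by (intro exI[of _ T]) (auto simp: v_def)
    next
      case False
      define c s where "c = v k0 / r" and "s = v b / r"
      have r2: "r\<^sup>2 = (v k0)\<^sup>2 + (v b)\<^sup>2" by (simp add: r_def)
      have "c\<^sup>2 + s\<^sup>2 = ((v k0)\<^sup>2 + (v b)\<^sup>2) / r\<^sup>2" by (simp add: c_def s_def power_divide add_divide_distrib)
      then have cs: "c\<^sup>2 + s\<^sup>2 = 1" using False by (simp add: r2[symmetric])
      have b: "b \<in> K" "b \<noteq> k0" using insert.prems by auto
      have g: "good K (givens k0 b c s)" using K b cs by (intro good_givens) auto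
      have "app K (\<lambda>j k. \<Sum>l\<in>K. givens k0 b c s j l * T l k) w j = 0" if "j \<in> insert b B" for j
      proof -
        have jK: "j \<in> K" "j \<noteq> k0" using that insert.prems by auto
        have "app K (\<lambda>j k. \<Sum>l\<in>K. givens k0 b c s j l * T l k) w j = app K (givens k0 b c s) v j"
          by (simp add: app_mult v_def)
        also have "\<dots> = (if j = b then - s * v k0 + c * v b else v j)"
          using K b jK by (subst app_givens) auto
        also have "\<dots> = 0" using that T(2) insert.hyps by (auto simp: c_def s_def v_def)
        finally show ?thesis .
      qed
      then show ?thesis using good_mult[OF g T(1)] by blast
    qed
  qed
  then show ?thesis using K by (meson finite_Diff order_refl)
qed

text \<open>Independence arguments need a kernel vector that is a function of the matrix entries
  alone; \<open>r\<close> sets all other coordinates to 0 before the measurable solution is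
  evaluated. Through \<open>pos\<close> the equations may come from rows or from columns.\<close>

lemma kernel_selection:
  fixes pos :: "'a \<Rightarrow> 'b \<Rightarrow> nat \<times> nat"
  assumes "finite I" "finite J" "card I < card J"
  obtains s where "\<And>c. s c \<in> borel_measurable Om" "\<And>X. \<exists>c\<in>J. s c X \<noteq> 0"
    "\<And>X i. i \<in> I \<Longrightarrow> (\<Sum>c\<in>J. s c X * X (pos i c)) = 0"
    "\<And>X Y c. (\<forall>i\<in>I. \<forall>c\<in>J. X (pos i c) = Y (pos i c)) \<Longrightarrow> s c X = s c Y"
proof -
  define r :: "(nat \<times> nat \<Rightarrow> real) \<Rightarrow> nat \<times> nat \<Rightarrow> real" where
    "r X p = (if p \<in> (\<Union>i\<in>I. pos i ` J) then X p else 0)" for X p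
  have r[measurable]: "r \<in> measurable Om Om"
    by (rule measurable_into_Om) (simp add: r_def)
  obtain s where s: "\<And>c. s c \<in> borel_measurable Om"
    "\<And>X. (\<exists>c\<in>J. s c X \<noteq> 0)" "\<And>X i. i\<in>I \<Longrightarrow> (\<Sum>c\<in>J. s c X * X (pos i c)) = 0"
    using homogeneous_system_solution[OF assms, of "\<lambda>i c X. X (pos i c)" Om] by auto
  note [measurable] = s(1)
  show thesis
  proof (rule that[of "\<lambda>c X. s c (r X)"])
    show "(\<lambda>X. s c (r X)) \<in> borel_measurable Om" for c by measurable
    show "\<exists>c\<in>J. s c (r X) \<noteq> 0" for X using s(2) .
    show "(\<Sum>c\<in>J. s c (r X) * X (pos i c)) = 0" if "i \<in> I" for X i
    proof -
      have "(\<Sum>c\<in>J. s c (r X) * X (pos i c)) = (\<Sum>c\<in>J. s c (r X) * r X (pos i c))"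
        by (intro sum.cong) (use that in \<open>auto simp: r_def\<close>)
      then show ?thesis using s(3)[OF that, of "r X"] by simp
    qed
    show "s c (r X) = s c (r Y)" if "\<forall>i\<in>I. \<forall>c\<in>J. X (pos i c) = Y (pos i c)" for X Y c
    proof -
      have "r X = r Y" using that by (auto simp: r_def fun_eq_iff)
      then show ?thesis by simp
    qed
  qed
qed

text \<open>The coefficients ignore the entry \<open>(k, c0)\<close>. With everything else fixed,
  the form vanishes for at most one value of that entry, and single values have Gaussian measure
  0.\<close>

lemma AE_Om_linear_neq:
  assumes [measurable]: "\<And>c. s c \<in> borel_measurable Om"
    and C: "finite C" "c0 \<in> C"
    and dep: "\<And>X u c. s c (X((k, c0) := u)) = s c X"
  shows "AE X in Om. s c0 X \<noteq> 0 \<longrightarrow> (\<Sum>c\<in>C. s c X * X (k, c)) \<noteq> 0"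
proof -
  define Q where "Q X \<longleftrightarrow> s c0 X \<noteq> 0 \<and> (\<Sum>c\<in>C. s c X * X (k, c)) = 0" for X
  have [measurable]: "Measurable.pred Om Q" unfolding Q_def by measurable
  have "measure std_normal {u. Q (X((k, c0) := u))} = 0" for X
  proof -
    have "{u. Q (X((k, c0) := u))} \<subseteq> {- (\<Sum>c\<in>C - {c0}. s c X * X (k, c)) / s c0 X}"
    proof
      fix u assume "u \<in> {u. Q (X((k, c0) := u))}"
      then have "s c0 X \<noteq> 0" "(\<Sum>c\<in>C. s c X * (X((k, c0) := u)) (k, c)) = 0" by (auto simp: Q_def dep)
      moreover have "(\<Sum>c\<in>C. s c X * (X((k, c0) := u)) (k, c)) = s c0 X * u + (\<Sum>c\<in>C - {c0}. s c X * X (k, c))"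
        using C by (subst sum.remove[of C c0]) (auto intro!: sum.cong)
      ultimately show "u \<in> {- (\<Sum>c\<in>C - {c0}. s c X * X (k, c)) / s c0 X}" by (auto simp: field_simps)
    qed
    moreover have "emeasure std_normal {t} = 0" for t
      by (subst emeasure_density) (auto simp: nn_integral_0_iff_AE intro!: AE_I[where N="{t}"] simp: indicator_def)
    then have "{t} \<in> null_sets std_normal" for t by (auto simp: null_sets_def)
    ultimately have "emeasure std_normal {u. Q (X((k, c0) := u))} = 0"
      by (meson emeasure_mono emeasure_eq_0 null_setsD1 null_setsD2 null_sets_subset le_zero_eq)
    then show ?thesis by (simp add: measure_def)
  qed
  then have "measure Om {X. Q X} = 0" by (simp add: prob_upd[where a="(k, c0)"])
  then have "AE X in Om. \<not> Q X"
    using Om.prob_eq_0[of "{X. Q X}"] \<open>Measurable.pred Om Q\<close> by (simp add: pred_def)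
  then show ?thesis by (rule AE_mp) (auto simp: Q_def)
qed

text \<open>Row by row: almost surely the old rows stay nonsingular without column
  \<open>c0\<close>, so their kernel is the line through \<open>s\<close>. The new row is
  independent of \<open>s\<close> and almost surely not orthogonal to it.\<close>

lemma AE_nonsing:
  assumes "finite K" "finite C" "card K = card C"
  shows "AE X in Om. nonsing K C (\<lambda>k c. X (k, c))"
  using assms
proof (induction K arbitrary: C rule: finite_induct)
  case empty
  then show ?case by (simp add: nonsing_def)
next
  case (insert k K)
  then obtain c0 where c0: "c0 \<in> C" by fastforce
  define C' where "C' = C - {c0}"
  have C': "finite C'" "card K = card C'" using insert c0 by (auto simp: C'_def)
  have "card K < card C" using insert by simp
  obtain s where s: "\<And>c. s c \<in> borel_measurable Om" "\<And>X. \<exists>c\<in>C. s c X \<noteq> 0"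
    "\<And>X k. k\<in>K \<Longrightarrow> (\<Sum>c\<in>C. s c X * X (k, c)) = 0"
    "\<And>X Y c. (\<forall>k\<in>K. \<forall>c\<in>C. X (k, c) = Y (k, c)) \<Longrightarrow> s c X = s c Y"
    by (rule kernel_selection[OF insert.hyps(1) insert.prems(1) \<open>card K < card C\<close>, of "\<lambda>k c. (k, c)"], rule that)
  have "AE X in Om. s c0 X \<noteq> 0 \<longrightarrow> (\<Sum>c\<in>C. s c X * X (k, c)) \<noteq> 0"
    by (rule AE_Om_linear_neq[OF s(1) insert.prems(1) c0]) (rule s(4), use insert.hyps in auto)
  moreover have "AE X in Om. nonsing K C' (\<lambda>k c. X (k, c))" by (rule insert.IH[OF C'])
  ultimately show ?case
  proof eventually_elim
    case (elim X)
    have splitC: "(\<Sum>c\<in>C. t c * X (j, c)) = t c0 * X (j, c0) + (\<Sum>c\<in>C'. t c * X (j, c))" for t j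
      unfolding C'_def using insert.prems c0 by (subst sum.remove[of C c0]) auto
    have z: "\<forall>c\<in>C. t c = 0" if "t c0 = 0" "\<And>j. j \<in> K \<Longrightarrow> (\<Sum>c\<in>C. t c * X (j, c)) = 0" for t
    proof -
      have "\<forall>j\<in>K. (\<Sum>c\<in>C'. t c * X (j, c)) = 0" using that splitC[of t] by simp
      with elim(2) have "\<forall>c\<in>C'. t c = 0" unfolding nonsing_def by blast
      then show ?thesis using that(1) by (auto simp: C'_def)
    qed
    have sc: "s c0 X \<noteq> 0" using z[of "\<lambda>c. s c X"] s(2)[of X] s(3) by auto
    with elim(1) have ne: "(\<Sum>c\<in>C. s c X * X (k, c)) \<noteq> 0" by blast
    show ?case unfolding nonsing_def
    proof (intro allI impI)
      fix t assume t: "\<forall>i\<in>insert k K. (\<Sum>c\<in>C. t c * X (i, c)) = 0"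
      define l where "l = t c0 / s c0 X"
      have "\<forall>c\<in>C. t c - l * s c X = 0"
      proof (rule z)
        show "t c0 - l * s c0 X = 0" using sc by (simp add: l_def)
        fix j assume "j \<in> K"
        then show "(\<Sum>c\<in>C. (t c - l * s c X) * X (j, c)) = 0"
          using t s(3)[of j X] by (simp add: left_diff_distrib sum_subtractf mult.assoc sum_distrib_left[symmetric])
      qed
      then have tl: "\<forall>c\<in>C. t c = l * s c X" by auto
      then have "(\<Sum>c\<in>C. t c * X (k, c)) = l * (\<Sum>c\<in>C. s c X * X (k, c))"
        by (simp add: sum_distrib_left mult.assoc)
      then have "l = 0" using t ne by auto
      then show "\<forall>c\<in>C. t c = 0" using tl by simp
    qed
  qed
qed

definition kernelvec :: "nat set \<Rightarrow> nat set \<Rightarrow> (nat \<times> nat \<Rightarrow> real) \<Rightarrow> (nat \<Rightarrow> real) \<Rightarrow> bool" where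
  "kernelvec I C X v \<longleftrightarrow> (\<forall>c\<in>C. ip I v (\<lambda>k. X (k, c)) = 0)"

text \<open>With one row more than columns this says that the kernel is a line not contained in the
  coordinate hyperplane at \<open>k0\<close>; comparing coordinates at \<open>k0\<close> then
  identifies kernel vectors up to a scalar.\<close>

definition rigid :: "nat set \<Rightarrow> nat set \<Rightarrow> nat \<Rightarrow> (nat \<times> nat \<Rightarrow> real) \<Rightarrow> bool" where
  "rigid I C k0 X \<longleftrightarrow> (\<forall>v. kernelvec I C X v \<and> v k0 = 0 \<longrightarrow> (\<forall>k\<in>I. v k = 0))"

lemma AE_rigid:
  assumes "finite I" "finite C" "card I = Suc (card C)" "k0 \<in> I"
  shows "AE X in Om. rigid I C k0 X"
proof -
  have "AE X in Om. nonsing (I - {k0}) C (\<lambda>k c. X (k, c))"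
    using assms by (intro AE_nonsing) auto
  then show ?thesis
  proof eventually_elim
    case (elim X)
    have t: "nonsing C (I - {k0}) (\<lambda>c k. X (k, c))"
      using nonsing_transpose[OF _ _ _ elim] assms by simp
    show ?case unfolding rigid_def
    proof (intro allI impI)
      fix v assume v: "kernelvec I C X v \<and> v k0 = 0"
      have "(\<Sum>k\<in>I - {k0}. v k * X (k, c)) = 0" if "c \<in> C" for c
        using v that assms by (auto simp: kernelvec_def ip_def sum.remove[of I k0])
      then have "\<forall>k\<in>I - {k0}. v k = 0" using t unfolding nonsing_def by blast
      then show "\<forall>k\<in>I. v k = 0" using v by auto
    qed
  qed
qed

lemma rigid_unique:
  assumes "rigid I C k0 X" "kernelvec I C X u" "kernelvec I C X v" "k \<in> I" "u k \<noteq> 0"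
  shows "\<forall>k\<in>I. v k = v k0 / u k0 * u k"
proof -
  have u0: "u k0 \<noteq> 0" using assms unfolding rigid_def by blast
  define w where "w = (\<lambda>k. v k + (- (v k0 / u k0)) * u k)"
  have "kernelvec I C X w" using assms(2,3) unfolding kernelvec_def w_def ip_add ip_scale by simp
  moreover have "w k0 = 0" using u0 by (simp add: w_def)
  ultimately have "\<forall>k\<in>I. w k = 0" using assms(1) unfolding rigid_def by blast
  then show ?thesis by (auto simp: w_def)
qed

lemma kernelvec_act:
  assumes "isom I T" "kernelvec I C X v"
  shows "kernelvec I C (act T I C X) (app I T v)"
  unfolding kernelvec_def
proof
  fix c assume c: "c \<in> C"
  have "ip I (app I T v) (\<lambda>k. act T I C X (k, c)) = ip I (app I T v) (app I T (\<lambda>k. X (k, c)))"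
    by (rule ip_cong) (use c in \<open>auto simp: act_def\<close>)
  also have "\<dots> = ip I v (\<lambda>k. X (k, c))" using assms(1) by (rule isom_ip)
  also have "\<dots> = 0" using assms(2) c by (simp add: kernelvec_def)
  finally show "ip I (app I T v) (\<lambda>k. act T I C X (k, c)) = 0" .
qed

lemma isom_nonzero:
  assumes "finite I" "isom I T" "k \<in> I" "v k \<noteq> 0"
  shows "\<exists>k\<in>I. app I T v k \<noteq> 0"
proof (rule ccontr)
  assume "\<not> ?thesis"
  then have "ip I (app I T v) (app I T v) = 0" by (simp add: ip_def)
  then have "ip I v v = 0" using assms(2) by (simp add: isom_def)
  then show False using ip_pos[of I k v] assms by simp
qed

text \<open>A rotation sends \<open>h\<close> to the axis \<open>k1\<close>, so the form becomes a
  multiple of coordinate \<open>k1\<close> of the rotated kernel vector. Rigidity of the rotated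
  matrix, which has the same law, keeps that coordinate away from 0.\<close>

lemma AE_kernel_form_nonzero:
  assumes "finite I" "finite C" "card I = Suc (card C)" "k1 \<in> I" "h k1 \<noteq> 0"
  shows "AE X in Om. \<forall>v k. kernelvec I C X v \<longrightarrow> k \<in> I \<longrightarrow> v k \<noteq> 0 \<longrightarrow> ip I h v \<noteq> 0"
proof -
  obtain T where T: "good I T" "\<And>j. j \<in> I - {k1} \<Longrightarrow> app I T h j = 0"
    using rotate_to_axis[of I k1 h] assms by blast
  have iso: "isom I T" and mp: "mpres (act T I C)" using T(1) assms(2) by (auto simp: good_def)
  have "AE X in Om. rigid I C k1 (act T I C X)"
    by (rule mpres_AE[OF mp AE_rigid]) (use assms in auto)
  then show ?thesis
  proof eventually_elim
    case (elim X)
    show ?case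
    proof (intro allI impI)
      fix v k assume v: "kernelvec I C X v" "k \<in> I" "v k \<noteq> 0"
      have "ip I h v = ip I (app I T h) (app I T v)" using isom_ip[OF iso] by simp
      also have "\<dots> = app I T h k1 * app I T v k1" by (rule ip_axis) (use assms T in auto)
      finally have eq: "ip I h v = app I T h k1 * app I T v k1" .
      have "app I T v k1 \<noteq> 0"
        using elim kernelvec_act[OF iso v(1)] isom_nonzero[of I T k v, OF assms(1) iso v(2,3)] unfolding rigid_def by blast
      moreover have "app I T h k1 \<noteq> 0"
      proof -
        obtain k where k: "k \<in> I" "app I T h k \<noteq> 0"
          using isom_nonzero[of I T k1 h, OF assms(1) iso assms(4,5)] by blast
        then have "k = k1" using T(2)[of k] by blast
        then show ?thesis using k by simp
      qed
      ultimately show "ip I h v \<noteq> 0" unfolding eq by simp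
    qed
  qed
qed

section \<open>Spherical caps and the distribution of the kernel direction\<close>

lemma std_normal_interval_pos:
  assumes "a < b"
  shows "emeasure std_normal {a<..<b} \<noteq> 0"
proof
  assume "emeasure std_normal {a<..<b} = 0"
  then have "(\<integral>\<^sup>+x. ennreal (std_normal_density x) * indicator {a<..<b} x \<partial>lborel) = 0"
    by (subst (asm) emeasure_density) auto
  then have "AE x in lborel. ennreal (std_normal_density x) * indicator {a<..<b} x = 0"
    by (subst (asm) nn_integral_0_iff_AE) auto
  then have "AE x in lborel. x \<notin> {a<..<b}"
  proof eventually_elim
    case (elim x)
    have "std_normal_density x > 0" by (rule normal_density_pos) simp
    then show ?case using elim by (auto simp: indicator_def split: if_splits)
  qed
  then have "emeasure lborel {a<..<b} = 0"
    by (subst (asm) AE_iff_measurable[OF _ refl]) (auto simp: greaterThanLessThan_def greaterThan_def lessThan_def Collect_conj_eq)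
  then show False using assms by simp
qed

text \<open>A double cap: the squared cosine of the angle between the vectors exceeds
  \<open>1 - 1 / (n + 2)\<close>. The condition ignores nonzero scalar factors, and the offset 2
  keeps the threshold at least 1/2 for all \<open>n\<close>.\<close>

definition cap :: "nat set \<Rightarrow> nat \<Rightarrow> (nat \<Rightarrow> real) \<Rightarrow> (nat \<Rightarrow> real) \<Rightarrow> bool" where
  "cap I n v z \<longleftrightarrow> (ip I v z)\<^sup>2 > (1 - 1 / (real n + 2)) * (ip I v v * ip I z z)"

definition cone :: "nat set \<Rightarrow> 'j set \<Rightarrow> ('j \<Rightarrow> nat \<Rightarrow> real) \<Rightarrow> (nat \<Rightarrow> real) \<Rightarrow> bool" where
  "cone I J h v \<longleftrightarrow> (\<forall>j\<in>J. ip I (h j) v > 0)"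

text \<open>A selected kernel vector has arbitrary sign, so the cone is taken together with its
  negative.\<close>

definition dcone :: "nat set \<Rightarrow> 'j set \<Rightarrow> ('j \<Rightarrow> nat \<Rightarrow> real) \<Rightarrow> (nat \<Rightarrow> real) \<Rightarrow> bool" where
  "dcone I J h v \<longleftrightarrow> cone I J h v \<or> cone I J h (\<lambda>k. - v k)"

lemma cap_cong: "(\<And>k. k \<in> I \<Longrightarrow> v k = v' k) \<Longrightarrow> (\<And>k. k \<in> I \<Longrightarrow> z k = z' k) \<Longrightarrow> cap I n v z = cap I n v' z'"
  unfolding cap_def using ip_cong[of I v v' z z'] ip_cong[of I v v' v v'] ip_cong[of I z z' z z'] by simp

lemma cap_isom: "isom I T \<Longrightarrow> cap I n (app I T v) (app I T z) = cap I n v z"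
  unfolding cap_def by (simp add: isom_ip)

lemma cap_scale_left: "t \<noteq> 0 \<Longrightarrow> cap I n (\<lambda>k. t * v k) z = cap I n v z"
proof -
  assume "t \<noteq> 0"
  then have t: "t\<^sup>2 > 0" by simp
  have "cap I n (\<lambda>k. t * v k) z \<longleftrightarrow> t\<^sup>2 * ((1 - 1 / (real n + 2)) * (ip I v v * ip I z z)) < t\<^sup>2 * (ip I v z)\<^sup>2"
    unfolding cap_def ip_scale by (simp add: power2_eq_square mult_ac)
  also have "\<dots> \<longleftrightarrow> cap I n v z" unfolding cap_def using t by (rule mult_less_cancel_left_pos)
  finally show ?thesis .
qed

lemma cap_commute: "cap I n v z = cap I n z v"
  unfolding cap_def by (simp add: ip_commute[of I v z] mult.commute)

text \<open>Write \<open>z = t * a + w\<close> with \<open>w\<close> orthogonal to \<open>a\<close>.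
  The cap gives \<open>(n + 1) * ip I w w < t^2 * ip I a a\<close>, so for large \<open>n\<close>
  the part \<open>t * ip I h a\<close> dominates \<open>ip I h w\<close>; Cauchy-Schwarz yields the
  bound \<open>n0\<close>.\<close>

lemma cap_sign:
  assumes "finite I" "ip I h a \<noteq> 0"
  shows "\<exists>n0. \<forall>n\<ge>n0. \<forall>z. cap I n a z \<longrightarrow> ip I h z * (ip I a z * ip I h a) > 0"
proof -
  define \<alpha> where "\<alpha> = ip I a a"
  have a: "\<alpha> > 0"
  proof -
    have "\<alpha> \<noteq> 0"
    proof
      assume "\<alpha> = 0"
      then have "\<forall>k\<in>I. a k = 0" using assms(1) by (simp add: \<alpha>_def ip_eq_0)
      then have "ip I h a = 0" by (simp add: ip_def)
      with assms show False by simp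
    qed
    then show ?thesis using ip_nonneg[of I a] by (simp add: \<alpha>_def)
  qed
  define H where "H = ip I h h"
  obtain n0 :: nat where n0: "H * \<alpha> / (ip I h a)\<^sup>2 \<le> real n0" using real_arch_simple by blast
  show ?thesis
  proof (intro exI[of _ n0] allI impI)
    fix n z assume n: "n0 \<le> n" and cap: "cap I n a z"
    define t where "t = ip I a z / \<alpha>"
    define w where "w = (\<lambda>k. z k + (- t) * a k)"
    have az: "ip I a z = t * \<alpha>" using a by (simp add: t_def)
    have hz: "ip I h z = t * ip I h a + ip I h w" unfolding w_def ip_add ip_scale by simp
    have "ip I w w = ip I z z - 2 * t * ip I a z + t\<^sup>2 * \<alpha>"
      unfolding w_def ip_add ip_scale \<alpha>_def by (simp add: ip_commute[of I z a] power2_eq_square algebra_simps)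
    also have "\<dots> = ip I z z - t\<^sup>2 * \<alpha>" unfolding az by (simp add: power2_eq_square)
    finally have ww: "ip I w w = ip I z z - t\<^sup>2 * \<alpha>" .
    have "(1 - 1 / (real n + 2)) * (\<alpha> * ip I z z) < t\<^sup>2 * \<alpha> * \<alpha>"
      using cap unfolding cap_def az \<alpha>_def[symmetric] by (simp add: power2_eq_square mult_ac)
    then have "(1 - 1 / (real n + 2)) * ip I z z * \<alpha> < t\<^sup>2 * \<alpha> * \<alpha>" by (simp add: mult_ac)
    then have "(1 - 1 / (real n + 2)) * ip I z z < t\<^sup>2 * \<alpha>" using a by (simp only: mult_less_cancel_right_pos)
    then have "(real n + 1) * ip I z z < (real n + 2) * (t\<^sup>2 * \<alpha>)" by (simp add: field_simps)
    then have w1: "(real n + 1) * ip I w w < t\<^sup>2 * \<alpha>" unfolding ww by (simp add: algebra_simps)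
    have t0: "t \<noteq> 0" using w1 ip_nonneg[of I w] by (auto simp: mult_less_0_iff)
    have "(ip I h w)\<^sup>2 \<le> H * ip I w w" unfolding H_def by (rule ip_Cauchy_Schwarz)
    have "H * \<alpha> \<le> real n0 * (ip I h a)\<^sup>2" using n0 assms(2) by (simp add: field_simps)
    also have "\<dots> \<le> (real n + 1) * (ip I h a)\<^sup>2" using n by (intro mult_right_mono) auto
    finally have Ha: "H * \<alpha> \<le> (real n + 1) * (ip I h a)\<^sup>2" .
    have lt: "(ip I h w)\<^sup>2 < (t * ip I h a)\<^sup>2"
    proof (cases "H = 0")
      case True
      then have "(ip I h w)\<^sup>2 \<le> 0" using \<open>(ip I h w)\<^sup>2 \<le> H * ip I w w\<close> by simp
      then show ?thesis using t0 assms(2) by (smt (verit) zero_less_power2 mult_eq_0_iff)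
    next
      case False
      then have "H > 0" using ip_nonneg[of I h] by (simp add: H_def)
      have "(real n + 1) * (ip I h w)\<^sup>2 \<le> H * ((real n + 1) * ip I w w)"
        using \<open>(ip I h w)\<^sup>2 \<le> H * ip I w w\<close> mult_left_mono[of "(ip I h w)\<^sup>2" "H * ip I w w" "real n + 1"] by (simp add: mult_ac)
      also have "\<dots> < H * (t\<^sup>2 * \<alpha>)" using w1 \<open>H > 0\<close> by (rule mult_strict_left_mono)
      also have "\<dots> \<le> t\<^sup>2 * ((real n + 1) * (ip I h a)\<^sup>2)" using mult_left_mono[OF Ha, of "t\<^sup>2"] by (simp add: mult_ac)
      finally have "(real n + 1) * (ip I h w)\<^sup>2 < (real n + 1) * (t * ip I h a)\<^sup>2" by (simp add: power_mult_distrib mult_ac)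
      then show ?thesis by (rule mult_left_less_imp_less) simp
    qed
    have "\<bar>ip I h w\<bar> < \<bar>t * ip I h a\<bar>"
      by (rule power2_less_imp_less) (use lt in simp_all)
    then have "\<bar>ip I h w * (t * ip I h a)\<bar> < \<bar>t * ip I h a\<bar> * \<bar>t * ip I h a\<bar>"
      unfolding abs_mult[of "ip I h w"] by (intro mult_strict_right_mono) auto
    then have "ip I h w * (t * ip I h a) + (t * ip I h a) * (t * ip I h a) > 0"
      by (simp add: abs_mult_self_eq)
    from mult_pos_pos[OF this a] have "(ip I h z * (t * ip I h a)) * \<alpha> > 0" unfolding hz by (simp add: algebra_simps)
    then show "ip I h z * (ip I a z * ip I h a) > 0" unfolding az by (simp add: mult_ac)
  qed
qed

lemma cap_dcone:
  assumes "finite I" "finite J" "J \<noteq> {}" "\<And>j. j \<in> J \<Longrightarrow> ip I (h j) a \<noteq> 0"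
  shows "\<exists>n0. \<forall>n\<ge>n0. \<forall>z. cap I n a z \<longrightarrow> dcone I J h z = dcone I J h a"
proof -
  have "\<forall>j\<in>J. \<exists>n0. \<forall>n\<ge>n0. \<forall>z. cap I n a z \<longrightarrow> ip I (h j) z * (ip I a z * ip I (h j) a) > 0"
    using cap_sign[OF assms(1)] assms(4) by blast
  then obtain N where N: "\<And>j n z. j \<in> J \<Longrightarrow> N j \<le> n \<Longrightarrow> cap I n a z \<Longrightarrow> ip I (h j) z * (ip I a z * ip I (h j) a) > 0"
    by metis
  show ?thesis
  proof (intro exI[of _ "Max (N ` J)"] allI impI)
    fix n z assume n: "Max (N ` J) \<le> n" and cap: "cap I n a z"
    have s: "ip I (h j) z * (ip I a z * ip I (h j) a) > 0" if "j \<in> J" for j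
    proof (rule N[OF that _ cap])
      show "N j \<le> n" using n that assms(2) by (meson Max_ge finite_imageI image_eqI order_trans)
    qed
    have neg: "ip I (h j) (\<lambda>k. - v k) = - ip I (h j) v" for j v by (simp add: ip_def sum_negf)
    have "ip I a z \<noteq> 0" using s assms(3) by force
    then consider "ip I a z > 0" | "ip I a z < 0" by linarith
    then show "dcone I J h z = dcone I J h a"
    proof cases
      case 1
      have "ip I (h j) z > 0 \<longleftrightarrow> ip I (h j) a > 0" "ip I (h j) z < 0 \<longleftrightarrow> ip I (h j) a < 0" if "j \<in> J" for j
        using s[OF that] 1 by (auto simp: zero_less_mult_iff mult_less_0_iff)
      then show ?thesis by (simp add: dcone_def cone_def neg)
    next
      case 2
      have "ip I (h j) z > 0 \<longleftrightarrow> ip I (h j) a < 0" "ip I (h j) z < 0 \<longleftrightarrow> ip I (h j) a > 0" if "j \<in> J" for j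
        using s[OF that] 2 by (auto simp: zero_less_mult_iff mult_less_0_iff)
      then show ?thesis by (auto simp: dcone_def cone_def neg)
    qed
  qed
qed

lemma measurable_ip [measurable (raw)]:
  assumes "\<And>k. (\<lambda>w. u w k) \<in> borel_measurable M" "\<And>k. (\<lambda>w. v w k) \<in> borel_measurable M"
  shows "(\<lambda>w. ip I (u w) (v w)) \<in> borel_measurable M"
  unfolding ip_def using assms by (intro borel_measurable_sum borel_measurable_times) auto

lemma measurable_cap [measurable (raw)]:
  assumes [measurable]: "\<And>k. (\<lambda>w. u w k) \<in> borel_measurable M" "\<And>k. (\<lambda>w. v w k) \<in> borel_measurable M"
  shows "Measurable.pred M (\<lambda>w. cap I n (u w) (v w))"
  unfolding cap_def by measurable

lemma measurable_dcone [measurable (raw)]: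
  assumes [measurable]: "\<And>k. (\<lambda>w. v w k) \<in> borel_measurable M" and "finite J"
  shows "Measurable.pred M (\<lambda>w. dcone I J h (v w))"
  unfolding dcone_def cone_def using assms(2) by measurable

text \<open>The measure of a cap does not depend on its centre: a rotation takes the centre to a
  multiple of the axis vector and preserves the law of the column.\<close>

lemma prob_cap_column:
  assumes "finite I" "k0 \<in> I" "k1 \<in> I" "v k1 \<noteq> 0"
  shows "measure Om {X. cap I n v (\<lambda>k. X (k, z0))} =
    measure Om {X. cap I n (\<lambda>k. if k = k0 then 1 else 0) (\<lambda>k. X (k, z0))}"
proof -
  obtain T where T: "good I T" "\<And>j. j \<in> I - {k0} \<Longrightarrow> app I T v j = 0"
    using rotate_to_axis[of I k0 v] assms by blast
  have iso: "isom I T" and mp: "mpres (act T I {z0})" using T(1) by (auto simp: good_def)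
  define t where "t = app I T v k0"
  have t: "t \<noteq> 0" using isom_nonzero[of I T k1 v, OF assms(1) iso assms(3,4)] T(2) by (auto simp: t_def)
  have "cap I n v (\<lambda>k. X (k, z0)) \<longleftrightarrow> cap I n (\<lambda>k. if k = k0 then 1 else 0) (\<lambda>k. act T I {z0} X (k, z0))" for X
  proof -
    have "cap I n v (\<lambda>k. X (k, z0)) \<longleftrightarrow> cap I n (app I T v) (app I T (\<lambda>k. X (k, z0)))" using cap_isom[OF iso] by simp
    also have "\<dots> \<longleftrightarrow> cap I n (\<lambda>k. t * (if k = k0 then 1 else 0)) (\<lambda>k. act T I {z0} X (k, z0))"
      by (rule cap_cong) (use T(2) in \<open>auto simp: t_def act_def\<close>)
    also have "\<dots> \<longleftrightarrow> cap I n (\<lambda>k. if k = k0 then 1 else 0) (\<lambda>k. act T I {z0} X (k, z0))"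
      by (rule cap_scale_left[OF t])
    finally show ?thesis .
  qed
  then have "measure Om {X. cap I n v (\<lambda>k. X (k, z0))} =
      measure Om {X. cap I n (\<lambda>k. if k = k0 then 1 else 0) (\<lambda>k. act T I {z0} X (k, z0))}" by simp
  also have "\<dots> = measure Om {X. cap I n (\<lambda>k. if k = k0 then 1 else 0) (\<lambda>k. X (k, z0))}"
    by (rule mpres_prob[OF mp]) measurable
  finally show ?thesis .
qed

text \<open>The cap contains a box of positive measure: coordinate \<open>k0\<close> exceeds
  \<open>R\<close>, the others are below 1 in absolute value, and \<open>R\<close> is large enough
  for the angle condition. Positivity matters because cap measures become divisors.\<close>

lemma prob_cap_pos:
  assumes "finite I" "k0 \<in> I"
  shows "measure Om {X. cap I n (\<lambda>k. if k = k0 then 1 else 0) (\<lambda>k. X (k, z0))} > 0"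
proof -
  define e where "e = (\<lambda>k. if k = k0 then 1 else 0 :: real)"
  define R where "R = (real n + 2) * (real (card I) + 1)"
  define A where "A = (\<lambda>p :: nat \<times> nat. if p = (k0, z0) then {R<..<R+1} else {-1<..<1::real})"
  have R: "R \<ge> 1" unfolding R_def using mult_mono[of 1 "real n + 2" 1 "real (card I) + 1"] by simp
  have "{X. \<forall>p\<in>I \<times> {z0}. X p \<in> A p} \<subseteq> {X. cap I n e (\<lambda>k. X (k, z0))}"
  proof
    fix X assume "X \<in> {X. \<forall>p\<in>I \<times> {z0}. X p \<in> A p}"
    then have X: "\<And>k. k \<in> I \<Longrightarrow> X (k, z0) \<in> A (k, z0)" by auto
    from X[of k0] have x0: "X (k0, z0) > R" using assms(2) by (simp add: A_def)
    have o: "(\<Sum>k\<in>I - {k0}. X (k, z0) * X (k, z0)) \<le> (\<Sum>k\<in>I - {k0}. 1)"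
    proof (rule sum_mono)
      fix k assume "k \<in> I - {k0}"
      then have "\<bar>X (k, z0)\<bar> < 1" using X[of k] by (auto simp: A_def)
      then show "X (k, z0) * X (k, z0) \<le> 1" using abs_square_less_1[of "X (k, z0)"] by (simp add: power2_eq_square)
    qed
    define a where "a = X (k0, z0)"
    have zz: "ip I (\<lambda>k. X (k, z0)) (\<lambda>k. X (k, z0)) \<le> a * a + real (card I)"
      using o assms card_mono[of I "I - {k0}"] unfolding ip_def a_def by (subst sum.remove[of I k0]) auto
    have ee: "ip I e e = 1" "ip I e (\<lambda>k. X (k, z0)) = a" using assms ip_axis[of I k0 e] by (auto simp: e_def a_def)
    have "R < a * a"
    proof -
      have "R * 1 \<le> R * R" using R by (intro mult_left_mono) auto
      also have "\<dots> < a * a" using x0 R by (intro mult_strict_mono) (auto simp: a_def)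
      finally show ?thesis by simp
    qed
    moreover have "(real n + 1) * real (card I) \<le> R" unfolding R_def by (intro mult_mono) auto
    ultimately have "(real n + 1) * (a * a + real (card I)) < (real n + 2) * (a * a)" by (simp add: algebra_simps)
    then have "(real n + 1) * ip I (\<lambda>k. X (k, z0)) (\<lambda>k. X (k, z0)) < (real n + 2) * (a * a)"
      using zz by (meson le_less_trans mult_left_mono of_nat_0_le_iff add_nonneg_nonneg zero_le_one)
    then have "(1 - 1 / (real n + 2)) * ip I (\<lambda>k. X (k, z0)) (\<lambda>k. X (k, z0)) < a * a" by (simp add: field_simps)
    then show "X \<in> {X. cap I n e (\<lambda>k. X (k, z0))}" by (simp add: cap_def ee power2_eq_square)
  qed
  moreover have m: "{X. cap I n e (\<lambda>k. X (k, z0))} \<in> sets Om"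
  proof -
    have "Measurable.pred Om (\<lambda>X. cap I n e (\<lambda>k. X (k, z0)))" by measurable
    then show ?thesis by (simp add: pred_def)
  qed
  ultimately have "emeasure Om {X. \<forall>p\<in>I \<times> {z0}. X p \<in> A p} \<le> emeasure Om {X. cap I n e (\<lambda>k. X (k, z0))}"
    by (intro emeasure_mono)
  moreover have "emeasure Om {X. \<forall>p\<in>I \<times> {z0}. X p \<in> A p} = (\<Prod>p\<in>I \<times> {z0}. emeasure std_normal (A p))"
    using assms by (intro emeasure_Om_box) (auto simp: A_def)
  moreover have "(\<Prod>p\<in>I \<times> {z0}. emeasure std_normal (A p)) \<noteq> 0"
    using assms std_normal_interval_pos by (simp add: A_def prod_zero_iff)
  ultimately have "emeasure Om {X. cap I n e (\<lambda>k. X (k, z0))} \<noteq> 0" by auto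
  then show ?thesis unfolding e_def[symmetric]
    by (simp add: Om.emeasure_eq_measure zero_less_measure_iff)
qed

text \<open>Rotating the rows rotates the kernel line, although the selected vector need not be
  equivariant. Rigidity makes the two vectors proportional, and \<open>cap\<close> does not see the
  factor.\<close>

lemma prob_cap_kernel:
  assumes I: "finite I" "finite C" "card I = Suc (card C)" "k0 \<in> I"
    and a: "\<And>X. kernelvec I C X (a X)" "\<And>X. \<exists>k\<in>I. a X k \<noteq> 0" "\<And>k. (\<lambda>X. a X k) \<in> borel_measurable Om"
    and z: "k1 \<in> I" "z k1 \<noteq> 0"
  shows "measure Om {X. cap I n (a X) z} = measure Om {X. cap I n (a X) (\<lambda>k. if k = k0 then 1 else 0)}"
proof -
  note [measurable] = a(3)
  obtain T where T: "good I T" "\<And>j. j \<in> I - {k0} \<Longrightarrow> app I T z j = 0"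
    using rotate_to_axis[of I k0 z] I by blast
  have iso: "isom I T" and mp: "mpres (act T I C)" using T(1) I(2) by (auto simp: good_def)
  define t where "t = app I T z k0"
  have t: "t \<noteq> 0" using isom_nonzero[of I T k1 z, OF I(1) iso z] T(2) by (auto simp: t_def)
  have Q: "Measurable.pred Om (\<lambda>X. cap I n (a X) (\<lambda>k. if k = k0 then 1 else 0))" by measurable
  have Qm: "Measurable.pred Om (\<lambda>X. cap I n (a (act T I C X)) (\<lambda>k. if k = k0 then 1 else 0))"
    using measurable_compose[OF mpres_measurable[OF mp] Q] by simp
  have "AE X in Om. rigid I C k0 (act T I C X)"
    by (rule mpres_AE[OF mp AE_rigid[OF I]])
  then have "AE X in Om. cap I n (a X) z \<longleftrightarrow> cap I n (a (act T I C X)) (\<lambda>k. if k = k0 then 1 else 0)"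
  proof eventually_elim
    case (elim X)
    let ?X = "act T I C X"
    obtain k where k: "k \<in> I" "a X k \<noteq> 0" using a(2) by blast
    obtain k' where k': "k' \<in> I" "app I T (a X) k' \<noteq> 0" using isom_nonzero[of I T k "a X", OF I(1) iso k] by blast
    obtain k2 where k2: "k2 \<in> I" "a ?X k2 \<noteq> 0" using a(2) by blast
    define l where "l = app I T (a X) k0 / a ?X k0"
    have l: "\<forall>k\<in>I. app I T (a X) k = l * a ?X k" unfolding l_def
      using rigid_unique[where u="a ?X", OF elim a(1) kernelvec_act[OF iso a(1)] k2] .
    then have "l \<noteq> 0" using k' by auto
    have "cap I n (a X) z \<longleftrightarrow> cap I n (app I T (a X)) (app I T z)" using cap_isom[OF iso] by simp
    also have "\<dots> \<longleftrightarrow> cap I n (\<lambda>k. l * a ?X k) (\<lambda>k. t * (if k = k0 then 1 else 0))"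
      by (rule cap_cong) (use T(2) l in \<open>auto simp: t_def\<close>)
    also have "\<dots> \<longleftrightarrow> cap I n (a ?X) (\<lambda>k. t * (if k = k0 then 1 else 0))" by (rule cap_scale_left[OF \<open>l \<noteq> 0\<close>])
    also have "\<dots> \<longleftrightarrow> cap I n (a ?X) (\<lambda>k. if k = k0 then 1 else 0)"
      unfolding cap_commute[of I n "a ?X"] by (rule cap_scale_left[OF t])
    finally show ?case .
  qed
  then have "measure Om {X. cap I n (a X) z} = measure Om {X. cap I n (a (act T I C X)) (\<lambda>k. if k = k0 then 1 else 0)}"
  proof (intro Om.finite_measure_eq_AE)
    have "Measurable.pred Om (\<lambda>X. cap I n (a X) z)" by measurable
    then show "{X. cap I n (a X) z} \<in> sets Om" by (simp add: pred_def)
    show "{X. cap I n (a (act T I C X)) (\<lambda>k. if k = k0 then 1 else 0)} \<in> sets Om" using Qm by (simp add: pred_def)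
  qed auto
  also have "\<dots> = measure Om {X. cap I n (a X) (\<lambda>k. if k = k0 then 1 else 0)}"
    by (rule mpres_prob[OF mp Q])
  finally show ?thesis .
qed

text \<open>The direction of the kernel of a Gaussian matrix is uniform: compare both sides after replacing
  one of the two directions by a small spherical cap around it, whose measure is the same for all centres.\<close>

lemma prob_dcone_kernel:
  assumes I: "finite I" "finite C" "card I = Suc (card C)" "z0 \<notin> C"
    and a: "\<And>X. kernelvec I C X (a X)" "\<And>X. \<exists>k\<in>I. a X k \<noteq> 0" "\<And>k. (\<lambda>X. a X k) \<in> borel_measurable Om"
      "\<And>X Y. (\<And>k c. k \<in> I \<Longrightarrow> c \<in> C \<Longrightarrow> X (k, c) = Y (k, c)) \<Longrightarrow> a X = a Y"
    and J: "finite J" "J \<noteq> {}" "\<And>j. j \<in> J \<Longrightarrow> \<exists>k\<in>I. h j k \<noteq> 0"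
  shows "measure Om {X. dcone I J h (a X)} = measure Om {X. dcone I J h (\<lambda>k. X (k, z0))}"
proof -
  note [measurable] = a(3) and [simp] = J(1)
  obtain k0 where k0: "k0 \<in> I" using I by fastforce
  define e where "e = (\<lambda>k. if k = k0 then 1 else 0 :: real)"
  define c where "c n = measure Om {X. cap I n e (\<lambda>k. X (k, z0))}" for n
  define c' where "c' n = measure Om {X. cap I n (a X) e}" for n
  have cpos: "c n > 0" for n unfolding c_def e_def by (rule prob_cap_pos[OF I(1) k0])
  have 1: "measure Om {X. cap I n v (\<lambda>k. X (k, z0))} = c n" if "\<exists>k\<in>I. v k \<noteq> 0" for v n
    using prob_cap_column[OF I(1) k0] that unfolding c_def e_def by blast
  have 2: "measure Om {X. cap I n (a X) z} = c' n" if "\<exists>k\<in>I. z k \<noteq> 0" for z n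
    using prob_cap_kernel[OF I(1-3) k0 a(1-3)] that unfolding c'_def e_def by blast
  let ?A = "UNIV \<times> C" and ?B = "UNIV \<times> {z0}"
  have oA: "a (override ?A x x') = a x" "(\<lambda>k. override ?A x x' (k, z0)) = (\<lambda>k. x' (k, z0))" for x x'
    using I(4) by (auto intro!: a(4) simp: override_def)
  have oB: "a (override ?B x x') = a x'" "(\<lambda>k. override ?B x x' (k, z0)) = (\<lambda>k. x (k, z0))" for x x'
    using I(4) by (auto intro!: a(4) simp: override_def)
  have nz: "AE X in Om. \<exists>k\<in>I. X (k, z0) \<noteq> 0"
  proof -
    have "AE X in Om. nonsing {k0} {z0} (\<lambda>k c. X (k, c))" by (rule AE_nonsing) auto
    then show ?thesis
    proof eventually_elim
      case (elim X)
      have "X (k0, z0) \<noteq> 0"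
      proof
        assume "X (k0, z0) = 0"
        then have "(1::real) = 0" using elim unfolding nonsing_def by (auto dest: spec[of _ "\<lambda>_. 1"])
        then show False by simp
      qed
      then show ?case using k0 by blast
    qed
  qed
  \<comment> \<open>The probability that the kernel vector and column \<open>z0\<close> form a small
    angle is computed twice, freezing either of them. They are independent because \<open>z0\<close>
    is not in \<open>C\<close>.\<close>
  have cc: "c' n = c n" for n
  proof -
    have "measure Om {X. cap I n (a X) (\<lambda>k. X (k, z0))} = (\<integral>x. c n \<partial>Om)"
      by (subst prob_resample(1)[where A="?A"]) (auto simp: oA 1[OF a(2)])
    moreover have "measure Om {X. cap I n (a X) (\<lambda>k. X (k, z0))} = (\<integral>x. c' n \<partial>Om)"
    proof -
      have Q: "Measurable.pred Om (\<lambda>X. cap I n (a X) (\<lambda>k. X (k, z0)))" by measurable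
      have "measure Om {X. cap I n (a X) (\<lambda>k. X (k, z0))} = (\<integral>x. measure Om {x'. cap I n (a x') (\<lambda>k. x (k, z0))} \<partial>Om)"
        by (subst prob_resample(1)[OF Q, where A="?B"]) (simp add: oB)
      also have "\<dots> = (\<integral>x. c' n \<partial>Om)"
      proof (rule integral_cong_AE)
        show "(\<lambda>x. measure Om {x'. cap I n (a x') (\<lambda>k. x (k, z0))}) \<in> borel_measurable Om"
          using prob_resample(2)[OF Q, where A="?B"] by (simp add: oB)
        show "AE x in Om. measure Om {x'. cap I n (a x') (\<lambda>k. x (k, z0))} = c' n"
          using nz by eventually_elim (rule 2)
      qed measurable
      finally show ?thesis .
    qed
    ultimately show ?thesis using Om.prob_space by simp
  qed
  \<comment> \<open>With \<open>a x\<close> frozen, the probability that the column lies both in the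
    double cone and in the cap around \<open>a x\<close>. Freezing the column instead evaluates the
    mean of \<open>f n\<close>, while \<open>f n / c n\<close> tends to the indicator that the
    kernel vector itself lies in the double cone.\<close>
  define f where "f = (\<lambda>n x. measure Om {x'. dcone I J h (\<lambda>k. x' (k, z0)) \<and> cap I n (a x) (\<lambda>k. x' (k, z0))})"
  have Qm: "Measurable.pred Om (\<lambda>X. dcone I J h (\<lambda>k. X (k, z0)) \<and> cap I n (a X) (\<lambda>k. X (k, z0)))" for n
    by measurable
  have fm[measurable]: "f n \<in> borel_measurable Om" for n
    using prob_resample(2)[OF Qm, where A="?A"] by (simp add: oA f_def)
  have fint: "(\<integral>x. f n x \<partial>Om) = c n * measure Om {X. dcone I J h (\<lambda>k. X (k, z0))}" for n
  proof -
    have "(\<integral>x. f n x \<partial>Om) = measure Om {X. dcone I J h (\<lambda>k. X (k, z0)) \<and> cap I n (a X) (\<lambda>k. X (k, z0))}"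
      by (subst prob_resample(1)[OF Qm, where A="?A"]) (simp add: oA f_def)
    also have "\<dots> = (\<integral>x. measure Om {x'. dcone I J h (\<lambda>k. x (k, z0)) \<and> cap I n (a x') (\<lambda>k. x (k, z0))} \<partial>Om)"
      by (subst prob_resample(1)[OF Qm, where A="?B"]) (simp add: oB)
    also have "\<dots> = (\<integral>x. c n * indicator {X. dcone I J h (\<lambda>k. X (k, z0))} x \<partial>Om)"
    proof (rule integral_cong_AE)
      show "(\<lambda>x. measure Om {x'. dcone I J h (\<lambda>k. x (k, z0)) \<and> cap I n (a x') (\<lambda>k. x (k, z0))}) \<in> borel_measurable Om"
        using prob_resample(2)[OF Qm, where A="?B"] by (simp add: oB)
      show "AE x in Om. measure Om {x'. dcone I J h (\<lambda>k. x (k, z0)) \<and> cap I n (a x') (\<lambda>k. x (k, z0))} =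
          c n * indicator {X. dcone I J h (\<lambda>k. X (k, z0))} x"
        using nz by eventually_elim (auto simp: indicator_def 2 cc)
    qed measurable
    also have "\<dots> = c n * measure Om {X. dcone I J h (\<lambda>k. X (k, z0))}"
      by simp
    finally show ?thesis .
  qed
  have fle: "f n x \<le> c n" "f n x \<ge> 0" for n x
  proof -
    have "Measurable.pred Om (\<lambda>x'. cap I n (a x) (\<lambda>k. x' (k, z0)))" by measurable
    then have "f n x \<le> measure Om {x'. cap I n (a x) (\<lambda>k. x' (k, z0))}"
      unfolding f_def by (intro Om.finite_measure_mono) (auto simp: pred_def)
    then show "f n x \<le> c n" using 1[OF a(2)] by simp
  qed (simp add: f_def)
  have "AE x in Om. \<forall>j\<in>J. ip I (h j) (a x) \<noteq> 0"
  proof (rule AE_finite_allI[OF J(1)])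
    fix j assume "j \<in> J"
    then obtain k1 where "k1 \<in> I" "h j k1 \<noteq> 0" using J(3) by blast
    from AE_kernel_form_nonzero[where h="h j", OF I(1-3) this]
    show "AE x in Om. ip I (h j) (a x) \<noteq> 0"
    proof eventually_elim
      case (elim X)
      then show ?case using a(1,2)[of X] by blast
    qed
  qed
  then have lim: "AE x in Om. (\<lambda>n. f n x / c n) \<longlonglongrightarrow> indicator {X. dcone I J h (a X)} x"
  proof eventually_elim
    case (elim x)
    obtain n0 where n0: "\<And>n z. n0 \<le> n \<Longrightarrow> cap I n (a x) z \<Longrightarrow> dcone I J h z = dcone I J h (a x)"
      using cap_dcone[of I J h "a x"] I J elim by blast
    have "f n x / c n = indicator {X. dcone I J h (a X)} x" if "n0 \<le> n" for n
    proof -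
      have "{x'. dcone I J h (\<lambda>k. x' (k, z0)) \<and> cap I n (a x) (\<lambda>k. x' (k, z0))} =
          (if dcone I J h (a x) then {x'. cap I n (a x) (\<lambda>k. x' (k, z0))} else {})"
        using n0[OF that] by auto
      then show ?thesis using 1[OF a(2)[of x], of n] cpos[of n] by (simp add: f_def indicator_def)
    qed
    then have "eventually (\<lambda>n. f n x / c n = indicator {X. dcone I J h (a X)} x) sequentially"
      using eventually_sequentially by blast
    then show ?case by (rule tendsto_eventually)
  qed
  have "(\<lambda>n. \<integral>x. f n x / c n \<partial>Om) \<longlonglongrightarrow> (\<integral>x. indicator {X. dcone I J h (a X)} x \<partial>Om)"
  proof (rule integral_dominated_convergence[where w="\<lambda>_. 1"])
    have [measurable]: "Measurable.pred Om (\<lambda>X. dcone I J h (a X))" by measurable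
    show "(\<lambda>x. indicator {X. dcone I J h (a X)} x :: real) \<in> borel_measurable Om" by measurable
    show "AE x in Om. norm (f n x / c n) \<le> 1" for n
      using fle[of n] cpos[of n] by (auto simp: field_simps)
  qed (use lim in auto)
  moreover have "(\<integral>x. f n x / c n \<partial>Om) = measure Om {X. dcone I J h (\<lambda>k. X (k, z0))}" for n
    using fint[of n] cpos[of n] by simp
  ultimately have "(\<integral>x. indicator {X. dcone I J h (a X)} x \<partial>Om) = measure Om {X. dcone I J h (\<lambda>k. X (k, z0))}"
    by (simp add: LIMSEQ_const_iff)
  then show ?thesis by simp
qed

subsection \<open>Solid angles\<close>

lemma mpres_reindex:
  assumes pi: "inj \<pi>"
  shows "mpres (\<lambda>X p. X (\<pi> p))"
  unfolding mpres_def
proof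
  show F: "(\<lambda>X p. X (\<pi> p)) \<in> measurable Om Om" by (rule measurable_into_Om) measurable
  show "distr Om Om (\<lambda>X p. X (\<pi> p)) = Om"
  proof (rule Om_eqI)
    show "finite_measure (distr Om Om (\<lambda>X p. X (\<pi> p)))"
      using Om.prob_space_distr[OF F] by (simp add: prob_space_def)
    fix B :: "nat \<times> nat \<Rightarrow> real set" and J :: "(nat \<times> nat) set"
    assume J: "finite J" and B: "\<And>i. i \<in> J \<Longrightarrow> B i \<in> sets borel"
    have s: "{X. \<forall>i\<in>J. X i \<in> B i} \<in> sets Om"
    proof -
      have "{X \<in> space Om. \<forall>i\<in>J. X i \<in> B i} \<in> sets Om"
        using B J by (intro sets.sets_Collect_finite_All measurable_sets_Collect[OF measurable_Om_component]) auto
      then show ?thesis by simp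
    qed
    have "emeasure (distr Om Om (\<lambda>X p. X (\<pi> p))) {X. \<forall>i\<in>J. X i \<in> B i} =
        emeasure Om {X. \<forall>i\<in>\<pi> ` J. X i \<in> B (inv \<pi> i)}"
      by (subst emeasure_distr[OF F s]) (simp add: vimage_def inv_f_f[OF pi])
    also have "\<dots> = (\<Prod>i\<in>\<pi> ` J. emeasure std_normal (B (inv \<pi> i)))"
      by (rule emeasure_Om_box) (use J B in \<open>auto simp: inv_f_f[OF pi]\<close>)
    also have "\<dots> = (\<Prod>i\<in>J. emeasure std_normal (B i))"
      by (subst prod.reindex) (auto simp: inv_f_f[OF pi] intro: inj_on_subset[OF pi])
    finally show "emeasure (distr Om Om (\<lambda>X p. X (\<pi> p))) {X. \<forall>i\<in>J. X i \<in> B i} = (\<Prod>i\<in>J. emeasure std_normal (B i))" .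
  qed simp
qed

lemma mpres_transpose: "mpres (\<lambda>X p. X (prod.swap p))"
  by (rule mpres_reindex) simp

lemma mpres_swap_rows: "mpres (\<lambda>X p. X (if fst p = a then b else if fst p = b then a else fst p, snd p))"
  by (rule mpres_reindex) (auto simp: inj_on_def split: if_splits)

lemma mpres_swap_columns: "mpres (\<lambda>X p. X (fst p, if snd p = a then b else if snd p = b then a else snd p))"
  by (rule mpres_reindex) (auto simp: inj_on_def split: if_splits)

lemma mpres_uminus: "mpres (\<lambda>X p. - X p)"
  using mpres_signs[of "\<lambda>_. -1"] by simp

text \<open>A rotation of the feature space turns the form with coefficients \<open>v\<close> into
  \<open>t\<close> times one coordinate, simultaneously for all samples involved; the transposition
  lets it act on features. A positive scale drops out and a negative one is absorbed by the symmetry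
  of the Gaussian.\<close>

lemma prob_linear_forms:
  assumes C: "finite C" "c1 \<in> C" "v c1 \<noteq> 0" and J: "finite J"
  shows "measure Om {X. \<forall>j\<in>J. y j * ((\<Sum>i\<in>C. v i * X (j, i)) - (\<Sum>i\<in>C. v i * X (k0, i)) / \<tau>) > 0} =
    measure Om {X. \<forall>j\<in>J. y j * (X (0, j) - X (0, k0) / \<tau>) > 0}"
proof -
  obtain T where T: "good C T" "\<And>j. j \<in> C - {c1} \<Longrightarrow> app C T v j = 0"
    using rotate_to_axis[of C c1 v] C by blast
  have iso: "isom C T" and mp: "mpres (act T C (insert k0 J))" using T(1) J by (auto simp: good_def)
  define t where "t = app C T v c1"
  have t: "t \<noteq> 0" using isom_nonzero[of C T c1 v, OF C(1) iso C(2,3)] T(2) by (auto simp: t_def)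
  define Q where "Q c X \<longleftrightarrow> (\<forall>j\<in>J. y j * (c * (X (c1, j) - X (c1, k0) / \<tau>)) > 0)" for c and X :: "nat \<times> nat \<Rightarrow> real"
  note [simp] = J
  have Qm: "Measurable.pred Om (Q c)" for c unfolding Q_def by measurable
  define F where "F = (\<lambda>X :: nat \<times> nat \<Rightarrow> real. act T C (insert k0 J) (\<lambda>p. X (prod.swap p)))"
  have F: "mpres F" unfolding F_def by (rule mpres_comp[OF mp mpres_transpose])
  have lin: "(\<Sum>i\<in>C. v i * X (j, i)) = t * F X (c1, j)" if "j \<in> insert k0 J" for X j
  proof -
    have "(\<Sum>i\<in>C. v i * X (j, i)) = ip C v (\<lambda>i. X (j, i))" by (simp add: ip_def)
    also have "\<dots> = ip C (app C T v) (app C T (\<lambda>i. X (j, i)))" using isom_ip[OF iso] by simp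
    also have "\<dots> = t * app C T (\<lambda>i. X (j, i)) c1" unfolding t_def
      by (rule ip_axis) (use C T in auto)
    also have "app C T (\<lambda>i. X (j, i)) c1 = F X (c1, j)" using that C(2) by (simp add: F_def act_def)
    finally show ?thesis .
  qed
  have "(\<forall>j\<in>J. y j * ((\<Sum>i\<in>C. v i * X (j, i)) - (\<Sum>i\<in>C. v i * X (k0, i)) / \<tau>) > 0) \<longleftrightarrow> Q t (F X)" for X
    by (simp add: lin Q_def right_diff_distrib)
  then have "measure Om {X. \<forall>j\<in>J. y j * ((\<Sum>i\<in>C. v i * X (j, i)) - (\<Sum>i\<in>C. v i * X (k0, i)) / \<tau>) > 0} =
      measure Om {X. Q t (F X)}" by simp
  also have "\<dots> = measure Om {X. Q t X}" by (rule mpres_prob[OF F Qm])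
  also have "\<dots> = measure Om {X. Q 1 X}"
  proof -
    have pos: "Q c = Q 1" if "c > 0" for c
    proof -
      have "y j * (c * r) > 0 \<longleftrightarrow> y j * (1 * r) > 0" for j r
        using that by (simp add: mult.left_commute[of "y j"] zero_less_mult_iff)
      then show ?thesis unfolding Q_def by auto
    qed
    show ?thesis
    proof (cases "t > 0")
      case False
      then have "- t > 0" using t by simp
      have "Q t X \<longleftrightarrow> Q (- t) (\<lambda>p. - X p)" for X by (simp add: Q_def algebra_simps)
      then have "measure Om {X. Q t X} = measure Om {X. Q (- t) (\<lambda>p. - X p)}" by simp
      also have "\<dots> = measure Om {X. Q (- t) X}" by (rule mpres_prob[OF mpres_uminus Qm])
      finally show ?thesis using pos[OF \<open>- t > 0\<close>] by simp
    next
      case True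
      from pos[OF this] show ?thesis by simp
    qed
  qed
  also have "\<dots> = measure Om {X. \<forall>j\<in>J. y j * (X (0, j) - X (0, k0) / \<tau>) > 0}"
  proof -
    have Qm0: "Measurable.pred Om (\<lambda>X. \<forall>j\<in>J. y j * (X (0, j) - X (0, k0) / \<tau>) > 0)" by measurable
    show ?thesis
      using mpres_prob[OF mpres_swap_rows[of 0 c1] Qm0] by (simp add: Q_def)
  qed
  finally show ?thesis .
qed

text \<open>The chance that the points in \<open>J\<close> lie on the correct sides of a hyperplane
  of fixed direction whose offset is a Gaussian \<open>\<xi>\<close> over \<open>\<tau>\<close>;
  given \<open>\<xi>\<close> the sides are independent.\<close>

definition offprob :: "nat set \<Rightarrow> (nat \<Rightarrow> real) \<Rightarrow> real \<Rightarrow> real" where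
  "offprob J y \<tau> = (\<integral>\<xi>. (\<Prod>j\<in>J. measure std_normal {..y j * \<xi> / \<tau>}) \<partial>std_normal)"

lemma std_normal_atom: "measure std_normal {t} = 0"
proof -
  have "emeasure std_normal {t} = 0"
    by (subst emeasure_density) (auto simp: nn_integral_0_iff_AE intro!: AE_I[where N="{t}"] simp: indicator_def)
  then show ?thesis by (simp add: measure_def)
qed

lemma std_normal_reflect:
  assumes [measurable]: "A \<in> sets borel"
  shows "measure std_normal (uminus -` A) = measure std_normal A"
proof -
  have "measure (distr std_normal std_normal uminus) A = measure std_normal (uminus -` A)"
    by (subst measure_distr) auto
  then show ?thesis unfolding std_normal_uminus by simp
qed

lemma std_normal_halfline:
  assumes "y = 1 \<or> y = (-1::real)"
  shows "measure std_normal {x. y * (x - t) > 0} = measure std_normal {..- y * t}"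
proof -
  have lt: "measure std_normal {..<s} = measure std_normal {..s}" for s
  proof -
    have "{..s} = {..<s} \<union> {s}" by auto
    then show ?thesis using std_normal.finite_measure_Union[of "{..<s}" "{s}"] std_normal_atom by simp
  qed
  show ?thesis
  proof (cases "y = 1")
    case True
    have "{x. y * (x - t) > 0} = uminus -` {..<- t}" using True by auto
    then show ?thesis using std_normal_reflect[of "{..<-t}"] lt True by simp
  next
    case False
    then have "y = -1" using assms by simp
    then have "{x. y * (x - t) > 0} = {..<t}" by auto
    then show ?thesis using lt \<open>y = -1\<close> by simp
  qed
qed

lemma integral_Om_component:
  fixes f :: "real \<Rightarrow> 'b :: {banach, second_countable_topology}"
  assumes [measurable]: "f \<in> borel_measurable borel"
  shows "(\<integral>X. f (X p) \<partial>Om) = (\<integral>x. f x \<partial>std_normal)"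
proof -
  have "distr Om std_normal (\<lambda>X. X p) = std_normal"
    unfolding Om_def by (rule distr_PiM_component) (simp_all add: prob_space_std_normal)
  moreover have "(\<integral>x. f x \<partial>distr Om std_normal (\<lambda>X. X p)) = (\<integral>X. f (X p) \<partial>Om)"
    by (rule integral_distr) auto
  ultimately show ?thesis by simp
qed

lemma measurable_std_normal_cdf: "(\<lambda>t. measure std_normal {..t}) \<in> borel_measurable borel"
proof (rule borel_measurable_mono)
  show "mono (\<lambda>t. measure std_normal {..t})"
    by (intro monoI std_normal.finite_measure_mono) auto
qed

lemma prob_off:
  assumes J: "finite J" "k0 \<notin> J" "\<And>j. j \<in> J \<Longrightarrow> y j \<in> {-1, 1}"
  shows "measure Om {X. \<forall>j\<in>J. y j * (X (0, j) - X (0, k0) / \<tau>) > 0} = offprob J y \<tau>"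
proof -
  note [simp] = J(1) and [measurable] = measurable_std_normal_cdf
  have Q: "Measurable.pred Om (\<lambda>X. \<forall>j\<in>J. y j * (X (0, j) - X (0, k0) / \<tau>) > 0)" by measurable
  have inner: "measure Om {x'. \<forall>j\<in>J. y j * (x' (0, j) - r) > 0} = (\<Prod>j\<in>J. measure std_normal {..- y j * r})" for r
  proof -
    have "emeasure Om {x'. \<forall>p\<in>Pair (0::nat) ` J. x' p \<in> {x. y (snd p) * (x - r) > 0}} =
        (\<Prod>p\<in>Pair (0::nat) ` J. emeasure std_normal {x. y (snd p) * (x - r) > 0})"
      using emeasure_Om_box[of "Pair (0::nat) ` J" "\<lambda>p. {x. y (snd p) * (x - r) > 0}"] by simp
    also have "\<dots> = (\<Prod>j\<in>J. emeasure std_normal {x. y j * (x - r) > 0})"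
      by (subst prod.reindex) (auto simp: inj_on_def)
    also have "\<dots> = (\<Prod>j\<in>J. ennreal (measure std_normal {..- y j * r}))"
      using J(3) by (intro prod.cong refl) (subst std_normal.emeasure_eq_measure, subst std_normal_halfline, auto)
    also have "\<dots> = ennreal (\<Prod>j\<in>J. measure std_normal {..- y j * r})" by (rule prod_ennreal) simp
    finally show ?thesis by (simp add: measure_def prod_nonneg)
  qed
  have "measure Om {X. \<forall>j\<in>J. y j * (X (0, j) - X (0, k0) / \<tau>) > 0} =
      (\<integral>x. measure Om {x'. \<forall>j\<in>J. y j * (x' (0, j) - x (0, k0) / \<tau>) > 0} \<partial>Om)"
  proof (subst prob_resample(1)[OF Q, where A="{(0, k0)}"], intro Bochner_Integration.integral_cong refl arg_cong[where f="measure Om"] Collect_cong ball_cong)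
    fix x x' j assume "j \<in> J"
    then have "j \<noteq> k0" using J(2) by auto
    then show "(y j * (override {(0, k0)} x x' (0, j) - override {(0, k0)} x x' (0, k0) / \<tau>) > 0) =
      (y j * (x' (0, j) - x (0, k0) / \<tau>) > 0)" by (simp add: override_def)
  qed
  also have "\<dots> = (\<integral>x. (\<Prod>j\<in>J. measure std_normal {..- y j * (x (0, k0) / \<tau>)}) \<partial>Om)"
    unfolding inner ..
  also have "\<dots> = (\<integral>x. (\<Prod>j\<in>J. measure std_normal {..- y j * (- x (0, k0) / \<tau>)}) \<partial>Om)"
    (is "integral\<^sup>L Om ?f = integral\<^sup>L Om ?g")
  proof -
    have F: "(\<lambda>X p. - X p) \<in> measurable Om Om" using mpres_uminus by (rule mpres_measurable)
    have "integral\<^sup>L (distr Om Om (\<lambda>X p. - X p)) ?f = (\<integral>x. ?f (\<lambda>p. - x p) \<partial>Om)"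
      by (rule integral_distr[OF F]) measurable
    then show ?thesis using mpres_uminus by (simp add: mpres_def)
  qed
  also have "\<dots> = (\<integral>x. (\<Prod>j\<in>J. measure std_normal {..y j * x (0, k0) / \<tau>}) \<partial>Om)" by simp
  also have "\<dots> = offprob J y \<tau>" unfolding offprob_def
    by (rule integral_Om_component[where f="\<lambda>\<xi>. (\<Prod>j\<in>J. measure std_normal {..y j * \<xi> / \<tau>})"]) measurable
  finally show ?thesis .
qed

lemma offprob_uminus: "offprob J y (- \<tau>) = offprob J y \<tau>"
proof -
  note [measurable] = measurable_std_normal_cdf
  have "integral\<^sup>L (distr std_normal std_normal uminus) (\<lambda>\<xi>. (\<Prod>j\<in>J. measure std_normal {..y j * \<xi> / \<tau>})) =
      (\<integral>\<xi>. (\<Prod>j\<in>J. measure std_normal {..y j * (- \<xi>) / \<tau>}) \<partial>std_normal)"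
    by (rule integral_distr) measurable
  then show ?thesis unfolding std_normal_uminus by (simp add: offprob_def)
qed

text \<open>The normalised solid angle of the cone cut out by the signs \<open>y\<close> in the
  hyperplane orthogonal to the vector of ones: subtracting the mean projects a Gaussian vector onto
  that hyperplane.\<close>

definition ang :: "nat set \<Rightarrow> (nat \<Rightarrow> real) \<Rightarrow> real" where
  "ang K y = measure Om {X. \<forall>j\<in>K. y j * (X (j, 0) - (\<Sum>k\<in>K. X (k, 0)) / real (card K)) > 0}"

text \<open>The square of \<open>\<tau>\<close> is the squared length of the vector of ones, and its
  sign stays open. Pairing the rotated vector of ones with rotated unit vectors forces all entries
  of row \<open>k0\<close> to be \<open>1 / \<tau>\<close>.\<close>

lemma frame:
  assumes K: "finite K" "k0 \<in> K"
  obtains T \<tau> where "good K T" "\<tau>\<^sup>2 = real (card K)" "\<tau> \<noteq> 0"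
    "\<And>j. j \<in> K \<Longrightarrow> T k0 j = 1 / \<tau>" "\<And>j. j \<in> K \<Longrightarrow> app K T (\<lambda>_. 1) j = (if j = k0 then \<tau> else 0)"
proof -
  obtain T where T: "good K T" "\<And>j. j \<in> K - {k0} \<Longrightarrow> app K T (\<lambda>_. 1) j = 0"
    using rotate_to_axis[of K k0 "\<lambda>_. 1"] K by blast
  have iso: "isom K T" using T by (simp add: good_def)
  define \<tau> where "\<tau> = app K T (\<lambda>_. 1) k0"
  have ax: "ip K (app K T (\<lambda>_. 1)) z = \<tau> * z k0" for z
    unfolding \<tau>_def by (rule ip_axis) (use K T in auto)
  have "\<tau>\<^sup>2 = ip K (app K T (\<lambda>_. 1)) (app K T (\<lambda>_. 1))" unfolding ax by (simp add: \<tau>_def power2_eq_square)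
  also have "\<dots> = real (card K)" unfolding isom_ip[OF iso] by (simp add: ip_def)
  finally have t2: "\<tau>\<^sup>2 = real (card K)" .
  then have t0: "\<tau> \<noteq> 0" using K by auto
  have "T k0 j = 1 / \<tau>" if "j \<in> K" for j
  proof -
    let ?e = "\<lambda>k. if k = j then 1 else 0 :: real"
    have "1 = ip K (\<lambda>_. 1) ?e" using ip_axis[of K j ?e "\<lambda>_. 1"] K that by (simp add: ip_commute)
    also have "\<dots> = ip K (app K T (\<lambda>_. 1)) (app K T ?e)" by (simp add: isom_ip[OF iso])
    also have "\<dots> = \<tau> * app K T ?e k0" by (rule ax)
    also have "app K T ?e k0 = T k0 j" using K that unfolding app_def by (subst sum.remove[of K j]) auto
    finally show ?thesis using t0 by (simp add: field_simps)
  qed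
  then show thesis using that[of T \<tau>] T t2 t0 by (auto simp: \<tau>_def)
qed

lemma ang_frame:
  assumes K: "finite K" "k0 \<in> K"
    and T: "good K T" "\<tau>\<^sup>2 = real (card K)" "\<tau> \<noteq> 0" "\<And>j. j \<in> K \<Longrightarrow> T k0 j = 1 / \<tau>"
    "\<And>j. j \<in> K \<Longrightarrow> app K T (\<lambda>_. 1) j = (if j = k0 then \<tau> else 0)"
  shows "measure Om {X. cone (K - {k0}) K (\<lambda>j k. y j * T k j) (\<lambda>k. X (k, z0))} = ang K y"
proof -
  note [simp] = K(1)
  have iso: "isom K T" and mp: "mpres (act T K {z0})" using T(1) by (auto simp: good_def)
  have Q: "Measurable.pred Om (\<lambda>X. cone (K - {k0}) K (\<lambda>j k. y j * T k j) (\<lambda>k. X (k, z0)))"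
    unfolding cone_def by measurable
  have eq: "cone (K - {k0}) K (\<lambda>j k. y j * T k j) (\<lambda>k. act T K {z0} X (k, z0)) \<longleftrightarrow>
      (\<forall>j\<in>K. y j * (X (j, z0) - (\<Sum>k\<in>K. X (k, z0)) / real (card K)) > 0)" for X
  proof -
    let ?x = "\<lambda>k. X (k, z0)"
    have "\<tau> * app K T ?x k0 = ip K (app K T (\<lambda>_. 1)) (app K T ?x)"
      using ip_axis[of K k0 "app K T (\<lambda>_. 1)" "app K T ?x"] K T(5) by simp
    also have "\<dots> = (\<Sum>k\<in>K. X (k, z0))" unfolding isom_ip[OF iso] by (simp add: ip_def)
    finally have s: "(\<Sum>k\<in>K. X (k, z0)) = \<tau> * app K T ?x k0" ..
    have "ip (K - {k0}) (\<lambda>k. y j * T k j) (\<lambda>k. act T K {z0} X (k, z0)) =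
        y j * (X (j, z0) - (\<Sum>k\<in>K. X (k, z0)) / real (card K))" if j: "j \<in> K" for j
    proof -
      have "X (j, z0) = app K (tr T) (app K T ?x) j" using isom_left_inverse[OF K(1) iso j] by simp
      also have "\<dots> = T k0 j * app K T ?x k0 + (\<Sum>k\<in>K - {k0}. T k j * app K T ?x k)"
        unfolding app_def[of K "tr T"] tr_def using K by (simp add: sum.remove[of K k0])
      also have "T k0 j * app K T ?x k0 = (\<Sum>k\<in>K. X (k, z0)) / real (card K)"
        unfolding s T(4)[OF j] T(2)[symmetric] using T(3) by (simp add: power2_eq_square)
      finally have "X (j, z0) - (\<Sum>k\<in>K. X (k, z0)) / real (card K) = (\<Sum>k\<in>K - {k0}. T k j * app K T ?x k)" by simp
      then show ?thesis by (simp add: ip_def act_def sum_distrib_left mult.assoc)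
    qed
    then show ?thesis by (simp add: cone_def)
  qed
  have Q': "Measurable.pred Om (\<lambda>X. \<forall>j\<in>K. y j * (X (j, z) - (\<Sum>k\<in>K. X (k, z)) / real (card K)) > 0)" for z
    by measurable
  have "measure Om {X. cone (K - {k0}) K (\<lambda>j k. y j * T k j) (\<lambda>k. X (k, z0))} =
     measure Om {X. \<forall>j\<in>K. y j * (X (j, z0) - (\<Sum>k\<in>K. X (k, z0)) / real (card K)) > 0}"
    unfolding mpres_prob[OF mp Q, symmetric] eq ..
  also have "\<dots> = ang K y"
  proof -
    show ?thesis unfolding ang_def
      using mpres_prob[OF mpres_swap_columns[of z0 0] Q'[of z0]] by simp
  qed
  finally show ?thesis .
qed

subsection \<open>Probability of a certificate\<close>

lemma measurable_cone [measurable (raw)]: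
  assumes [measurable]: "\<And>k. (\<lambda>w. v w k) \<in> borel_measurable M" and "finite J"
  shows "Measurable.pred M (\<lambda>w. cone I J h (v w))"
  unfolding cone_def using assms(2) by measurable

lemma ip_uminus: "ip I h (\<lambda>k. - v k) = - ip I h v" "ip I (\<lambda>k. - v k) h = - ip I v h"
  by (simp_all add: ip_def sum_negf)

lemma cone_exclusive: "J \<noteq> {} \<Longrightarrow> cone I J h v \<Longrightarrow> cone I J h (\<lambda>k. - v k) \<Longrightarrow> False"
  unfolding cone_def ip_uminus by (metis all_not_in_conv neg_0_less_iff_less order_less_asym)

text \<open>Column \<open>j\<close> of an isometry has length 1, but its entry at \<open>k0\<close>
  has square \<open>1 / card K\<close>, less than 1 as soon as there are two points; so another
  entry is nonzero.\<close>

lemma frame_forms_nonzero: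
  assumes K: "finite K" "k0 \<in> K" "j \<in> K" "isom K T" and c: "card K \<ge> 2" "(T k0 j)\<^sup>2 = 1 / real (card K)"
  shows "\<exists>k\<in>K - {k0}. T k j \<noteq> 0"
proof (rule ccontr)
  assume "\<not> ?thesis"
  then have z: "\<And>k. k \<in> K - {k0} \<Longrightarrow> T k j = 0" by blast
  let ?e = "\<lambda>k. if k = j then 1 else 0 :: real"
  have a: "app K T ?e k = T k j" for k using K unfolding app_def by (subst sum.remove[of K j]) auto
  have "ip K (app K T ?e) (app K T ?e) = T k0 j * T k0 j"
    using ip_axis[of K k0 "app K T ?e" "app K T ?e"] K z by (simp add: a)
  moreover have "ip K (app K T ?e) (app K T ?e) = ip K ?e ?e" using K by (simp add: isom_def)
  moreover have "ip K ?e ?e = 1" using ip_axis[of K j ?e ?e] K by simp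
  ultimately show False using c by (simp add: power2_eq_square)
qed

text \<open>Only the orientation with negative pairing with column \<open>l\<close> is admissible.
  Reversing the sign of that column exchanges the two orientations, so the event has half the
  probability of the double cone. A single cone has half the probability of the double cone for a
  Gaussian vector as well, and the uniform kernel direction connects the two.\<close>

lemma prob_half_cone:
  assumes I: "finite I" "card I = Suc l"
    and a: "\<And>X. kernelvec I {..<l} X (a X)" "\<And>X. \<exists>k\<in>I. a X k \<noteq> 0" "\<And>k. (\<lambda>X. a X k) \<in> borel_measurable Om"
      "\<And>X Y. (\<And>k c. k \<in> I \<Longrightarrow> c < l \<Longrightarrow> X (k, c) = Y (k, c)) \<Longrightarrow> a X = a Y"
    and J: "finite J" "J \<noteq> {}" "\<And>j. j \<in> J \<Longrightarrow> \<exists>k\<in>I. h j k \<noteq> 0"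
  shows "measure Om {X. (cone I J h (a X) \<and> ip I (a X) (\<lambda>k. X (k, l)) < 0) \<or>
      (cone I J h (\<lambda>k. - a X k) \<and> ip I (a X) (\<lambda>k. X (k, l)) > 0)} =
    measure Om {X. cone I J h (\<lambda>k. X (k, l))}"
proof -
  note [simp] = J(1) and [measurable] = a(3)
  define D where "D s X \<longleftrightarrow> (cone I J h (a X) \<and> s * ip I (a X) (\<lambda>k. X (k, l)) < 0) \<or>
      (cone I J h (\<lambda>k. - a X k) \<and> s * ip I (a X) (\<lambda>k. X (k, l)) > 0)" for s :: real and X
  have Dm: "Measurable.pred Om (D s)" for s unfolding D_def by measurable
  have Ds: "{X. D s X} \<in> sets Om" for s using Dm[of s] by (simp add: pred_def)
  define F where "F = (\<lambda>(X :: nat \<times> nat \<Rightarrow> real) p. (if snd p = l then - 1 else 1) * X p)"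
  have F: "mpres F" unfolding F_def by (rule mpres_signs) auto
  have aF: "a (F X) = a X" for X by (rule a(4)) (simp add: F_def)
  have "ip I (a (F X)) (\<lambda>k. F X (k, l)) = - ip I (a X) (\<lambda>k. X (k, l))" for X
    unfolding aF ip_uminus(1)[symmetric] by (simp add: F_def)
  then have "D 1 (F X) = D (- 1) X" for X by (simp add: D_def aF)
  then have eq: "measure Om {X. D (- 1) X} = measure Om {X. D 1 X}"
    using mpres_prob[OF F Dm[of 1]] by simp
  have nz: "AE X in Om. ip I (a X) (\<lambda>k. X (k, l)) \<noteq> 0"
  proof -
    have "AE X in Om. nonsing I {..l} (\<lambda>k c. X (k, c))" by (rule AE_nonsing) (use I in auto)
    then show ?thesis
    proof eventually_elim
      case (elim X)
      have t: "nonsing {..l} I (\<lambda>c k. X (k, c))" using nonsing_transpose[OF _ _ _ elim] I by simp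
      show ?case
      proof
        assume 0: "ip I (a X) (\<lambda>k. X (k, l)) = 0"
        have "(\<Sum>k\<in>I. a X k * X (k, c)) = 0" if "c \<in> {..l}" for c
          using 0 a(1)[of X] that by (cases "c = l") (auto simp: kernelvec_def ip_def)
        then have "\<forall>k\<in>I. a X k = 0" using t unfolding nonsing_def by blast
        then show False using a(2)[of X] by blast
      qed
    qed
  qed
  have ex: "\<not> (cone I J h v \<and> cone I J h (\<lambda>k. - v k))" for v
    using cone_exclusive[OF J(2), of I h v] by blast
  have "measure Om {X. dcone I J h (a X)} = measure Om ({X. D 1 X} \<union> {X. D (- 1) X})"
  proof (rule Om.finite_measure_eq_AE)
    show "AE x in Om. (x \<in> {X. dcone I J h (a X)}) = (x \<in> {X. D 1 X} \<union> {X. D (- 1) X})"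
      using nz by eventually_elim (auto simp: dcone_def D_def)
    have "Measurable.pred Om (\<lambda>X. dcone I J h (a X))" by measurable
    then show "{X. dcone I J h (a X)} \<in> sets Om" by (simp add: pred_def)
  qed (use Ds in auto)
  also have "\<dots> = measure Om {X. D 1 X} + measure Om {X. D (- 1) X}"
    by (intro Om.finite_measure_Union Ds) (use ex in \<open>auto simp: D_def\<close>)
  finally have 1: "measure Om {X. dcone I J h (a X)} = 2 * measure Om {X. D 1 X}" using eq by simp
  have Cm: "Measurable.pred Om (\<lambda>X. cone I J h (\<lambda>k. X (k, l)))" "Measurable.pred Om (\<lambda>X. cone I J h (\<lambda>k. - X (k, l)))" by measurable
  have "{X. dcone I J h (\<lambda>k. X (k, l))} = {X. cone I J h (\<lambda>k. X (k, l))} \<union> {X. cone I J h (\<lambda>k. - X (k, l))}"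
    by (auto simp: dcone_def)
  then have "measure Om {X. dcone I J h (\<lambda>k. X (k, l))} = measure Om {X. cone I J h (\<lambda>k. X (k, l))} + measure Om {X. cone I J h (\<lambda>k. - X (k, l))}"
  proof (simp only:, intro Om.finite_measure_Union)
    show "{X. cone I J h (\<lambda>k. X (k, l))} \<inter> {X. cone I J h (\<lambda>k. - X (k, l))} = {}"
      using ex by blast
  qed (use Cm in \<open>simp_all add: pred_def\<close>)
  also have "measure Om {X. cone I J h (\<lambda>k. - X (k, l))} = measure Om {X. cone I J h (\<lambda>k. X (k, l))}"
    by (rule mpres_prob[OF mpres_uminus Cm(1)])
  finally have 2: "measure Om {X. dcone I J h (\<lambda>k. X (k, l))} = 2 * measure Om {X. cone I J h (\<lambda>k. X (k, l))}" by simp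
  have "measure Om {X. dcone I J h (a X)} = measure Om {X. dcone I J h (\<lambda>k. X (k, l))}"
  proof (rule prob_dcone_kernel[where C="{..<l}", OF I(1) _ _ _ a(1-3) _ J])
    show "a X = a Y" if "\<And>k c. k \<in> I \<Longrightarrow> c \<in> {..<l} \<Longrightarrow> X (k, c) = Y (k, c)" for X Y
      by (rule a(4)) (use that in simp)
  qed (use I in simp_all)
  with 1 2 show ?thesis by (simp add: D_def)
qed

text \<open>The certificate is defined by quantifiers over real vectors; \<open>E\<close> is a
  measurable event that agrees with it almost surely. After the rotation, freezing the rows
  \<open>I = K - {k0}\<close> decides the dual half, and the conditional probability of the primal
  half is almost surely constant.\<close>

lemma prob_certificate:
  assumes S: "finite S" "K \<subseteq> S" "card K = l + 2" "\<And>j. j \<in> S \<Longrightarrow> y j \<in> {-1, 1}"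
  shows "\<exists>E. Measurable.pred Om E \<and>
    (AE X in Om. E X \<longleftrightarrow> dualcert K y l X \<and> supporting S K y (l + 2) X) \<and>
    measure Om {X. E X} = ang K y * offprob (S - K) y (sqrt (real (l + 2)))"
proof -
  note sum.lessThan_Suc [simp del]
  have fK: "finite K" using S finite_subset by blast
  have K0: "K \<noteq> {}" using S by auto
  then obtain k0 where k0: "k0 \<in> K" by blast
  obtain T \<tau> where T: "good K T" "\<tau>\<^sup>2 = real (card K)" "\<tau> \<noteq> 0"
    "\<And>j. j \<in> K \<Longrightarrow> T k0 j = 1 / \<tau>" "\<And>j. j \<in> K \<Longrightarrow> app K T (\<lambda>_. 1) j = (if j = k0 then \<tau> else 0)"
    by (rule frame[OF fK k0], rule that)
  have iso: "isom K T" and iso': "isom K (tr T)" and mp: "mpres (act T K {..<l+2})" using T(1) by (auto simp: good_def)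
  define I where "I = K - {k0}"
  have I: "finite I" "card I = Suc l" "k0 \<notin> I" using fK k0 S(3) by (auto simp: I_def)
  define h where "h j k = y j * T k j" for j k
  have yy: "y j * y j = 1" if "j \<in> K" for j using S(2,4) that by fastforce
  have hnz: "\<exists>k\<in>I. h j k \<noteq> 0" if "j \<in> K" for j
    using frame_forms_nonzero[OF fK k0 that iso] S(3) T(2) T(4)[OF that] yy[OF that]
    by (auto simp: I_def h_def power_divide)
  have "card {..<l} < card I" "card I < card {..<l+2}" using I by auto
  obtain s where s: "\<And>c. s c \<in> borel_measurable Om" "\<And>X. \<exists>c\<in>I. s c X \<noteq> 0"
    "\<And>X i. i \<in> {..<l} \<Longrightarrow> (\<Sum>c\<in>I. s c X * X (c, i)) = 0"
    "\<And>X Y c. (\<forall>i\<in>{..<l}. \<forall>c\<in>I. X (c, i) = Y (c, i)) \<Longrightarrow> s c X = s c Y"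
    by (rule kernel_selection[OF _ I(1) \<open>card {..<l} < card I\<close>, of "\<lambda>i c. (c, i)"], simp, rule that)
  obtain v where v: "\<And>c. v c \<in> borel_measurable Om" "\<And>X. \<exists>c\<in>{..<l+2}. v c X \<noteq> 0"
    "\<And>X i. i \<in> I \<Longrightarrow> (\<Sum>c\<in>{..<l+2}. v c X * X (i, c)) = 0"
    "\<And>X Y c. (\<forall>i\<in>I. \<forall>c\<in>{..<l+2}. X (i, c) = Y (i, c)) \<Longrightarrow> v c X = v c Y"
    by (rule kernel_selection[OF I(1) _ \<open>card I < card {..<l+2}\<close>, of "\<lambda>i c. (i, c)"], simp, rule that)
  note [measurable] = s(1) v(1)
  have [simp]: "finite K" "finite (S - K)" using fK S by auto
  define a where "a X = (\<lambda>k. s k X)" for X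
  have a: "kernelvec I {..<l} X (a X)" "\<exists>k\<in>I. a X k \<noteq> 0" for X
    using s(2,3) by (auto simp: kernelvec_def ip_def a_def)
  have am: "(\<lambda>X. a X k) \<in> borel_measurable Om" for k using s(1)[of k] by (simp add: a_def)
  note [measurable] = am
  have ad: "a X = a Y" if "\<And>k c. k \<in> I \<Longrightarrow> c < l \<Longrightarrow> X (k, c) = Y (k, c)" for X Y
    unfolding a_def using that by (intro ext s(4)) auto
  \<comment> \<open>\<open>a\<close> is a kernel vector of the first \<open>l\<close> columns on the
    rows \<open>I\<close>. The two alternatives are its two orientations; an admissible one yields
    correctly signed multipliers and a negative pairing with column \<open>l\<close>.\<close>
  define D where "D X \<longleftrightarrow> (cone I K h (a X) \<and> ip I (a X) (\<lambda>k. X (k, l)) < 0) \<or>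
      (cone I K h (\<lambda>k. - a X k) \<and> ip I (a X) (\<lambda>k. X (k, l)) > 0)" for X
  \<comment> \<open>\<open>v\<close> gives the slopes of the hyperplane through the points of
    \<open>K\<close>. Normalising its last entry to 1 would mean dividing by
    \<open>v (l+1) X\<close>; multiplying by it instead changes the form only by the positive factor
    \<open>(v (l+1) X)^2\<close>.\<close>
  define H where "H X \<longleftrightarrow> v (l+1) X \<noteq> 0 \<and> (\<forall>j\<in>S - K. y j * ((\<Sum>i\<in>{..<l+2}. v (l+1) X * v i X * X (j, i)) -
      (\<Sum>i\<in>{..<l+2}. v (l+1) X * v i X * X (k0, i)) / \<tau>) > 0)" for X
  have Dm: "Measurable.pred Om D" unfolding D_def by measurable
  have Hm: "Measurable.pred Om H" unfolding H_def by measurable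
  let ?F = "act T K {..<l+2}"
  define E where "E X \<longleftrightarrow> D (?F X) \<and> H (?F X)" for X
  note [measurable] = Dm Hm mpres_measurable[OF mp]
  have Em: "Measurable.pred Om E" unfolding E_def by measurable
  \<comment> \<open>Once the first \<open>l + 1\<close> columns are nonsingular on \<open>I\<close>,
    a kernel vector is determined by its last entry. This makes the normalised slopes
    unique.\<close>
  have vnz: "v (l+1) X \<noteq> 0" and vun: "\<And>w. (\<forall>k\<in>I. (\<Sum>i\<in>{..<l+2}. w i * X (k, i)) = 0) \<Longrightarrow> w (l+1) = 1 \<Longrightarrow> \<forall>i<l+2. w i = v i X / v (l+1) X"
    if ns: "nonsing I {..l} (\<lambda>k c. X (k, c))" for X
  proof -
    have z: "\<forall>i<l+2. w i = 0" if "w (l+1) = 0" "\<forall>k\<in>I. (\<Sum>i\<in>{..<l+2}. w i * X (k, i)) = 0" for w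
    proof -
      have "{..<l+2} = insert (l+1) {..l}" by auto
      then have "\<forall>k\<in>I. (\<Sum>i\<in>{..l}. w i * X (k, i)) = 0" using that by simp
      then have "\<forall>i\<in>{..l}. w i = 0" using ns unfolding nonsing_def by blast
      then show ?thesis using that(1) by (auto simp: less_Suc_eq_le le_Suc_eq)
    qed
    show nz: "v (l+1) X \<noteq> 0"
    proof
      assume 0: "v (l+1) X = 0"
      have "\<forall>i<l+2. v i X = 0"
        by (rule z[of "\<lambda>i. v i X"]) (rule 0, rule ballI, rule v(3))
      then show False using v(2)[of X] by blast
    qed
    fix w assume w: "\<forall>k\<in>I. (\<Sum>i\<in>{..<l+2}. w i * X (k, i)) = 0" "w (l+1) = 1"
    define d where "d i = w i - v i X / v (l+1) X" for i
    have "d (l+1) = 0" using w nz by (simp add: d_def)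
    moreover have "\<forall>k\<in>I. (\<Sum>i\<in>{..<l+2}. d i * X (k, i)) = 0"
    proof
      fix k assume "k \<in> I"
      have "(\<Sum>i\<in>{..<l+2}. d i * X (k, i)) = (\<Sum>i\<in>{..<l+2}. w i * X (k, i)) - (\<Sum>i\<in>{..<l+2}. v i X * X (k, i)) / v (l+1) X"
        by (simp add: d_def left_diff_distrib sum_subtractf sum_divide_distrib)
      then show "(\<Sum>i\<in>{..<l+2}. d i * X (k, i)) = 0" using w \<open>k \<in> I\<close> v(3)[OF \<open>k \<in> I\<close>, of X] by simp
    qed
    ultimately have "\<forall>i<l+2. d i = 0" by (rule z)
    then show "\<forall>i<l+2. w i = v i X / v (l+1) X" by (simp add: d_def)
  qed
  obtain k1 where k1: "k1 \<in> I" using I by fastforce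
  have ipI: "ip K \<gamma> z = ip I \<gamma> z" if "\<gamma> k0 = 0" for \<gamma> z
    using that k0 fK unfolding ip_def I_def by (subst sum.remove[of K k0]) auto
  have Fc: "?F X (k, i) = app K T (\<lambda>k. X (k, i)) k" if "k \<in> K" "i < l + 2" for X k i
    using that by (simp add: act_def)
  \<comment> \<open>Multipliers \<open>\<alpha>\<close> correspond to
    \<open>\<gamma> = app K T \<alpha>\<close>. The intercept equation becomes
    \<open>\<gamma> k0 = 0\<close>, the next \<open>l\<close> equations put \<open>\<gamma>\<close>
    into the kernel on \<open>I\<close>, and the transpose of \<open>T\<close> turns the sign
    conditions into the cone of \<open>h\<close>.\<close>
  have dual: "dualcert K y l X \<longleftrightarrow> D (?F X)" if rig: "rigid I {..<l} k1 (?F X)" for X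
  proof -
    have r0: "(\<Sum>j\<in>K. \<alpha> j * row X j 0) = \<tau> * app K T \<alpha> k0" for \<alpha>
    proof -
      have "(\<Sum>j\<in>K. \<alpha> j * row X j 0) = ip K (\<lambda>_. 1) \<alpha>" by (simp add: ip_def row_def)
      also have "\<dots> = ip K (app K T (\<lambda>_. 1)) (app K T \<alpha>)" by (simp add: isom_ip[OF iso])
      also have "\<dots> = \<tau> * app K T \<alpha> k0" using ip_axis[of K k0 "app K T (\<lambda>_. 1)" "app K T \<alpha>"] k0 T(5) by simp
      finally show ?thesis .
    qed
    have rS: "(\<Sum>j\<in>K. \<alpha> j * row X j (Suc i)) = ip K (app K T \<alpha>) (\<lambda>k. ?F X (k, i))" if "i < l + 2" for \<alpha> i
    proof -
      have "(\<Sum>j\<in>K. \<alpha> j * row X j (Suc i)) = ip K \<alpha> (\<lambda>k. X (k, i))" by (simp add: ip_def row_def)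
      also have "\<dots> = ip K (app K T \<alpha>) (app K T (\<lambda>k. X (k, i)))" by (simp add: isom_ip[OF iso])
      also have "\<dots> = ip K (app K T \<alpha>) (\<lambda>k. ?F X (k, i))" by (rule ip_cong) (use that Fc in auto)
      finally show ?thesis .
    qed
    have form: "y j * app K (tr T) \<gamma> j = ip I (h j) \<gamma>" if "\<gamma> k0 = 0" for \<gamma> j
    proof -
      have "y j * app K (tr T) \<gamma> j = ip K \<gamma> (h j)"
        by (simp add: app_def tr_def ip_def h_def sum_distrib_left mult_ac)
      also have "\<dots> = ip I (h j) \<gamma>" unfolding ipI[of \<gamma>, OF that] by (rule ip_commute)
      finally show ?thesis .
    qed
    show ?thesis
    proof
      assume "dualcert K y l X"
      then obtain \<alpha> where \<alpha>: "\<And>j. j \<in> K \<Longrightarrow> y j * \<alpha> j > 0" "\<And>c. c \<le> l \<Longrightarrow> (\<Sum>j\<in>K. \<alpha> j * row X j c) = 0"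
        "(\<Sum>j\<in>K. \<alpha> j * row X j (Suc l)) < 0" unfolding dualcert_def by blast
      define \<gamma> where "\<gamma> = app K T \<alpha>"
      have g0: "\<gamma> k0 = 0" using r0[of \<alpha>] \<alpha>(2)[of 0] T(3) by (simp add: \<gamma>_def)
      have ker: "kernelvec I {..<l} (?F X) \<gamma>"
        unfolding kernelvec_def
      proof
        fix i assume "i \<in> {..<l}"
        then have "ip K \<gamma> (\<lambda>k. ?F X (k, i)) = 0" using rS[of i \<alpha>] \<alpha>(2)[of "Suc i"] by (simp add: \<gamma>_def)
        then show "ip I \<gamma> (\<lambda>k. ?F X (k, i)) = 0" unfolding ipI[of \<gamma>, OF g0] .
      qed
      obtain k where k: "k \<in> I" "a (?F X) k \<noteq> 0" using a(2) by blast
      define lam where "lam = \<gamma> k1 / a (?F X) k1"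
      have g: "\<forall>k\<in>I. \<gamma> k = lam * a (?F X) k" unfolding lam_def
        by (rule rigid_unique[OF rig a(1) ker k])
      have fr: "y j * \<alpha> j = lam * ip I (h j) (a (?F X))" if "j \<in> K" for j
      proof -
        have "y j * \<alpha> j = y j * app K (tr T) \<gamma> j" using isom_left_inverse[OF fK iso that] by (simp add: \<gamma>_def)
        also have "\<dots> = ip I (h j) \<gamma>" by (rule form[of \<gamma>, OF g0])
        also have "\<dots> = ip I (h j) (\<lambda>k. lam * a (?F X) k)" by (rule ip_cong) (use g in auto)
        finally show ?thesis by (simp add: ip_scale)
      qed
      have "ip I \<gamma> (\<lambda>k. ?F X (k, l)) < 0" using rS[of l \<alpha>] \<alpha>(3) ipI[of \<gamma>, OF g0] by (simp add: \<gamma>_def)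
      moreover have "ip I \<gamma> (\<lambda>k. ?F X (k, l)) = ip I (\<lambda>k. lam * a (?F X) k) (\<lambda>k. ?F X (k, l))"
        by (rule ip_cong) (use g in auto)
      ultimately have sl: "lam * ip I (a (?F X)) (\<lambda>k. ?F X (k, l)) < 0" by (simp add: ip_scale)
      show "D (?F X)"
      proof (cases "lam > 0")
        case True
        have "ip I (h j) (a (?F X)) > 0" if "j \<in> K" for j
          using fr[OF that] \<alpha>(1)[OF that] True by (simp add: zero_less_mult_iff)
        then show ?thesis using sl True by (auto simp: D_def cone_def mult_less_0_iff)
      next
        case False
        then have "lam < 0" using sl by (cases "lam = 0") auto
        have "ip I (h j) (a (?F X)) < 0" if "j \<in> K" for j
          using fr[OF that] \<alpha>(1)[OF that] \<open>lam < 0\<close> by (simp add: zero_less_mult_iff)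
        then show ?thesis using sl \<open>lam < 0\<close> by (auto simp: D_def cone_def ip_uminus mult_less_0_iff)
      qed
    next
      assume "D (?F X)"
      then obtain \<sigma> :: real where sg: "cone I K h (\<lambda>k. \<sigma> * a (?F X) k)" "\<sigma> * ip I (a (?F X)) (\<lambda>k. ?F X (k, l)) < 0"
        unfolding D_def
      proof (elim disjE conjE)
        assume "cone I K h (a (?F X))" "ip I (a (?F X)) (\<lambda>k. ?F X (k, l)) < 0"
        then show thesis using that[of 1] by simp
      next
        assume "cone I K h (\<lambda>k. - a (?F X) k)" "ip I (a (?F X)) (\<lambda>k. ?F X (k, l)) > 0"
        then show thesis using that[of "-1"] by simp
      qed
      define \<gamma> where "\<gamma> k = (if k = k0 then 0 else \<sigma> * a (?F X) k)" for k
      have g0: "\<gamma> k0 = 0" by (simp add: \<gamma>_def)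
      have gI: "\<gamma> k = \<sigma> * a (?F X) k" if "k \<in> I" for k using that I(3) by (auto simp: \<gamma>_def)
      define \<alpha> where "\<alpha> = app K (tr T) \<gamma>"
      have ta: "app K T \<alpha> k = \<gamma> k" if "k \<in> K" for k
        using isom_left_inverse[OF fK iso' that, of \<gamma>] by (simp add: \<alpha>_def tr_tr)
      have tip: "ip K (app K T \<alpha>) z = ip I (\<lambda>k. \<sigma> * a (?F X) k) z" for z
      proof -
        have "ip K (app K T \<alpha>) z = ip K \<gamma> z" by (rule ip_cong) (use ta in auto)
        also have "\<dots> = ip I \<gamma> z" by (rule ipI[of \<gamma>, OF g0])
        also have "\<dots> = ip I (\<lambda>k. \<sigma> * a (?F X) k) z" by (rule ip_cong) (use gI in auto)
        finally show ?thesis .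
      qed
      show "dualcert K y l X"
        unfolding dualcert_def
      proof (intro exI[of _ \<alpha>] conjI ballI allI impI)
        fix j assume "j \<in> K"
        have "y j * \<alpha> j = ip I (h j) \<gamma>" unfolding \<alpha>_def by (rule form[of \<gamma>, OF g0])
        also have "\<dots> = ip I (h j) (\<lambda>k. \<sigma> * a (?F X) k)" by (rule ip_cong) (use gI in auto)
        also have "\<dots> > 0" using sg(1) \<open>j \<in> K\<close> by (simp add: cone_def)
        finally show "y j * \<alpha> j > 0" .
      next
        fix c assume "c \<le> l"
        show "(\<Sum>j\<in>K. \<alpha> j * row X j c) = 0"
        proof (cases c)
          case 0
          then show ?thesis using r0[of \<alpha>] ta[OF k0] g0 by simp
        next
          case (Suc i)
          then show ?thesis using rS[of i \<alpha>] tip \<open>c \<le> l\<close> a(1)[of "?F X"] by (simp add: ip_scale kernelvec_def)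
        qed
      next
        show "(\<Sum>j\<in>K. \<alpha> j * row X j (Suc l)) < 0"
          using rS[of l \<alpha>] tip sg(2) by (simp add: ip_scale)
      qed
    qed
  qed
  \<comment> \<open>A function that vanishes on \<open>K\<close> has vanishing rotated values. In
    the rows \<open>I\<close> the intercept is absent, so the slopes form a kernel vector; row
    \<open>k0\<close> then fixes the intercept, as in \<open>\<beta>\<^sub>0\<close>.\<close>
  have supp: "supporting S K y (l + 2) X \<longleftrightarrow> H (?F X)" if ns: "nonsing I {..l} (\<lambda>k c. ?F X (k, c))" for X
  proof -
    have affs: "aff X (l+2) \<beta> j = \<beta> 0 + (\<Sum>i\<in>{..<l+2}. \<beta> (Suc i) * X (j, i))" for \<beta> j
      unfolding aff_def by (subst sum.atMost_shift) (simp add: row_def)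
    have Taff: "app K T (aff X (l+2) \<beta>) k = (if k = k0 then \<tau> * \<beta> 0 else 0) + (\<Sum>i\<in>{..<l+2}. \<beta> (Suc i) * ?F X (k, i))"
      if "k \<in> K" for \<beta> k
    proof -
      have "app K T (aff X (l+2) \<beta>) k = \<beta> 0 * app K T (\<lambda>_. 1) k + (\<Sum>i\<in>{..<l+2}. \<beta> (Suc i) * app K T (\<lambda>k. X (k, i)) k)"
        unfolding app_def affs by (simp add: distrib_left sum.distrib sum_distrib_left mult_ac) (subst sum.swap, simp add: mult_ac)
      then show ?thesis using that T(5)[OF that] Fc[OF that] by simp
    qed
    have off: "?F X (j, i) = X (j, i)" if "j \<in> S - K" for j i using that by (simp add: act_def)
    let ?v = "\<lambda>i. v i (?F X)"
    have vnz': "?v (l+1) \<noteq> 0" by (rule vnz[OF ns])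
    define \<beta>\<^sub>0 where "\<beta>\<^sub>0 = (\<lambda>c. case c of 0 \<Rightarrow> - (\<Sum>i\<in>{..<l+2}. ?v i / ?v (l+1) * ?F X (k0, i)) / \<tau> | Suc i \<Rightarrow> ?v i / ?v (l+1))"
    have val: "y j * aff X (l+2) \<beta>\<^sub>0 j > 0 \<longleftrightarrow>
      y j * ((\<Sum>i\<in>{..<l+2}. ?v (l+1) * ?v i * ?F X (j, i)) - (\<Sum>i\<in>{..<l+2}. ?v (l+1) * ?v i * ?F X (k0, i)) / \<tau>) > 0"
      if "j \<in> S - K" for j
    proof -
      have s1: "(\<Sum>i\<in>{..<l+2}. ?v i / ?v (l+1) * Z i) = (\<Sum>i\<in>{..<l+2}. ?v i * Z i) / ?v (l+1)" for Z
        by (simp add: sum_divide_distrib)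
      have s2: "(\<Sum>i\<in>{..<l+2}. ?v (l+1) * ?v i * Z i) = ?v (l+1) * (\<Sum>i\<in>{..<l+2}. ?v i * Z i)" for Z
        by (simp add: sum_distrib_left mult.assoc)
      have aff0: "aff X (l+2) \<beta>\<^sub>0 j = - ((\<Sum>i\<in>{..<l+2}. ?v i * ?F X (k0, i)) / ?v (l+1)) / \<tau>
          + (\<Sum>i\<in>{..<l+2}. ?v i * X (j, i)) / ?v (l+1)"
        unfolding affs s1[symmetric] by (simp only: \<beta>\<^sub>0_def nat.case)
      define c where "c = ?v (l+1) * ?v (l+1)"
      define B where "B = (\<Sum>i\<in>{..<l+2}. ?v (l+1) * ?v i * ?F X (j, i)) - (\<Sum>i\<in>{..<l+2}. ?v (l+1) * ?v i * ?F X (k0, i)) / \<tau>"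
      have cp: "c > 0" unfolding c_def using vnz' not_real_square_gt_zero by blast
      have "B = c * aff X (l+2) \<beta>\<^sub>0 j"
        unfolding aff0 B_def s2 c_def off[OF that] using vnz' by (simp add: right_diff_distrib distrib_left)
      then have eq: "y j * B = c * (y j * aff X (l+2) \<beta>\<^sub>0 j)" by simp
      show ?thesis unfolding B_def[symmetric] eq using cp by (simp only: zero_less_mult_iff[of c]) auto
    qed
    show ?thesis
    proof
      assume "supporting S K y (l + 2) X"
      then obtain \<beta> where b: "\<beta> (l+2) = 1" "\<And>j. j \<in> K \<Longrightarrow> aff X (l+2) \<beta> j = 0" "\<And>j. j \<in> S - K \<Longrightarrow> y j * aff X (l+2) \<beta> j > 0"
        unfolding supporting_def by blast
      have T0: "app K T (aff X (l+2) \<beta>) k = 0" for k using b(2) by (simp add: app_def)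
      have "(\<Sum>i\<in>{..<l+2}. \<beta> (Suc i) * ?F X (k, i)) = 0" if "k \<in> I" for k
        using Taff[of k \<beta>] T0 that I(3) by (auto simp: I_def)
      then have bv: "\<forall>i<l+2. \<beta> (Suc i) = ?v i / ?v (l+1)"
        using b(1) by (intro vun[OF ns]) auto
      have "\<beta> 0 = \<beta>\<^sub>0 0"
      proof -
        have "\<tau> * \<beta> 0 + (\<Sum>i\<in>{..<l+2}. \<beta> (Suc i) * ?F X (k0, i)) = 0" using Taff[OF k0, of \<beta>] T0 by simp
        moreover have "(\<Sum>i\<in>{..<l+2}. \<beta> (Suc i) * ?F X (k0, i)) = (\<Sum>i\<in>{..<l+2}. ?v i / ?v (l+1) * ?F X (k0, i))"
          by (rule sum.cong) (use bv in auto)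
        ultimately have "\<tau> * \<beta> 0 = - (\<Sum>i\<in>{..<l+2}. ?v i / ?v (l+1) * ?F X (k0, i))" by linarith
        then have "\<tau> * \<beta> 0 / \<tau> = - (\<Sum>i\<in>{..<l+2}. ?v i / ?v (l+1) * ?F X (k0, i)) / \<tau>" by (simp only:)
        then show ?thesis using T(3) by (simp add: \<beta>\<^sub>0_def)
      qed
      then have "aff X (l+2) \<beta> j = aff X (l+2) \<beta>\<^sub>0 j" for j
        unfolding affs using bv by (auto simp: \<beta>\<^sub>0_def intro!: sum.cong)
      then show "H (?F X)" using b(3) vnz' val unfolding H_def by simp
    next
      assume H: "H (?F X)"
      show "supporting S K y (l + 2) X"
        unfolding supporting_def
      proof (intro exI[of _ \<beta>\<^sub>0] conjI ballI)
        show "\<beta>\<^sub>0 (l+2) = 1" using vnz' by (simp add: \<beta>\<^sub>0_def)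
        show "aff X (l+2) \<beta>\<^sub>0 j = 0" if "j \<in> K" for j
        proof -
          have "app K T (aff X (l+2) \<beta>\<^sub>0) k = 0" if "k \<in> K" for k
          proof (cases "k = k0")
            case True
            then show ?thesis using Taff[OF k0, of \<beta>\<^sub>0] T(3) by (simp add: \<beta>\<^sub>0_def)
          next
            case False
            then have "k \<in> I" using that by (simp add: I_def)
            have "(\<Sum>i\<in>{..<l+2}. \<beta>\<^sub>0 (Suc i) * ?F X (k, i)) = (\<Sum>i\<in>{..<l+2}. ?v i * ?F X (k, i)) / ?v (l+1)"
              by (simp add: \<beta>\<^sub>0_def sum_divide_distrib)
            then show ?thesis using Taff[OF that, of \<beta>\<^sub>0] False v(3)[OF \<open>k \<in> I\<close>, of "?F X"] by simp
          qed
          then have "app K (tr T) (app K T (aff X (l+2) \<beta>\<^sub>0)) j = 0" by (simp add: app_def[of K "tr T"])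
          then show ?thesis using isom_left_inverse[OF fK iso that] by simp
        qed
        show "y j * aff X (l+2) \<beta>\<^sub>0 j > 0" if "j \<in> S - K" for j
          using H val[OF that] that unfolding H_def by blast
      qed
    qed
  qed
  have ns0: "AE X in Om. nonsing I {..l} (\<lambda>k c. X (k, c))" by (rule AE_nonsing) (use I in auto)
  have AE: "AE X in Om. E X \<longleftrightarrow> dualcert K y l X \<and> supporting S K y (l + 2) X"
  proof -
    have "AE X in Om. rigid I {..<l} k1 (?F X)"
      by (rule mpres_AE[OF mp AE_rigid]) (use I k1 in auto)
    moreover have "AE X in Om. nonsing I {..l} (\<lambda>k c. ?F X (k, c))" by (rule mpres_AE[OF mp ns0])
    ultimately show ?thesis
    proof eventually_elim
      case (elim X)
      show ?case unfolding E_def dual[OF elim(1)] supp[OF elim(2)] ..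
    qed
  qed
  have PD: "measure Om {X. D X} = ang K y"
  proof -
    have "measure Om {X. D X} = measure Om {X. cone I K h (\<lambda>k. X (k, l))}"
      unfolding D_def by (rule prob_half_cone[OF I(1,2) a am ad fK K0 hnz])
    also have "\<dots> = ang K y" unfolding I_def h_def[abs_def]
      by (rule ang_frame[OF fK k0 T])
    finally show ?thesis .
  qed
  \<comment> \<open>Freezing the rows \<open>I\<close> fixes \<open>D\<close> and the slopes
    \<open>v\<close>. \<open>H\<close> then involves only fresh rows, and the probability of correct
    sides does not depend on the slopes.\<close>
  let ?A = "I \<times> UNIV"
  have "measure Om {X. E X} = measure Om {X. D X \<and> H X}"
    unfolding E_def by (rule mpres_prob[OF mp]) measurable
  also have "\<dots> = (\<integral>x. measure Om {x'. D (override ?A x x') \<and> H (override ?A x x')} \<partial>Om)"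
    by (rule prob_resample) measurable
  also have "\<dots> = (\<integral>x. offprob (S - K) y \<tau> * indicator {X. D X} x \<partial>Om)"
  proof (rule integral_cong_AE)
    have DHm: "Measurable.pred Om (\<lambda>X. D X \<and> H X)" by measurable
    show "(\<lambda>x. measure Om {x'. D (override ?A x x') \<and> H (override ?A x x')}) \<in> borel_measurable Om"
      by (rule prob_resample(2)[OF DHm])
    show "AE x in Om. measure Om {x'. D (override ?A x x') \<and> H (override ?A x x')} = offprob (S - K) y \<tau> * indicator {X. D X} x"
      using ns0
    proof eventually_elim
      case (elim x)
      have aO: "a (override ?A x x') = a x" for x' by (rule ad) (simp add: override_def)
      have "ip I (a x) (\<lambda>k. override ?A x x' (k, l)) = ip I (a x) (\<lambda>k. x (k, l))" for x'
        by (rule ip_cong) (simp_all add: override_def)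
      then have DO: "D (override ?A x x') = D x" for x' by (simp add: D_def aO)
      have vO: "v c (override ?A x x') = v c x" for x' c by (rule v(4)) (simp add: override_def)
      define w where "w i = v (l+1) x * v i x" for i
      have v0: "v (l+1) x \<noteq> 0" by (rule vnz[OF elim])
      have ov: "override ?A x x' (j, i) = x' (j, i)" if "j \<in> S - K \<or> j = k0" for x' j i
        using that I(3) by (auto simp: override_def I_def)
      have HO: "H (override ?A x x') \<longleftrightarrow> (\<forall>j\<in>S - K. y j * ((\<Sum>i\<in>{..<l+2}. w i * x' (j, i)) - (\<Sum>i\<in>{..<l+2}. w i * x' (k0, i)) / \<tau>) > 0)" for x'
        unfolding H_def vO using v0 by (simp add: ov w_def)
      have "measure Om {x'. H (override ?A x x')} = offprob (S - K) y \<tau>"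
      proof -
        have "measure Om {x'. H (override ?A x x')} = measure Om {X. \<forall>j\<in>S - K. y j * (X (0, j) - X (0, k0) / \<tau>) > 0}"
          unfolding HO by (rule prob_linear_forms[where ?c1.0="l+1"]) (use v0 in \<open>auto simp: w_def\<close>)
        also have "\<dots> = offprob (S - K) y \<tau>" by (rule prob_off) (use S k0 in auto)
        finally show ?thesis .
      qed
      then show ?case by (simp add: DO indicator_def)
    qed
    have "{X. D X} \<in> sets Om" using Dm by (simp add: pred_def)
    then show "(\<lambda>x. offprob (S - K) y \<tau> * indicator {X. D X} x) \<in> borel_measurable Om" by measurable
  qed
  also have "\<dots> = offprob (S - K) y \<tau> * ang K y" by (simp add: PD)
  \<comment> \<open>The frame leaves the sign of \<open>\<tau>\<close> open, and
    \<open>offprob\<close> is even in it.\<close>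
  also have "offprob (S - K) y \<tau> = offprob (S - K) y (sqrt (real (l + 2)))"
  proof -
    have "\<tau>\<^sup>2 = (sqrt (real (l + 2)))\<^sup>2" using T(2) S(3) by simp
    then have "\<tau> = sqrt (real (l + 2)) \<or> \<tau> = - sqrt (real (l + 2))" unfolding power2_eq_iff .
    then show ?thesis
    proof
      assume "\<tau> = - sqrt (real (l + 2))"
      then show ?thesis by (simp only: offprob_uminus)
    qed (simp only:)
  qed
  finally show ?thesis using Em AE by (intro exI[of _ E]) (simp add: mult.commute)
qed

subsection \<open>The function Phi on the coordinate axes\<close>

text \<open>A common form for both axes: real \<open>z\<close> gives a multiple of the Gaussian
  distribution function, imaginary \<open>z\<close> a multiple of the characteristic function of a
  Gaussian on a half line.\<close>

definition gJ :: "complex \<Rightarrow> complex" where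
  "gJ z = (\<integral>u. indicator {0..} u *\<^sub>R exp (- (of_real u - z)\<^sup>2 / 2) \<partial>lborel)"

lemma norm_gauss_shift: "norm (exp (- (of_real u - z)\<^sup>2 / 2)) = exp ((Im z)\<^sup>2 / 2) * exp (- (u - Re z)\<^sup>2 / 2)"
proof -
  have "Re (- (of_real u - z)\<^sup>2 / 2) = (Im z)\<^sup>2 / 2 + - (u - Re z)\<^sup>2 / 2"
    by (simp add: Re_power2 field_simps)
  then show ?thesis by (simp add: exp_add[symmetric])
qed

lemma integrable_gauss_real: "integrable lborel (\<lambda>u::real. exp (- (u - x)\<^sup>2 / 2))"
proof -
  have "integrable lborel (normal_density x 1)" by (rule integrable_normal_density) simp
  then have "integrable lborel (\<lambda>u. sqrt (2 * pi) * normal_density x 1 u)" by (rule integrable_mult_right)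
  then show ?thesis by (simp add: normal_density_def)
qed

lemma integrable_gauss_shift:
  fixes z :: complex
  shows "integrable lborel (\<lambda>u. indicator {0..} u *\<^sub>R exp (- (of_real u - z)\<^sup>2 / 2))"
proof (rule Bochner_Integration.integrable_bound)
  show "integrable lborel (\<lambda>u. exp ((Im z)\<^sup>2 / 2) * exp (- (u - Re z)\<^sup>2 / 2))"
    by (intro integrable_mult_right integrable_gauss_real)
  show "AE u in lborel. norm (indicator {0..} u *\<^sub>R exp (- (of_real u - z)\<^sup>2 / 2)) \<le> norm (exp ((Im z)\<^sup>2 / 2) * exp (- (u - Re z)\<^sup>2 / 2))"
    by (intro AE_I2) (simp add: norm_gauss_shift[simplified] indicator_def)
qed measurable

lemma std_normal_half: "measure std_normal {..0} = 1 / 2"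
proof -
  have "measure std_normal {x. 1 * (x - 0) > 0} = measure std_normal {..- 1 * 0}"
    by (rule std_normal_halfline) simp
  moreover have "measure std_normal (UNIV - {..0}) = 1 - measure std_normal {..0}"
    using std_normal.prob_compl[of "{..0}"] by simp
  moreover have "UNIV - {..0} = {x::real. 1 * (x - 0) > 0}" by auto
  ultimately show ?thesis by simp
qed

lemma gJ_real: "gJ (of_real x) = of_real (sqrt (2 * pi) * measure std_normal {..x})"
proof -
  have "gJ (of_real x) = (\<integral>u. of_real (indicator {0..} u * exp (- (u - x)\<^sup>2 / 2)) \<partial>lborel)"
    unfolding gJ_def
  proof (rule Bochner_Integration.integral_cong[OF refl])
    fix u :: real
    have "- (of_real u - complex_of_real x)\<^sup>2 / 2 = of_real (- (u - x)\<^sup>2 / 2)" by simp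
    then have "exp (- (of_real u - complex_of_real x)\<^sup>2 / 2) = of_real (exp (- (u - x)\<^sup>2 / 2))"
      by (simp only: exp_of_real)
    then show "indicator {0..} u *\<^sub>R exp (- (of_real u - complex_of_real x)\<^sup>2 / 2) = of_real (indicator {0..} u * exp (- (u - x)\<^sup>2 / 2))"
      by (simp add: scaleR_conv_of_real)
  qed
  also have "\<dots> = of_real (\<integral>u. indicator {0..} u * exp (- (u - x)\<^sup>2 / 2) \<partial>lborel)"
    by (rule integral_complex_of_real)
  also have "(\<integral>u. indicator {0..} u * exp (- (u - x)\<^sup>2 / 2) \<partial>lborel) =
      (\<integral>u. indicator {0..} (x + (-1) * u) * exp (- ((x + (-1) * u) - x)\<^sup>2 / 2) \<partial>lborel)"
    by (subst lborel_integral_real_affine[where c="-1" and t=x]) simp_all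
  also have "\<dots> = (\<integral>u. sqrt (2 * pi) * (std_normal_density u * indicator {..x} u) \<partial>lborel)"
    by (rule Bochner_Integration.integral_cong) (auto simp: indicator_def normal_density_def)
  also have "\<dots> = sqrt (2 * pi) * (\<integral>u. std_normal_density u * indicator {..x} u \<partial>lborel)" by simp
  also have "(\<integral>u. std_normal_density u * indicator {..x} u \<partial>lborel) = (\<integral>u. indicator {..x} u \<partial>std_normal)"
    by (subst integral_density) (auto simp: normal_density_nonneg)
  finally show ?thesis by simp
qed

text \<open>With a primitive \<open>F\<close> of the integrand, \<open>gJ w\<close> is the limit of
  \<open>F (n - w) - F (- w)\<close>. Comparison with \<open>w = 0\<close> leaves
  \<open>F (n - z) - F n\<close>, an integral over a segment of fixed length on which the integrand
  tends to 0 uniformly.\<close>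

lemma gJ_primitive: "gJ z = of_real (sqrt (2 * pi)) / 2 + contour_integral (linepath 0 z) (\<lambda>t. exp (- (t\<^sup>2) / 2))"
proof -
  let ?f = "\<lambda>t::complex. exp (- (t\<^sup>2) / 2)"
  have "?f holomorphic_on UNIV" by (intro holomorphic_intros) auto
  then obtain F where F: "\<And>x. (F has_field_derivative ?f x) (at x)"
    using holomorphic_convex_primitive'[of UNIV ?f] by (auto simp: convex_UNIV)
  have ci: "contour_integral (linepath a c) ?f = F c - F a" for a c
    using contour_integral_unique[OF contour_integral_primitive[of UNIV F ?f "linepath a c"]] F by auto
  \<comment> \<open>The integrand is even, so \<open>F\<close> is odd up to the constant
    \<open>2 * F 0\<close>.\<close>
  have odd: "F (- w) = 2 * F 0 - F w" for w
  proof -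
    have "((\<lambda>t. F (- t) + F t) has_field_derivative 0) (at t within UNIV)" for t
      by (rule derivative_eq_intros DERIV_chain'[where g=F and f=uminus] F refl | simp)+
    then obtain c where "\<And>t. F (- t) + F t = c"
      using has_field_derivative_zero_constant[of UNIV "\<lambda>t. F (- t) + F t"] by (auto simp: convex_UNIV)
    from this[of w] this[of 0] show ?thesis by (simp add: algebra_simps)
  qed
  have lim: "(\<lambda>n. F (of_real (real n) - w) - F (- w)) \<longlonglongrightarrow> gJ w" for w
  proof -
    have "(\<integral>u. indicator {0..real n} u *\<^sub>R exp (- (of_real u - w)\<^sup>2 / 2) \<partial>lborel) = F (of_real (real n) - w) - F (- w)" for n
    proof -
      have "((\<lambda>u. F (of_real u - w)) has_vector_derivative ?f (of_real u - w)) (at u within {0..real n})" for u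
      proof (rule has_vector_derivative_real_field)
        have "((\<lambda>a. F (a - w)) has_field_derivative ?f (of_real u - w) * 1) (at (of_real u))"
        proof (rule DERIV_chain'[where f="\<lambda>a. a - w" and g=F])
          show "((\<lambda>a. a - w) has_field_derivative 1) (at (of_real u))" by (auto intro!: derivative_eq_intros)
        qed (rule F)
        then show "((\<lambda>a. F (a - w)) has_field_derivative ?f (of_real u - w)) (at (of_real u))" by simp
      qed
      then have "((\<lambda>u. F (of_real u - w)) has_vector_derivative ?f (of_real u - w)) (at u within {0..real n})" for u .
      from integral_FTC_Icc[of 0 "real n" "\<lambda>u. F (of_real u - w)" "\<lambda>u. ?f (of_real u - w)", OF _ this]
      show ?thesis by (simp add: continuous_intros)
    qed
    moreover have "(\<lambda>n. \<integral>u. indicator {0..real n} u *\<^sub>R exp (- (of_real u - w)\<^sup>2 / 2) \<partial>lborel) \<longlonglongrightarrow> gJ w"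
      unfolding gJ_def
    proof (rule integral_dominated_convergence[where w="\<lambda>u. norm (indicator {0..} u *\<^sub>R exp (- (of_real u - w)\<^sup>2 / 2))"])
      show "integrable lborel (\<lambda>u. norm (indicator {0..} u *\<^sub>R exp (- (of_real u - w)\<^sup>2 / 2)))"
        by (rule integrable_norm[OF integrable_gauss_shift])
      show "AE u in lborel. (\<lambda>n. indicator {0..real n} u *\<^sub>R exp (- (of_real u - w)\<^sup>2 / 2)) \<longlonglongrightarrow> indicator {0..} u *\<^sub>R exp (- (of_real u - w)\<^sup>2 / 2)"
      proof (intro AE_I2 tendsto_eventually)
        fix u :: real
        obtain n0 where "u \<le> real n0" using real_arch_simple by blast
        then show "\<forall>\<^sub>F n in sequentially. indicator {0..real n} u *\<^sub>R exp (- (of_real u - w)\<^sup>2 / 2) = indicator {0..} u *\<^sub>R exp (- (of_real u - w)\<^sup>2 / 2)"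
          by (intro eventually_sequentiallyI[of n0]) (auto simp: indicator_def)
      qed
    qed (auto simp: indicator_def)
    ultimately show ?thesis by simp
  qed
  have "(\<lambda>n. F (of_real (real n) - z) - F (of_real (real n))) \<longlonglongrightarrow> 0"
  proof (rule Lim_null_comparison)
    show "(\<lambda>n. exp (- (real n)\<^sup>2 / 2 + real n * norm z + (norm z)\<^sup>2 / 2) * norm z) \<longlonglongrightarrow> 0"
      by real_asymp
    show "\<forall>\<^sub>F n in sequentially. norm (F (of_real (real n) - z) - F (of_real (real n)))
        \<le> exp (- (real n)\<^sup>2 / 2 + real n * norm z + (norm z)\<^sup>2 / 2) * norm z"
    proof (intro always_eventually allI)
      fix n
      let ?S = "closed_segment (of_real (real n)) (of_real (real n) - z)"
      have "norm (F (of_real (real n) - z) - F (of_real (real n))) \<le>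
          exp (- (real n)\<^sup>2 / 2 + real n * norm z + (norm z)\<^sup>2 / 2) * norm ((of_real (real n) - z) - of_real (real n))"
      proof (rule field_differentiable_bound[where S="?S" and f'="?f"])
        show "(F has_field_derivative ?f t) (at t within ?S)" for t
          using F by (rule has_field_derivative_at_within)
        fix t assume "t \<in> ?S"
        then obtain s where s: "0 \<le> s" "s \<le> 1" "t = (1 - s) *\<^sub>R of_real (real n) + s *\<^sub>R (of_real (real n) - z)"
          by (auto simp: in_segment)
        then have t: "t = of_real (real n) - of_real s * z" by (simp add: scaleR_conv_of_real algebra_simps)
        have "Re (- (t\<^sup>2) / 2) = - (real n)\<^sup>2 / 2 + real n * (s * Re z) + ((s * Im z)\<^sup>2 - (s * Re z)\<^sup>2) / 2"
          unfolding t by (simp add: Re_power2 power2_eq_square field_simps)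
        also have "\<dots> \<le> - (real n)\<^sup>2 / 2 + real n * norm z + (norm z)\<^sup>2 / 2"
        proof -
          have 1: "s * Re z \<le> norm z"
          proof -
            have "s * Re z \<le> s * norm z" using s complex_Re_le_cmod by (intro mult_left_mono) auto
            also have "\<dots> \<le> norm z" using s by (intro mult_left_le_one_le) auto
            finally show ?thesis .
          qed
          have "s * \<bar>Im z\<bar> \<le> 1 * norm z" using s abs_Im_le_cmod by (intro mult_mono) auto
          then have "(s * \<bar>Im z\<bar>)\<^sup>2 \<le> (norm z)\<^sup>2" using s by (intro power_mono) auto
          then have 2: "(s * Im z)\<^sup>2 \<le> (norm z)\<^sup>2" by (simp add: power_mult_distrib)
          have "real n * (s * Re z) \<le> real n * norm z" using 1 by (intro mult_left_mono) auto
          moreover have "(s * Im z)\<^sup>2 - (s * Re z)\<^sup>2 \<le> (norm z)\<^sup>2" using 2 zero_le_power2[of "s * Re z"] by linarith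
          ultimately show ?thesis by (intro add_mono order_refl divide_right_mono) auto
        qed
        finally show "norm (?f t) \<le> exp (- (real n)\<^sup>2 / 2 + real n * norm z + (norm z)\<^sup>2 / 2)" by simp
      qed auto
      then show "norm (F (of_real (real n) - z) - F (of_real (real n)))
        \<le> exp (- (real n)\<^sup>2 / 2 + real n * norm z + (norm z)\<^sup>2 / 2) * norm z" by simp
    qed
  qed
  moreover have "(\<lambda>n. (F (of_real (real n) - z) - F (- z)) - (F (of_real (real n) - 0) - F (- 0))) \<longlonglongrightarrow> gJ z - gJ 0"
    by (intro tendsto_diff lim)
  then have "(\<lambda>n. (F (of_real (real n) - z) - F (of_real (real n))) + (F 0 - F (- z))) \<longlonglongrightarrow> gJ z - gJ 0"
    by (simp add: algebra_simps)
  ultimately have "(\<lambda>n. F 0 - F (- z)) \<longlonglongrightarrow> gJ z - gJ 0 - 0"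
    using tendsto_diff[of "\<lambda>n. (F (of_real (real n) - z) - F (of_real (real n))) + (F 0 - F (- z))" "gJ z - gJ 0" sequentially
       "\<lambda>n. F (of_real (real n) - z) - F (of_real (real n))" 0] by (simp add: algebra_simps)
  then have "gJ z - gJ 0 = F 0 - F (- z)" by (simp add: LIMSEQ_const_iff)
  then show ?thesis using gJ_real[of 0] std_normal_half unfolding ci odd by (simp add: algebra_simps)
qed

lemma Phi_gJ: "Phi k z = gJ (z / of_real (sqrt (real k + 1))) / of_real (sqrt (2 * pi))"
  unfolding Phi_def gJ_primitive by (simp add: add_divide_distrib)

lemma Phi_real: "Phi k (of_real x) = of_real (measure std_normal {..x / sqrt (real k + 1)})"
proof -
  have "complex_of_real x / of_real (sqrt (real k + 1)) = of_real (x / sqrt (real k + 1))" by simp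
  then show ?thesis unfolding Phi_gJ by (simp only: gJ_real) simp
qed

text \<open>The characteristic function of a standard Gaussian restricted to the half line with sign
  \<open>y\<close>, not normalised to total mass 1.\<close>

definition hchi :: "real \<Rightarrow> real \<Rightarrow> complex" where
  "hchi y t = (\<integral>u. indicator {u. y * u > 0} u *\<^sub>R iexp (t * u) \<partial>std_normal)"

lemma integrable_hchi: "integrable std_normal (\<lambda>u. indicator {u. y * u > 0} u *\<^sub>R iexp (t * u))"
  by (rule std_normal.integrable_const_bound[where B=1]) (auto simp: indicator_def)

lemma hchi_reflect: "hchi (- y) t = hchi y (- t)"
proof -
  have "hchi (- y) t = integral\<^sup>L (distr std_normal std_normal uminus) (\<lambda>u. indicator {u. - y * u > 0} u *\<^sub>R iexp (t * u))"
    unfolding std_normal_uminus hchi_def ..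
  also have "\<dots> = (\<integral>u. indicator {u. - y * u > 0} (- u) *\<^sub>R iexp (t * (- u)) \<partial>std_normal)"
    by (rule integral_distr) measurable
  also have "\<dots> = hchi y (- t)" unfolding hchi_def by (rule Bochner_Integration.integral_cong) (auto simp: indicator_def)
  finally show ?thesis .
qed

lemma gJ_imag: "gJ (\<i> * of_real t) = of_real (sqrt (2 * pi) * exp (t\<^sup>2 / 2)) * hchi 1 t"
proof -
  have "hchi 1 t = (\<integral>u. std_normal_density u *\<^sub>R (indicator {u. 1 * u > 0} u *\<^sub>R iexp (t * u)) \<partial>lborel)"
    unfolding hchi_def by (rule integral_density) (auto simp: normal_density_nonneg)
  then have "of_real (sqrt (2 * pi) * exp (t\<^sup>2 / 2)) * hchi 1 t =
     (\<integral>u. of_real (sqrt (2 * pi) * exp (t\<^sup>2 / 2)) * (std_normal_density u *\<^sub>R (indicator {u. 1 * u > 0} u *\<^sub>R iexp (t * u))) \<partial>lborel)"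
    by (simp only: integral_mult_right_zero)
  also have "\<dots> = gJ (\<i> * of_real t)"
    unfolding gJ_def
  proof (rule integral_cong_AE)
    have "AE u in lborel. u \<noteq> (0::real)" by (rule AE_lborel_singleton)
    then show "AE u in lborel. of_real (sqrt (2 * pi) * exp (t\<^sup>2 / 2)) * (std_normal_density u *\<^sub>R (indicator {u. 1 * u > 0} u *\<^sub>R iexp (t * u))) =
        indicator {0..} u *\<^sub>R exp (- (of_real u - \<i> * of_real t)\<^sup>2 / 2)"
    proof eventually_elim
      case (elim u)
      have "- (of_real u - \<i> * of_real t)\<^sup>2 / 2 = of_real (t\<^sup>2 / 2) + of_real (- u\<^sup>2 / 2) + \<i> * of_real (t * u)"
        by (simp add: power2_eq_square algebra_simps add_divide_distrib diff_divide_distrib)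
      then have "exp (- (of_real u - \<i> * of_real t)\<^sup>2 / 2) = of_real (exp (t\<^sup>2 / 2)) * of_real (exp (- u\<^sup>2 / 2)) * iexp (t * u)"
        by (simp only: exp_add exp_of_real)
      then show ?case using elim
        by (simp add: indicator_def normal_density_def scaleR_conv_of_real)
    qed
  qed measurable
  finally show ?thesis ..
qed

text \<open>Expanding the square in the exponent takes \<open>exp (g^2 / (2 * (k + 1)))\<close> out
  of the integral. A product of \<open>k + 1\<close> such values carries
  \<open>exp (g^2 / 2)\<close>, the inverse of the exponential in the density of
  \<open>g\<close>.\<close>

lemma Phi_imag:
  assumes "y = 1 \<or> y = (-1::real)"
  shows "Phi k (\<i> * of_real (y * g)) = of_real (exp (g\<^sup>2 / (2 * (real k + 1)))) * hchi y (g / sqrt (real k + 1))"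
proof -
  define t where "t = g / sqrt (real k + 1)"
  have t2: "t\<^sup>2 / 2 = g\<^sup>2 / (2 * (real k + 1))" by (simp add: t_def power_divide)
  have "\<i> * of_real (y * g) / of_real (sqrt (real k + 1)) = \<i> * of_real (y * t)" by (simp add: t_def)
  then have "Phi k (\<i> * of_real (y * g)) = gJ (\<i> * of_real (y * t)) / of_real (sqrt (2 * pi))" unfolding Phi_gJ by (simp only:)
  also have "\<dots> = of_real (exp ((y * t)\<^sup>2 / 2)) * hchi 1 (y * t)" unfolding gJ_imag by simp
  also have "(y * t)\<^sup>2 = t\<^sup>2" using assms by auto
  also have "hchi 1 (y * t) = hchi y t" using assms hchi_reflect[of 1 t] by auto
  finally show ?thesis unfolding t2 unfolding t_def .
qed

lemma norm_hchi_le_1: "norm (hchi y t) \<le> 1"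
proof -
  have "norm (hchi y t) \<le> (\<integral>u. norm (indicator {u. y * u > 0} u *\<^sub>R iexp (t * u)) \<partial>std_normal)"
    unfolding hchi_def by (rule integral_norm_bound)
  also have "\<dots> \<le> (\<integral>u. 1 \<partial>std_normal)"
    by (intro integral_mono integrable_norm integrable_hchi) (auto simp: indicator_def)
  finally show ?thesis using std_normal.prob_space by simp
qed

text \<open>Integration by parts: the boundary term is the density at 0, and the remaining integral
  is at most the first absolute moment \<open>sqrt (2 / pi)\<close>. Each is at most 1, which gives
  the bound 2.\<close>

lemma norm_hchi_decay:
  assumes "y = 1 \<or> y = (-1::real)"
  shows "\<bar>t\<bar> * norm (hchi y t) \<le> 2"
proof -
  have pos: "\<bar>t\<bar> * norm (hchi 1 t) \<le> 2" for t
  proof -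
    let ?\<phi> = std_normal_density
    define f where "f u = of_real (?\<phi> u) * iexp (t * u)" for u
    define f' where "f' u = of_real (- u * ?\<phi> u) * iexp (t * u) + \<i> * of_real t * f u" for u
    have d: "(f has_vector_derivative f' u) (at u within A)" for u A
    proof -
      have 1: "(?\<phi> has_real_derivative - u * ?\<phi> u) (at u)"
        unfolding std_normal_density_def by (auto intro!: derivative_eq_intros simp: field_simps)
      have 2: "((\<lambda>u. complex_of_real (?\<phi> u)) has_vector_derivative of_real (- u * ?\<phi> u)) (at u)"
        using has_vector_derivative_of_real[OF 1] .
      have 3: "((\<lambda>u. iexp (t * u)) has_vector_derivative iexp (t * u) * (\<i> * of_real t)) (at u)"
      proof -
        have "((\<lambda>z. exp (\<i> * (of_real t * z))) has_field_derivative iexp (t * u) * (\<i> * of_real t)) (at (of_real u))"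
          by (auto intro!: derivative_eq_intros)
        from has_vector_derivative_real_field[OF this] show ?thesis by simp
      qed
      have "(f has_vector_derivative of_real (?\<phi> u) * (iexp (t * u) * (\<i> * of_real t)) + of_real (- u * ?\<phi> u) * iexp (t * u)) (at u)"
        unfolding f_def by (rule has_vector_derivative_mult[OF 2 3])
      then show ?thesis unfolding f'_def f_def by (simp add: mult_ac add.commute has_vector_derivative_at_within)
    qed
    have phic: "isCont ?\<phi> u" for u unfolding std_normal_density_def by (intro continuous_intros) auto
    have c: "continuous_on A f'" for A
      unfolding f'_def f_def std_normal_density_def by (intro continuous_intros) auto
    have i1: "integrable lborel (\<lambda>u. of_real (- u * ?\<phi> u) * iexp (t * u) :: complex)"
    proof (rule Bochner_Integration.integrable_bound[OF integrable_std_normal_moment_abs[of 1]])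
      show "AE u in lborel. norm (of_real (- u * ?\<phi> u) * iexp (t * u) :: complex) \<le> norm (?\<phi> u * \<bar>u\<bar> ^ 1)"
        by (intro AE_I2) (simp add: norm_mult abs_mult normal_density_nonneg)
    qed measurable
    have i2: "integrable lborel f"
    proof (rule Bochner_Integration.integrable_bound[OF integrable_normal_density[of 1 0]])
      show "AE u in lborel. norm (f u) \<le> norm (?\<phi> u)" by (intro AE_I2) (simp add: f_def norm_mult)
      show "f \<in> borel_measurable lborel" unfolding f_def by measurable
    qed simp
    have i3: "integrable lborel f'" unfolding f'_def by (intro Bochner_Integration.integrable_add i1 integrable_mult_right i2)
    have ii: "integrable lborel (\<lambda>u. indicator {0..} u *\<^sub>R h u)" if "integrable lborel h" for h :: "real \<Rightarrow> complex"
      using that by (rule integrable_mult_indicator[rotated]) simp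
    have lim1: "(\<lambda>n. \<integral>u. indicator {0..real n} u *\<^sub>R f' u \<partial>lborel) \<longlonglongrightarrow> (\<integral>u. indicator {0..} u *\<^sub>R f' u \<partial>lborel)"
    proof (rule integral_dominated_convergence[where w="\<lambda>u. norm (f' u)"])
      show "integrable lborel (\<lambda>u. norm (f' u))" by (rule integrable_norm[OF i3])
      have [measurable]: "f' \<in> borel_measurable lborel" using i3 by simp
      show "(\<lambda>u. indicator {0..} u *\<^sub>R f' u) \<in> borel_measurable lborel" "\<And>n. (\<lambda>u. indicator {0..real n} u *\<^sub>R f' u) \<in> borel_measurable lborel"
        by measurable
      show "AE u in lborel. (\<lambda>n. indicator {0..real n} u *\<^sub>R f' u) \<longlonglongrightarrow> indicator {0..} u *\<^sub>R f' u"
      proof (intro AE_I2 tendsto_eventually)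
        fix u :: real
        obtain n0 where "u \<le> real n0" using real_arch_simple by blast
        then show "\<forall>\<^sub>F n in sequentially. indicator {0..real n} u *\<^sub>R f' u = indicator {0..} u *\<^sub>R f' u"
          by (intro eventually_sequentiallyI[of n0]) (auto simp: indicator_def)
      qed
    qed (auto simp: indicator_def)
    have "(\<integral>u. indicator {0..real n} u *\<^sub>R f' u \<partial>lborel) = f (real n) - f 0" for n
      by (rule integral_FTC_Icc) (auto intro!: d c)
    moreover have "(\<lambda>n. f (real n) - f 0) \<longlonglongrightarrow> 0 - f 0"
    proof (intro tendsto_diff tendsto_const)
      show "(\<lambda>n. f (real n)) \<longlonglongrightarrow> 0"
      proof (rule Lim_null_comparison)
        show "(\<lambda>n. std_normal_density (real n)) \<longlonglongrightarrow> 0" unfolding std_normal_density_def by real_asymp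
        show "\<forall>\<^sub>F n in sequentially. norm (f (real n)) \<le> std_normal_density (real n)"
          by (intro always_eventually allI) (simp add: f_def norm_mult normal_density_nonneg)
      qed
    qed
    ultimately have e1: "(\<integral>u. indicator {0..} u *\<^sub>R f' u \<partial>lborel) = - f 0"
      using LIMSEQ_unique[OF lim1] by simp
    have e2: "(\<integral>u. indicator {0..} u *\<^sub>R f' u \<partial>lborel) =
       (\<integral>u. indicator {0..} u *\<^sub>R (of_real (- u * ?\<phi> u) * iexp (t * u)) \<partial>lborel) + \<i> * of_real t * (\<integral>u. indicator {0..} u *\<^sub>R f u \<partial>lborel)"
    proof -
      have "(\<integral>u. indicator {0..} u *\<^sub>R f' u \<partial>lborel) =
        (\<integral>u. indicator {0..} u *\<^sub>R (of_real (- u * ?\<phi> u) * iexp (t * u)) + \<i> * of_real t * (indicator {0..} u *\<^sub>R f u) \<partial>lborel)"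
        by (rule Bochner_Integration.integral_cong) (auto simp: f'_def scaleR_add_right scaleR_diff_right)
      also have "\<dots> = (\<integral>u. indicator {0..} u *\<^sub>R (of_real (- u * ?\<phi> u) * iexp (t * u)) \<partial>lborel) + (\<integral>u. \<i> * of_real t * (indicator {0..} u *\<^sub>R f u) \<partial>lborel)"
        by (intro Bochner_Integration.integral_add ii i1 integrable_mult_right i2)
      finally show ?thesis by (simp only: integral_mult_right_zero)
    qed
    have h: "hchi 1 t = (\<integral>u. indicator {0..} u *\<^sub>R f u \<partial>lborel)"
    proof -
      have "hchi 1 t = (\<integral>u. std_normal_density u *\<^sub>R (indicator {u. 1 * u > 0} u *\<^sub>R iexp (t * u)) \<partial>lborel)"
        unfolding hchi_def by (rule integral_density) (auto simp: normal_density_nonneg)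
      also have "\<dots> = (\<integral>u. indicator {0..} u *\<^sub>R f u \<partial>lborel)"
      proof (rule integral_cong_AE)
        show "AE u in lborel. std_normal_density u *\<^sub>R (indicator {u. 1 * u > 0} u *\<^sub>R iexp (t * u)) = indicator {0..} u *\<^sub>R f u"
          using AE_lborel_singleton[of "0::real"]
          by eventually_elim (auto simp: f_def indicator_def scaleR_conv_of_real)
        show "(\<lambda>u. indicator {0..} u *\<^sub>R f u) \<in> borel_measurable lborel" unfolding f_def by measurable
      qed measurable
      finally show ?thesis .
    qed
    have bnd: "norm (\<integral>u. indicator {0..} u *\<^sub>R (of_real (- u * ?\<phi> u) * iexp (t * u)) \<partial>lborel :: complex) \<le> 1"
    proof -
      have "norm (\<integral>u. indicator {0..} u *\<^sub>R (of_real (- u * ?\<phi> u) * iexp (t * u)) \<partial>lborel :: complex) \<le>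
          (\<integral>u. norm (indicator {0..} u *\<^sub>R (of_real (- u * ?\<phi> u) * iexp (t * u)) :: complex) \<partial>lborel)"
        by (rule integral_norm_bound)
      also have "\<dots> \<le> (\<integral>u. ?\<phi> u * \<bar>u\<bar> ^ 1 \<partial>lborel)"
        by (intro integral_mono integrable_norm ii i1 integrable_std_normal_moment_abs)
          (auto simp: indicator_def norm_mult abs_mult normal_density_nonneg mult_nonneg_nonpos)
      also have "\<dots> = sqrt (2 / pi)" using integral_std_normal_moment_abs_odd[of 0] by simp
      also have "\<dots> \<le> 1" using pi_gt3 by simp
      finally show ?thesis .
    qed
    have "\<bar>t\<bar> * norm (hchi 1 t) = norm (\<i> * of_real t * hchi 1 t)" by (simp add: norm_mult)
    also have "\<i> * of_real t * hchi 1 t = - f 0 - (\<integral>u. indicator {0..} u *\<^sub>R (of_real (- u * ?\<phi> u) * iexp (t * u)) \<partial>lborel)"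
      using e1 e2 unfolding h by (simp add: algebra_simps)
    also have "norm \<dots> \<le> norm (- f 0) + 1" using norm_triangle_ineq4[of "- f 0"] bnd by (rule order_trans[OF _ add_left_mono])
    also have "\<dots> \<le> 2"
    proof -
      have "1\<^sup>2 \<le> 2 * pi" using pi_gt3 by simp
      then have "1 \<le> sqrt (2 * pi)" by (rule real_le_rsqrt)
      then show ?thesis by (simp add: f_def std_normal_density_def norm_mult norm_divide field_simps)
    qed
    finally show ?thesis .
  qed
  show ?thesis using assms pos[of t] pos[of "- t"] hchi_reflect[of 1 t] by auto
qed

subsection \<open>Fourier inversion of the solid angle\<close>

lemma integral_prod_column:
  fixes f :: "nat \<Rightarrow> real \<Rightarrow> complex"
  assumes K: "finite K" and f: "\<And>j. j \<in> K \<Longrightarrow> integrable std_normal (f j)"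
  shows "(\<integral>X. (\<Prod>j\<in>K. f j (X (j, 0))) \<partial>Om) = (\<Prod>j\<in>K. \<integral>u. f j u \<partial>std_normal)"
proof -
  interpret P: product_prob_space "\<lambda>_. std_normal" K
    by unfold_locales
  have fm[measurable]: "f j \<in> borel_measurable borel" if "j \<in> K" for j using f[OF that] by simp
  have d: "distr Om (PiM K (\<lambda>_. std_normal)) (\<lambda>X. \<lambda>j\<in>K. X (j, 0)) = PiM K (\<lambda>_. std_normal)"
    unfolding Om_def by (rule distr_PiM_reindex) (auto simp: inj_on_def prob_space_std_normal)
  have m: "(\<lambda>X. \<lambda>j\<in>K. X (j, 0)) \<in> measurable Om (PiM K (\<lambda>_. std_normal))"
    by (rule measurable_restrict) simp
  have pm: "(\<lambda>x. \<Prod>j\<in>K. f j (x j)) \<in> borel_measurable (PiM K (\<lambda>_. std_normal))"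
    by (rule borel_measurable_prod) (rule measurable_compose[OF measurable_component_singleton], auto simp: fm)
  have "(\<Prod>j\<in>K. \<integral>u. f j u \<partial>std_normal) = (\<integral>x. (\<Prod>j\<in>K. f j (x j)) \<partial>PiM K (\<lambda>_. std_normal))"
    using P.product_integral_prod[OF K, of f] f by simp
  also have "\<dots> = (\<integral>x. (\<Prod>j\<in>K. f j (x j)) \<partial>distr Om (PiM K (\<lambda>_. std_normal)) (\<lambda>X. \<lambda>j\<in>K. X (j, 0)))"
    unfolding d ..
  also have "\<dots> = (\<integral>X. (\<Prod>j\<in>K. f j ((\<lambda>j\<in>K. X (j, 0)) j)) \<partial>Om)" by (rule integral_distr[OF m pm])
  also have "\<dots> = (\<integral>X. (\<Prod>j\<in>K. f j (X (j, 0))) \<partial>Om)"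
    by (intro Bochner_Integration.integral_cong prod.cong) auto
  finally show ?thesis ..
qed

lemma integral_upd:
  fixes g :: "(nat \<times> nat \<Rightarrow> real) \<Rightarrow> complex"
  assumes [measurable]: "g \<in> borel_measurable Om" and b: "\<And>X. norm (g X) \<le> 1"
  shows "(\<integral>X. g X \<partial>Om) = (\<integral>u. (\<integral>X. g (X(p := u)) \<partial>Om) \<partial>std_normal)"
proof -
  interpret S: pair_prob_space std_normal Om ..
  have m: "(\<lambda>(u, x). x(p := u)) \<in> measurable (std_normal \<Otimes>\<^sub>M Om) Om" by measurable
  have "(\<integral>X. g X \<partial>Om) = (\<integral>X. g X \<partial>distr (std_normal \<Otimes>\<^sub>M Om) Om (\<lambda>(u, x). x(p := u)))"
    unfolding distr_upd ..
  also have "\<dots> = (\<integral>z. g (case z of (u, x) \<Rightarrow> x(p := u)) \<partial>(std_normal \<Otimes>\<^sub>M Om))"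
    by (rule integral_distr[OF m]) simp
  also have "\<dots> = (\<integral>u. (\<integral>X. g (X(p := u)) \<partial>Om) \<partial>std_normal)"
  proof (subst S.integral_fst'[symmetric])
    have mm: "(\<lambda>z. g (case z of (u, x) \<Rightarrow> x(p := u))) \<in> borel_measurable (std_normal \<Otimes>\<^sub>M Om)"
      by (rule measurable_compose[OF m]) simp
    show "integrable (std_normal \<Otimes>\<^sub>M Om) (\<lambda>z. g (case z of (u, x) \<Rightarrow> x(p := u)))"
      by (rule S.P.integrable_const_bound[where B=1]) (use b mm in auto)
  qed simp
  finally show ?thesis .
qed

lemma integrable_inverse_quadratic: "integrable lborel (\<lambda>x::real. inverse (1 + x\<^sup>2))"
  using integrable_inverse_1_plus_square by (simp add: set_integrable_def)

lemma AE_column_form_nonzero: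
  assumes "finite I" "k1 \<in> I" "h k1 \<noteq> 0"
  shows "AE X in Om. ip I h (\<lambda>k. X (k, 0)) \<noteq> 0"
proof -
  obtain T where T: "good I T" "\<And>j. j \<in> I - {k1} \<Longrightarrow> app I T h j = 0"
    using rotate_to_axis[of I k1 h] assms by blast
  have iso: "isom I T" and mp: "mpres (act T I {0})" using T(1) by (auto simp: good_def)
  define t where "t = app I T h k1"
  have t: "t \<noteq> 0" using isom_nonzero[of I T k1 h, OF assms(1) iso assms(2,3)] T(2) by (auto simp: t_def)
  have "AE X in Om. nonsing {k1} {0} (\<lambda>k c. X (k, c))" by (rule AE_nonsing) auto
  then have "AE X in Om. X (k1, 0) \<noteq> 0"
  proof eventually_elim
    case (elim X)
    show ?case
    proof
      assume "X (k1, 0) = 0"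
      then have "(1::real) = 0" using elim unfolding nonsing_def by (auto dest: spec[of _ "\<lambda>_. 1"])
      then show False by simp
    qed
  qed
  from mpres_AE[OF mp this] show ?thesis
  proof eventually_elim
    case (elim X)
    have "ip I h (\<lambda>k. X (k, 0)) = ip I (app I T h) (app I T (\<lambda>k. X (k, 0)))" using isom_ip[OF iso] by simp
    also have "\<dots> = t * app I T (\<lambda>k. X (k, 0)) k1" unfolding t_def by (rule ip_axis) (use assms T in auto)
    also have "app I T (\<lambda>k. X (k, 0)) k1 = act T I {0} X (k1, 0)" using assms by (simp add: act_def)
    finally show ?case using elim t by simp
  qed
qed

lemma measurable_hchi [measurable]: "hchi y \<in> borel_measurable borel"
proof -
  have "(\<lambda>t. hchi y t) \<in> borel_measurable borel"
    unfolding hchi_def by (rule std_normal.borel_measurable_lebesgue_integral) measurable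
  then show ?thesis by simp
qed

text \<open>The available bound on one factor is of order \<open>1 / \<bar>g\<bar>\<close>. Two such
  factors give an integrable bound and the others have norm at most 1, hence the condition
  \<open>k \<ge> 1\<close>.\<close>

lemma integrable_prod_hchi:
  assumes K: "finite K" "card K = Suc k" "k \<ge> 1" and y: "\<And>j. j \<in> K \<Longrightarrow> y j = 1 \<or> y j = (-1::real)"
  shows "integrable lborel (\<lambda>g. \<Prod>j\<in>K. hchi (y j) (g / sqrt (real k + 1)))"
proof (rule Bochner_Integration.integrable_bound)
  let ?p = "real k + 1"
  show "integrable lborel (\<lambda>g. (1 + 4 * ?p) * inverse (1 + g\<^sup>2))"
    by (intro integrable_mult_right integrable_inverse_quadratic)
  show "AE g in lborel. norm (\<Prod>j\<in>K. hchi (y j) (g / sqrt ?p)) \<le> norm ((1 + 4 * ?p) * inverse (1 + g\<^sup>2))"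
  proof (intro AE_I2)
    fix g :: real
    define n where "n j = norm (hchi (y j) (g / sqrt ?p))" for j
    obtain j1 where j1: "j1 \<in> K" using K by fastforce
    have "card (K - {j1}) \<ge> 1" using K j1 by simp
    then have "K - {j1} \<noteq> {}" by (metis card.empty not_one_le_zero)
    then obtain j2 where j2: "j2 \<in> K - {j1}" by blast
    have nn: "n j \<ge> 0" "n j \<le> 1" for j using norm_hchi_le_1 by (auto simp: n_def)
    have "norm (\<Prod>j\<in>K. hchi (y j) (g / sqrt ?p)) = (\<Prod>j\<in>K. n j)" by (simp add: prod_norm n_def)
    also have "\<dots> = n j1 * (n j2 * (\<Prod>j\<in>K - {j1} - {j2}. n j))"
      using K j1 j2 by (subst prod.remove[of K j1], simp, simp, subst prod.remove[of "K - {j1}" j2]) auto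
    also have "\<dots> \<le> n j1 * (n j2 * 1)" using nn by (intro mult_left_mono prod_le_1) auto
    finally have le: "norm (\<Prod>j\<in>K. hchi (y j) (g / sqrt ?p)) \<le> n j1 * n j2" by simp
    have dec: "\<bar>g\<bar> * n j \<le> 2 * sqrt ?p" if "j \<in> K" for j
    proof -
      have "\<bar>g / sqrt ?p\<bar> * n j \<le> 2" unfolding n_def by (rule norm_hchi_decay[OF y[OF that]])
      then show ?thesis by (simp add: field_simps)
    qed
    have "g\<^sup>2 * (n j1 * n j2) = (\<bar>g\<bar> * n j1) * (\<bar>g\<bar> * n j2)" by (simp add: power2_eq_square mult_ac)
    also have "\<dots> \<le> (2 * sqrt ?p) * (2 * sqrt ?p)" using mult_mono[OF dec[of j1] dec[of j2]] j1 j2 nn by simp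
    also have "\<dots> = 4 * ?p" by simp
    finally have "g\<^sup>2 * (n j1 * n j2) \<le> 4 * ?p" .
    moreover have "n j1 * n j2 \<le> 1 * 1" using nn by (intro mult_mono) auto
    ultimately have "(1 + g\<^sup>2) * (n j1 * n j2) \<le> 1 + 4 * ?p" by (simp add: distrib_right)
    moreover have "1 + g\<^sup>2 > 0" using zero_le_power2[of g] by linarith
    ultimately have "n j1 * n j2 \<le> (1 + 4 * ?p) * inverse (1 + g\<^sup>2)"
      by (simp add: field_simps)
    moreover have "(1 + 4 * ?p) * inverse (1 + g\<^sup>2) \<ge> 0" using \<open>1 + g\<^sup>2 > 0\<close> by simp
    ultimately show "norm (\<Prod>j\<in>K. hchi (y j) (g / sqrt ?p)) \<le> norm ((1 + 4 * ?p) * inverse (1 + g\<^sup>2))"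
      using le by simp
  qed
qed measurable

text \<open>The product is the characteristic function of the coordinate sum on the event of correct
  signs. In the frame this sum is \<open>\<tau> * \<zeta>\<close> with \<open>\<zeta>\<close> the
  rotated coordinate \<open>k0\<close>; integrating out the others leaves a Fourier transform in
  \<open>\<zeta>\<close>.\<close>

lemma prod_hchi_fourier:
  assumes K: "finite K" "k0 \<in> K" "card K = Suc k"
    and T: "good K T" "\<tau>\<^sup>2 = real (card K)" "\<tau> \<noteq> 0" "\<And>j. j \<in> K \<Longrightarrow> T k0 j = 1 / \<tau>"
    "\<And>j. j \<in> K \<Longrightarrow> app K T (\<lambda>_. 1) j = (if j = k0 then \<tau> else 0)"
  shows "(\<Prod>j\<in>K. hchi (y j) (g / sqrt (real k + 1))) =
    (\<integral>\<zeta>. of_real (measure Om {X. \<forall>j\<in>K. y j * (ip (K - {k0}) (\<lambda>k. T k j) (\<lambda>k. X (k, 0)) + \<zeta> / \<tau>) > 0}) *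
       iexp (g * (\<tau> / sqrt (real k + 1)) * \<zeta>) \<partial>std_normal)"
proof -
  note [simp] = K(1)
  let ?p = "sqrt (real k + 1)"
  have iso: "isom K T" and mp: "mpres (act T K {0})" using T(1) by (auto simp: good_def)
  define G where "G X = indicator {X. \<forall>j\<in>K. y j * (ip (K - {k0}) (\<lambda>k. T k j) (\<lambda>k. X (k, 0)) + X (k0, 0) / \<tau>) > 0} X *\<^sub>R
     iexp (g * (\<tau> / ?p) * X (k0, 0))" for X :: "nat \<times> nat \<Rightarrow> real"
  have Q: "Measurable.pred Om (\<lambda>X. \<forall>j\<in>K. y j * (ip (K - {k0}) (\<lambda>k. T k j) (\<lambda>k. X (k, 0)) + X (k0, 0) / \<tau>) > 0)" by measurable
  have [measurable]: "{X. \<forall>j\<in>K. y j * (ip (K - {k0}) (\<lambda>k. T k j) (\<lambda>k. X (k, 0)) + X (k0, 0) / \<tau>) > 0} \<in> sets Om"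
    using Q by (simp add: pred_def)
  have Gm[measurable]: "G \<in> borel_measurable Om" unfolding G_def[abs_def] by measurable
  have "(\<Prod>j\<in>K. hchi (y j) (g / ?p)) =
      (\<integral>X. (\<Prod>j\<in>K. indicator {u. y j * u > 0} (X (j, 0)) *\<^sub>R iexp (g / ?p * X (j, 0))) \<partial>Om)"
    unfolding hchi_def by (rule integral_prod_column[symmetric, OF K(1)]) (rule integrable_hchi)
  also have "\<dots> = (\<integral>X. G (act T K {0} X) \<partial>Om)"
  proof (rule Bochner_Integration.integral_cong[OF refl])
    fix X :: "nat \<times> nat \<Rightarrow> real"
    let ?x = "\<lambda>k. X (k, 0)"
    let ?Z = "act T K {0} X"
    have Z: "?Z (k, 0) = app K T ?x k" if "k \<in> K" for k using that by (simp add: act_def)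
    have "\<tau> * app K T ?x k0 = ip K (app K T (\<lambda>_. 1)) (app K T ?x)"
      using ip_axis[of K k0 "app K T (\<lambda>_. 1)" "app K T ?x"] K T(5) by simp
    also have "\<dots> = (\<Sum>k\<in>K. X (k, 0))" unfolding isom_ip[OF iso] by (simp add: ip_def)
    finally have s: "(\<Sum>k\<in>K. X (k, 0)) = \<tau> * ?Z (k0, 0)" using Z[OF K(2)] by simp
    have x: "X (j, 0) = ip (K - {k0}) (\<lambda>k. T k j) (\<lambda>k. ?Z (k, 0)) + ?Z (k0, 0) / \<tau>" if j: "j \<in> K" for j
    proof -
      have "X (j, 0) = app K (tr T) (app K T ?x) j" using isom_left_inverse[OF K(1) iso j] by simp
      also have "\<dots> = T k0 j * app K T ?x k0 + (\<Sum>k\<in>K - {k0}. T k j * app K T ?x k)"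
        unfolding app_def[of K "tr T"] tr_def using K by (simp add: sum.remove[of K k0])
      also have "(\<Sum>k\<in>K - {k0}. T k j * app K T ?x k) = ip (K - {k0}) (\<lambda>k. T k j) (\<lambda>k. ?Z (k, 0))"
        unfolding ip_def by (rule sum.cong) (use Z in auto)
      finally show ?thesis using T(4)[OF j] Z[OF K(2)] by simp
    qed
    have "(\<Prod>j\<in>K. indicator {u. y j * u > 0} (X (j, 0)) *\<^sub>R iexp (g / ?p * X (j, 0))) =
        of_real (\<Prod>j\<in>K. indicator {u. y j * u > 0} (X (j, 0))) * (\<Prod>j\<in>K. iexp (g / ?p * X (j, 0)))"
      by (simp add: scaleR_conv_of_real prod.distrib)
    also have "(\<Prod>j\<in>K. iexp (g / ?p * X (j, 0))) = exp (\<Sum>j\<in>K. \<i> * of_real (g / ?p * X (j, 0)))"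
      by (simp only: exp_sum K(1))
    also have "(\<Sum>j\<in>K. \<i> * of_real (g / ?p * X (j, 0))) = \<i> * of_real (g / ?p * (\<Sum>j\<in>K. X (j, 0)))"
      by (simp only: sum_distrib_left of_real_sum)
    also have "g / ?p * (\<Sum>j\<in>K. X (j, 0)) = g * (\<tau> / ?p) * ?Z (k0, 0)" unfolding s by simp
    also have "(\<Prod>j\<in>K. indicator {u. y j * u > 0} (X (j, 0)) :: real) = of_bool (\<forall>j\<in>K. y j * X (j, 0) > 0)"
    proof (cases "\<forall>j\<in>K. y j * X (j, 0) > 0")
      case False
      then obtain j where "j \<in> K" "\<not> y j * X (j, 0) > 0" by blast
      then have "\<exists>j\<in>K. indicator {u. y j * u > 0} (X (j, 0)) = (0::real)" by (intro bexI[of _ j]) auto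
      then show ?thesis using False by (simp add: prod_zero_iff)
    qed simp
    also have "(\<forall>j\<in>K. y j * X (j, 0) > 0) \<longleftrightarrow> (\<forall>j\<in>K. y j * (ip (K - {k0}) (\<lambda>k. T k j) (\<lambda>k. ?Z (k, 0)) + ?Z (k0, 0) / \<tau>) > 0)"
      using x by simp
    finally show "(\<Prod>j\<in>K. indicator {u. y j * u > 0} (X (j, 0)) *\<^sub>R iexp (g / ?p * X (j, 0))) = G ?Z"
      by (simp only: G_def indicator_def mem_Collect_eq scaleR_conv_of_real)
  qed
  also have "\<dots> = (\<integral>X. G X \<partial>Om)"
  proof -
    have "(\<integral>X. G X \<partial>distr Om Om (act T K {0})) = (\<integral>X. G (act T K {0} X) \<partial>Om)"
      by (rule integral_distr[OF mpres_measurable[OF mp] Gm])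
    then show ?thesis using mp by (simp add: mpres_def)
  qed
  also have "\<dots> = (\<integral>\<zeta>. (\<integral>X. G (X((k0, 0) := \<zeta>)) \<partial>Om) \<partial>std_normal)"
    by (rule integral_upd[OF Gm]) (auto simp: G_def indicator_def)
  also have "\<dots> = (\<integral>\<zeta>. of_real (measure Om {X. \<forall>j\<in>K. y j * (ip (K - {k0}) (\<lambda>k. T k j) (\<lambda>k. X (k, 0)) + \<zeta> / \<tau>) > 0}) *
       iexp (g * (\<tau> / ?p) * \<zeta>) \<partial>std_normal)"
  proof (rule Bochner_Integration.integral_cong[OF refl])
    fix \<zeta> :: real
    let ?A = "{X. \<forall>j\<in>K. y j * (ip (K - {k0}) (\<lambda>k. T k j) (\<lambda>k. X (k, 0)) + \<zeta> / \<tau>) > 0}"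
    have ipU: "ip (K - {k0}) (\<lambda>k. T k j) (\<lambda>k. (X((k0, 0) := \<zeta>)) (k, 0)) = ip (K - {k0}) (\<lambda>k. T k j) (\<lambda>k. X (k, 0))" for X j
      by (rule ip_cong) auto
    have "G (X((k0, 0) := \<zeta>)) = of_real (indicator ?A X) * iexp (g * (\<tau> / ?p) * \<zeta>)" for X
      by (simp only: G_def ipU indicator_def mem_Collect_eq fun_upd_same scaleR_conv_of_real)
    then have "(\<integral>X. G (X((k0, 0) := \<zeta>)) \<partial>Om) = (\<integral>X. of_real (indicator ?A X) * iexp (g * (\<tau> / ?p) * \<zeta>) \<partial>Om)" by simp
    also have "\<dots> = (\<integral>X. of_real (indicator ?A X) \<partial>Om) * iexp (g * (\<tau> / ?p) * \<zeta>)" by (rule integral_mult_left_zero)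
    also have "(\<integral>X. of_real (indicator ?A X) \<partial>Om) = complex_of_real (\<integral>X. indicator ?A X \<partial>Om)" by (rule integral_complex_of_real)
    also have "(\<integral>X. indicator ?A X \<partial>Om) = measure Om ?A" by simp
    finally show "(\<integral>X. G (X((k0, 0) := \<zeta>)) \<partial>Om) = of_real (measure Om ?A) * iexp (g * (\<tau> / ?p) * \<zeta>)" .
  qed
  finally show ?thesis .
qed

text \<open>Damp the integral by the factor \<open>std_normal_density (\<delta> * g)\<close>, apply Fubini and let \<open>\<delta>\<close> tend to \<open>0\<close>.\<close>

lemma fourier_inversion_at_0:
  fixes m :: "real \<Rightarrow> real" and P :: "real \<Rightarrow> complex"
  assumes m: "m \<in> borel_measurable borel" "\<And>t. \<bar>m t\<bar> \<le> 1" "isCont m 0"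
    and e: "\<epsilon> = 1 \<or> \<epsilon> = -1"
    and P: "\<And>g. P g = (\<integral>\<zeta>. of_real (m \<zeta>) * iexp (g * \<epsilon> * \<zeta>) \<partial>std_normal)" "integrable lborel P"
  shows "(\<integral>g. P g \<partial>lborel) = of_real (sqrt (2 * pi) * m 0)"
proof -
  interpret N: pair_prob_space std_normal std_normal ..
  note [measurable] = m(1)
  have Pm[measurable]: "P \<in> borel_measurable borel" using P(2) by simp
  let ?\<phi> = std_normal_density
  \<comment> \<open>Fubini passes the damping factor to the characteristic function of the Gaussian,
    which concentrates \<open>m\<close> near 0. The substitutions \<open>x = \<delta> * g\<close>
    and \<open>\<zeta> = \<delta> * \<xi>\<close> produce the same factor \<open>\<delta>\<close> on
    both sides, which cancels.\<close>
  have key: "(\<integral>g. ?\<phi> (\<delta> * g) *\<^sub>R P g \<partial>lborel) = of_real (\<integral>\<xi>. ?\<phi> (\<delta> * \<xi>) * m (\<delta> * \<xi>) * exp (- \<xi>\<^sup>2 / 2) \<partial>lborel)"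
    if d: "\<delta> > 0" for \<delta>
  proof -
    have fint: "integrable (std_normal \<Otimes>\<^sub>M std_normal) (\<lambda>(x, \<zeta>). of_real (m \<zeta>) * iexp (x / \<delta> * \<epsilon> * \<zeta>))"
      by (rule N.P.integrable_const_bound[where B=1]) (auto simp: norm_mult m(2))
    have "(\<integral>x. P (x / \<delta>) \<partial>std_normal) = (\<integral>x. (\<integral>\<zeta>. of_real (m \<zeta>) * iexp (x / \<delta> * \<epsilon> * \<zeta>) \<partial>std_normal) \<partial>std_normal)"
      unfolding P(1) ..
    also have "\<dots> = (\<integral>\<zeta>. (\<integral>x. of_real (m \<zeta>) * iexp (x / \<delta> * \<epsilon> * \<zeta>) \<partial>std_normal) \<partial>std_normal)"
      using N.Fubini_integral[OF fint] by simp
    also have "\<dots> = (\<integral>\<zeta>. of_real (m \<zeta> * exp (- (\<zeta> / \<delta>)\<^sup>2 / 2)) \<partial>std_normal)"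
    proof (rule Bochner_Integration.integral_cong[OF refl])
      fix \<zeta> :: real
      have "(\<integral>x. of_real (m \<zeta>) * iexp (x / \<delta> * \<epsilon> * \<zeta>) \<partial>std_normal) = of_real (m \<zeta>) * (\<integral>x. iexp (x / \<delta> * \<epsilon> * \<zeta>) \<partial>std_normal)"
        by (rule integral_mult_right_zero)
      also have "(\<integral>x. iexp (x / \<delta> * \<epsilon> * \<zeta>) \<partial>std_normal) = char std_normal (\<epsilon> * \<zeta> / \<delta>)"
        unfolding char_def by (intro Bochner_Integration.integral_cong refl) (simp add: mult_ac)
      also have "\<dots> = of_real (exp (- (\<epsilon> * \<zeta> / \<delta>)\<^sup>2 / 2))" by (simp add: char_std_normal_distribution)
      also have "(\<epsilon> * \<zeta> / \<delta>)\<^sup>2 = (\<zeta> / \<delta>)\<^sup>2" using e by auto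
      finally show "(\<integral>x. of_real (m \<zeta>) * iexp (x / \<delta> * \<epsilon> * \<zeta>) \<partial>std_normal) = of_real (m \<zeta> * exp (- (\<zeta> / \<delta>)\<^sup>2 / 2))"
        by simp
    qed
    also have "\<dots> = of_real (\<integral>\<zeta>. m \<zeta> * exp (- (\<zeta> / \<delta>)\<^sup>2 / 2) \<partial>std_normal)"
      by (rule integral_complex_of_real)
    also have "(\<integral>\<zeta>. m \<zeta> * exp (- (\<zeta> / \<delta>)\<^sup>2 / 2) \<partial>std_normal) = (\<integral>\<zeta>. ?\<phi> \<zeta> *\<^sub>R (m \<zeta> * exp (- (\<zeta> / \<delta>)\<^sup>2 / 2)) \<partial>lborel)"
      by (rule integral_density) (auto simp: normal_density_nonneg)
    also have "\<dots> = \<delta> * (\<integral>\<xi>. ?\<phi> (\<delta> * \<xi>) * m (\<delta> * \<xi>) * exp (- \<xi>\<^sup>2 / 2) \<partial>lborel)"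
      using d by (subst lborel_integral_real_affine[where c=\<delta> and t=0]) (auto simp: mult.assoc)
    finally have 1: "(\<integral>x. P (x / \<delta>) \<partial>std_normal) = of_real (\<delta> * (\<integral>\<xi>. ?\<phi> (\<delta> * \<xi>) * m (\<delta> * \<xi>) * exp (- \<xi>\<^sup>2 / 2) \<partial>lborel))" .
    have "(\<integral>x. P (x / \<delta>) \<partial>std_normal) = (\<integral>x. ?\<phi> x *\<^sub>R P (x / \<delta>) \<partial>lborel)"
      by (rule integral_density) (auto simp: normal_density_nonneg)
    also have "\<dots> = \<delta> *\<^sub>R (\<integral>g. ?\<phi> (\<delta> * g) *\<^sub>R P g \<partial>lborel)"
      using d by (subst lborel_integral_real_affine[where c=\<delta> and t=0]) auto
    finally have 2: "(\<integral>x. P (x / \<delta>) \<partial>std_normal) = \<delta> *\<^sub>R (\<integral>g. ?\<phi> (\<delta> * g) *\<^sub>R P g \<partial>lborel)" .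
    have "\<delta> *\<^sub>R (\<integral>g. ?\<phi> (\<delta> * g) *\<^sub>R P g \<partial>lborel) = \<delta> *\<^sub>R of_real (\<integral>\<xi>. ?\<phi> (\<delta> * \<xi>) * m (\<delta> * \<xi>) * exp (- \<xi>\<^sup>2 / 2) \<partial>lborel)"
      unfolding 2[symmetric] 1 by (simp add: scaleR_conv_of_real)
    then show ?thesis using d by (simp only: scaleR_cancel_left) auto
  qed
  define d where "d n = 1 / (real n + 1)" for n
  have dpos: "d n > 0" for n by (simp add: d_def)
  have d0: "d \<longlonglongrightarrow> 0" unfolding d_def by real_asymp
  have phile: "?\<phi> x \<le> 1" for x
  proof -
    have "1\<^sup>2 \<le> 2 * pi" using pi_gt3 by simp
    then have "1 \<le> sqrt (2 * pi)" by (rule real_le_rsqrt)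
    then have "exp (- x\<^sup>2 / 2) \<le> sqrt (2 * pi)" by (rule order_trans[rotated]) simp
    then have "exp (- x\<^sup>2 / 2) / sqrt (2 * pi) \<le> 1" by (simp add: divide_le_eq_1)
    then show ?thesis by (simp add: std_normal_density_def)
  qed
  have phicont: "(\<lambda>n. ?\<phi> (d n * x)) \<longlonglongrightarrow> ?\<phi> 0" for x
  proof -
    have "isCont ?\<phi> 0" unfolding std_normal_density_def by (intro continuous_intros) auto
    moreover have "(\<lambda>n. d n * x) \<longlonglongrightarrow> 0" using tendsto_mult_left_zero[OF d0] .
    ultimately show ?thesis by (rule isCont_tendsto_compose)
  qed
  have "(\<lambda>n. \<integral>g. ?\<phi> (d n * g) *\<^sub>R P g \<partial>lborel) \<longlonglongrightarrow> (\<integral>g. ?\<phi> 0 *\<^sub>R P g \<partial>lborel)"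
  proof (rule integral_dominated_convergence[where w="\<lambda>g. norm (P g)"])
    show "AE g in lborel. (\<lambda>n. ?\<phi> (d n * g) *\<^sub>R P g) \<longlonglongrightarrow> ?\<phi> 0 *\<^sub>R P g"
      by (intro AE_I2 tendsto_scaleR phicont tendsto_const)
    show "AE g in lborel. norm (?\<phi> (d n * g) *\<^sub>R P g) \<le> norm (P g)" for n
      using phile by (intro AE_I2) (simp add: normal_density_nonneg mult_left_le_one_le)
  qed (use P(2) in auto)
  then have L1: "(\<lambda>n. \<integral>g. ?\<phi> (d n * g) *\<^sub>R P g \<partial>lborel) \<longlonglongrightarrow> ?\<phi> 0 *\<^sub>R (\<integral>g. P g \<partial>lborel)" by simp
  have ge: "integrable lborel (\<lambda>\<xi>::real. exp (- \<xi>\<^sup>2 / 2))" using integrable_gauss_real[of 0] by simp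
  have "(\<lambda>n. \<integral>\<xi>. ?\<phi> (d n * \<xi>) * m (d n * \<xi>) * exp (- \<xi>\<^sup>2 / 2) \<partial>lborel) \<longlonglongrightarrow> (\<integral>\<xi>. ?\<phi> 0 * m 0 * exp (- \<xi>\<^sup>2 / 2) \<partial>lborel)"
  proof (rule integral_dominated_convergence[where w="\<lambda>\<xi>. exp (- \<xi>\<^sup>2 / 2)"])
    show "AE \<xi> in lborel. (\<lambda>n. ?\<phi> (d n * \<xi>) * m (d n * \<xi>) * exp (- \<xi>\<^sup>2 / 2)) \<longlonglongrightarrow> ?\<phi> 0 * m 0 * exp (- \<xi>\<^sup>2 / 2)"
    proof (intro AE_I2 tendsto_mult phicont tendsto_const)
      fix \<xi> :: real
      have "(\<lambda>n. d n * \<xi>) \<longlonglongrightarrow> 0" using tendsto_mult_left_zero[OF d0] .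
      with m(3) show "(\<lambda>n. m (d n * \<xi>)) \<longlonglongrightarrow> m 0" by (rule isCont_tendsto_compose)
    qed
    show "AE \<xi> in lborel. norm (?\<phi> (d n * \<xi>) * m (d n * \<xi>) * exp (- \<xi>\<^sup>2 / 2)) \<le> exp (- \<xi>\<^sup>2 / 2)" for n
    proof (intro AE_I2)
      fix \<xi> :: real
      have "\<bar>?\<phi> (d n * \<xi>) * m (d n * \<xi>)\<bar> \<le> 1 * 1"
        unfolding abs_mult using phile m(2) by (intro mult_mono) (auto simp: normal_density_nonneg)
      then show "norm (?\<phi> (d n * \<xi>) * m (d n * \<xi>) * exp (- \<xi>\<^sup>2 / 2)) \<le> exp (- \<xi>\<^sup>2 / 2)"
        by (simp add: abs_mult)
    qed
  qed (use ge in auto)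
  also have "(\<integral>\<xi>. ?\<phi> 0 * m 0 * exp (- \<xi>\<^sup>2 / 2) \<partial>lborel) = ?\<phi> 0 * m 0 * sqrt (2 * pi)"
  proof -
    have "(\<integral>\<xi>. exp (- \<xi>\<^sup>2 / 2) \<partial>lborel) = (\<integral>\<xi>. sqrt (2 * pi) * ?\<phi> \<xi> \<partial>lborel)"
      by (rule Bochner_Integration.integral_cong) (auto simp: std_normal_density_def)
    also have "\<dots> = sqrt (2 * pi)" by simp
    finally show ?thesis by simp
  qed
  finally have "(\<lambda>n. complex_of_real (\<integral>\<xi>. ?\<phi> (d n * \<xi>) * m (d n * \<xi>) * exp (- \<xi>\<^sup>2 / 2) \<partial>lborel)) \<longlonglongrightarrow> of_real (?\<phi> 0 * m 0 * sqrt (2 * pi))"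
    by (rule tendsto_of_real)
  then have "(\<lambda>n. \<integral>g. ?\<phi> (d n * g) *\<^sub>R P g \<partial>lborel) \<longlonglongrightarrow> of_real (?\<phi> 0 * m 0 * sqrt (2 * pi))"
    by (simp only: key[OF dpos])
  from LIMSEQ_unique[OF L1 this] have "?\<phi> 0 *\<^sub>R (\<integral>g. P g \<partial>lborel) = ?\<phi> 0 *\<^sub>R of_real (sqrt (2 * pi) * m 0)"
    by (simp add: scaleR_conv_of_real mult_ac)
  moreover have "?\<phi> 0 \<noteq> 0" using normal_density_pos[of 1 0 0] by simp
  ultimately show ?thesis by (simp only: scaleR_cancel_left) auto
qed

text \<open>\<open>m t\<close> is the probability of correct signs when the coordinate along the
  ones is held at \<open>t\<close>, so \<open>m 0\<close> is the solid angle. Against the density of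
  \<open>g\<close> the product of the \<open>Phi\<close> values becomes \<open>P\<close> times
  \<open>1 / sqrt (2 * pi)\<close>, and inversion at 0 evaluates its integral.\<close>

lemma ang_eq_Phi_integral:
  assumes K: "finite K" "card K = Suc k" "k \<ge> 1" and y: "\<And>j. j \<in> K \<Longrightarrow> y j = 1 \<or> y j = (-1::real)"
  shows "integrable std_normal (\<lambda>g. \<Prod>j\<in>K. Phi k (\<i> * of_real (y j * g)))"
    and "(\<integral>g. (\<Prod>j\<in>K. Phi k (\<i> * of_real (y j * g))) \<partial>std_normal) = of_real (ang K y)"
proof -
  note [simp] = K(1)
  obtain k0 where k0: "k0 \<in> K" using K by fastforce
  obtain T \<tau> where T: "good K T" "\<tau>\<^sup>2 = real (card K)" "\<tau> \<noteq> 0"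
    "\<And>j. j \<in> K \<Longrightarrow> T k0 j = 1 / \<tau>" "\<And>j. j \<in> K \<Longrightarrow> app K T (\<lambda>_. 1) j = (if j = k0 then \<tau> else 0)"
    by (rule frame[OF K(1) k0], rule that)
  have iso: "isom K T" using T(1) by (simp add: good_def)
  define P where "P g = (\<Prod>j\<in>K. hchi (y j) (g / sqrt (real k + 1)))" for g
  have Pint: "integrable lborel P" unfolding P_def[abs_def] by (rule integrable_prod_hchi[OF K y])
  define W where "W j X = ip (K - {k0}) (\<lambda>k. T k j) (\<lambda>k. X (k, 0))" for j and X :: "nat \<times> nat \<Rightarrow> real"
  have Wm[measurable]: "W j \<in> borel_measurable Om" for j unfolding W_def[abs_def] by measurable
  define m where "m t = measure Om {X. \<forall>j\<in>K. y j * (W j X + t / \<tau>) > 0}" for t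
  have ms: "{X. \<forall>j\<in>K. y j * (W j X + t / \<tau>) > 0} \<in> sets Om" for t
  proof -
    have "Measurable.pred Om (\<lambda>X. \<forall>j\<in>K. y j * (W j X + t / \<tau>) > 0)" by measurable
    then show ?thesis by (simp add: pred_def)
  qed
  have mm: "m \<in> borel_measurable borel"
  proof -
    have "Measurable.pred (borel \<Otimes>\<^sub>M Om) (\<lambda>z. \<forall>j\<in>K. y j * (W j (snd z) + fst z / \<tau>) > 0)" by measurable
    then have "Measurable.pred (std_normal \<Otimes>\<^sub>M Om) (\<lambda>z. \<forall>j\<in>K. y j * (W j (snd z) + fst z / \<tau>) > 0)"
      by (simp add: measurable_cong_sets[OF sets_pair_measure_cong[OF _ refl], of std_normal borel])
    from prob_pair_fubini(2)[OF prob_space_std_normal prob_space_Om this]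
    show ?thesis by (simp add: m_def[abs_def])
  qed
  define \<epsilon> where "\<epsilon> = \<tau> / sqrt (real k + 1)"
  have "\<epsilon>\<^sup>2 = 1" using T(2) K(2) by (simp add: \<epsilon>_def power_divide)
  then have eps: "\<epsilon> = 1 \<or> \<epsilon> = -1" by (simp add: power2_eq_1_iff)
  have Wnz: "AE X in Om. \<forall>j\<in>K. W j X \<noteq> 0"
  proof (rule AE_finite_allI[OF K(1)])
    fix j assume j: "j \<in> K"
    have "(T k0 j)\<^sup>2 = 1 / real (card K)" using T(2) T(4)[OF j] by (simp add: power_divide)
    then obtain k1 where "k1 \<in> K - {k0}" "T k1 j \<noteq> 0"
      using frame_forms_nonzero[OF K(1) k0 j iso] K by auto
    then show "AE X in Om. W j X \<noteq> 0" unfolding W_def using AE_column_form_nonzero[of "K - {k0}" k1 "\<lambda>k. T k j"] by simp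
  qed
  \<comment> \<open>Almost surely no form \<open>W j\<close> vanishes, so every sign is stable under
    a small shift; dominated convergence passes this to \<open>m\<close>.\<close>
  have cont: "isCont m 0"
  proof (rule continuous_at_sequentiallyI)
    fix t :: "nat \<Rightarrow> real" assume t: "t \<longlonglongrightarrow> 0"
    have "(\<lambda>n. \<integral>X. indicator {X. \<forall>j\<in>K. y j * (W j X + t n / \<tau>) > 0} X \<partial>Om) \<longlonglongrightarrow>
        (\<integral>X. indicator {X. \<forall>j\<in>K. y j * (W j X + 0 / \<tau>) > 0} X \<partial>Om :: real)"
    proof (rule integral_dominated_convergence[where w="\<lambda>_. 1"])
      show "AE X in Om. (\<lambda>n. indicator {X. \<forall>j\<in>K. y j * (W j X + t n / \<tau>) > 0} X) \<longlonglongrightarrow>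
          (indicator {X. \<forall>j\<in>K. y j * (W j X + 0 / \<tau>) > 0} X :: real)"
        using Wnz
      proof eventually_elim
        case (elim X)
        have "\<forall>\<^sub>F n in sequentially. \<forall>j\<in>K. (y j * (W j X + t n / \<tau>) > 0) = (y j * W j X > 0)"
        proof (rule eventually_ball_finite[OF K(1)], rule ballI)
          fix j assume j: "j \<in> K"
          have lim: "(\<lambda>n. y j * (W j X + t n / \<tau>)) \<longlonglongrightarrow> y j * (W j X + 0 / \<tau>)"
            using T(3) by (intro tendsto_intros t) auto
          have "y j * W j X \<noteq> 0" using elim j y[OF j] by auto
          then consider "y j * W j X > 0" | "y j * W j X < 0" by linarith
          then show "\<forall>\<^sub>F n in sequentially. (y j * (W j X + t n / \<tau>) > 0) = (y j * W j X > 0)"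
          proof cases
            case 1
            then have "\<forall>\<^sub>F n in sequentially. y j * (W j X + t n / \<tau>) > 0" using order_tendstoD(1)[OF lim, of 0] by simp
            then show ?thesis using 1 by (auto elim: eventually_mono)
          next
            case 2
            then have "\<forall>\<^sub>F n in sequentially. y j * (W j X + t n / \<tau>) < 0" using order_tendstoD(2)[OF lim, of 0] by simp
            then show ?thesis using 2 by (auto elim!: eventually_mono)
          qed
        qed
        then show ?case by (intro tendsto_eventually) (auto elim!: eventually_mono simp: indicator_def)
      qed
    qed (use ms in auto)
    then show "(\<lambda>n. m (t n)) \<longlonglongrightarrow> m 0" by (simp add: m_def)
  qed
  have PF: "P g = (\<integral>\<zeta>. of_real (m \<zeta>) * iexp (g * \<epsilon> * \<zeta>) \<partial>std_normal)" for g
    unfolding P_def m_def W_def \<epsilon>_def by (rule prod_hchi_fourier[OF K(1) k0 K(2) T])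
  have I: "(\<integral>g. P g \<partial>lborel) = of_real (sqrt (2 * pi) * m 0)"
    by (rule fourier_inversion_at_0[OF mm _ cont eps PF Pint]) (simp add: m_def)
  have m0: "m 0 = ang K y"
  proof -
    have "m 0 = measure Om {X. cone (K - {k0}) K (\<lambda>j k. y j * T k j) (\<lambda>k. X (k, 0))}"
      by (simp add: m_def W_def cone_def ip_def sum_distrib_left mult.assoc)
    also have "\<dots> = ang K y" by (rule ang_frame[OF K(1) k0 T])
    finally show ?thesis .
  qed
  have eq: "(\<Prod>j\<in>K. Phi k (\<i> * of_real (y j * g))) = of_real (exp (g\<^sup>2 / 2)) * P g" for g
  proof -
    have "(\<Prod>j\<in>K. Phi k (\<i> * of_real (y j * g))) =
        (\<Prod>j\<in>K. of_real (exp (g\<^sup>2 / (2 * (real k + 1)))) * hchi (y j) (g / sqrt (real k + 1)))"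
      by (rule prod.cong[OF refl], rule Phi_imag, rule y)
    also have "\<dots> = of_real (exp (g\<^sup>2 / (2 * (real k + 1))) ^ card K) * P g"
      by (simp add: prod.distrib P_def)
    also have "exp (g\<^sup>2 / (2 * (real k + 1))) ^ card K = exp (g\<^sup>2 / 2)"
    proof -
      have "real (card K) * (g\<^sup>2 / (2 * (real k + 1))) = g\<^sup>2 / 2" using K(2) by (simp add: field_simps)
      then show ?thesis by (simp only: exp_of_nat_mult[symmetric])
    qed
    finally show ?thesis .
  qed
  have Pm[measurable]: "P \<in> borel_measurable borel" using Pint by simp
  have dens: "std_normal_density g *\<^sub>R (of_real (exp (g\<^sup>2 / 2)) * P g) = of_real (1 / sqrt (2 * pi)) * P g" for g
    by (simp add: std_normal_density_def scaleR_conv_of_real exp_minus field_simps flip: of_real_mult)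
  show "integrable std_normal (\<lambda>g. \<Prod>j\<in>K. Phi k (\<i> * of_real (y j * g)))"
    unfolding eq
  proof (subst integrable_density)
    show "integrable lborel (\<lambda>g. std_normal_density g *\<^sub>R (of_real (exp (g\<^sup>2 / 2)) * P g))"
      unfolding dens by (intro integrable_mult_right Pint)
  qed (auto simp: normal_density_nonneg)
  have "(\<integral>g. (\<Prod>j\<in>K. Phi k (\<i> * of_real (y j * g))) \<partial>std_normal) =
      (\<integral>g. std_normal_density g *\<^sub>R (of_real (exp (g\<^sup>2 / 2)) * P g) \<partial>lborel)"
    unfolding eq by (rule integral_density) (auto simp: normal_density_nonneg)
  also have "\<dots> = of_real (1 / sqrt (2 * pi)) * (\<integral>g. P g \<partial>lborel)" unfolding dens by (rule integral_mult_right_zero)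
  also have "\<dots> = of_real (ang K y)" unfolding I m0 by simp
  finally show "(\<integral>g. (\<Prod>j\<in>K. Phi k (\<i> * of_real (y j * g))) \<partial>std_normal) = of_real (ang K y)" .
qed

subsection \<open>Recursion in the dimension\<close>

text \<open>Finitely many strict inequalities survive a small change of the coefficients. Finite
  lists of rationals are countable, so separability becomes a countable union of measurable
  events.\<close>

lemma rational_strict_solution:
  fixes a :: "'i \<Rightarrow> nat \<Rightarrow> real"
  assumes "finite S" "\<And>j. j \<in> S \<Longrightarrow> (\<Sum>c\<le>m. \<beta> c * a j c) > 0"
  shows "\<exists>xs::rat list. \<forall>j\<in>S. (\<Sum>c\<le>m. of_rat (nth_default 0 xs c) * a j c) > 0"
proof -
  define e where "e j = (\<Sum>c\<le>m. \<beta> c * a j c) / (1 + (\<Sum>c\<le>m. \<bar>a j c\<bar>))" for j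
  have den: "1 + (\<Sum>c\<le>m. \<bar>a j c\<bar>) > 0" for j
    by (rule add_pos_nonneg) (auto intro: sum_nonneg)
  have ep: "e j > 0" if "j \<in> S" for j unfolding e_def using assms(2)[OF that] den by simp
  define \<epsilon> where "\<epsilon> = Min (insert 1 (e ` S))"
  have e0: "\<epsilon> > 0" unfolding \<epsilon>_def using assms(1) ep by (subst Min_gr_iff) auto
  have el: "\<epsilon> \<le> e j" if "j \<in> S" for j unfolding \<epsilon>_def using assms(1) that by (intro Min_le) auto
  have "\<forall>c. \<exists>q::rat. \<bar>of_rat q - \<beta> c\<bar> < \<epsilon>"
  proof
    fix c
    obtain q where "\<beta> c < real_of_rat q" "real_of_rat q < \<beta> c + \<epsilon>"
      using of_rat_dense[of "\<beta> c" "\<beta> c + \<epsilon>"] e0 by auto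
    then show "\<exists>q::rat. \<bar>of_rat q - \<beta> c\<bar> < \<epsilon>" by (intro exI[of _ q]) auto
  qed
  then obtain q :: "nat \<Rightarrow> rat" where q: "\<And>c. \<bar>of_rat (q c) - \<beta> c\<bar> < \<epsilon>" by metis
  define xs where "xs = map q [0..<Suc m]"
  have xs: "nth_default 0 xs c = q c" if "c \<le> m" for c
    using that by (simp add: xs_def nth_default_def del: upt_Suc)
  have "(\<Sum>c\<le>m. of_rat (nth_default 0 xs c) * a j c) > 0" if j: "j \<in> S" for j
  proof -
    have "(\<Sum>c\<le>m. of_rat (nth_default 0 xs c) * a j c) = (\<Sum>c\<le>m. \<beta> c * a j c) + (\<Sum>c\<le>m. (of_rat (q c) - \<beta> c) * a j c)"
      unfolding sum.distrib[symmetric] by (rule sum.cong) (simp_all add: xs algebra_simps)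
    moreover have "\<bar>\<Sum>c\<le>m. (of_rat (q c) - \<beta> c) * a j c\<bar> \<le> (\<Sum>c\<le>m. \<epsilon> * \<bar>a j c\<bar>)"
      by (rule order_trans[OF sum_abs sum_mono]) (simp add: abs_mult mult_right_mono less_imp_le[OF q])
    moreover have "(\<Sum>c\<le>m. \<epsilon> * \<bar>a j c\<bar>) < (\<Sum>c\<le>m. \<beta> c * a j c)"
    proof -
      have "(\<Sum>c\<le>m. \<epsilon> * \<bar>a j c\<bar>) = \<epsilon> * (\<Sum>c\<le>m. \<bar>a j c\<bar>)" by (simp add: sum_distrib_left)
      also have "\<dots> < \<epsilon> * (1 + (\<Sum>c\<le>m. \<bar>a j c\<bar>))" using e0 by simp
      also have "\<dots> \<le> e j * (1 + (\<Sum>c\<le>m. \<bar>a j c\<bar>))" using el[OF j] den[of j] by (intro mult_right_mono) auto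
      also have "\<dots> = (\<Sum>c\<le>m. \<beta> c * a j c)" unfolding e_def using den[of j] by simp
      finally show ?thesis .
    qed
    ultimately show ?thesis by linarith
  qed
  then show ?thesis by blast
qed

lemma measurable_row [measurable]: "(\<lambda>X. row X j c) \<in> borel_measurable Om"
  by (cases c) (simp_all add: row_def)

lemma measurable_aff [measurable]: "(\<lambda>X. aff X m \<beta> j) \<in> borel_measurable Om"
  unfolding aff_def by measurable

lemma measurable_sep:
  assumes [simp]: "finite S"
  shows "Measurable.pred Om (sep S y m)"
proof -
  have "sep S y m X \<longleftrightarrow> (\<exists>xs::rat list. \<forall>j\<in>S. y j * aff X m (\<lambda>c. of_rat (nth_default 0 xs c)) j > 0)" for X
  proof
    assume "sep S y m X"
    then obtain \<beta> where "\<And>j. j \<in> S \<Longrightarrow> (\<Sum>c\<le>m. \<beta> c * (y j * row X j c)) > 0"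
      unfolding sep_def aff_def by (auto simp: sum_distrib_left mult_ac)
    then have "\<exists>xs::rat list. \<forall>j\<in>S. (\<Sum>c\<le>m. of_rat (nth_default 0 xs c) * (y j * row X j c)) > 0"
      using assms by (intro rational_strict_solution[where \<beta> = \<beta>]) blast+
    then show "\<exists>xs::rat list. \<forall>j\<in>S. y j * aff X m (\<lambda>c. of_rat (nth_default 0 xs c)) j > 0"
      unfolding aff_def by (simp add: sum_distrib_left mult_ac)
  qed (auto simp: sep_def)
  then have "sep S y m = (\<lambda>X. \<exists>xs::rat list. \<forall>j\<in>S. y j * aff X m (\<lambda>c. of_rat (nth_default 0 xs c)) j > 0)"
    by (simp add: fun_eq_iff)
  then show ?thesis by simp
qed

lemma measurable_seppos:
  assumes [simp]: "finite S"
  shows "Measurable.pred Om (seppos S y m)"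
proof -
  have "seppos S y m X \<longleftrightarrow> (\<exists>xs::rat list. nth_default 0 xs m > 0 \<and> (\<forall>j\<in>S. y j * aff X m (\<lambda>c. of_rat (nth_default 0 xs c)) j > 0))" for X
  proof
    assume "seppos S y m X"
    then obtain \<beta> where b: "\<beta> m > 0" "\<And>j. j \<in> S \<Longrightarrow> (\<Sum>c\<le>m. \<beta> c * (y j * row X j c)) > 0"
      unfolding seppos_def aff_def by (auto simp: sum_distrib_left mult_ac)
    \<comment> \<open>The extra constraint \<open>None\<close> encodes that the last coefficient is
      positive.\<close>
    let ?a = "\<lambda>j c. case j of None \<Rightarrow> if c = m then 1 else 0 | Some j \<Rightarrow> y j * row X j c"
    have last: "(\<Sum>c\<le>m. \<gamma> c * (if c = m then 1 else 0)) = \<gamma> m" for \<gamma> :: "nat \<Rightarrow> real"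
    proof -
      have "(\<Sum>c\<le>m. \<gamma> c * (if c = m then 1 else 0)) = (\<Sum>c\<le>m. if c = m then \<gamma> c else 0)" by (intro sum.cong) auto
      then show ?thesis by simp
    qed
    have "(\<Sum>c\<le>m. \<beta> c * ?a j c) > 0" if "j \<in> insert None (Some ` S)" for j
      using that b last[of \<beta>] by auto
    then have "\<exists>xs::rat list. \<forall>j\<in>insert None (Some ` S). (\<Sum>c\<le>m. of_rat (nth_default 0 xs c) * ?a j c) > 0"
      using assms by (intro rational_strict_solution[where \<beta> = \<beta>]) blast+
    then obtain xs :: "rat list" where
      xs: "\<And>j. j\<in>insert None (Some ` S) \<Longrightarrow> (\<Sum>c\<le>m. of_rat (nth_default 0 xs c) * ?a j c) > 0" by blast
    have "real_of_rat (nth_default 0 xs m) > 0" using xs[of None] last[of "\<lambda>c. of_rat (nth_default 0 xs c)"] by simp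
    moreover have "y j * aff X m (\<lambda>c. of_rat (nth_default 0 xs c)) j > 0" if "j \<in> S" for j
      using xs[of "Some j"] that unfolding aff_def by (simp add: sum_distrib_left mult_ac)
    ultimately show "\<exists>xs::rat list. nth_default 0 xs m > 0 \<and> (\<forall>j\<in>S. y j * aff X m (\<lambda>c. of_rat (nth_default 0 xs c)) j > 0)"
      by (intro exI[of _ xs]) auto
  next
    assume "\<exists>xs::rat list. nth_default 0 xs m > 0 \<and> (\<forall>j\<in>S. y j * aff X m (\<lambda>c. of_rat (nth_default 0 xs c)) j > 0)"
    then obtain xs :: "rat list" where "nth_default 0 xs m > 0" "\<forall>j\<in>S. y j * aff X m (\<lambda>c. of_rat (nth_default 0 xs c)) j > 0" by blast
    then show "seppos S y m X" unfolding seppos_def by (intro exI[of _ "\<lambda>c. of_rat (nth_default 0 xs c)"]) auto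
  qed
  then have "seppos S y m = (\<lambda>X. \<exists>xs::rat list. nth_default 0 xs m > 0 \<and> (\<forall>j\<in>S. y j * aff X m (\<lambda>c. of_rat (nth_default 0 xs c)) j > 0))"
    by (simp add: fun_eq_iff)
  then show ?thesis by simp
qed

lemma sets_seppos: "finite S \<Longrightarrow> {X. seppos S y m X} \<in> sets Om"
  using measurable_seppos[of S y m] by (simp add: pred_def)

section \<open>Symmetry under a sign change of the last feature\<close>

lemma aff_unit: "aff X (Suc m) (\<lambda>c. if c = Suc m then 1 else 0) j = X (j, m)"
  unfolding aff_Suc aff_def by (simp add: row_def)

lemma sep_perturb:
  assumes "finite S" "\<And>j. j \<in> S \<Longrightarrow> y j * aff X (Suc m) \<beta> j > 0"
  shows "\<exists>\<epsilon>>0. \<forall>j\<in>S. y j * aff X (Suc m) (\<lambda>c. \<beta> c + \<epsilon> * (s * (if c = Suc m then 1 else 0))) j > 0"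
proof -
  have "\<exists>\<epsilon>>0. \<forall>j\<in>S. y j * aff X (Suc m) \<beta> j + \<epsilon> * (y j * (s * X (j, m))) > 0"
    using small_perturbation[OF assms(1), of "\<lambda>j. y j * aff X (Suc m) \<beta> j" "\<lambda>j. y j * (s * X (j, m))"] assms(2) by blast
  then show ?thesis unfolding aff_add aff_scale aff_unit by (simp add: algebra_simps)
qed

lemma sep_imp_sep_Suc:
  assumes "sep S y m X"
  shows "\<exists>\<beta>. \<beta> (Suc m) = 0 \<and> (\<forall>j\<in>S. y j * aff X (Suc m) \<beta> j > 0)"
proof -
  from assms obtain \<beta> where b: "\<forall>j\<in>S. y j * aff X m \<beta> j > 0" unfolding sep_def by blast
  then show ?thesis by (intro exI[of _ "\<beta>(Suc m := 0)"]) (simp add: aff_Suc aff_upd)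
qed

lemma seppos_imp_sep: "seppos S y m X \<Longrightarrow> sep S y m X"
  unfolding seppos_def sep_def by blast

lemma sep_imp_seppos_Suc:
  assumes "finite S" "sep S y m X"
  shows "seppos S y (Suc m) X"
proof -
  obtain \<beta> where b: "\<beta> (Suc m) = 0" "\<And>j. j\<in>S \<Longrightarrow> y j * aff X (Suc m) \<beta> j > 0" using sep_imp_sep_Suc[OF assms(2)] by blast
  obtain \<epsilon> where "\<epsilon> > 0" "\<forall>j\<in>S. y j * aff X (Suc m) (\<lambda>c. \<beta> c + \<epsilon> * (1 * (if c = Suc m then 1 else 0))) j > 0"
    using sep_perturb[OF assms(1) b(2)] by blast
  then show ?thesis unfolding seppos_def
    by (intro exI[of _ "\<lambda>c. \<beta> c + \<epsilon> * (1 * (if c = Suc m then 1 else 0))"]) (use b in auto)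
qed

definition flipcol :: "nat \<Rightarrow> (nat \<times> nat \<Rightarrow> real) \<Rightarrow> nat \<times> nat \<Rightarrow> real" where
  "flipcol m X = (\<lambda>p. (if snd p = m then - 1 else 1) * X p)"

lemma mpres_flipcol: "mpres (flipcol m)"
  unfolding flipcol_def by (rule mpres_signs) auto

lemma aff_flipcol: "aff (flipcol m X) (Suc m) \<beta> j = aff X (Suc m) (\<beta>(Suc m := - \<beta> (Suc m))) j"
proof -
  have "aff (flipcol m X) m \<beta> j = aff X m \<beta> j"
    unfolding aff_def by (intro sum.cong) (auto simp: row_def flipcol_def split: nat.split)
  then show ?thesis by (simp add: aff_Suc aff_upd flipcol_def)
qed

lemma seppos_flipcol: "seppos S y (Suc m) (flipcol m X) \<longleftrightarrow> (\<exists>\<beta>. \<beta> (Suc m) < 0 \<and> (\<forall>j\<in>S. y j * aff X (Suc m) \<beta> j > 0))"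
proof
  assume "seppos S y (Suc m) (flipcol m X)"
  then obtain \<beta> where "\<beta> (Suc m) > 0" "\<forall>j\<in>S. y j * aff X (Suc m) (\<beta>(Suc m := - \<beta> (Suc m))) j > 0"
    unfolding seppos_def aff_flipcol by blast
  then show "\<exists>\<beta>. \<beta> (Suc m) < 0 \<and> (\<forall>j\<in>S. y j * aff X (Suc m) \<beta> j > 0)"
    by (intro exI[of _ "\<beta>(Suc m := - \<beta> (Suc m))"]) auto
next
  assume "\<exists>\<beta>. \<beta> (Suc m) < 0 \<and> (\<forall>j\<in>S. y j * aff X (Suc m) \<beta> j > 0)"
  then obtain \<beta> where b: "\<beta> (Suc m) < 0" "\<forall>j\<in>S. y j * aff X (Suc m) \<beta> j > 0" by blast
  let ?b = "\<beta>(Suc m := - \<beta> (Suc m))"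
  have "?b(Suc m := - ?b (Suc m)) = \<beta>" by (simp add: fun_eq_iff)
  then show "seppos S y (Suc m) (flipcol m X)" unfolding seppos_def aff_flipcol
    using b by (intro exI[of _ ?b]) simp
qed

text \<open>Inclusion-exclusion for positive and negative last coefficient, two events exchanged by
  \<open>flipcol\<close>. A coefficient 0 can be perturbed to either sign; this completes the union
  and gives one inclusion for the intersection.\<close>

lemma prob_seppos:
  assumes S: "finite S"
  shows "2 * measure Om {X. seppos S y (Suc m) X} = measure Om {X. sep S y (Suc m) X} + measure Om {X. sep S y m X}"
proof -
  let ?A = "{X. seppos S y (Suc m) X}" and ?B = "{X. seppos S y (Suc m) (flipcol m X)}"
  have B: "?B \<in> sets Om"
    using measurable_compose[OF mpres_measurable[OF mpres_flipcol] measurable_seppos[OF S]] by (simp add: pred_def)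
  have A: "?A \<in> sets Om" by (rule sets_seppos[OF S])
  have un: "?A \<union> ?B = {X. sep S y (Suc m) X}"
  proof (intro equalityI subsetI)
    fix X assume "X \<in> {X. sep S y (Suc m) X}"
    then obtain \<beta> where b: "\<And>j. j \<in> S \<Longrightarrow> y j * aff X (Suc m) \<beta> j > 0" unfolding sep_def by blast
    consider "\<beta> (Suc m) > 0" | "\<beta> (Suc m) < 0" | "\<beta> (Suc m) = 0" by linarith
    then show "X \<in> ?A \<union> ?B"
    proof cases
      case 1
      then show ?thesis using b unfolding seppos_def by blast
    next
      case 2
      then show ?thesis using b unfolding seppos_flipcol by blast
    next
      case 3
      obtain \<epsilon> where "\<epsilon> > 0" "\<forall>j\<in>S. y j * aff X (Suc m) (\<lambda>c. \<beta> c + \<epsilon> * (1 * (if c = Suc m then 1 else 0))) j > 0"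
        using sep_perturb[OF S b] by blast
      then have "seppos S y (Suc m) X" unfolding seppos_def
        by (intro exI[of _ "\<lambda>c. \<beta> c + \<epsilon> * (1 * (if c = Suc m then 1 else 0))"]) (use 3 in auto)
      then show ?thesis by blast
    qed
  qed (auto simp: seppos_flipcol intro: seppos_imp_sep, auto simp: sep_def)
  have int: "?A \<inter> ?B = {X. sep S y m X}"
  proof (intro equalityI subsetI)
    fix X assume "X \<in> ?A \<inter> ?B"
    then have sA: "seppos S y (Suc m) X" and sB: "seppos S y (Suc m) (flipcol m X)" by simp_all
    from sA obtain \<beta> where b: "\<beta> (Suc m) > 0" "\<And>j. j \<in> S \<Longrightarrow> y j * aff X (Suc m) \<beta> j > 0"
      unfolding seppos_def by blast
    from sB obtain \<gamma> where g: "\<gamma> (Suc m) < 0" "\<And>j. j \<in> S \<Longrightarrow> y j * aff X (Suc m) \<gamma> j > 0"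
      unfolding seppos_flipcol by blast
    \<comment> \<open>The weight for which the last coefficients cancel in \<open>d\<close>; it is
      positive because they have opposite signs.\<close>
    define t where "t = - \<beta> (Suc m) / \<gamma> (Suc m)"
    have t: "t > 0" using b g by (simp add: t_def divide_pos_neg)
    define d where "d = (\<lambda>c. \<beta> c + t * \<gamma> c)"
    have "d (Suc m) = 0" using g by (simp add: d_def t_def)
    moreover have "y j * aff X (Suc m) d j > 0" if "j \<in> S" for j
    proof -
      have "y j * aff X (Suc m) d j = y j * aff X (Suc m) \<beta> j + t * (y j * aff X (Suc m) \<gamma> j)"
        unfolding d_def aff_add by (simp add: algebra_simps)
      then show ?thesis using b(2)[OF that] g(2)[OF that] t by (simp add: add_pos_pos)
    qed
    ultimately show "X \<in> {X. sep S y m X}" unfolding sep_def aff_Suc by auto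
  next
    fix X assume "X \<in> {X. sep S y m X}"
    then have s: "sep S y m X" by simp
    obtain \<beta> where b: "\<beta> (Suc m) = 0" "\<And>j. j\<in>S \<Longrightarrow> y j * aff X (Suc m) \<beta> j > 0" using sep_imp_sep_Suc[OF s] by blast
    obtain \<epsilon> where e: "\<epsilon> > 0" "\<forall>j\<in>S. y j * aff X (Suc m) (\<lambda>c. \<beta> c + \<epsilon> * (- 1 * (if c = Suc m then 1 else 0))) j > 0"
      using sep_perturb[OF S b(2)] by blast
    have "X \<in> ?B" unfolding seppos_flipcol mem_Collect_eq
      by (intro exI[of _ "\<lambda>c. \<beta> c + \<epsilon> * (- 1 * (if c = Suc m then 1 else 0))"]) (use b e in auto)
    moreover have "X \<in> ?A" using sep_imp_seppos_Suc[OF S s] by simp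
    ultimately show "X \<in> ?A \<inter> ?B" by blast
  qed
  have "measure Om ?B = measure Om ?A" by (rule mpres_prob[OF mpres_flipcol measurable_seppos[OF S]])
  moreover have "measure Om (?A \<union> ?B) = measure Om ?A + measure Om ?B - measure Om (?A \<inter> ?B)"
    using Om.finite_measure_Union'[OF A B] Om.finite_measure_Diff'[OF B A] by (simp add: Int_commute)
  ultimately show ?thesis unfolding un int by simp
qed

text \<open>The intercept column is not random. Rotating the rows \<open>K\<close> removes it from
  all rows but \<open>k0\<close>, where a square Gaussian matrix remains and forces the slopes to
  vanish; row \<open>k0\<close> then does the same for the intercept.\<close>

lemma AE_gen:
  assumes S: "finite S"
  shows "AE X in Om. gen X S m"
proof -
  have one: "AE X in Om. nonsing K {..m} (row X)" if K: "K \<subseteq> S" "card K = Suc m" for K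
  proof -
    have fK: "finite K" using K S finite_subset by blast
    obtain k0 where k0: "k0 \<in> K" using K by fastforce
    obtain T \<tau> where T: "good K T" "\<tau>\<^sup>2 = real (card K)" "\<tau> \<noteq> 0"
      "\<And>j. j \<in> K \<Longrightarrow> T k0 j = 1 / \<tau>" "\<And>j. j \<in> K \<Longrightarrow> app K T (\<lambda>_. 1) j = (if j = k0 then \<tau> else 0)"
      by (rule frame[OF fK k0], rule that)
    have mp: "mpres (act T K {..<m})" using T(1) by (auto simp: good_def)
    have "AE X in Om. nonsing (K - {k0}) {..<m} (\<lambda>k c. X (k, c))"
      by (rule AE_nonsing) (use fK k0 K in auto)
    from mpres_AE[OF mp this] show ?thesis
    proof eventually_elim
      case (elim X)
      let ?F = "act T K {..<m} X"
      show ?case unfolding nonsing_def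
      proof (intro allI impI)
        fix s assume s: "\<forall>i\<in>K. (\<Sum>c\<in>{..m}. s c * row X i c) = 0"
        have exp: "(\<Sum>c\<in>{..m}. s c * row X i c) = s 0 + (\<Sum>c\<in>{..<m}. s (Suc c) * X (i, c))" for i
          by (subst sum.atMost_shift) (simp add: row_def)
        have rot: "s 0 * app K T (\<lambda>_. 1) k + (\<Sum>c\<in>{..<m}. s (Suc c) * ?F (k, c)) = 0" if k: "k \<in> K" for k
        proof -
          have "(\<Sum>c\<in>{..<m}. s (Suc c) * ?F (k, c)) = (\<Sum>c\<in>{..<m}. \<Sum>i\<in>K. T k i * (s (Suc c) * X (i, c)))"
            using k by (intro sum.cong) (auto simp: act_def app_def sum_distrib_left mult_ac)
          also have "\<dots> = (\<Sum>i\<in>K. T k i * (\<Sum>c\<in>{..<m}. s (Suc c) * X (i, c)))"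
            by (subst sum.swap) (simp add: sum_distrib_left)
          finally have "s 0 * app K T (\<lambda>_. 1) k + (\<Sum>c\<in>{..<m}. s (Suc c) * ?F (k, c)) =
              (\<Sum>i\<in>K. T k i * (s 0 + (\<Sum>c\<in>{..<m}. s (Suc c) * X (i, c))))"
            by (simp add: app_def sum_distrib_left sum.distrib distrib_left mult_ac)
          also have "\<dots> = 0" using s exp by simp
          finally show ?thesis .
        qed
        have "(\<Sum>c\<in>{..<m}. s (Suc c) * ?F (k, c)) = 0" if "k \<in> K - {k0}" for k
          using rot[of k] T(5)[of k] that by auto
        then have z: "\<forall>c\<in>{..<m}. s (Suc c) = 0"
          using elim unfolding nonsing_def by (auto dest: spec[of _ "\<lambda>c. s (Suc c)"])
        then have "s 0 * \<tau> = 0" using rot[OF k0] T(5)[OF k0] by simp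
        then have "s 0 = 0" using T(3) by simp
        with z show "\<forall>c\<in>{..m}. s c = 0"
        proof (intro ballI)
          fix c assume "c \<in> {..m}"
          with z \<open>s 0 = 0\<close> show "s c = 0" by (cases c) auto
        qed
      qed
    qed
  qed
  have "finite {K. K \<subseteq> S \<and> card K = Suc m}" using S by (auto intro: finite_subset[OF _ finite_Pow_iff[THEN iffD2]])
  then have "AE X in Om. \<forall>K\<in>{K. K \<subseteq> S \<and> card K = Suc m}. nonsing K {..m} (row X)"
    by (rule AE_finite_allI) (use one in auto)
  then show ?thesis by eventually_elim (auto simp: gen_def)
qed

text \<open>Almost surely the number of certificates equals the difference of the two indicators:
  none if \<open>seppos\<close> already holds with \<open>l + 1\<close> features or fails with
  \<open>l + 2\<close>, exactly one otherwise. Taking expectations gives the sum over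
  \<open>K\<close>.\<close>

lemma prob_seppos_difference:
  assumes S: "finite S" "l + 2 < card S" "\<And>j. j \<in> S \<Longrightarrow> y j \<in> {-1, 1}"
  shows "measure Om {X. seppos S y (l + 2) X} = measure Om {X. seppos S y (l + 1) X} +
    (\<Sum>K | K \<subseteq> S \<and> card K = l + 2. ang K y * offprob (S - K) y (sqrt (real (l + 2))))"
proof -
  let ?KK = "{K. K \<subseteq> S \<and> card K = l + 2}"
  have fin: "finite ?KK" using S(1) by (auto intro: finite_subset[OF _ finite_Pow_iff[THEN iffD2]])
  have "\<forall>K\<in>?KK. \<exists>E. Measurable.pred Om E \<and>
    (AE X in Om. E X \<longleftrightarrow> dualcert K y l X \<and> supporting S K y (l + 2) X) \<and>
    measure Om {X. E X} = ang K y * offprob (S - K) y (sqrt (real (l + 2)))"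
    by (intro ballI, rule prob_certificate[OF S(1)]) (use S(3) in simp_all)
  from bchoice[OF this] obtain E where E: "\<And>K. K \<in> ?KK \<Longrightarrow> Measurable.pred Om (E K)"
    "\<And>K. K \<in> ?KK \<Longrightarrow> AE X in Om. E K X \<longleftrightarrow> dualcert K y l X \<and> supporting S K y (l + 2) X"
    "\<And>K. K \<in> ?KK \<Longrightarrow> measure Om {X. E K X} = ang K y * offprob (S - K) y (sqrt (real (l + 2)))" by blast
  have Es: "{X. E K X} \<in> sets Om" if "K \<in> ?KK" for K using E(1)[OF that] by (simp add: pred_def)
  have "AE X in Om. \<forall>K\<in>?KK. E K X \<longleftrightarrow> dualcert K y l X \<and> supporting S K y (l + 2) X"
    by (rule AE_finite_allI[OF fin]) (rule E(2))
  with AE_gen[OF S(1), of l] AE_gen[OF S(1), of "Suc l"] AE_gen[OF S(1), of "l + 2"]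
  have ae: "AE X in Om. indicator {X. seppos S y (l + 2) X} X =
      indicator {X. seppos S y (l + 1) X} X + (\<Sum>K\<in>?KK. indicator {X. E K X} X :: real)"
  proof eventually_elim
    case (elim X)
    define cert where "cert K \<longleftrightarrow> dualcert K y l X \<and> supporting S K y (l + 2) X" for K
    have "(\<Sum>K\<in>?KK. indicator {X. E K X} X :: real) = (\<Sum>K\<in>?KK. if cert K then 1 else 0)"
      by (rule sum.cong) (use elim(4) in \<open>auto simp: indicator_def cert_def\<close>)
    also have "\<dots> = real (card {K\<in>?KK. cert K})" using fin by (simp add: sum.If_cases Int_def)
    finally have sum: "(\<Sum>K\<in>?KK. indicator {X. E K X} X :: real) = real (card {K\<in>?KK. cert K})" .
    have imp2: "seppos S y (l + 2) X" if "K \<in> ?KK" "cert K" for K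
    proof (rule certificate_imp_seppos[OF S(1) S(3) elim(2)])
      show "l + 2 \<le> card S" using S(2) by simp
      show "K \<subseteq> S" "card K = l + 2" "supporting S K y (l + 2) X" using that by (simp_all add: cert_def)
    qed
    have imp1: "\<not> seppos S y (l + 1) X" if "K \<in> ?KK" "cert K" for K
      unfolding Suc_eq_plus1[symmetric]
    proof (rule dualcert_imp_not_seppos[OF _ _ S(1,3)])
      show "dualcert K y l X" "K \<subseteq> S" using that by (simp_all add: cert_def)
    qed
    consider "seppos S y (l + 1) X" | "\<not> seppos S y (l + 1) X" "seppos S y (l + 2) X" | "\<not> seppos S y (l + 2) X" by blast
    then show ?case
    proof cases
      case 1
      then have "seppos S y (l + 2) X" using sep_imp_seppos_Suc[OF S(1) seppos_imp_sep[OF 1]] by simp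
      moreover have none: "{K\<in>?KK. cert K} = {}" using imp1 1 by blast
      ultimately show ?thesis using 1 unfolding sum none by simp
    next
      case 2
      obtain K where K: "K \<in> ?KK" "cert K"
        using certificate_exists[OF S(1,3,2) elim(1-3) 2(2)] 2(1) by (auto simp: cert_def)
      have "{K\<in>?KK. cert K} = {K}"
      proof (intro equalityI subsetI)
        fix K' assume "K' \<in> {K\<in>?KK. cert K}"
        then have K': "K' \<subseteq> S" "dualcert K' y l X" "supporting S K' y (l + 2) X" by (simp_all add: cert_def)
        have "K \<subseteq> S" "dualcert K y l X" "supporting S K y (l + 2) X" using K by (simp_all add: cert_def)
        with certificate_unique[OF S(1,3) K'] have "K' = K" by blast
        then show "K' \<in> {K}" by simp
      qed (use K in auto)
      then show ?thesis using 2 unfolding sum by simp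
    next
      case 3
      then have "\<not> seppos S y (l + 1) X" using sep_imp_seppos_Suc[OF S(1) seppos_imp_sep, of y "l + 1" X] by auto
      moreover have none: "{K\<in>?KK. cert K} = {}" using imp2 3 by blast
      ultimately show ?thesis using 3 unfolding sum none by simp
    qed
  qed
  have meas: "indicator {X. seppos S y k X} \<in> borel_measurable Om" for k
    by (rule borel_measurable_indicator[OF sets_seppos[OF S(1)]])
  have int: "integrable Om (indicator A :: _ \<Rightarrow> real)" if "A \<in> sets Om" for A
    using that by (intro integrable_real_indicator) (auto simp: Om.emeasure_eq_measure)
  have "measure Om {X. seppos S y (l + 2) X} = (\<integral>X. indicator {X. seppos S y (l + 2) X} X \<partial>Om)" by simp
  also have "\<dots> = (\<integral>X. indicator {X. seppos S y (l + 1) X} X + (\<Sum>K\<in>?KK. indicator {X. E K X} X) \<partial>Om)"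
    by (rule integral_cong_AE[OF meas _ ae])
      (intro borel_measurable_add borel_measurable_sum meas borel_measurable_indicator Es)
  also have "\<dots> = (\<integral>X. indicator {X. seppos S y (l + 1) X} X \<partial>Om) + (\<integral>X. (\<Sum>K\<in>?KK. indicator {X. E K X} X) \<partial>Om)"
    by (intro Bochner_Integration.integral_add Bochner_Integration.integrable_sum int Es sets_seppos[OF S(1)])
  also have "(\<integral>X. (\<Sum>K\<in>?KK. indicator {X. E K X} X :: real) \<partial>Om) = (\<Sum>K\<in>?KK. \<integral>X. indicator {X. E K X} X \<partial>Om)"
    by (intro Bochner_Integration.integral_sum int Es)
  also have "(\<integral>X. indicator {X. seppos S y (l + 1) X} X \<partial>Om) + \<dots> =
      measure Om {X. seppos S y (l + 1) X} + (\<Sum>K\<in>?KK. measure Om {X. E K X})" by simp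
  also have "(\<Sum>K\<in>?KK. measure Om {X. E K X}) = (\<Sum>K\<in>?KK. ang K y * offprob (S - K) y (sqrt (real (l + 2))))"
    by (rule sum.cong[OF refl E(3)])
  finally show ?thesis .
qed

section \<open>Averages over label vectors\<close>

definition wt :: "real \<Rightarrow> real \<Rightarrow> real" where
  "wt b s = (if s = 1 then b else 1 - b)"

definition weight :: "real \<Rightarrow> nat set \<Rightarrow> (nat \<Rightarrow> real) \<Rightarrow> real" where
  "weight b S y = (\<Prod>j\<in>S. wt b (y j))"

definition labels :: "nat set \<Rightarrow> (nat \<Rightarrow> real) set" where
  "labels S = (\<Pi>\<^sub>E j\<in>S. {-1, 1})"

definition labelling :: "nat set \<Rightarrow> nat set \<Rightarrow> nat \<Rightarrow> real" where
  "labelling S B = (\<lambda>j\<in>S. if j \<in> B then 1 else -1)"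

lemma labels_bij: "bij_betw (labelling S) (Pow S) (labels S)"
proof (rule bij_betw_byWitness[where f'="\<lambda>y. {j\<in>S. y j = 1}"])
  show "\<forall>y\<in>labels S. labelling S {j \<in> S. y j = 1} = y"
  proof
    fix y assume "y \<in> labels S"
    then have y: "\<And>j. j \<in> S \<Longrightarrow> y j \<in> {-1, 1}" "\<And>j. j \<notin> S \<Longrightarrow> y j = undefined"
      by (auto simp: labels_def PiE_iff extensional_def)
    show "labelling S {j \<in> S. y j = 1} = y"
    proof
      fix j show "labelling S {j \<in> S. y j = 1} j = y j"
        using y[of j] by (auto simp: labelling_def)
    qed
  qed
next
  show "\<forall>B\<in>Pow S. {j \<in> S. labelling S B j = 1} = B"
    by (auto simp: labelling_def split: if_splits)
qed (auto simp: labelling_def labels_def split: if_splits)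

lemma weight_labelling:
  assumes "finite S" "B \<subseteq> S"
  shows "weight b S (labelling S B) = b ^ card B * (1 - b) ^ (card S - card B)"
proof -
  have "weight b S (labelling S B) = (\<Prod>j\<in>S. if j \<in> B then b else 1 - b)"
    unfolding weight_def by (rule prod.cong) (auto simp: labelling_def wt_def)
  also have "\<dots> = b ^ card (S \<inter> B) * (1 - b) ^ card (S - B)"
    using assms by (simp add: prod.If_cases Diff_eq Collect_neg_eq)
  also have "S \<inter> B = B" using assms by auto
  also have "card (S - B) = card S - card B" using assms by (simp add: card_Diff_subset finite_subset)
  finally show ?thesis .
qed

text \<open>Without features only constant functions are available, so exactly the two constant
  labellings are separable; they differ because \<open>S\<close> is nonempty.\<close>

lemma sum_sep_0:
  assumes S: "finite S" "S \<noteq> {}"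
  shows "(\<Sum>y\<in>labels S. weight b S y * measure Om {X. sep S y 0 X}) = b ^ card S + (1 - b) ^ card S"
proof -
  have sepB: "sep S (labelling S B) 0 X \<longleftrightarrow> B = {} \<or> B = S" if "B \<subseteq> S" for B X
  proof
    assume "sep S (labelling S B) 0 X"
    then obtain \<beta> :: "nat \<Rightarrow> real" where b: "\<And>j. j \<in> S \<Longrightarrow> labelling S B j * \<beta> 0 > 0"
      by (auto simp: sep_def aff_def row_def)
    show "B = {} \<or> B = S"
    proof (cases "\<beta> 0 > 0")
      case True
      have "j \<in> B" if "j \<in> S" for j using b[OF that] True that by (auto simp: labelling_def split: if_splits)
      then show ?thesis using \<open>B \<subseteq> S\<close> by auto
    next
      case False
      have "j \<notin> B" if "j \<in> S" for j using b[OF that] False that by (auto simp: labelling_def split: if_splits)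
      then show ?thesis using \<open>B \<subseteq> S\<close> by auto
    qed
  next
    assume "B = {} \<or> B = S"
    then show "sep S (labelling S B) 0 X"
    proof
      assume "B = {}"
      then show ?thesis unfolding sep_def by (intro exI[of _ "\<lambda>_. -1"]) (simp add: aff_def row_def labelling_def)
    next
      assume "B = S"
      then show ?thesis unfolding sep_def by (intro exI[of _ "\<lambda>_. 1"]) (simp add: aff_def row_def labelling_def)
    qed
  qed
  have "(\<Sum>y\<in>labels S. weight b S y * measure Om {X. sep S y 0 X}) =
      (\<Sum>B\<in>Pow S. weight b S (labelling S B) * measure Om {X. sep S (labelling S B) 0 X})"
    by (rule sum.reindex_bij_betw[OF labels_bij, symmetric])
  also have "\<dots> = (\<Sum>B\<in>Pow S. if B \<in> {{}, S} then weight b S (labelling S B) else 0)"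
  proof (rule sum.cong[OF refl])
    fix B assume "B \<in> Pow S"
    then have "{X. sep S (labelling S B) 0 X} = (if B = {} \<or> B = S then UNIV else {})" using sepB by auto
    moreover have "measure Om UNIV = 1" using Om.prob_space by simp
    ultimately show "weight b S (labelling S B) * measure Om {X. sep S (labelling S B) 0 X} =
        (if B \<in> {{}, S} then weight b S (labelling S B) else 0)" by simp
  qed
  also have "\<dots> = (\<Sum>B\<in>{{}, S}. weight b S (labelling S B))"
    using S by (subst sum.inter_restrict[symmetric]) (auto intro!: sum.cong)
  also have "\<dots> = b ^ card S + (1 - b) ^ card S"
    using S by (simp add: weight_labelling)
  finally show ?thesis .
qed

definition upper :: "nat set \<Rightarrow> (nat \<Rightarrow> real) \<Rightarrow> nat set \<Rightarrow> bool" where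
  "upper S x B \<longleftrightarrow> B \<subseteq> S \<and> (\<forall>j\<in>B. \<forall>i\<in>S - B. x i < x j)"

text \<open>Upper sets are nested, so their size determines them; adding the point with the largest
  remaining value produces every size up to \<open>card S\<close>.\<close>

lemma upper_bij:
  assumes S: "finite S" "inj_on x S"
  shows "bij_betw card {B. upper S x B} {..card S}"
proof (rule bij_betw_imageI)
  show "inj_on card {B. upper S x B}"
  proof (rule inj_onI)
    fix B B' assume BB: "B \<in> {B. upper S x B}" "B' \<in> {B. upper S x B}" "card B = card B'"
    then have f: "finite B" "finite B'" using S by (auto simp: upper_def intro: finite_subset)
    have "B \<subseteq> B' \<or> B' \<subseteq> B"
    proof (rule ccontr)
      assume "\<not> ?thesis"
      then obtain i j where "i \<in> B" "i \<notin> B'" "j \<in> B'" "j \<notin> B" by auto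
      then have "x i < x j" "x j < x i" using BB by (auto simp: upper_def)
      then show False by simp
    qed
    then show "B = B'" using card_subset_eq[OF f(1), of B'] card_subset_eq[OF f(2), of B] BB(3) by auto
  qed
  have ex: "\<exists>B. upper S x B \<and> card B = N" if "N \<le> card S" for N
    using that
  proof (induction N)
    case 0
    then show ?case by (intro exI[of _ "{}"]) (auto simp: upper_def)
  next
    case (Suc N)
    then obtain B where B: "upper S x B" "card B = N" by auto
    have fB: "finite B" "B \<subseteq> S" using B S by (auto simp: upper_def intro: finite_subset)
    have "S - B \<noteq> {}" using Suc.prems B fB by auto
    then have "Max (x ` (S - B)) \<in> x ` (S - B)" using S by (intro Max_in) auto
    then obtain j where j: "j \<in> S - B" "x j = Max (x ` (S - B))" by auto
    have "x i < x j" if "i \<in> S - insert j B" for i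
    proof -
      have "x i \<le> x j" unfolding j(2) using S that by (intro Max_ge) auto
      moreover have "x i \<noteq> x j" using inj_onD[OF S(2), of i j] that j(1) by auto
      ultimately show ?thesis by simp
    qed
    then have "upper S x (insert j B)" using B j by (auto simp: upper_def)
    moreover have "card (insert j B) = Suc N" using B j fB by simp
    ultimately show ?case by blast
  qed
  show "card ` {B. upper S x B} = {..card S}"
  proof (intro equalityI subsetI)
    fix N assume "N \<in> card ` {B. upper S x B}"
    then show "N \<in> {..card S}" using S by (auto simp: upper_def intro: card_mono)
  next
    fix N assume "N \<in> {..card S}"
    then obtain B where "upper S x B" "card B = N" using ex by auto
    then show "N \<in> card ` {B. upper S x B}" by blast
  qed
qed

text \<open>With positive slope the points labelled 1 are those above a threshold, placed between
  the largest value outside \<open>B\<close> and the smallest inside. The default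
  \<open>hi - 1\<close> covers an empty complement, and \<open>B = {}\<close> is treated
  apart.\<close>

lemma seppos_1_upper:
  assumes S: "finite S" "B \<subseteq> S"
  shows "seppos S (labelling S B) 1 X \<longleftrightarrow> upper S (\<lambda>j. X (j, 0)) B"
proof
  assume "seppos S (labelling S B) 1 X"
  then obtain \<beta> where b1: "\<beta> 1 > 0" "\<forall>j\<in>S. labelling S B j * aff X 1 \<beta> j > 0"
    unfolding seppos_def by blast
  then have b: "\<beta> 1 > 0" "\<And>j. j \<in> S \<Longrightarrow> labelling S B j * (\<beta> 0 + \<beta> 1 * X (j, 0)) > 0"
    by (simp_all add: aff_def row_def)
  show "upper S (\<lambda>j. X (j, 0)) B"
    unfolding upper_def
  proof (intro conjI ballI S(2))
    fix j i assume ji: "j \<in> B" "i \<in> S - B"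
    have "\<beta> 0 + \<beta> 1 * X (j, 0) > 0" using b(2)[of j] ji S by (auto simp: labelling_def)
    moreover have "\<beta> 0 + \<beta> 1 * X (i, 0) < 0" using b(2)[of i] ji S by (auto simp: labelling_def)
    ultimately have "\<beta> 1 * X (i, 0) < \<beta> 1 * X (j, 0)" by linarith
    then show "X (i, 0) < X (j, 0)" using b(1) by simp
  qed
next
  assume u: "upper S (\<lambda>j. X (j, 0)) B"
  let ?x = "\<lambda>j. X (j, 0)"
  have f: "finite B" "finite (S - B)" using S finite_subset by auto
  have "\<exists>t. (\<forall>j\<in>B. ?x j > t) \<and> (\<forall>i\<in>S - B. ?x i < t)"
  proof (cases "B = {}")
    case True
    have "?x i < Max (insert 0 (?x ` (S - B))) + 1" if "i \<in> S - B" for i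
    proof -
      have "?x i \<le> Max (insert 0 (?x ` (S - B)))" by (rule Max_ge) (use f that in auto)
      then show ?thesis by linarith
    qed
    with True show ?thesis by blast
  next
    case False
    define hi where "hi = Min (?x ` B)"
    have hi: "hi \<le> ?x j" if "j \<in> B" for j unfolding hi_def using f that by (intro Min_le) auto
    have "hi \<in> ?x ` B" unfolding hi_def using f False by (intro Min_in) auto
    then obtain j0 where j0: "j0 \<in> B" "?x j0 = hi" by auto
    define lo where "lo = Max (insert (hi - 1) (?x ` (S - B)))"
    have lo: "?x i \<le> lo" if "i \<in> S - B" for i unfolding lo_def using f that by (intro Max_ge) auto
    have "lo < hi" unfolding lo_def using f u j0 by (subst Max_less_iff) (auto simp: upper_def)
    show ?thesis
    proof (intro exI[of _ "(lo + hi) / 2"] conjI ballI)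
      fix j assume "j \<in> B"
      with hi[of j] \<open>lo < hi\<close> show "(lo + hi) / 2 < ?x j" by simp
    next
      fix i assume "i \<in> S - B"
      with lo[of i] \<open>lo < hi\<close> show "?x i < (lo + hi) / 2" by simp
    qed
  qed
  then obtain t where t: "\<And>j. j \<in> B \<Longrightarrow> ?x j > t" "\<And>i. i \<in> S - B \<Longrightarrow> ?x i < t" by blast
  show "seppos S (labelling S B) 1 X" unfolding seppos_def
    by (intro exI[of _ "\<lambda>c. if c = 0 then - t else 1"]) (use t in \<open>auto simp: aff_def row_def labelling_def\<close>)
qed

text \<open>The sum over labels can be evaluated before integration: for distinct feature values
  there is exactly one admissible labelling of each size \<open>N\<close>, so the integrand is
  almost surely constant.\<close>

lemma sum_seppos_1:
  assumes S: "finite S"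
  shows "(\<Sum>y\<in>labels S. weight b S y * measure Om {X. seppos S y 1 X}) = (\<Sum>N\<le>card S. b ^ N * (1 - b) ^ (card S - N))"
proof -
  have fl: "finite (labels S)" unfolding labels_def using S by (intro finite_PiE) auto
  have inj: "AE X in Om. inj_on (\<lambda>j. X (j, 0)) S"
  proof -
    have "AE X in Om. \<forall>c\<in>{K. K \<subseteq> S \<and> card K = 2}. gen X c 1"
      using S by (intro AE_finite_allI AE_gen) (auto intro: finite_subset)
    then show ?thesis
    proof eventually_elim
      case (elim X)
      show ?case
      proof (rule inj_onI, rule ccontr)
        fix i j assume ij: "i \<in> S" "j \<in> S" "X (i, 0) = X (j, 0)" "i \<noteq> j"
        then have "gen X {i, j} 1" using elim by auto
        moreover have "\<forall>k\<in>{i, j}. aff X 1 (\<lambda>c. if c = 0 then - X (i, 0) else 1) k = 0"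
          using ij by (simp add: aff_def row_def)
        ultimately have "\<forall>c\<le>1::nat. (if c = 0 then - X (i, 0) else 1) = (0 :: real)"
          using ij by (intro gen_zero[of X "{i, j}" 1 "{i, j}"]) auto
        then have "(if 1 = (0::nat) then - X (i, 0) else 1) = (0 :: real)" by blast
        then show False by simp
      qed
    qed
  qed
  have int: "integrable Om (\<lambda>X. weight b S y * indicator {X. seppos S y 1 X} X)" for y
    by (intro integrable_mult_right integrable_real_indicator sets_seppos[OF S]) (auto simp: Om.emeasure_eq_measure)
  have "(\<Sum>y\<in>labels S. weight b S y * measure Om {X. seppos S y 1 X}) =
      (\<Sum>y\<in>labels S. (\<integral>X. weight b S y * indicator {X. seppos S y 1 X} X \<partial>Om))" by simp
  also have "\<dots> = (\<integral>X. (\<Sum>y\<in>labels S. weight b S y * indicator {X. seppos S y 1 X} X) \<partial>Om)"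
    by (rule Bochner_Integration.integral_sum[symmetric, OF int])
  also have "\<dots> = (\<integral>X. (\<Sum>N\<le>card S. b ^ N * (1 - b) ^ (card S - N)) \<partial>Om)"
  proof (rule integral_cong_AE)
    show "AE X in Om. (\<Sum>y\<in>labels S. weight b S y * indicator {X. seppos S y 1 X} X) = (\<Sum>N\<le>card S. b ^ N * (1 - b) ^ (card S - N))"
      using inj
    proof eventually_elim
      case (elim X)
      have "(\<Sum>y\<in>labels S. weight b S y * indicator {X. seppos S y 1 X} X) =
          (\<Sum>B\<in>Pow S. weight b S (labelling S B) * indicator {X. seppos S (labelling S B) 1 X} X)"
        by (rule sum.reindex_bij_betw[OF labels_bij, symmetric])
      also have "\<dots> = (\<Sum>B\<in>Pow S. if upper S (\<lambda>j. X (j, 0)) B then b ^ card B * (1 - b) ^ (card S - card B) else 0)"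
        using seppos_1_upper[OF S, of _ X] by (intro sum.cong refl) (simp add: weight_labelling[OF S] indicator_def del: One_nat_def)
      also have "\<dots> = (\<Sum>B | upper S (\<lambda>j. X (j, 0)) B. b ^ card B * (1 - b) ^ (card S - card B))"
      proof -
        have "Pow S \<inter> {B. upper S (\<lambda>j. X (j, 0)) B} = {B. upper S (\<lambda>j. X (j, 0)) B}" by (auto simp: upper_def)
        then show ?thesis using S by (simp add: sum.If_cases)
      qed
      also have "\<dots> = (\<Sum>N\<le>card S. b ^ N * (1 - b) ^ (card S - N))"
        by (rule sum.reindex_bij_betw[OF upper_bij[OF S elim]])
      finally show ?case .
    qed
  qed (intro borel_measurable_sum borel_measurable_integrable[OF int] borel_measurable_const)+
  also have "\<dots> = (\<Sum>N\<le>card S. b ^ N * (1 - b) ^ (card S - N))" using Om.prob_space by simp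
  finally show ?thesis .
qed

section \<open>From solid angles to the coefficients \<open>mu\<close>\<close>

lemma std_gaussian_pair: "(std_gaussian :: (real \<times> real) measure) = std_normal \<Otimes>\<^sub>M std_normal"
proof -
  have B: "(Basis :: (real \<times> real) set) = {(1, 0), (0, 1)}" by (auto simp: Basis_prod_def)
  have "std_normal \<Otimes>\<^sub>M std_normal =
      density (lborel \<Otimes>\<^sub>M lborel) (\<lambda>(x, y). ennreal (std_normal_density x) * ennreal (std_normal_density y))"
    by (rule pair_measure_density) (auto intro: prob_space_imp_sigma_finite prob_space_std_normal lborel.sigma_finite_measure_axioms)
  also have "\<dots> = density lborel (\<lambda>v. ennreal (\<Prod>i\<in>Basis. std_normal_density (v \<bullet> i)))"
    by (simp add: lborel_prod B ennreal_mult' case_prod_beta' inner_prod_def)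
  finally show ?thesis unfolding std_gaussian_def by simp
qed

lemma integral_fst_mult_snd:
  fixes f g :: "real \<Rightarrow> complex"
  assumes f: "integrable std_normal f" and g: "integrable std_normal g"
  shows "integrable (std_normal \<Otimes>\<^sub>M std_normal) (\<lambda>(x, y). f x * g y)"
    and "(\<integral>(x, y). f x * g y \<partial>(std_normal \<Otimes>\<^sub>M std_normal)) = (\<integral>x. f x \<partial>std_normal) * (\<integral>y. g y \<partial>std_normal)"
proof -
  interpret P: pair_sigma_finite std_normal std_normal
    by (simp add: pair_sigma_finite_def prob_space_imp_sigma_finite prob_space_std_normal)
  have [measurable]: "f \<in> borel_measurable borel" "g \<in> borel_measurable borel"
    using borel_measurable_integrable[OF f] borel_measurable_integrable[OF g] by simp_all
  show int: "integrable (std_normal \<Otimes>\<^sub>M std_normal) (\<lambda>(x, y). f x * g y)"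
  proof (rule P.Fubini_integrable)
    show "(\<lambda>(x, y). f x * g y) \<in> borel_measurable (std_normal \<Otimes>\<^sub>M std_normal)" by measurable
    have "(\<lambda>x. \<integral>y. norm (case (x, y) of (x, y) \<Rightarrow> f x * g y) \<partial>std_normal) = (\<lambda>x. norm (f x) * (\<integral>y. norm (g y) \<partial>std_normal))"
      by (simp add: norm_mult)
    then show "integrable std_normal (\<lambda>x. \<integral>y. norm (case (x, y) of (x, y) \<Rightarrow> f x * g y) \<partial>std_normal)"
      by (simp only:) (intro integrable_mult_left integrable_norm f)
    show "AE x in std_normal. integrable std_normal (\<lambda>y. case (x, y) of (x, y) \<Rightarrow> f x * g y)"
      by (rule AE_I2) (simp add: g)
  qed
  show "(\<integral>(x, y). f x * g y \<partial>(std_normal \<Otimes>\<^sub>M std_normal)) = (\<integral>x. f x \<partial>std_normal) * (\<integral>y. g y \<partial>std_normal)"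
    unfolding P.integral_fst'[OF int, symmetric] by simp
qed

text \<open>Weights and factors are products over the samples, so the sum over all labellings
  factorises into one two-term sum per sample. This is how \<open>Phi_mix\<close> arises.\<close>

lemma sum_labels_prod:
  fixes f h :: "real \<Rightarrow> complex"
  assumes S: "finite S" "K \<subseteq> S"
  shows "(\<Sum>y\<in>labels S. of_real (weight b S y) * ((\<Prod>j\<in>K. f (y j)) * (\<Prod>j\<in>S - K. h (y j)))) =
    (of_real b * f 1 + of_real (1 - b) * f (-1)) ^ card K * (of_real b * h 1 + of_real (1 - b) * h (-1)) ^ card (S - K)"
proof -
  let ?F = "\<lambda>j s. of_real (wt b s) * (if j \<in> K then f s else h s)"
  have fK: "finite K" using S finite_subset by blast
  have split: "(\<Prod>j\<in>S. if j \<in> K then u j else v j) = (\<Prod>j\<in>K. u j) * (\<Prod>j\<in>S - K. v j)" for u v :: "nat \<Rightarrow> complex"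
  proof -
    have "S \<inter> {j. j \<in> K} = K" "S \<inter> - {j. j \<in> K} = S - K" using S by auto
    then show ?thesis using S by (simp add: prod.If_cases)
  qed
  have "(\<Sum>y\<in>labels S. of_real (weight b S y) * ((\<Prod>j\<in>K. f (y j)) * (\<Prod>j\<in>S - K. h (y j)))) =
      (\<Sum>y\<in>labels S. \<Prod>j\<in>S. ?F j (y j))"
    by (rule sum.cong) (simp_all add: weight_def prod.distrib split)
  also have "\<dots> = (\<Prod>j\<in>S. \<Sum>s\<in>{-1, 1}. ?F j s)"
    unfolding labels_def by (rule prod_sum_PiE[symmetric]) (use S in auto)
  also have "\<dots> = (\<Prod>j\<in>S. if j \<in> K then of_real b * f 1 + of_real (1 - b) * f (-1)
      else of_real b * h 1 + of_real (1 - b) * h (-1))"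
    by (rule prod.cong) (auto simp: wt_def)
  also have "\<dots> = (of_real b * f 1 + of_real (1 - b) * f (-1)) ^ card K * (of_real b * h 1 + of_real (1 - b) * h (-1)) ^ card (S - K)"
    unfolding split by simp
  finally show ?thesis .
qed

lemma offprob_Phi:
  assumes J: "finite J"
  shows "integrable std_normal (\<lambda>g. \<Prod>j\<in>J. Phi k (of_real (y j * g)))"
    and "(\<integral>g. (\<Prod>j\<in>J. Phi k (of_real (y j * g))) \<partial>std_normal) = of_real (offprob J y (sqrt (real k + 1)))"
proof -
  note [measurable] = measurable_std_normal_cdf
  have eq: "(\<lambda>g. \<Prod>j\<in>J. Phi k (of_real (y j * g))) =
      (\<lambda>g. of_real (\<Prod>j\<in>J. measure std_normal {..y j * g / sqrt (real k + 1)}))"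
    by (simp only: Phi_real of_real_prod)
  have int: "integrable std_normal (\<lambda>g. \<Prod>j\<in>J. measure std_normal {..y j * g / sqrt (real k + 1)})"
  proof (rule std_normal.integrable_const_bound[where B = 1])
    show "AE g in std_normal. norm (\<Prod>j\<in>J. measure std_normal {..y j * g / sqrt (real k + 1)}) \<le> 1"
      by (rule AE_I2) (simp add: abs_prod prod_le_1)
  qed measurable
  show "integrable std_normal (\<lambda>g. \<Prod>j\<in>J. Phi k (of_real (y j * g)))"
    unfolding eq by (rule integrable_bounded_linear[OF bounded_linear_of_real int])
  show "(\<integral>g. (\<Prod>j\<in>J. Phi k (of_real (y j * g))) \<partial>std_normal) = of_real (offprob J y (sqrt (real k + 1)))"
    unfolding eq offprob_def by (rule integral_of_real[OF int])
qed

text \<open>Summed over the labels under the integral sign, every \<open>K\<close> of size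
  \<open>k + 1\<close> contributes the same integral, and the binomial coefficient counts the sets.
  The exchange needs integrability for each single labelling, which \<open>k \<ge> 1\<close>
  provides.\<close>

lemma sum_ang_offprob_eq_mu:
  assumes k: "1 \<le> k" "k + 1 < n"
  shows "of_real (\<Sum>y\<in>labels {1..n}. weight b {1..n} y *
      (\<Sum>K | K \<subseteq> {1..n} \<and> card K = k + 1. ang K y * offprob ({1..n} - K) y (sqrt (real k + 1)))) = mu b n (n - k)"
proof -
  let ?S = "{1..n}" and ?KK = "{K. K \<subseteq> {1..n} \<and> card K = k + 1}"
  let ?I = "\<lambda>(g, g'). Phi_mix b k (\<i> * of_real g) ^ (k + 1) * Phi_mix b k (of_real g') ^ (n - (k + 1))"
  have one: "(\<Sum>y\<in>labels ?S. of_real (weight b ?S y * (ang K y * offprob (?S - K) y (sqrt (real k + 1))))) =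
      (\<integral>z. ?I z \<partial>(std_normal \<Otimes>\<^sub>M std_normal))" if K: "K \<in> ?KK" for K
  proof -
    have fK: "finite K" "K \<subseteq> ?S" "card K = Suc k" using K finite_subset by auto
    let ?A = "\<lambda>y g. \<Prod>j\<in>K. Phi k (\<i> * of_real (y j * g))" and ?B = "\<lambda>y g. \<Prod>j\<in>?S - K. Phi k (of_real (y j * g))"
    have y1: "y j = 1 \<or> y j = -1" if "y \<in> labels ?S" "j \<in> K" for y j
      using that fK(2) by (auto simp: labels_def PiE_iff)
    have A: "integrable std_normal (?A y)" "(\<integral>g. ?A y g \<partial>std_normal) = of_real (ang K y)" if "y \<in> labels ?S" for y
      using ang_eq_Phi_integral[OF fK(1,3) k(1) y1[OF that]] by simp_all
    have B: "integrable std_normal (?B y)" "(\<integral>g. ?B y g \<partial>std_normal) = of_real (offprob (?S - K) y (sqrt (real k + 1)))" for y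
      by (rule offprob_Phi; simp)+
    have int: "integrable (std_normal \<Otimes>\<^sub>M std_normal) (\<lambda>(g, g'). ?A y g * ?B y g')" if "y \<in> labels ?S" for y
      by (rule integral_fst_mult_snd(1)[OF A(1)[OF that] B(1)])
    have "(\<Sum>y\<in>labels ?S. of_real (weight b ?S y * (ang K y * offprob (?S - K) y (sqrt (real k + 1))))) =
        (\<Sum>y\<in>labels ?S. (\<integral>z. of_real (weight b ?S y) * (case z of (g, g') \<Rightarrow> ?A y g * ?B y g') \<partial>(std_normal \<Otimes>\<^sub>M std_normal)))"
    proof (rule sum.cong[OF refl])
      fix y assume y: "y \<in> labels ?S"
      have "(\<integral>z. of_real (weight b ?S y) * (case z of (g, g') \<Rightarrow> ?A y g * ?B y g') \<partial>(std_normal \<Otimes>\<^sub>M std_normal)) =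
          of_real (weight b ?S y) * (\<integral>z. (case z of (g, g') \<Rightarrow> ?A y g * ?B y g') \<partial>(std_normal \<Otimes>\<^sub>M std_normal))"
        by (rule integral_mult_right_zero)
      also have "\<dots> = of_real (weight b ?S y) * (of_real (ang K y) * of_real (offprob (?S - K) y (sqrt (real k + 1))))"
        unfolding integral_fst_mult_snd(2)[OF A(1)[OF y] B(1)] A(2)[OF y] B(2) ..
      finally show "complex_of_real (weight b ?S y * (ang K y * offprob (?S - K) y (sqrt (real k + 1)))) =
          (\<integral>z. of_real (weight b ?S y) * (case z of (g, g') \<Rightarrow> ?A y g * ?B y g') \<partial>(std_normal \<Otimes>\<^sub>M std_normal))"
        by (simp only: of_real_mult)
    qed
    also have "\<dots> = (\<integral>z. (\<Sum>y\<in>labels ?S. of_real (weight b ?S y) * (case z of (g, g') \<Rightarrow> ?A y g * ?B y g')) \<partial>(std_normal \<Otimes>\<^sub>M std_normal))"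
      by (rule Bochner_Integration.integral_sum[symmetric]) (rule integrable_mult_right[OF int])
    also have "\<dots> = (\<integral>z. ?I z \<partial>(std_normal \<Otimes>\<^sub>M std_normal))"
    proof (rule Bochner_Integration.integral_cong[OF refl])
      fix z :: "real \<times> real"
      obtain g g' where z: "z = (g, g')" by fastforce
      have card: "card (?S - K) = n - (k + 1)" using fK by (simp add: card_Diff_subset)
      show "(\<Sum>y\<in>labels ?S. of_real (weight b ?S y) * (case z of (g, g') \<Rightarrow> ?A y g * ?B y g')) = ?I z"
        unfolding z prod.case
        using sum_labels_prod[of ?S K b "\<lambda>s. Phi k (\<i> * of_real (s * g))" "\<lambda>s. Phi k (of_real (s * g'))"] fK(2,3)
        unfolding card by (simp add: Phi_mix_def)
    qed
    finally show ?thesis .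
  qed
  have cK: "card ?KK = n choose (k + 1)" using n_subsets[of ?S "k + 1"] by simp
  have "complex_of_real (\<Sum>y\<in>labels ?S. weight b ?S y * (\<Sum>K\<in>?KK. ang K y * offprob (?S - K) y (sqrt (real k + 1)))) =
      (\<Sum>K\<in>?KK. \<Sum>y\<in>labels ?S. of_real (weight b ?S y * (ang K y * offprob (?S - K) y (sqrt (real k + 1)))))"
    unfolding sum_distrib_left of_real_sum by (rule sum.swap)
  also have "\<dots> = (\<Sum>K\<in>?KK. (\<integral>z. ?I z \<partial>(std_normal \<Otimes>\<^sub>M std_normal)))"
    by (rule sum.cong[OF refl one])
  also have "\<dots> = of_nat (n choose (k + 1)) * (\<integral>z. ?I z \<partial>std_gaussian)"
    unfolding sum_constant cK std_gaussian_pair ..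
  also have "\<dots> = mu b n (n - k)"
    using k by (auto simp: mu_def Let_def)
  finally show ?thesis .
qed

section \<open>Recursion for the averaged separability probability\<close>

definition sepsum :: "real \<Rightarrow> nat \<Rightarrow> nat \<Rightarrow> real" where
  "sepsum b n m = (\<Sum>y\<in>labels {1..n}. weight b {1..n} y * measure Om {X. sep {1..n} y m X})"

lemma sum_seppos:
  "2 * (\<Sum>y\<in>labels {1..n}. weight b {1..n} y * measure Om {X. seppos {1..n} y (Suc m) X}) =
    sepsum b n (Suc m) + sepsum b n m"
proof -
  have "2 * (\<Sum>y\<in>labels {1..n}. weight b {1..n} y * measure Om {X. seppos {1..n} y (Suc m) X}) =
      (\<Sum>y\<in>labels {1..n}. weight b {1..n} y * (2 * measure Om {X. seppos {1..n} y (Suc m) X}))"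
    by (simp add: sum_distrib_left mult_ac)
  also have "\<dots> = sepsum b n (Suc m) + sepsum b n m"
    by (simp only: prob_seppos[OF finite_atLeastAtMost] sepsum_def distrib_left sum.distrib)
  finally show ?thesis .
qed

lemma sepsum_0: "1 \<le> n \<Longrightarrow> sepsum b n 0 = b ^ n + (1 - b) ^ n"
  unfolding sepsum_def using sum_sep_0[of "{1..n}" b] by simp

text \<open>In the sum over sizes the terms \<open>N = 0\<close> and \<open>N = n\<close> reproduce
  \<open>sepsum b n 0\<close>, and the interior terms are \<open>mu b n n\<close>. Doubling and
  subtracting \<open>sepsum b n 0\<close> once gives the claim.\<close>

lemma sepsum_1:
  assumes "1 < n"
  shows "of_real (sepsum b n 1) = of_real (b ^ n + (1 - b) ^ n) + 2 * mu b n n"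
proof -
  have "(\<Sum>N\<le>n. b ^ N * (1 - b) ^ (n - N)) = (1 - b) ^ n + (\<Sum>N = 1..n - 1. b ^ N * (1 - b) ^ (n - N)) + b ^ n"
  proof -
    have e: "{..n} = insert 0 (insert n {1..n - 1})" using assms by auto
    have "0 \<notin> insert n {1..n - 1}" "n \<notin> {1..n - 1}" using assms by auto
    then show ?thesis unfolding e by simp
  qed
  then have "sepsum b n 1 = b ^ n + (1 - b) ^ n + 2 * (\<Sum>N = 1..n - 1. b ^ N * (1 - b) ^ (n - N))"
    using sum_seppos[of b n 0] sum_seppos_1[of "{1..n}" b] sepsum_0[of n b] assms by simp
  then show ?thesis using assms by (simp add: mu_def)
qed

text \<open>Subtracting the relations for \<open>l + 2\<close> and \<open>l + 1\<close> features
  cancels \<open>sepsum b n (l + 1)\<close>. The sets \<open>K\<close> have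
  \<open>l + 2 = k + 1\<close> points with \<open>k = l + 1\<close>, hence the index
  \<open>n - (l + 1)\<close>.\<close>

lemma sepsum_Suc_Suc:
  assumes "l + 2 < n"
  shows "of_real (sepsum b n (l + 2)) = of_real (sepsum b n l) + 2 * mu b n (n - (l + 1))"
proof -
  let ?S = "{1..n}"
  let ?T = "\<lambda>m. \<Sum>y\<in>labels ?S. weight b ?S y * measure Om {X. seppos ?S y m X}"
  let ?D = "\<Sum>y\<in>labels ?S. weight b ?S y *
      (\<Sum>K | K \<subseteq> ?S \<and> card K = (l + 1) + 1. ang K y * offprob (?S - K) y (sqrt (real (l + 1) + 1)))"
  have "?T (l + 2) = (\<Sum>y\<in>labels ?S. weight b ?S y * (measure Om {X. seppos ?S y (l + 1) X} +
      (\<Sum>K | K \<subseteq> ?S \<and> card K = (l + 1) + 1. ang K y * offprob (?S - K) y (sqrt (real (l + 1) + 1)))))"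
  proof (rule sum.cong[OF refl])
    fix y assume "y \<in> labels ?S"
    then have y: "\<And>j. j \<in> ?S \<Longrightarrow> y j \<in> {-1, 1}" by (auto simp: labels_def PiE_iff)
    have "real (l + 2) = real (l + 1) + 1" "l + 2 = (l + 1) + 1" by simp_all
    with prob_seppos_difference[of ?S l y] assms y
    show "weight b ?S y * measure Om {X. seppos ?S y (l + 2) X} = weight b ?S y * (measure Om {X. seppos ?S y (l + 1) X} +
      (\<Sum>K | K \<subseteq> ?S \<and> card K = (l + 1) + 1. ang K y * offprob (?S - K) y (sqrt (real (l + 1) + 1))))"
      by simp
  qed
  also have "\<dots> = ?T (l + 1) + ?D" by (simp only: distrib_left sum.distrib)
  finally have "?T (l + 2) = ?T (l + 1) + ?D" .
  then have "sepsum b n (l + 2) = sepsum b n l + 2 * ?D"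
    using sum_seppos[of b n "l + 1"] sum_seppos[of b n l] by simp
  then have "complex_of_real (sepsum b n (l + 2)) = of_real (sepsum b n l) + 2 * of_real ?D" by (simp only: of_real_add of_real_mult of_real_numeral)
  also have "complex_of_real ?D = mu b n (n - (l + 1))"
    by (rule sum_ang_offprob_eq_mu) (use assms in auto)
  finally show ?thesis .
qed

text \<open>Even and odd \<open>p\<close> form separate recursions, started at 0 and 1. In the step
  from \<open>p\<close> to \<open>p + 2\<close> the new term is \<open>j = 1\<close>, and the old
  terms are shifted by 2.\<close>

lemma sepsum_eq_sum_mu:
  assumes "p < n" "1 \<le> n"
  shows "of_real (sepsum b n p) = of_real (b ^ n + (1 - b) ^ n) + 2 * (\<Sum>j | odd j \<and> j \<le> p. mu b n (n - p + j))"
  using assms(1)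
proof (induction p rule: induct_nat_012)
  case 0
  have "{j. odd j \<and> j \<le> (0::nat)} = {}" by (auto elim: oddE)
  then show ?case using sepsum_0[OF assms(2)] by simp
next
  case 1
  have "{j. odd j \<and> j \<le> Suc 0} = {1}" by (auto simp: le_Suc_eq)
  then show ?case using sepsum_1[of n b] 1 by simp
next
  case (ge2 p)
  let ?f = "\<lambda>j. mu b n (n - Suc (Suc p) + j)"
  have set: "{j. odd j \<and> j \<le> Suc (Suc p)} = insert 1 ((\<lambda>j. j + 2) ` {j. odd j \<and> j \<le> p})"
  proof (intro equalityI subsetI)
    fix j assume j: "j \<in> {j. odd j \<and> j \<le> Suc (Suc p)}"
    show "j \<in> insert 1 ((\<lambda>j. j + 2) ` {j. odd j \<and> j \<le> p})"
    proof (cases "j = 1")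
      case False
      then have "j \<noteq> 0" "j \<noteq> 1" using j by (auto elim: oddE)
      then have "j = (j - 2) + 2" "j - 2 \<in> {j. odd j \<and> j \<le> p}" using j by auto
      then show ?thesis by blast
    qed simp
  qed auto
  have fin: "finite {j. odd j \<and> j \<le> p}" by (rule finite_subset[of _ "{..p}"]) auto
  have "(\<Sum>j | odd j \<and> j \<le> Suc (Suc p). ?f j) = ?f 1 + (\<Sum>j | odd j \<and> j \<le> p. ?f (j + 2))"
    unfolding set using fin by (subst sum.insert) (auto simp: sum.reindex inj_on_def)
  also have "?f 1 = mu b n (n - (p + 1))"
    using ge2.prems by (intro arg_cong[where f = "mu b n"]) linarith
  also have "(\<Sum>j | odd j \<and> j \<le> p. ?f (j + 2)) = (\<Sum>j | odd j \<and> j \<le> p. mu b n (n - p + j))"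
    using ge2.prems by (intro sum.cong refl arg_cong[where f = "mu b n"]) linarith
  finally have eq: "(\<Sum>j | odd j \<and> j \<le> Suc (Suc p). ?f j) = mu b n (n - (p + 1)) + (\<Sum>j | odd j \<and> j \<le> p. mu b n (n - p + j))" .
  have "p < n" using ge2.prems by simp
  from ge2.IH(1)[OF this] sepsum_Suc_Suc[of p n b] ge2.prems
  show ?case unfolding eq by (simp add: algebra_simps)
qed

text \<open>Beyond \<open>j = p\<close> the index exceeds \<open>n\<close>, where \<open>mu\<close>
  is 0 by definition.\<close>

lemma infsum_mu_odd:
  assumes "p < n"
  shows "(\<Sum>\<^sub>\<infinity>j\<in>{j. 1 \<le> j \<and> odd j}. mu b n (n - p + j)) = (\<Sum>j | odd j \<and> j \<le> p. mu b n (n - p + j))"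
proof -
  have "(\<Sum>\<^sub>\<infinity>j\<in>{j. 1 \<le> j \<and> odd j}. mu b n (n - p + j)) = (\<Sum>\<^sub>\<infinity>j\<in>{j. odd j \<and> j \<le> p}. mu b n (n - p + j))"
  proof (rule infsum_cong_neutral)
    fix j assume "j \<in> {j. odd j \<and> j \<le> p} - {j. 1 \<le> j \<and> odd j}"
    then show "mu b n (n - p + j) = 0" by (cases "j = 0") auto
  next
    fix j assume "j \<in> {j. 1 \<le> j \<and> odd j} - {j. odd j \<and> j \<le> p}"
    then show "mu b n (n - p + j) = 0" using assms by (auto simp: mu_def)
  qed (rule refl)
  also have "\<dots> = (\<Sum>j | odd j \<and> j \<le> p. mu b n (n - p + j))"
    by (rule infsum_finite) (auto intro: finite_subset[of _ "{..p}"])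
  finally show ?thesis .
qed

subsection \<open>From the sample to the Gaussian array\<close>

lemma emeasure_std_gaussian_box:
  fixes A :: "'p::finite \<Rightarrow> real set"
  assumes [measurable]: "\<And>i. A i \<in> sets borel"
  shows "emeasure (std_gaussian :: (real ^ 'p) measure) {v. \<forall>i. v $ i \<in> A i} = (\<Prod>i\<in>UNIV. emeasure std_normal (A i))"
proof -
  define ax :: "'p \<Rightarrow> real ^ 'p" where "ax i = axis i 1" for i
  have B: "Basis = range ax" by (auto simp: Basis_vec_def ax_def)
  have inj: "inj ax" by (auto simp: inj_on_def ax_def axis_eq_axis)
  have nth: "v \<bullet> ax i = v $ i" for v i by (simp add: ax_def inner_axis)
  have [measurable]: "(\<lambda>v::real ^ 'p. v $ i) \<in> borel_measurable borel" for i
    by (intro borel_measurable_continuous_onI continuous_intros)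
  let ?B = "{v::real ^ 'p. \<forall>i. v $ i \<in> A i}"
  let ?F = "\<lambda>b x. ennreal (std_normal_density x) * indicator (A (inv ax b)) x"
  have Bm: "?B \<in> sets borel"
  proof -
    have "{v \<in> space (borel :: (real ^ 'p) measure). \<forall>i. v $ i \<in> A i} \<in> sets borel" by measurable
    then show ?thesis by simp
  qed
  have "emeasure std_gaussian ?B =
      (\<integral>\<^sup>+v. ennreal (\<Prod>i\<in>Basis. std_normal_density (v \<bullet> i)) * indicator ?B v \<partial>lborel)"
    unfolding std_gaussian_def using Bm by (intro emeasure_density) auto
  also have "\<dots> = (\<integral>\<^sup>+v. (\<Prod>b\<in>Basis. ?F b (v \<bullet> b)) \<partial>lborel)"
  proof (rule nn_integral_cong)
    fix v :: "real ^ 'p"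
    have ind: "(indicator ?B v :: ennreal) = (\<Prod>i\<in>UNIV. indicator (A i) (v $ i))"
      by (auto simp: indicator_def prod_zero_iff)
    have "(\<Prod>b\<in>Basis. ?F b (v \<bullet> b)) = (\<Prod>i\<in>UNIV. ennreal (std_normal_density (v $ i)) * indicator (A i) (v $ i))"
      unfolding B by (subst prod.reindex[OF inj]) (simp add: nth inv_f_f[OF inj])
    also have "\<dots> = ennreal (\<Prod>i\<in>UNIV. std_normal_density (v $ i)) * indicator ?B v"
      unfolding prod.distrib ind by (simp add: prod_ennreal)
    also have "(\<Prod>i\<in>UNIV. std_normal_density (v $ i)) = (\<Prod>i\<in>Basis. std_normal_density (v \<bullet> i))"
      unfolding B by (subst prod.reindex[OF inj]) (simp add: nth)
    finally show "ennreal (\<Prod>i\<in>Basis. std_normal_density (v \<bullet> i)) * indicator ?B v = (\<Prod>b\<in>Basis. ?F b (v \<bullet> b))" ..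
  qed
  also have "\<dots> = (\<Prod>b\<in>Basis. (\<integral>\<^sup>+x. ?F b x \<partial>lborel))"
    by (rule nn_integral_lborel_prod) auto
  also have "\<dots> = (\<Prod>i\<in>UNIV. (\<integral>\<^sup>+x. ?F (ax i) x \<partial>lborel))"
    unfolding B by (subst prod.reindex[OF inj]) simp
  also have "\<dots> = (\<Prod>i\<in>UNIV. emeasure std_normal (A i))"
    by (rule prod.cong) (simp_all add: inv_f_f[OF inj] emeasure_density)
  finally show ?thesis .
qed

text \<open>The index type \<open>'p\<close> carries no numbering; the bijection \<open>h\<close>
  matches its elements with the feature columns \<open>0, ..., p - 1\<close> of the array.\<close>

locale labelled_gaussian_sample = prob_space M
  for M :: "'w measure" +
  fixes x :: "nat \<Rightarrow> 'w \<Rightarrow> real ^ 'p" and y :: "nat \<Rightarrow> 'w \<Rightarrow> real" and n :: nat and b :: real and h :: "nat \<Rightarrow> 'p"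
  assumes n: "1 \<le> n"
    and h: "bij_betw h {..<CARD('p)} UNIV"
    and y_range: "\<And>j \<omega>. j \<in> {1..n} \<Longrightarrow> \<omega> \<in> space M \<Longrightarrow> y j \<omega> \<in> {-1, 1}"
    and indep: "indep_vars (\<lambda>_. borel \<Otimes>\<^sub>M borel) (\<lambda>j \<omega>. (x j \<omega>, y j \<omega>)) {1..n}"
    and x_normal: "\<And>j. j \<in> {1..n} \<Longrightarrow> distr M borel (x j) = std_gaussian"
    and xy_indep: "\<And>j. j \<in> {1..n} \<Longrightarrow> indep_set
        {x j -` A \<inter> space M | A. A \<in> sets borel} {y j -` B \<inter> space M | B. B \<in> sets borel}"
    and b: "\<And>j. j \<in> {1..n} \<Longrightarrow> b = measure M {\<omega> \<in> space M. y j \<omega> = 1}"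
begin

definition coords :: "(nat \<times> nat) set" where
  "coords = {1..n} \<times> {..<CARD('p)}"

text \<open>Coordinates outside the sample are filled with 0 and hence not Gaussian; only events
  that ignore them are transferred.\<close>

definition data :: "'w \<Rightarrow> nat \<times> nat \<Rightarrow> real" where
  "data \<omega> = (\<lambda>(j, c). if (j, c) \<in> coords then x j \<omega> $ h c else 0)"

lemma finite_coords [simp]: "finite coords"
  by (simp add: coords_def)

lemma measurable_xy:
  assumes "j \<in> {1..n}"
  shows "x j \<in> borel_measurable M" "y j \<in> borel_measurable M"
proof -
  have "random_variable (borel \<Otimes>\<^sub>M borel) (\<lambda>\<omega>. (x j \<omega>, y j \<omega>))"
    using indep assms unfolding indep_vars_def by blast
  from measurable_compose[OF this measurable_fst] measurable_compose[OF this measurable_snd]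
  show "x j \<in> borel_measurable M" "y j \<in> borel_measurable M" by simp_all
qed

lemma prob_label:
  assumes j: "j \<in> {1..n}" and s: "s \<in> {-1, 1}"
  shows "prob (y j -` {s} \<inter> space M) = wt b s"
proof -
  note [measurable] = measurable_xy[OF j]
  have 1: "prob (y j -` {1} \<inter> space M) = b"
    unfolding b[OF j] by (rule arg_cong[where f = prob]) auto
  have "y j -` {-1} \<inter> space M = space M - (y j -` {1} \<inter> space M)"
    using y_range[OF j] by fastforce
  then have "prob (y j -` {-1} \<inter> space M) = 1 - b"
    using prob_compl[OF measurable_sets[OF measurable_xy(2)[OF j], of "{1}"]] 1 by simp
  with 1 show ?thesis using s by (auto simp: wt_def)
qed

lemma weight_nonneg: "0 \<le> weight b {1..n} \<eta>"
proof -
  have "1 \<in> {1..n}" using n by simp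
  from b[OF this] have "0 \<le> b" "b \<le> 1" by (simp_all add: prob_le_1)
  then show ?thesis unfolding weight_def by (intro prod_nonneg) (simp add: wt_def)
qed

lemma prob_block:
  assumes j: "j \<in> {1..n}" and s: "s \<in> {-1, 1}" and A [measurable]: "\<And>c. A c \<in> sets borel"
  shows "prob ((\<lambda>\<omega>. (x j \<omega>, y j \<omega>)) -` ({v. \<forall>c<CARD('p). v $ h c \<in> A c} \<times> {s}) \<inter> space M) =
    (\<Prod>c<CARD('p). measure std_normal (A c)) * wt b s"
    and "{v::real ^ 'p. \<forall>c<CARD('p). v $ h c \<in> A c} \<in> sets borel"
proof -
  let ?p = "CARD('p)"
  let ?h = "inv_into {..<?p} h"
  let ?B = "{v::real ^ 'p. \<forall>c<?p. v $ h c \<in> A c}"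
  have [measurable]: "(\<lambda>v::real ^ 'p. v $ i) \<in> borel_measurable borel" for i
    by (intro borel_measurable_continuous_onI continuous_intros)
  show B: "?B \<in> sets borel"
  proof -
    have "{v \<in> space (borel :: (real ^ 'p) measure). \<forall>c\<in>{..<?p}. v $ h c \<in> A c} \<in> sets borel" by measurable
    then show ?thesis by (simp add: lessThan_def)
  qed
  have hinv: "?h (h c) = c" if "c < ?p" for c
    using bij_betw_inv_into_left[OF h] that by simp
  have Beq: "?B = {v. \<forall>i. v $ i \<in> A (?h i)}"
  proof (intro Collect_cong)
    fix v :: "real ^ 'p"
    have "(\<forall>i. v $ i \<in> A (?h i)) \<longleftrightarrow> (\<forall>i\<in>h ` {..<?p}. v $ i \<in> A (?h i))"
      using h by (simp add: bij_betw_def)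
    also have "\<dots> \<longleftrightarrow> (\<forall>c<?p. v $ h c \<in> A c)" by (auto simp: hinv)
    finally show "(\<forall>c<?p. v $ h c \<in> A c) \<longleftrightarrow> (\<forall>i. v $ i \<in> A (?h i))" ..
  qed
  have "prob (x j -` ?B \<inter> space M) = measure (distr M borel (x j)) ?B"
    using measurable_xy[OF j] B by (simp add: measure_distr)
  also have "\<dots> = (\<Prod>i\<in>UNIV. measure std_normal (A (?h i)))"
    unfolding x_normal[OF j] Beq measure_def
    by (subst emeasure_std_gaussian_box)
      (simp_all add: A std_normal.emeasure_eq_measure prod_ennreal prod_nonneg)
  also have "\<dots> = (\<Prod>c<?p. measure std_normal (A (?h (h c))))"
    by (rule prod.reindex_bij_betw[OF h, symmetric])
  also have "\<dots> = (\<Prod>c<?p. measure std_normal (A c))" by (rule prod.cong) (simp_all add: hinv)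
  finally have px: "prob (x j -` ?B \<inter> space M) = (\<Prod>c<?p. measure std_normal (A c))" .
  have "(\<lambda>\<omega>. (x j \<omega>, y j \<omega>)) -` (?B \<times> {s}) \<inter> space M = (x j -` ?B \<inter> space M) \<inter> (y j -` {s} \<inter> space M)"
    by auto
  moreover have "prob ((x j -` ?B \<inter> space M) \<inter> (y j -` {s} \<inter> space M)) = prob (x j -` ?B \<inter> space M) * prob (y j -` {s} \<inter> space M)"
  proof (rule indep_setD[OF xy_indep[OF j]])
    show "x j -` ?B \<inter> space M \<in> {x j -` A \<inter> space M | A. A \<in> sets borel}" using B by blast
    have "{s} \<in> sets borel" by simp
    then show "y j -` {s} \<inter> space M \<in> {y j -` B \<inter> space M | B. B \<in> sets borel}" by blast
  qed
  ultimately show "prob ((\<lambda>\<omega>. (x j \<omega>, y j \<omega>)) -` (?B \<times> {s}) \<inter> space M) =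
      (\<Prod>c<?p. measure std_normal (A c)) * wt b s"
    using px prob_label[OF j s] by simp
qed

text \<open>Independence of the samples gives one factor for each \<open>j\<close>; independence of
  features and label, together with the product form of the Gaussian, splits that factor
  further.\<close>

lemma prob_box:
  assumes \<eta>: "\<eta> \<in> labels {1..n}" and A: "\<And>i. A i \<in> sets borel"
  shows "prob {\<omega> \<in> space M. (\<forall>j\<in>{1..n}. y j \<omega> = \<eta> j) \<and> (\<forall>i\<in>coords. data \<omega> i \<in> A i)} =
    weight b {1..n} \<eta> * (\<Prod>i\<in>coords. measure std_normal (A i))"
proof -
  let ?S = "{1..n}" and ?p = "CARD('p)"
  let ?B = "\<lambda>j. {v::real ^ 'p. \<forall>c<?p. v $ h c \<in> A (j, c)} \<times> {\<eta> j}"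
  have s: "\<eta> j \<in> {-1, 1}" if "j \<in> ?S" for j using \<eta> that by (auto simp: labels_def PiE_iff)
  have "{\<omega> \<in> space M. (\<forall>j\<in>?S. y j \<omega> = \<eta> j) \<and> (\<forall>i\<in>coords. data \<omega> i \<in> A i)} =
      (\<Inter>j\<in>?S. (\<lambda>\<omega>. (x j \<omega>, y j \<omega>)) -` ?B j \<inter> space M)"
    using n by (auto simp: coords_def data_def)
  also have "prob \<dots> = (\<Prod>j\<in>?S. prob ((\<lambda>\<omega>. (x j \<omega>, y j \<omega>)) -` ?B j \<inter> space M))"
  proof (rule indep_varsD_finite[OF indep])
    show "?B j \<in> sets (borel \<Otimes>\<^sub>M borel)" if "j \<in> ?S" for j
      using prob_block(2)[OF that s[OF that], of "\<lambda>c. A (j, c)"] A by (intro pair_measureI) auto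
  qed (use n in auto)
  also have "\<dots> = (\<Prod>j\<in>?S. (\<Prod>c<?p. measure std_normal (A (j, c))) * wt b (\<eta> j))"
    by (rule prod.cong[OF refl], rule prob_block(1)) (use s A in auto)
  also have "\<dots> = weight b ?S \<eta> * (\<Prod>i\<in>coords. measure std_normal (A i))"
    by (simp add: prod.distrib weight_def coords_def prod.cartesian_product case_prod_beta')
  finally show ?thesis .
qed

lemma label_event: "{\<omega> \<in> space M. \<forall>j\<in>{1..n}. y j \<omega> = \<eta> j} \<in> events"
proof (rule sets.sets_Collect_finite_All)
  fix j assume "j \<in> {1..n}"
  note [measurable] = measurable_xy(2)[OF this]
  show "{\<omega> \<in> space M. y j \<omega> = \<eta> j} \<in> events" by measurable
qed simp

lemma measurable_data: "(\<lambda>\<omega>. data \<omega> i) \<in> borel_measurable M"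
proof (cases "i \<in> coords")
  case True
  then obtain j c where i: "i = (j, c)" "j \<in> {1..n}" by (auto simp: coords_def)
  note [measurable] = measurable_xy(1)[OF i(2)]
  have [measurable]: "(\<lambda>v::real ^ 'p. v $ h c) \<in> borel_measurable borel"
    by (intro borel_measurable_continuous_onI continuous_intros)
  show ?thesis using True unfolding data_def i by simp
next
  case False
  then show ?thesis by (cases i) (simp add: data_def)
qed

text \<open>On the finite product over \<open>coords\<close>, the law of the data on one label
  pattern and a multiple of the Gaussian law agree on boxes, hence everywhere. \<open>Z\<close>
  extends finite vectors by 0, which \<open>cong\<close> makes harmless for
  \<open>E\<close>.\<close>

lemma prob_labelled_event:
  assumes \<eta>: "\<eta> \<in> labels {1..n}" and E: "Measurable.pred Om E"
    and cong: "\<And>X X'. (\<And>i. i \<in> coords \<Longrightarrow> X i = X' i) \<Longrightarrow> E X = E X'"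
  shows "{\<omega> \<in> space M. (\<forall>j\<in>{1..n}. y j \<omega> = \<eta> j) \<and> E (data \<omega>)} \<in> events"
    and "prob {\<omega> \<in> space M. (\<forall>j\<in>{1..n}. y j \<omega> = \<eta> j) \<and> E (data \<omega>)} = weight b {1..n} \<eta> * measure Om {X. E X}"
proof -
  let ?Y = "{\<omega> \<in> space M. \<forall>j\<in>{1..n}. y j \<omega> = \<eta> j}" and ?w = "weight b {1..n} \<eta>"
  let ?N = "PiM coords (\<lambda>_. borel :: real measure)"
  have dOm: "data \<in> measurable M Om" by (rule measurable_into_Om) (rule measurable_data)
  have r: "(\<lambda>X. restrict X coords) \<in> measurable Om ?N"
    by (rule measurable_restrict) simp
  have rd: "(\<lambda>\<omega>. restrict (data \<omega>) coords) \<in> measurable M ?N" by (rule measurable_compose[OF dOm r])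
  have Ed: "{\<omega> \<in> space M. E (data \<omega>)} \<in> events"
    using measurable_compose[OF dOm E] by (simp add: pred_def)
  have "{\<omega> \<in> space M. (\<forall>j\<in>{1..n}. y j \<omega> = \<eta> j) \<and> E (data \<omega>)} = ?Y \<inter> {\<omega> \<in> space M. E (data \<omega>)}" by auto
  then show "{\<omega> \<in> space M. (\<forall>j\<in>{1..n}. y j \<omega> = \<eta> j) \<and> E (data \<omega>)} \<in> events"
    using label_event[of \<eta>] Ed by simp
  define P where "P = distr (density M (indicator ?Y)) ?N (\<lambda>\<omega>. restrict (data \<omega>) coords)"
  define Q where "Q = scale_measure (ennreal ?w) (distr Om ?N (\<lambda>X. restrict X coords))"
  have P: "emeasure P B = emeasure M (?Y \<inter> {\<omega> \<in> space M. restrict (data \<omega>) coords \<in> B})" if "B \<in> sets ?N" for B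
  proof -
    have "emeasure P B = emeasure (density M (indicator ?Y)) ((\<lambda>\<omega>. restrict (data \<omega>) coords) -` B \<inter> space M)"
      unfolding P_def using rd that by (subst emeasure_distr) auto
    also have "\<dots> = emeasure M (?Y \<inter> ((\<lambda>\<omega>. restrict (data \<omega>) coords) -` B \<inter> space M))"
      by (rule emeasure_restricted[OF label_event measurable_sets[OF rd that]])
    also have "(\<lambda>\<omega>. restrict (data \<omega>) coords) -` B \<inter> space M = {\<omega> \<in> space M. restrict (data \<omega>) coords \<in> B}" by auto
    finally show ?thesis .
  qed
  have Q: "emeasure Q B = ennreal ?w * emeasure Om {X. restrict X coords \<in> B}" if "B \<in> sets ?N" for B
    unfolding Q_def using r that by (simp add: emeasure_distr vimage_def)
  have "P = Q"
  proof (rule measure_eqI_PiM_finite[where I = coords and M = "\<lambda>_. borel" and A = "\<lambda>_. space ?N"])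
    fix A :: "nat \<times> nat \<Rightarrow> real set" assume A: "\<And>i. i \<in> coords \<Longrightarrow> A i \<in> sets borel"
    define A' where "A' i = (if i \<in> coords then A i else {})" for i
    have A': "A' i \<in> sets borel" for i using A by (simp add: A'_def)
    have box: "PiE coords A \<in> sets ?N" using A by (intro sets_PiM_I_finite) auto
    have "?Y \<inter> {\<omega> \<in> space M. restrict (data \<omega>) coords \<in> PiE coords A} =
        {\<omega> \<in> space M. (\<forall>j\<in>{1..n}. y j \<omega> = \<eta> j) \<and> (\<forall>i\<in>coords. data \<omega> i \<in> A' i)}"
      by (auto simp: A'_def restrict_PiE_iff)
    then have "emeasure P (PiE coords A) = ennreal (?w * (\<Prod>i\<in>coords. measure std_normal (A' i)))"
      unfolding P[OF box] using prob_box[OF \<eta> A'] by (simp add: emeasure_eq_measure)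
    also have "\<dots> = ennreal ?w * (\<Prod>i\<in>coords. emeasure std_normal (A' i))"
      by (simp add: ennreal_mult'' prod_nonneg std_normal.emeasure_eq_measure prod_ennreal)
    also have "\<dots> = ennreal ?w * emeasure Om {X. \<forall>i\<in>coords. X i \<in> A' i}"
      using emeasure_Om_box[OF finite_coords A'] by simp
    also have "{X. \<forall>i\<in>coords. X i \<in> A' i} = {X. restrict X coords \<in> PiE coords A}"
      by (auto simp: A'_def restrict_PiE_iff)
    finally show "emeasure P (PiE coords A) = emeasure Q (PiE coords A)" unfolding Q[OF box] .
  next
    have "space ?N = PiE coords (\<lambda>_. UNIV)" by (simp add: space_PiM)
    moreover have "PiE coords (\<lambda>_. UNIV) \<in> prod_algebra coords (\<lambda>_. borel :: real measure)"
      by (rule prod_algebraI_finite) auto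
    ultimately show "range (\<lambda>_::nat. space ?N) \<subseteq> prod_algebra coords (\<lambda>_. borel)" by auto
    show "emeasure P (space ?N) \<noteq> \<infinity>" by (subst P) (auto simp: emeasure_eq_measure)
  qed (auto simp: P_def Q_def)
  define Z :: "(nat \<times> nat \<Rightarrow> real) \<Rightarrow> nat \<times> nat \<Rightarrow> real" where "Z X = (\<lambda>i. if i \<in> coords then X i else 0)" for X
  have "Z \<in> measurable ?N Om"
  proof (rule measurable_into_Om)
    show "(\<lambda>X. Z X i) \<in> borel_measurable ?N" for i
      by (cases "i \<in> coords") (simp_all add: Z_def)
  qed
  from measurable_compose[OF this E] have EZ: "{X \<in> space ?N. E (Z X)} \<in> sets ?N" by (simp add: pred_def)
  have Zr: "E (Z (restrict X coords)) = E X" for X by (rule cong) (simp add: Z_def)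
  have sp: "restrict X coords \<in> space ?N" for X :: "nat \<times> nat \<Rightarrow> real" by (simp add: space_PiM)
  have "emeasure M {\<omega> \<in> space M. (\<forall>j\<in>{1..n}. y j \<omega> = \<eta> j) \<and> E (data \<omega>)} = emeasure P {X \<in> space ?N. E (Z X)}"
    unfolding P[OF EZ] by (rule arg_cong[where f = "emeasure M"]) (auto simp: Zr sp)
  also have "\<dots> = ennreal ?w * emeasure Om {X. E X}"
    unfolding \<open>P = Q\<close> Q[OF EZ] by (simp add: Zr sp)
  finally show "prob {\<omega> \<in> space M. (\<forall>j\<in>{1..n}. y j \<omega> = \<eta> j) \<and> E (data \<omega>)} = ?w * measure Om {X. E X}"
    using weight_nonneg by (simp add: measure_def enn2real_mult)
qed

lemma sep_data_iff:
  "sep {1..n} \<eta> (CARD('p)) (data \<omega>) \<longleftrightarrow> (\<exists>\<beta>\<^sub>0 \<beta>. \<forall>j\<in>{1..n}. \<eta> j * (\<beta>\<^sub>0 + x j \<omega> \<bullet> \<beta>) > 0)"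
proof -
  let ?p = "CARD('p)"
  let ?h = "inv_into {..<?p} h"
  have inner: "x j \<omega> \<bullet> \<beta> = (\<Sum>c<?p. \<beta> $ h c * data \<omega> (j, c))" if "j \<in> {1..n}" for j \<beta>
  proof -
    have "x j \<omega> \<bullet> \<beta> = (\<Sum>i\<in>UNIV. x j \<omega> $ i * \<beta> $ i)" by (simp add: inner_vec_def)
    also have "\<dots> = (\<Sum>c<?p. x j \<omega> $ h c * \<beta> $ h c)" by (rule sum.reindex_bij_betw[OF h, symmetric])
    also have "\<dots> = (\<Sum>c<?p. \<beta> $ h c * data \<omega> (j, c))"
      by (rule sum.cong) (use that in \<open>auto simp: data_def coords_def\<close>)
    finally show ?thesis .
  qed
  have aff: "aff (data \<omega>) ?p \<gamma> j = \<gamma> 0 + (\<Sum>c<?p. \<gamma> (Suc c) * data \<omega> (j, c))" for \<gamma> j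
    unfolding aff_def by (subst sum.atMost_shift) (simp add: row_def)
  show ?thesis
  proof
    assume "sep {1..n} \<eta> ?p (data \<omega>)"
    then obtain \<gamma> where g: "\<And>j. j \<in> {1..n} \<Longrightarrow> \<eta> j * aff (data \<omega>) ?p \<gamma> j > 0" unfolding sep_def by blast
    define \<beta> :: "real ^ 'p" where "\<beta> = (\<chi> i. \<gamma> (Suc (?h i)))"
    have "\<beta> $ h c = \<gamma> (Suc c)" if "c < ?p" for c
      using bij_betw_inv_into_left[OF h, of c] that by (simp add: \<beta>_def)
    then have "aff (data \<omega>) ?p \<gamma> j = \<gamma> 0 + x j \<omega> \<bullet> \<beta>" if "j \<in> {1..n}" for j
      unfolding aff inner[OF that] by simp
    with g show "\<exists>\<beta>\<^sub>0 \<beta>. \<forall>j\<in>{1..n}. \<eta> j * (\<beta>\<^sub>0 + x j \<omega> \<bullet> \<beta>) > 0" by metis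
  next
    assume "\<exists>\<beta>\<^sub>0 \<beta>. \<forall>j\<in>{1..n}. \<eta> j * (\<beta>\<^sub>0 + x j \<omega> \<bullet> \<beta>) > 0"
    then obtain \<beta>\<^sub>0 \<beta> where g: "\<And>j. j \<in> {1..n} \<Longrightarrow> \<eta> j * (\<beta>\<^sub>0 + x j \<omega> \<bullet> \<beta>) > 0" by blast
    have "aff (data \<omega>) ?p (case_nat \<beta>\<^sub>0 (\<lambda>c. \<beta> $ h c)) j = \<beta>\<^sub>0 + x j \<omega> \<bullet> \<beta>" if "j \<in> {1..n}" for j
      unfolding aff inner[OF that] by simp
    with g show "sep {1..n} \<eta> ?p (data \<omega>)" unfolding sep_def by metis
  qed
qed

text \<open>The results on the array treat fixed labels, so the event is split into finitely many
  disjoint label patterns. This also shows that the uncountable union is measurable.\<close>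

lemma separability_prob_eq_sepsum: "separability_prob M n x y = sepsum b n (CARD('p))"
proof -
  let ?S = "{1..n}" and ?p = "CARD('p)"
  let ?A = "\<lambda>\<eta>. {\<omega> \<in> space M. (\<forall>j\<in>?S. y j \<omega> = \<eta> j) \<and> sep ?S \<eta> ?p (data \<omega>)}"
  have fl: "finite (labels ?S)" unfolding labels_def by (intro finite_PiE) auto
  have cong: "sep ?S \<eta> ?p X = sep ?S \<eta> ?p X'" if eq: "\<And>i. i \<in> coords \<Longrightarrow> X i = X' i" for \<eta> X X'
  proof -
    have "aff X ?p \<gamma> j = aff X' ?p \<gamma> j" if j: "j \<in> ?S" for \<gamma> j
      unfolding aff_def
    proof (rule sum.cong[OF refl])
      fix c assume "c \<in> {..?p}"
      then show "\<gamma> c * row X j c = \<gamma> c * row X' j c"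
        using eq[of "(j, c - 1)"] j
        by (cases c) (auto simp: row_def coords_def)
    qed
    then show ?thesis unfolding sep_def by simp
  qed
  have ev: "?A \<eta> \<in> events" and pr: "prob (?A \<eta>) = weight b ?S \<eta> * measure Om {X. sep ?S \<eta> ?p X}"
    if "\<eta> \<in> labels ?S" for \<eta>
    using prob_labelled_event[OF that measurable_sep cong] by simp_all
  have "(\<Union>(\<beta>\<^sub>0 :: real, \<beta> :: real ^ 'p)\<in>UNIV. \<Inter>j\<in>?S. {\<omega> \<in> space M. y j \<omega> * (\<beta>\<^sub>0 + x j \<omega> \<bullet> \<beta>) > 0}) =
      {\<omega> \<in> space M. sep ?S (\<lambda>j. y j \<omega>) ?p (data \<omega>)}"
    unfolding sep_data_iff using n by auto
  also have "\<dots> = (\<Union>\<eta>\<in>labels ?S. ?A \<eta>)"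
  proof (intro equalityI subsetI)
    fix \<omega> assume \<omega>: "\<omega> \<in> {\<omega> \<in> space M. sep ?S (\<lambda>j. y j \<omega>) ?p (data \<omega>)}"
    let ?\<eta> = "\<lambda>j\<in>?S. y j \<omega>"
    have "?\<eta> \<in> labels ?S" unfolding labels_def using y_range \<omega> by (intro restrict_PiE_iff[THEN iffD2]) auto
    moreover have "\<omega> \<in> ?A ?\<eta>" using \<omega> by (simp add: sep_def)
    ultimately show "\<omega> \<in> (\<Union>\<eta>\<in>labels ?S. ?A \<eta>)" by blast
  next
    fix \<omega> assume "\<omega> \<in> (\<Union>\<eta>\<in>labels ?S. ?A \<eta>)"
    then obtain \<eta> where "\<omega> \<in> space M" "\<forall>j\<in>?S. y j \<omega> = \<eta> j" "sep ?S \<eta> ?p (data \<omega>)" by blast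
    then show "\<omega> \<in> {\<omega> \<in> space M. sep ?S (\<lambda>j. y j \<omega>) ?p (data \<omega>)}" by (simp add: sep_def)
  qed
  finally have "separability_prob M n x y = prob (\<Union>\<eta>\<in>labels ?S. ?A \<eta>)"
    unfolding separability_prob_def by simp
  also have "\<dots> = (\<Sum>\<eta>\<in>labels ?S. prob (?A \<eta>))"
  proof (rule finite_measure_finite_Union[OF fl])
    show "?A ` labels ?S \<subseteq> events" using ev by blast
    show "disjoint_family_on ?A (labels ?S)"
      unfolding disjoint_family_on_def
    proof (intro ballI impI)
      fix \<eta> \<eta>' assume e: "\<eta> \<in> labels ?S" "\<eta>' \<in> labels ?S" "\<eta> \<noteq> \<eta>'"
      then have "\<not> (\<forall>j\<in>?S. \<eta> j = \<eta>' j)" unfolding labels_def by (metis PiE_ext)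
      then show "?A \<eta> \<inter> ?A \<eta>' = {}" by auto
    qed
  qed
  also have "\<dots> = sepsum b n ?p" unfolding sepsum_def by (rule sum.cong[OF refl pr])
  finally show ?thesis .
qed

end

theorem proposition2:
  fixes M :: "'w measure"
    and x :: "nat \<Rightarrow> 'w \<Rightarrow> real ^ 'p"
    and y :: "nat \<Rightarrow> 'w \<Rightarrow> real"
    and n p :: nat
    and b :: real
  assumes "prob_space M"
    and "p = CARD('p)" and "1 \<le> p" and "p < n"
    and y_range: "\<And>j \<omega>. j \<in> {1..n} \<Longrightarrow> \<omega> \<in> space M \<Longrightarrow> y j \<omega> \<in> {-1, 1}"
    and indep: "prob_space.indep_vars M (\<lambda>_. borel \<Otimes>\<^sub>M borel) (\<lambda>j \<omega>. (x j \<omega>, y j \<omega>)) {1..n}"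
    and ident: "\<And>i j. i \<in> {1..n} \<Longrightarrow> j \<in> {1..n} \<Longrightarrow>
        distr M (borel \<Otimes>\<^sub>M borel) (\<lambda>\<omega>. (x i \<omega>, y i \<omega>)) =
        distr M (borel \<Otimes>\<^sub>M borel) (\<lambda>\<omega>. (x j \<omega>, y j \<omega>))"
    and x_normal: "\<And>j. j \<in> {1..n} \<Longrightarrow> distr M borel (x j) = std_gaussian"
    and xy_indep: "\<And>j. j \<in> {1..n} \<Longrightarrow> prob_space.indep_set M
        {x j -` A \<inter> space M | A. A \<in> sets borel} {y j -` B \<inter> space M | B. B \<in> sets borel}"
    and b: "\<And>j. j \<in> {1..n} \<Longrightarrow> b = measure M {\<omega> \<in> space M. y j \<omega> = 1}"
  shows "complex_of_real (separability_prob M n x y) =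
    of_real (b ^ n + (1 - b) ^ n) + 2 * (\<Sum>\<^sub>\<infinity>j\<in>{j. 1 \<le> j \<and> odd j}. mu b n (n - p + j))"
proof -
  interpret prob_space M by fact
  obtain h :: "nat \<Rightarrow> 'p" where "bij_betw h {..<CARD('p)} UNIV"
    using ex_bij_betw_nat_finite[of "UNIV :: 'p set"] by (auto simp: lessThan_atLeast0)
  moreover have "1 \<le> n" using \<open>p < n\<close> by simp
  ultimately interpret labelled_gaussian_sample M x y n b h
    by unfold_locales (use y_range indep x_normal xy_indep b in auto)
  show ?thesis
    unfolding separability_prob_eq_sepsum infsum_mu_odd[OF \<open>p < n\<close>] \<open>p = CARD('p)\<close>[symmetric]
    by (rule sepsum_eq_sum_mu[OF \<open>p < n\<close> \<open>1 \<le> n\<close>])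
qed

end
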